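(* Let $d\ge 2$ and let $\gamma^{1},\gamma^{2}\in\mathcal{P}$ be distinct. Then there exists a coupling of the random walks in random environment $(\omega[p],X[p])$, $p\in[0,1]$, where $(\omega[p],X[p])$ is the annealed random walk in the i.i.d. environment with $\mu(\{\gamma^1\})=p$, $\mu(\{\gamma^2\})=1-p$, under which for all $0\le p<p'\le1$ the following hold: (i) almost surely, $N_n[p']\ge N_n[p]$ for every $n\ge0$; (ii) for every $e\in\mathcal{E}$ such that $e\in E^{1}\cap(E^{2})^c$ and $-e\notin E^{1}$, almost surely $X_n[p']\cdot e\ge X_n[p]\cdot e$ for every $n\ge0$; (iii) if $u_1^{[1]}>u_2^{[1]}$, then almost surely the event $B_n=\{X_n^{[1]}[p']\ge X_n^{[1]}[p]\}$ occurs for infinitely many $n$; (iv) let $V[p]=\lim_{n\to\infty}n^{-1}X_n[p]$ (this limit exists almost surely, but could in principle be random). Then for any $u\in\mathbb{R}^d\setminus\{o\}$: (a) $V[p']\cdot u\ge V[p]\cdot u$ almost surely if $(u_1-u_2)\cdot u\ge0$, and (b) $V[p']\cdot u\le V[p]\cdot u$ almost surely if $(u_1-u_2)\cdot u\le0$.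
   Context: $\mathcal{E}=\{\pm e_i: i=1,\dots,d\}$ is the set of unit vectors in $\mathbb{Z}^d$ and $o$ is the origin. $\mathcal{P}$ is the set of probability measures on $\mathcal{E}$, and $\mu$ is a probability measure on $\mathcal{P}$. An i.i.d. environment is a family $\omega=(\omega_x)_{x\in\mathbb{Z}^d}$ of i.i.d. elements of $\mathcal{P}$ with law $\mu$; $\nu=\mu^{\otimes\mathbb{Z}^d}$ is its law. Given $\omega$, $\mathbb{P}_\omega$ is the law of the time-homogeneous Markov chain $(X_n)_{n\ge0}$ on $\mathbb{Z}^d$ with $X_0=o$ and transition probability $\omega_x(e)$ from $x$ to $x+e$, $e\in\mathcal{E}$. The annealed law of $(\omega,X)$ is obtained by drawing $\omega$ from $\nu$ and then $X$ from $\mathbb{P}_\omega$. No ellipticity is assumed. A coupling is a single probability space on which all the pairs $(\omega[p],X[p])$, $p\in[0,1]$, are defined, each having its own annealed law. Notation: $E^{i}=\{e\in\mathcal{E}:\gamma^{i}(e)>0\}$; $u_i=\sum_{e\in\mathcal{E}}\gamma^{i}(e)\,e\in\mathbb{R}^d$ is the local drift of $\gamma^{i}$; $N_n[p]=\#\{0\le m<n:\omega_{X_m[p]}[p]=\gamma^{1}\}$; $y^{[j]}$ denotes the $j$-th coordinate of a vector $y$. *)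

theory Defs
  imports "HOL-Probability.Probability"
begin

text \<open>The lattice is \<open>int ^ 'd\<close> with \<open>d = CARD('d)\<close>. The index type is unordered, so a
  "first" coordinate is an explicitly named element of \<open>'d\<close>.\<close>

type_synonym 'd env = "int ^ 'd \<Rightarrow> (int ^ 'd) pmf"
type_synonym 'd path = "nat \<Rightarrow> int ^ 'd"

definition unit_vectors :: "(int ^ 'd::finite) set" where
  "unit_vectors = range (\<lambda>i. axis i 1) \<union> range (\<lambda>i. - axis i 1)"

definition step_laws :: "(int ^ 'd::finite) pmf set" where
  "step_laws = {\<gamma>. set_pmf \<gamma> \<subseteq> unit_vectors}"

definition rvec :: "int ^ 'd::finite \<Rightarrow> real ^ 'd" where
  "rvec x = (\<chi> i. of_int (x $ i))"

definition local_drift :: "(int ^ 'd::finite) pmf \<Rightarrow> real ^ 'd" where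
  "local_drift \<gamma> = (\<Sum>e\<in>unit_vectors. pmf \<gamma> e *\<^sub>R rvec e)"

definition two_point_law :: "'a \<Rightarrow> 'a \<Rightarrow> real \<Rightarrow> 'a pmf" where
  "two_point_law a b p = map_pmf (\<lambda>c. if c then a else b) (bernoulli_pmf p)"

lemma pmf_two_point_law:
  assumes "a \<noteq> b" "0 \<le> p" "p \<le> 1"
  shows "pmf (two_point_law a b p) a = p" "pmf (two_point_law a b p) b = 1 - p"
proof -
  have "(\<lambda>c. if c then a else b) -` {a} = {True}" "(\<lambda>c. if c then a else b) -` {b} = {False}"
    using assms(1) by (auto split: if_splits)
  then show "pmf (two_point_law a b p) a = p" "pmf (two_point_law a b p) b = 1 - p"
    using assms by (simp_all add: two_point_law_def pmf_map measure_pmf_single)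
qed

definition path_space :: "'d::finite path measure" where
  "path_space = PiM UNIV (\<lambda>_. count_space UNIV)"

text \<open>Only discrete laws \<open>\<mu>\<close> are needed (the environments take two values), so \<open>\<mu>\<close> is a
  \<open>pmf\<close> and the single-site space carries the discrete \<open>\<sigma>\<close>-algebra.\<close>

definition env_space :: "'d::finite env measure" where
  "env_space = PiM UNIV (\<lambda>_. count_space UNIV)"

definition env_law :: "(int ^ 'd::finite) pmf pmf \<Rightarrow> 'd env measure" where
  "env_law \<mu> = PiM UNIV (\<lambda>_. measure_pmf \<mu>)"

text \<open>Law of \<open>X n\<close> given the history \<open>X 0, \<dots>, X (n - 1)\<close>.\<close>

primrec walk_kernel :: "'d::finite env \<Rightarrow> nat \<Rightarrow> 'd path \<Rightarrow> (int ^ 'd) pmf" where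
  "walk_kernel \<omega> 0 h = return_pmf 0"
| "walk_kernel \<omega> (Suc n) h = map_pmf (\<lambda>e. h n + e) (\<omega> (h n))"

text \<open>The quenched law is the Ionescu-Tulcea measure of these kernels; the lemma
  \<open>quenched_law_cylinder\<close> below gives its finite-dimensional distributions.\<close>

definition quenched_law :: "'d::finite env \<Rightarrow> 'd path measure" where
  "quenched_law \<omega> = projective_family.lim UNIV
     (Ionescu_Tulcea.CI (\<lambda>n h. measure_pmf (walk_kernel \<omega> n h)) (\<lambda>_. count_space UNIV))
     (\<lambda>_. count_space UNIV)"

definition annealed_law :: "(int ^ 'd::finite) pmf pmf \<Rightarrow> ('d env \<times> 'd path) measure" where
  "annealed_law \<mu> = env_law \<mu> \<bind>
     (\<lambda>\<omega>. distr (quenched_law \<omega>) (env_space \<Otimes>\<^sub>M path_space) (\<lambda>X. (\<omega>, X)))"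

text \<open>All the pairs \<open>(\<omega> p, X p)\<close> live on the one probability space \<open>M\<close>. Since HOL cannot quantify
  existentially over types, an existence claim must fix the type of sample points; taking it to be
  \<open>real \<Rightarrow> 'd env \<times> 'd path\<close> loses nothing, as the joint law of any such family lives there.\<close>

definition rwre_coupling ::
  "(real \<Rightarrow> (int ^ 'd::finite) pmf pmf) \<Rightarrow> 's measure \<Rightarrow>
    (real \<Rightarrow> 's \<Rightarrow> 'd env) \<Rightarrow> (real \<Rightarrow> 's \<Rightarrow> 'd path) \<Rightarrow> bool" where
  "rwre_coupling \<mu> M \<omega> X \<longleftrightarrow> prob_space M \<and>
     (\<forall>p\<in>{0..1}. (\<lambda>s. (\<omega> p s, X p s)) \<in> M \<rightarrow>\<^sub>M env_space \<Otimes>\<^sub>M path_space \<and>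
        distr M (env_space \<Otimes>\<^sub>M path_space) (\<lambda>s. (\<omega> p s, X p s)) = annealed_law (\<mu> p))"

definition visits :: "(int ^ 'd::finite) pmf \<Rightarrow> 'd env \<Rightarrow> 'd path \<Rightarrow> nat \<Rightarrow> nat" where
  "visits \<gamma> \<omega> x n = card {m. m < n \<and> \<omega> (x m) = \<gamma>}"

text \<open>At \<open>n = 0\<close> the value is \<open>0\<close>, which is irrelevant for the limit.\<close>

definition mean_velocity :: "'d::finite path \<Rightarrow> nat \<Rightarrow> real ^ 'd" where
  "mean_velocity x n = (1 / real n) *\<^sub>R rvec (x n)"

text \<open>Meaningful only when the sequence converges.\<close>

definition velocity :: "'d::finite path \<Rightarrow> real ^ 'd" where
  "velocity x = lim (mean_velocity x)"


lemma Ionescu_Tulcea_walk: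
  "Ionescu_Tulcea (\<lambda>n h. measure_pmf (walk_kernel \<omega> n h)) (\<lambda>_. count_space UNIV)"
proof
  show "(\<lambda>h. measure_pmf (walk_kernel \<omega> n h)) \<in>
      PiM {0..<n} (\<lambda>_. count_space UNIV) \<rightarrow>\<^sub>M subprob_algebra (count_space UNIV)" for n
  proof (cases n)
    case 0
    then show ?thesis
      by (auto intro!: measurable_const measure_pmf_in_subprob_algebra)
  next
    case (Suc m)
    have "(\<lambda>h. h m) \<in> PiM {0..<n} (\<lambda>_. count_space UNIV) \<rightarrow>\<^sub>M
        (count_space UNIV :: (int ^ 'a) measure)"
      using Suc by (intro measurable_component_singleton) auto
    moreover have "(\<lambda>y. measure_pmf (map_pmf (\<lambda>e. y + e) (\<omega> y))) \<in>
        count_space UNIV \<rightarrow>\<^sub>M subprob_algebra (count_space UNIV)"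
      by (auto intro!: measure_pmf_in_subprob_algebra)
    ultimately show ?thesis
      using Suc by (auto dest: measurable_compose)
  qed
qed

lemma sets_quenched_law [measurable_cong]: "sets (quenched_law \<omega>) = sets path_space"
proof -
  interpret Ionescu_Tulcea "\<lambda>n h. measure_pmf (walk_kernel \<omega> n h)" "\<lambda>_. count_space UNIV"
    by (rule Ionescu_Tulcea_walk)
  show ?thesis
    by (simp add: quenched_law_def path_space_def)
qed

lemma prob_space_quenched_law: "prob_space (quenched_law \<omega>)"
proof -
  interpret Ionescu_Tulcea "\<lambda>n h. measure_pmf (walk_kernel \<omega> n h)" "\<lambda>_. count_space UNIV"
    by (rule Ionescu_Tulcea_walk)
  have "emeasure PF.lim (PF.emb UNIV {} (space (PiM {} (\<lambda>_. count_space UNIV)))) =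
      emeasure (CI {}) (space (PiM {} (\<lambda>_. count_space UNIV)))"
    by (intro lim) auto
  moreover have "emeasure (CI {}) (space (CI {})) = 1"
    by (intro prob_space.emeasure_space_1 PF.prob_space_P) auto
  ultimately have "emeasure PF.lim (space PF.lim) = 1"
    by (simp add: CI_def space_PiM prod_emb_def restrict_def)
  then show ?thesis
    by (auto simp: quenched_law_def intro: prob_spaceI)
qed

lemma quenched_law_cylinder:
  "emeasure (quenched_law \<omega>) {X. \<forall>k\<le>n. X k = x k} =
     (if x 0 = 0 then ennreal (\<Prod>k<n. pmf (\<omega> (x k)) (x (Suc k) - x k)) else 0)"
proof -
  interpret Ionescu_Tulcea "\<lambda>n h. measure_pmf (walk_kernel \<omega> n h)" "\<lambda>_. count_space UNIV"
    by (rule Ionescu_Tulcea_walk)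
  let ?S = "\<lambda>n. {restrict x {0..<n}}"
  let ?w = "\<lambda>n. \<Prod>k<n. ennreal (pmf (walk_kernel \<omega> k x) (x k))"
  have S: "?S n \<in> sets (PiM {0..<n} (\<lambda>_. count_space UNIV))" for n
  proof -
    have "?S n = PiE {0..<n} (\<lambda>k. {x k})"
      by (auto simp: PiE_iff extensional_def restrict_def fun_eq_iff)
    then show ?thesis by (auto intro!: sets_PiM_I_finite)
  qed
  have C: "emeasure (C 0 n (\<lambda>_. undefined)) (?S n) = ?w n" for n
  proof (induction n)
    case 0
    then show ?case using S[of 0] by (simp add: indicator_def restrict_def)
  next
    case (Suc n)
    have und: "(\<lambda>_. undefined) \<in> space (PiM {0..<0::nat} (\<lambda>_. count_space (UNIV::(int^'a) set)))"
      by (simp add: space_PiM)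
    note [measurable_cong] = sets_C[OF und]
    have spC: "space (C 0 n (\<lambda>_. undefined)) = space (PiM {0..<n} (\<lambda>_. count_space UNIV))"
      using space_C[OF und] by simp
    have meas: "eP n \<in> C 0 n (\<lambda>_. undefined) \<rightarrow>\<^sub>M
        subprob_algebra (PiM {0..<Suc n} (\<lambda>_. count_space UNIV))"
      using measurable_eP[of n] by (simp add: measurable_cong_sets[OF sets_C[OF und] refl])
    have wk: "walk_kernel \<omega> n (restrict x {0..<n}) = walk_kernel \<omega> n x"
      by (cases n) auto
    have eq: "emeasure (eP n h) (?S (Suc n)) =
        ennreal (pmf (walk_kernel \<omega> n x) (x n)) * indicator (?S n) h"
      if h: "h \<in> space (PiM {0..<n} (\<lambda>_. count_space UNIV))" for h
    proof -
      have "(\<lambda>y. h(n := y)) -` ?S (Suc n) = (if h = restrict x {0..<n} then {x n} else {})"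
      proof -
        have "h(n := y) = restrict x {0..<Suc n} \<longleftrightarrow> h = restrict x {0..<n} \<and> y = x n" for y
        proof
          assume a: "h(n := y) = restrict x {0..<Suc n}"
          have "y = x n" using fun_cong[OF a, of n] by simp
          moreover have "h k = restrict x {0..<n} k" for k
            using fun_cong[OF a, of k] h
            by (cases "k = n") (auto simp: space_PiM PiE_iff extensional_def restrict_def split: if_splits)
          ultimately show "h = restrict x {0..<n} \<and> y = x n" by auto
        qed (auto simp: restrict_def fun_eq_iff)
        then show ?thesis by (auto simp: vimage_def)
      qed
      then show ?thesis
        by (auto simp: emeasure_eP[OF h S] wk emeasure_pmf_single indicator_def)
    qed
    have "emeasure (C 0 (Suc n) (\<lambda>_. undefined)) (?S (Suc n)) =
        (\<integral>\<^sup>+h. emeasure (eP n h) (?S (Suc n)) \<partial>C 0 n (\<lambda>_. undefined))"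
      using S[of "Suc n"] meas
      by (simp add: emeasure_bind[where N = "PiM {0..<Suc n} (\<lambda>_. count_space UNIV)"] spC)
    also have "\<dots> = (\<integral>\<^sup>+h. ennreal (pmf (walk_kernel \<omega> n x) (x n)) * indicator (?S n) h
        \<partial>C 0 n (\<lambda>_. undefined))"
      by (intro nn_integral_cong eq) (simp add: spC)
    also have "\<dots> = ennreal (pmf (walk_kernel \<omega> n x) (x n)) * ?w n"
      using S[of n] sets_C[OF und, of n] by (simp add: nn_integral_cmult_indicator Suc)
    finally show ?case
      by (simp add: mult.commute del: C.simps restrict_apply)
  qed
  have "{X. \<forall>k\<le>n. X k = x k} = PF.emb UNIV {0..<Suc n} (?S (Suc n))"
    by (simp add: prod_emb_def space_PiM restrict_def fun_eq_iff less_Suc_eq_le vimage_def)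
  then have "emeasure (quenched_law \<omega>) {X. \<forall>k\<le>n. X k = x k} =
      emeasure PF.lim (PF.emb UNIV {0..<Suc n} (?S (Suc n)))"
    by (simp add: quenched_law_def)
  also have "\<dots> = emeasure (CI {0..<Suc n}) (?S (Suc n))"
    by (intro lim S) auto
  also have "\<dots> = emeasure (C 0 (Suc n) (\<lambda>_. undefined)) (?S (Suc n))"
    using emeasure_CI[of "{0..<Suc n}" "Suc n" "?S (Suc n)"] S[of "Suc n"]
    by (subst (asm) prod_emb_id) (auto simp: sets.sets_into_space PiE_iff space_PiM extensional_def)
  also have "\<dots> = ?w (Suc n)"
    by (rule C)
  also have "\<dots> = ennreal (pmf (return_pmf 0) (x 0)) *
      (\<Prod>k<n. ennreal (pmf (walk_kernel \<omega> (Suc k) x) (x (Suc k))))"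
    by (subst prod.lessThan_Suc_shift) simp
  also have "\<dots> = (if x 0 = 0 then ennreal (\<Prod>k<n. pmf (\<omega> (x k)) (x (Suc k) - x k)) else 0)"
  proof -
    have "pmf (map_pmf (\<lambda>e. y + e) q) z = pmf q (z - y)" for y z :: "int ^ 'a" and q
      using pmf_map_inj'[of "\<lambda>e. y + e" q "z - y"] by (simp add: inj_def)
    then show ?thesis
      by (auto simp: pmf_return prod_ennreal indicator_def)
  qed
  finally show ?thesis .
qed

lemma path_space_eq_sigma:
  "sets (path_space :: 'd::finite path measure) =
     sigma_sets UNIV (insert {} (range (\<lambda>(n, x). {X. \<forall>k\<le>n. X k = x k})))" (is "_ = sigma_sets UNIV ?G")
proof
  have cyl: "{X. \<forall>k\<le>n. X k = x k} \<in> sets path_space" for n and x :: "'d path"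
  proof -
    have "{X \<in> space path_space. \<forall>k\<in>{..n}. X k = x k} \<in> sets path_space"
      unfolding path_space_def by (intro sets.sets_Collect_finite_All) auto
    then show ?thesis by (simp add: path_space_def space_PiM atMost_iff Ball_def)
  qed
  have "?G \<subseteq> sets path_space"
    using cyl by auto
  then show "sigma_sets UNIV ?G \<subseteq> sets (path_space :: 'd path measure)"
    using sets.sigma_sets_subset[of ?G "path_space :: 'd path measure"]
    by (simp add: path_space_def space_PiM)
  interpret G: sigma_algebra UNIV "sigma_sets UNIV ?G"
    by (rule sigma_algebra_sigma_sets) auto
  have comp: "{X :: 'd path. X k \<in> A} \<in> sigma_sets UNIV ?G" for k A
  proof -
    have "{X :: 'd path. X k \<in> A} =
        (\<Union>xs\<in>{xs. length xs = Suc k \<and> xs ! k \<in> A}. {X. \<forall>i\<le>k. X i = xs ! i})" (is "?L = ?R")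
    proof
      show "?L \<subseteq> ?R"
      proof
        fix X :: "'d path" assume X: "X \<in> ?L"
        have e: "map X [0..<Suc k] ! i = X i" if "i \<le> k" for i
          using that by (metis diff_zero length_upt less_Suc_eq_le nth_map nth_upt plus_nat.add_0)
        show "X \<in> ?R"
          using X e by (intro UN_I[of "map X [0..<Suc k]"]) (auto simp del: upt_Suc)
      qed
    qed auto
    also have "\<dots> \<in> sigma_sets UNIV ?G"
    proof (intro G.countable_UN'')
      show "countable {xs :: (int ^ 'd) list. length xs = Suc k \<and> xs ! k \<in> A}"
        by simp
      show "{X :: 'd path. \<forall>i\<le>k. X i = xs ! i} \<in> sigma_sets UNIV ?G" for xs
        by (rule sigma_sets.Basic) (auto intro!: image_eqI[where x="(k, \<lambda>i. xs ! i)"])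
    qed
    finally show ?thesis .
  qed
  show "sets (path_space :: 'd path measure) \<subseteq> sigma_sets UNIV ?G"
    unfolding path_space_def sets_PiM_single using comp
    by (simp only: space_count_space PiE_UNIV_domain Pi_UNIV) (rule G.sigma_sets_subset, auto)
qed

lemma measurable_quenched_law [measurable]:
  "quenched_law \<in> env_space \<rightarrow>\<^sub>M subprob_algebra (path_space :: 'd::finite path measure)"
proof (rule measurable_subprob_algebra_generated[OF path_space_eq_sigma])
  let ?G = "insert {} (range (\<lambda>(n, x :: 'd path). {X. \<forall>k\<le>n. X k = x k}))"
  show "Int_stable ?G"
  proof (rule Int_stableI)
    have *: "{X. \<forall>k\<le>n. X k = x k} \<inter> {X. \<forall>k\<le>m. X k = y k} \<in> ?G"
      if "n \<le> m" for n m and x y :: "'d path"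
    proof (cases "\<forall>k\<le>n. x k = y k")
      case True
      then have "{X. \<forall>k\<le>n. X k = x k} \<inter> {X. \<forall>k\<le>m. X k = y k} = {X. \<forall>k\<le>m. X k = y k}"
        using that by auto
      then show ?thesis by (auto intro!: image_eqI[where x="(m, y)"])
    next
      case False
      then have "{X. \<forall>k\<le>n. X k = x k} \<inter> {X. \<forall>k\<le>m. X k = y k} = {}"
        using that by (auto dest: order_trans)
      then show ?thesis by simp
    qed
    fix a b assume "a \<in> ?G" "b \<in> ?G"
    then consider "a = {} \<or> b = {}"
      | n x m y where "a = {X. \<forall>k\<le>n. X k = x k}" "b = {X. \<forall>k\<le>m. X k = y k}"
      by (auto split: prod.splits)
    then show "a \<inter> b \<in> ?G"
    proof cases
      case 2
      then show ?thesis
        using *[of n m x y] *[of m n y x] by (metis Int_commute nle_le)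
    qed auto
  qed
  show "subprob_space (quenched_law \<omega>)" for \<omega> :: "'d env"
    by (intro prob_space_imp_subprob_space prob_space_quenched_law)
  show "sets (quenched_law \<omega>) = sets path_space" for \<omega> :: "'d env"
    by (rule sets_quenched_law)
  have "(\<lambda>\<omega> :: 'd env. ennreal (pmf (\<omega> y) z)) \<in> borel_measurable env_space" for y z
    unfolding env_space_def
    by (rule measurable_compose[OF measurable_component_singleton]) auto
  then have [measurable]: "(\<lambda>\<omega> :: 'd env. pmf (\<omega> y) z) \<in> borel_measurable env_space" for y z
    unfolding env_space_def
    by (intro measurable_compose[OF measurable_component_singleton]) auto
  show "(\<lambda>\<omega>. emeasure (quenched_law \<omega>) A) \<in> borel_measurable env_space" if A: "A \<in> ?G" for A
  proof (cases "A = {}")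
    case False
    then obtain n x where "A = {X. \<forall>k\<le>n. X k = x k}"
      using A by auto
    then show ?thesis
      by (simp add: quenched_law_cylinder)
  qed simp
  show "(\<lambda>\<omega>. emeasure (quenched_law \<omega>) UNIV) \<in> borel_measurable (env_space :: 'd env measure)"
  proof -
    have "emeasure (quenched_law \<omega>) UNIV = 1" for \<omega> :: "'d env"
      using prob_space.emeasure_space_1[OF prob_space_quenched_law[of \<omega>]]
        sets_eq_imp_space_eq[OF sets_quenched_law[of \<omega>]] by (simp add: path_space_def space_PiM)
    then show ?thesis by simp
  qed
qed auto

lemma annealed_law_cylinder:
  assumes [measurable]: "A \<in> sets env_space"
  shows "emeasure (annealed_law \<mu>) (A \<times> {X. \<forall>k\<le>n. X k = x k}) =
    (\<integral>\<^sup>+\<omega>. (if x 0 = 0 then ennreal (\<Prod>k<n. pmf (\<omega> (x k)) (x (Suc k) - x k)) else 0) *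
      indicator A \<omega> \<partial>env_law \<mu>)"
proof -
  have se [measurable_cong]: "sets (env_law \<mu>) = sets env_space"
    unfolding env_law_def env_space_def by (intro sets_PiM_cong) auto
  have cyl [measurable]: "{X. \<forall>k\<le>n. X k = x k} \<in> sets path_space"
    unfolding path_space_eq_sigma
    by (rule sigma_sets.Basic) (auto intro!: image_eqI[where x="(n, x)"])
  have ne: "space (env_law \<mu>) \<noteq> {}"
    by (simp add: env_law_def space_PiM)
  have sp: "space (quenched_law \<omega>) = UNIV" for \<omega> :: "'a env"
    using sets_eq_imp_space_eq[OF sets_quenched_law[of \<omega>]] by (simp add: path_space_def space_PiM)
  have spe: "space env_space = UNIV"
    by (simp add: env_space_def space_PiM)
  have K: "(\<lambda>\<omega>. distr (quenched_law \<omega>) (env_space \<Otimes>\<^sub>M path_space) (\<lambda>X. (\<omega>, X))) \<in>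
      env_law \<mu> \<rightarrow>\<^sub>M subprob_algebra (env_space \<Otimes>\<^sub>M path_space)"
    by (rule measurable_distr2[where f=Pair and M=path_space]) measurable
  have "emeasure (distr (quenched_law \<omega>) (env_space \<Otimes>\<^sub>M path_space) (\<lambda>X. (\<omega>, X)))
      (A \<times> {X. \<forall>k\<le>n. X k = x k}) =
      (if x 0 = 0 then ennreal (\<Prod>k<n. pmf (\<omega> (x k)) (x (Suc k) - x k)) else 0) * indicator A \<omega>" for \<omega>
  proof -
    have "(\<lambda>X. (\<omega>, X)) \<in> quenched_law \<omega> \<rightarrow>\<^sub>M env_space \<Otimes>\<^sub>M path_space"
      by (simp add: measurable_cong_sets[OF sets_quenched_law refl] measurable_Pair1' spe)
    then show ?thesis
      by (subst emeasure_distr) (auto simp: quenched_law_cylinder[symmetric] sp vimage_def indicator_def)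
  qed
  then show ?thesis
    unfolding annealed_law_def by (subst emeasure_bind[OF ne K]) auto
qed

end

theory Submission
  imports Defs
begin

text \<open>Give every site an independent uniform label and prepare two independent stacks of steps, one
  i.i.d. from \<open>\<gamma>1\<close> and one i.i.d. from \<open>\<gamma>2\<close>. The walk with parameter \<open>p\<close> reads the next step of the
  first stack at sites with label below \<open>p\<close> and of the second stack elsewhere, all parameters using the
  same labels and stacks. Whenever two walks have read equally often from the first stack they are at
  the same site, so the number of first-stack reads is monotone in \<open>p\<close>; this is (i), and since the
  position is determined by the two read counts, (ii) follows, as does (iv) by the law of large numbers
  for the stacks.

  For (iii), the difference of two walks after \<open>n\<close> steps is a sum of \<open>k\<close> fresh entries of the first
  stack minus \<open>k\<close> fresh entries of the second, with drift \<open>k\<close> times the gap of the local drifts. By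
  Chernoff bounds it is unlikely to be negative while \<open>k\<close> is large. If it were negative from some time
  on with positive probability, then optional stopping, applied to windows of bounded length starting
  at the first unread entries, would contradict the positive drift.

  The limiting velocity is obtained for each coordinate from levels that the walk reaches and never
  crosses back. If such an escape has probability zero, the walk spends a long time around most
  levels and has speed zero in that direction; otherwise the increments between regeneration levels
  are i.i.d. under the law conditioned on escape, and a maximal inequality yields the speed.\<close>

section \<open>Product measures\<close>

text \<open>No zero-one law for escape in a direction is used, so the velocity argument cannot
  assume that an escape happens almost surely. It treats each sign of a coordinate separately and
  distinguishes only whether the escape probability vanishes. Independence has a single source
  there: at a strict record of the level, no site at or above the record has been left before. In
  (iii) the obstacle is that staying behind forever is not decided by the entries read so far, so
  optional stopping does not apply to it. It is a decreasing limit of events that are so decided.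
  Windows cut off at length \<open>K\<close> make the error of this approximation at most
  \<open>2 * K\<close> times a vanishing probability, and the cut itself costs a multiple of
  \<open>K\<close> on an event of probability geometric in \<open>K\<close>. For
  \<open>p = 0\<close> or \<open>p' = 1\<close> the unread start of one window never moves and this
  argument stops working, but then the lead itself diverges and the tail bound alone
  suffices.\<close>

lemma PiM_splice:
  assumes M: "\<And>i. prob_space (M i)"
  shows "distr (PiM UNIV M \<Otimes>\<^sub>M PiM UNIV M) (PiM UNIV M) (\<lambda>(x, y) i. if i \<in> J then y i else x i) = PiM UNIV M"
    (is "?D = _")
proof -
  interpret P: product_prob_space M UNIV
    using M by (simp add: product_prob_spaceI)
  let ?f = "\<lambda>(x, y) i. if i \<in> J then y i else x i"
  have f: "?f \<in> PiM UNIV M \<Otimes>\<^sub>M PiM UNIV M \<rightarrow>\<^sub>M PiM UNIV M"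
  proof (rule measurable_PiM_single')
    show "(\<lambda>\<omega>. ?f \<omega> i) \<in> PiM UNIV M \<Otimes>\<^sub>M PiM UNIV M \<rightarrow>\<^sub>M M i" for i
      by (cases "i \<in> J") (auto simp: split_beta' intro!: measurable_compose[OF measurable_snd]
          measurable_compose[OF measurable_fst])
  qed (auto simp: space_pair_measure space_PiM PiE_iff split: if_splits)
  show ?thesis
  proof (rule P.PiM_eq)
    fix I F assume I: "finite I" "I \<subseteq> UNIV" "\<And>j. j \<in> I \<Longrightarrow> F j \<in> sets (M j)"
    let ?E = "\<lambda>K. prod_emb UNIV M K (Pi\<^sub>E K F)"
    have ss: "\<And>j x. j \<in> I \<Longrightarrow> x \<in> F j \<Longrightarrow> x \<in> space (M j)"
      using I(3)[THEN sets.sets_into_space] by auto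
    \<comment> \<open>A finite-dimensional box splits into its coordinates outside \<open>J\<close>,
      tested on the first copy, and those inside \<open>J\<close>, tested on the second.\<close>
    have "?f -` ?E I \<inter> space (PiM UNIV M \<Otimes>\<^sub>M PiM UNIV M) = ?E (I - J) \<times> ?E (I \<inter> J)"
      using ss by (auto simp: space_pair_measure space_PiM prod_emb_def PiE_iff restrict_def extensional_def split: if_splits)
    then have "emeasure ?D (?E I) = emeasure (PiM UNIV M \<Otimes>\<^sub>M PiM UNIV M) (?E (I - J) \<times> ?E (I \<inter> J))"
      using I by (subst emeasure_distr[OF f]) (auto intro!: sets_PiM_I)
    also have "\<dots> = emeasure (PiM UNIV M) (?E (I - J)) * emeasure (PiM UNIV M) (?E (I \<inter> J))"
      using I by (intro P.emeasure_pair_measure_Times sets_PiM_I) auto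
    also have "\<dots> = (\<Prod>j\<in>I - J. emeasure (M j) (F j)) * (\<Prod>j\<in>I \<inter> J. emeasure (M j) (F j))"
      using I by (subst (1 2) P.emeasure_PiM_emb) auto
    also have "\<dots> = (\<Prod>j\<in>(I - J) \<union> (I \<inter> J). emeasure (M j) (F j))"
      using I by (intro prod.union_disjoint[symmetric]) auto
    also have "(I - J) \<union> (I \<inter> J) = I" by auto
    finally show "emeasure ?D (?E I) = (\<Prod>j\<in>I. emeasure (M j) (F j))" .
  qed simp
qed

text \<open>After \<open>PiM_splice\<close> the factor \<open>f\<close> sees only the first copy and
  \<open>g\<close> only the second, so Tonelli factors the integral. Expressing dependence through
  invariance under changes of coordinates avoids sub-sigma-algebras and allows infinite
  \<open>J\<close>.\<close>

lemma nn_integral_PiM_indep: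
  fixes f g :: "('i \<Rightarrow> 'a) \<Rightarrow> ennreal"
  assumes M: "\<And>i. prob_space (M i)"
    and f[measurable]: "f \<in> borel_measurable (PiM UNIV M)" and g[measurable]: "g \<in> borel_measurable (PiM UNIV M)"
    and fJ: "\<And>x y. (\<And>i. i \<notin> J \<Longrightarrow> x i = y i) \<Longrightarrow> f x = f y"
    and gJ: "\<And>x y. (\<And>i. i \<in> J \<Longrightarrow> x i = y i) \<Longrightarrow> g x = g y"
  shows "(\<integral>\<^sup>+x. f x * g x \<partial>PiM UNIV M) = (\<integral>\<^sup>+x. f x \<partial>PiM UNIV M) * (\<integral>\<^sup>+x. g x \<partial>PiM UNIV M)"
proof -
  interpret P: prob_space "PiM UNIV M" using M by (rule prob_space_PiM)
  let ?f = "\<lambda>(x, y) i. if i \<in> J then y i else x i"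
  have m: "?f \<in> PiM UNIV M \<Otimes>\<^sub>M PiM UNIV M \<rightarrow>\<^sub>M PiM UNIV M"
  proof (rule measurable_PiM_single')
    show "(\<lambda>\<omega>. ?f \<omega> i) \<in> PiM UNIV M \<Otimes>\<^sub>M PiM UNIV M \<rightarrow>\<^sub>M M i" for i
      by (cases "i \<in> J") (auto simp: split_beta' intro!: measurable_compose[OF measurable_snd]
          measurable_compose[OF measurable_fst])
  qed (auto simp: space_pair_measure space_PiM PiE_iff split: if_splits)
  have "(\<integral>\<^sup>+x. f x * g x \<partial>PiM UNIV M) = (\<integral>\<^sup>+z. f (?f z) * g (?f z) \<partial>(PiM UNIV M \<Otimes>\<^sub>M PiM UNIV M))"
    by (subst PiM_splice[OF M, where J=J, symmetric]) (subst nn_integral_distr[OF m], auto)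
  also have "\<dots> = (\<integral>\<^sup>+z. f (fst z) * g (snd z) \<partial>(PiM UNIV M \<Otimes>\<^sub>M PiM UNIV M))"
    by (intro nn_integral_cong) (auto simp: split_beta' intro!: arg_cong2[where f="(*)"] fJ gJ)
  also have "\<dots> = (\<integral>\<^sup>+x. \<integral>\<^sup>+y. f x * g y \<partial>PiM UNIV M \<partial>PiM UNIV M)"
    by (subst P.nn_integral_fst[symmetric]) auto
  also have "\<dots> = (\<integral>\<^sup>+x. f x \<partial>PiM UNIV M) * (\<integral>\<^sup>+x. g x \<partial>PiM UNIV M)"
    by (simp add: nn_integral_cmult nn_integral_multc)
  finally show ?thesis .
qed

section \<open>Path measures\<close>

lemma space_path_space [simp]: "space path_space = UNIV"
  by (simp add: path_space_def space_PiM)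

lemma space_env_space [simp]: "space env_space = UNIV"
  by (simp add: env_space_def space_PiM)

lemma measurable_path_component [measurable]: "(\<lambda>X. X n) \<in> path_space \<rightarrow>\<^sub>M count_space UNIV"
  unfolding path_space_def by simp

lemma space_quenched_law [simp]: "space (quenched_law \<omega>) = UNIV"
  using sets_eq_imp_space_eq[OF sets_quenched_law[of \<omega>]] by simp

lemma emeasure_quenched_law_UNIV [simp]: "emeasure (quenched_law \<omega>) UNIV = 1"
  using prob_space.emeasure_space_1[OF prob_space_quenched_law[of \<omega>]] by simp

lemma sets_env_law [measurable_cong, simp]: "sets (env_law \<mu>) = sets env_space"
  unfolding env_law_def env_space_def by (intro sets_PiM_cong) auto

lemma space_env_law [simp]: "space (env_law \<mu>) = UNIV"
  by (simp add: env_law_def space_PiM)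

lemma prob_space_env_law: "prob_space (env_law \<mu>)"
  unfolding env_law_def by (intro prob_space_PiM prob_space_measure_pmf)

definition cyl :: "(nat \<Rightarrow> 'a) \<Rightarrow> nat \<Rightarrow> (nat \<Rightarrow> 'a) set" where
  "cyl x n = {X. \<forall>k\<le>n. X k = x k}"

lemma sets_cyl [measurable]: "cyl x n \<in> sets path_space"
  unfolding path_space_eq_sigma cyl_def
  by (rule sigma_sets.Basic) (auto intro!: image_eqI[where x="(n, x)"])

lemma Int_stable_cyl: "Int_stable (insert {} (range (\<lambda>(n, x). cyl x n)))"
proof (rule Int_stableI)
  have *: "cyl x n \<inter> cyl y m \<in> insert {} (range (\<lambda>(n, x). cyl x n))"
    if "n \<le> m" for n m and x y :: "nat \<Rightarrow> 'a"
  proof (cases "\<forall>k\<le>n. x k = y k")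
    case True
    then have "cyl x n \<inter> cyl y m = cyl y m"
      using that by (auto simp: cyl_def)
    then show ?thesis by (auto intro!: image_eqI[where x="(m, y)"])
  next
    case False
    then have "cyl x n \<inter> cyl y m = {}"
      using that by (auto simp: cyl_def dest: order_trans)
    then show ?thesis by simp
  qed
  fix a b :: "(nat \<Rightarrow> 'a) set"
  assume "a \<in> insert {} (range (\<lambda>(n, x). cyl x n))" "b \<in> insert {} (range (\<lambda>(n, x). cyl x n))"
  then consider "a = {} \<or> b = {}" | n x m y where "a = cyl x n" "b = cyl y m"
    by (auto split: prod.splits)
  then show "a \<inter> b \<in> insert {} (range (\<lambda>(n, x). cyl x n))"
  proof cases
    case 2
    then show ?thesis
      using *[of n m x y] *[of m n y x] by (metis Int_commute nle_le)
  qed auto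
qed

lemma path_measure_eqI:
  fixes M N :: "'d::finite path measure"
  assumes M: "finite_measure M" and s[simp]: "sets M = sets path_space" "sets N = sets path_space"
    and eq: "\<And>x n. emeasure M (cyl x n) = emeasure N (cyl x n)"
  shows "M = N"
proof -
  interpret finite_measure M by fact
  have sp: "space M = UNIV" using sets_eq_imp_space_eq[OF s(1)] by simp
  have e: "insert {} (range (\<lambda>(n, x). cyl x n)) = insert {} (range (\<lambda>(n, x :: 'd path). {X. \<forall>k\<le>n. X k = x k}))"
    unfolding cyl_def ..
  show ?thesis
  proof (rule measure_eqI_generator_eq_countable[OF Int_stable_cyl])
    show "sets M = sigma_sets UNIV (insert {} (range (\<lambda>(n, x). cyl x n)))"
      "sets N = sigma_sets UNIV (insert {} (range (\<lambda>(n, x). cyl x n)))"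
      using path_space_eq_sigma[where 'd='d] unfolding e by simp_all
    show "range (\<lambda>z. cyl (\<lambda>_. z) 0) \<subseteq> insert {} (range (\<lambda>(n, x). cyl x n))" by auto
    show "(\<Union>(range (\<lambda>z::int^'d. cyl (\<lambda>_. z) 0))) = UNIV" by (auto simp: cyl_def)
    show "countable (range (\<lambda>z::int^'d. cyl (\<lambda>_. z) 0))" by simp
  qed (auto simp: eq)
qed

definition prefix :: "nat \<Rightarrow> (nat \<Rightarrow> 'a) \<Rightarrow> 'a list" where
  "prefix t X = map X [0..<Suc t]"

lemma prefix_eq_iff: "prefix t X = prefix t Y \<longleftrightarrow> (\<forall>k\<le>t. X k = Y k)"
  unfolding prefix_def by (auto simp: map_eq_conv less_Suc_eq_le simp del: upt_Suc)

lemma prefix_eq_cyl: "{Y. prefix t Y = prefix t X} = cyl X t"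
  by (auto simp: prefix_eq_iff cyl_def)

lemma measurable_prefix [measurable]: "prefix t \<in> path_space \<rightarrow>\<^sub>M count_space UNIV"
proof (subst measurable_count_space_eq_countable, simp, intro conjI ballI)
  fix l :: "(int^'a) list"
  have "prefix t -` {l} \<inter> space path_space = (if \<exists>X. prefix t X = l then cyl (SOME X. prefix t X = l) t else {})"
  proof (cases "\<exists>X. prefix t X = l")
    case True
    then have "prefix t (SOME X. prefix t X = l) = l" by (rule someI_ex)
    then show ?thesis using True prefix_eq_cyl[of t "SOME X. prefix t X = l"] by auto
  qed auto
  then show "prefix t -` {l} \<inter> space path_space \<in> sets path_space" by auto
qed auto

text \<open>Takes the place of membership in the time-\<open>t\<close> sigma-algebra of the
  canonical filtration; sites are countable, so measurability follows
  (\<open>sets_det_by\<close>).\<close>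

definition det_by :: "nat \<Rightarrow> ((nat \<Rightarrow> 'a) \<Rightarrow> bool) \<Rightarrow> bool" where
  "det_by t P \<longleftrightarrow> (\<forall>X Y. (\<forall>k\<le>t. X k = Y k) \<longrightarrow> P X = P Y)"

lemma det_by_prefix:
  assumes "det_by t P"
  shows "P X \<longleftrightarrow> prefix t X \<in> prefix t ` Collect P"
proof
  assume "prefix t X \<in> prefix t ` Collect P"
  then obtain Y where "P Y" "prefix t X = prefix t Y" by auto
  with assms show "P X" unfolding det_by_def prefix_eq_iff by blast
qed auto

lemma sets_det_by: "det_by t P \<Longrightarrow> {X. P X} \<in> sets path_space"
proof -
  assume "det_by t P"
  then have "{X. P X} = prefix t -` (prefix t ` Collect P) \<inter> space path_space"
    using det_by_prefix by (intro set_eqI) auto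
  also have "\<dots> \<in> sets path_space" by measurable
  finally show ?thesis .
qed

lemma emeasure_prefix_sum:
  fixes M :: "'d::finite path measure"
  assumes [simp]: "sets M = sets path_space" and A: "A \<in> sets path_space"
  shows "emeasure M A = (\<integral>\<^sup>+l. emeasure M (A \<inter> {X. prefix t X = l}) \<partial>count_space UNIV)"
proof -
  have "A = (\<Union>l. A \<inter> {X. prefix t X = l})" by auto
  then have "emeasure M A = emeasure M (\<Union>l. A \<inter> {X. prefix t X = l})" by (rule arg_cong)
  also have "\<dots> = (\<integral>\<^sup>+l. emeasure M (A \<inter> {X. prefix t X = l}) \<partial>count_space UNIV)"
  proof (rule emeasure_UN_countable)
    show "A \<inter> {X. prefix t X = l} \<in> sets M" for l
      using A measurable_sets[OF measurable_prefix[of t], of "{l}"] by (auto simp: vimage_def)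
  qed (auto simp: disjoint_family_on_def)
  finally show ?thesis .
qed

text \<open>There are countably many prefixes up to time \<open>t\<close>, and an event decided by
  time \<open>t\<close> is the disjoint union of the cylinders it contains, so single cylinders
  suffice. The factor \<open>c\<close> is a probability in \<open>record_split\<close>, 1 when two
  environments are compared, and 0 for null events.\<close>

lemma emeasure_det_sum_eq:
  fixes M N :: "'d::finite path measure"
  assumes s: "sets M = sets path_space" "sets N = sets path_space" and P: "det_by t P"
    and AB: "A \<in> sets path_space" "B \<in> sets path_space"
    and eq: "\<And>x. P x \<Longrightarrow> emeasure M (cyl x t \<inter> A) = c * emeasure N (cyl x t \<inter> B)"
  shows "emeasure M ({X. P X} \<inter> A) = c * emeasure N ({X. P X} \<inter> B)"
proof -
  note [measurable] = AB sets_det_by[OF P]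
  have "emeasure M ({X. P X} \<inter> A \<inter> {X. prefix t X = l}) = c * emeasure N ({X. P X} \<inter> B \<inter> {X. prefix t X = l})" for l
  proof (cases "\<exists>x. P x \<and> prefix t x = l")
    case True
    then obtain x where x: "P x" "prefix t x = l" by auto
    have "{X. P X} \<inter> A \<inter> {X. prefix t X = l} = cyl x t \<inter> A" for A
      using x P by (auto simp: cyl_def prefix_eq_iff det_by_def simp flip: x(2))
    with eq[OF x(1)] show ?thesis by simp
  next
    case False
    then have "{X. P X} \<inter> A \<inter> {X. prefix t X = l} = {}" for A by auto
    then show ?thesis by simp
  qed
  then show ?thesis
    by (subst (1 2) emeasure_prefix_sum[where t=t]) (auto simp: s nn_integral_cmult)
qed

definition after :: "nat \<Rightarrow> (nat \<Rightarrow> 'a::group_add) \<Rightarrow> nat \<Rightarrow> 'a" where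
  "after t X k = X (t + k) - X t"

text \<open>Undoes the splitting of a path at \<open>t\<close> into its past and
  \<open>after\<close>. The value at time \<open>t\<close> is taken from \<open>X\<close>, so
  \<open>Y\<close> is recovered only if \<open>Y 0 = 0\<close>; this is where
  \<open>quenched_start\<close> enters the Markov property.\<close>

definition join :: "nat \<Rightarrow> (nat \<Rightarrow> 'a::plus) \<Rightarrow> (nat \<Rightarrow> 'a) \<Rightarrow> nat \<Rightarrow> 'a" where
  "join t X Y k = (if k \<le> t then X k else X t + Y (k - t))"

lemma measurable_after [measurable]: "after t \<in> path_space \<rightarrow>\<^sub>M path_space"
proof -
  have "(\<lambda>X k. X (t + k) - X t) \<in> path_space \<rightarrow>\<^sub>M (PiM UNIV (\<lambda>_. count_space UNIV) :: 'a path measure)"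
    by (rule measurable_PiM_single') auto
  then show ?thesis unfolding after_def[abs_def] path_space_def .
qed

lemma measurable_join [measurable]: "(\<lambda>(X, Y). join t X Y) \<in> path_space \<Otimes>\<^sub>M path_space \<rightarrow>\<^sub>M path_space"
proof -
  have "(\<lambda>(X, Y) k. join t X Y k) \<in> path_space \<Otimes>\<^sub>M path_space \<rightarrow>\<^sub>M (PiM UNIV (\<lambda>_. count_space UNIV) :: 'a path measure)"
  proof (rule measurable_PiM_single')
    show "(\<lambda>\<omega>. (case \<omega> of (X, Y) \<Rightarrow> join t X Y) k) \<in> path_space \<Otimes>\<^sub>M path_space \<rightarrow>\<^sub>M (count_space UNIV :: (int^'a) measure)" for k
      unfolding join_def split_beta' by measurable
  qed auto
  then show ?thesis unfolding path_space_def by (simp add: split_beta')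
qed

definition shift_env :: "'a \<Rightarrow> ('a::plus \<Rightarrow> 'b) \<Rightarrow> 'a \<Rightarrow> 'b" where
  "shift_env y \<omega> = (\<lambda>x. \<omega> (y + x))"

lemma measurable_shift_env [measurable]: "shift_env y \<in> env_space \<rightarrow>\<^sub>M env_space"
proof -
  have "(\<lambda>\<omega> x. \<omega> (y + x)) \<in> env_space \<rightarrow>\<^sub>M (PiM UNIV (\<lambda>_. count_space UNIV) :: 'a env measure)"
    unfolding env_space_def by (rule measurable_PiM_single') auto
  then show ?thesis unfolding shift_env_def[abs_def] env_space_def .
qed

lemma quenched_cyl:
  "emeasure (quenched_law \<omega>) (cyl x n) =
    (if x 0 = 0 then ennreal (\<Prod>k<n. pmf (\<omega> (x k)) (x (Suc k) - x k)) else 0)"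
  unfolding cyl_def by (rule quenched_law_cylinder)

lemma quenched_start: "AE X in quenched_law \<omega>. X 0 = 0"
proof -
  interpret prob_space "quenched_law \<omega>" by (rule prob_space_quenched_law)
  have "emeasure (quenched_law \<omega>) (cyl (\<lambda>_. 0) 0) = 1"
    by (simp add: quenched_cyl)
  then have "prob (cyl (\<lambda>_. 0) 0) = 1" by (simp add: measure_def)
  from AE_prob_1[OF this] show ?thesis by (auto simp: cyl_def)
qed

text \<open>Checked on cylinders: the weight of a finite path is a product over its steps, which
  splits at \<open>t\<close> into the weight of the past and that of the recentred future in the
  shifted environment.\<close>

lemma quenched_Markov_bind:
  "quenched_law \<omega> = quenched_law \<omega> \<bind> (\<lambda>X. distr (quenched_law (shift_env (X t) \<omega>)) path_space (join t X))"
    (is "_ = ?R")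
proof -
  let ?Q = "quenched_law \<omega>"
  interpret prob_space ?Q by (rule prob_space_quenched_law)
  have mq: "(\<lambda>X. quenched_law (shift_env (X t) \<omega>)) \<in> path_space \<rightarrow>\<^sub>M subprob_algebra path_space"
    by (rule measurable_compose[OF measurable_path_component[of t]])
       (auto intro!: measurable_space[OF measurable_quenched_law])
  have K0: "(\<lambda>X. distr (quenched_law (shift_env (X t) \<omega>)) path_space (join t X)) \<in> path_space \<rightarrow>\<^sub>M subprob_algebra path_space"
    by (rule measurable_distr2[OF _ mq]) measurable
  then have K: "(\<lambda>X. distr (quenched_law (shift_env (X t) \<omega>)) path_space (join t X)) \<in> ?Q \<rightarrow>\<^sub>M subprob_algebra path_space"
    by (simp add: measurable_cong_sets[OF sets_quenched_law refl])
  show ?thesis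
  proof (rule path_measure_eqI)
    show "finite_measure ?Q" by unfold_locales
    show "sets ?Q = sets path_space" by (rule sets_quenched_law)
    show "sets ?R = sets path_space" by (rule sets_bind) (auto simp: prob_space.not_empty[OF prob_space_quenched_law])
    fix x :: "'a path" and n
    have mj: "join t X \<in> quenched_law \<omega>' \<rightarrow>\<^sub>M path_space" for X and \<omega>' :: "'a env"
      using measurable_Pair2[OF measurable_join[of t]] by (simp add: measurable_cong_sets[OF sets_quenched_law refl])
    have "emeasure ?R (cyl x n) = (\<integral>\<^sup>+X. emeasure (quenched_law (shift_env (X t) \<omega>)) (join t X -` cyl x n) \<partial>?Q)"
      by (subst emeasure_bind[OF _ K]) (auto simp: emeasure_distr[OF mj])
    also have "\<dots> = emeasure ?Q (cyl x n)"
    proof (cases "n \<le> t")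
      case True
      have "join t X -` cyl x n = (if X \<in> cyl x n then UNIV else {})" for X
        using True by (auto simp: join_def cyl_def)
      then have "(\<integral>\<^sup>+X. emeasure (quenched_law (shift_env (X t) \<omega>)) (join t X -` cyl x n) \<partial>?Q) = (\<integral>\<^sup>+X. indicator (cyl x n) X \<partial>?Q)"
        by (intro nn_integral_cong) (simp add: indicator_def)
      then show ?thesis by (simp add: sets_quenched_law)
    next
      case False
      \<comment> \<open>Only almost everywhere: \<open>join\<close> ignores \<open>Y 0\<close>,
        whereas the cylinder of \<open>after t x\<close> demands \<open>Y 0 = 0\<close>.\<close>
      have *: "AE Y in quenched_law (shift_env (X t) \<omega>). Y \<in> join t X -` cyl x n \<longleftrightarrow> X \<in> cyl x t \<and> Y \<in> cyl (after t x) (n - t)" for X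
        using quenched_start
      proof eventually_elim
        case (elim Y)
        have "X \<in> cyl x t \<and> Y \<in> cyl (after t x) (n - t)" if "join t X Y \<in> cyl x n"
        proof -
          have a: "\<forall>k\<le>n. join t X Y k = x k" using that by (simp add: cyl_def)
          then have b: "X k = x k" if "k \<le> t" for k
            using spec[OF a, of k] False that by (simp add: join_def)
          moreover have "Y k = after t x k" if "k \<le> n - t" for k
            using spec[OF a, of "t + k"] elim False that b[of t]
            by (cases "k = 0") (auto simp: join_def after_def algebra_simps split: if_splits)
          ultimately show ?thesis by (simp add: cyl_def)
        qed
        moreover have "join t X Y k = x k" if "X \<in> cyl x t" "Y \<in> cyl (after t x) (n - t)" "k \<le> n" for k
          using that by (cases "k \<le> t") (auto simp: join_def cyl_def after_def dest!: spec[of _ "k - t"])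
        ultimately show ?case by (auto simp: cyl_def)
      qed
      have "emeasure (quenched_law (shift_env (X t) \<omega>)) (join t X -` cyl x n) =
          emeasure (quenched_law (shift_env (x t) \<omega>)) (cyl (after t x) (n - t)) * indicator (cyl x t) X" for X
      proof -
        have "emeasure (quenched_law (shift_env (X t) \<omega>)) (join t X -` cyl x n) =
          emeasure (quenched_law (shift_env (X t) \<omega>)) (if X \<in> cyl x t then cyl (after t x) (n - t) else {})"
        proof (rule emeasure_eq_AE)
          show "join t X -` cyl x n \<in> sets (quenched_law (shift_env (X t) \<omega>))"
            using measurable_sets[OF mj[of X], of "cyl x n"] by simp
        qed (use *[of X] in \<open>auto simp: sets_quenched_law\<close>)
        then show ?thesis by (auto simp: cyl_def)
      qed
      then have "(\<integral>\<^sup>+X. emeasure (quenched_law (shift_env (X t) \<omega>)) (join t X -` cyl x n) \<partial>?Q) =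
        emeasure (quenched_law (shift_env (x t) \<omega>)) (cyl (after t x) (n - t)) * emeasure ?Q (cyl x t)"
        by (simp add: sets_quenched_law nn_integral_cmult_indicator)
      also have "\<dots> = emeasure ?Q (cyl x n)"
      proof (cases "x 0 = 0")
        case True
        have "(\<Prod>k<n. pmf (\<omega> (x k)) (x (Suc k) - x k)) = (\<Prod>k<t. pmf (\<omega> (x k)) (x (Suc k) - x k)) * 
           (\<Prod>k<n - t. pmf (\<omega> (x (t + k))) (x (Suc (t + k)) - x (t + k)))"
          using False prod.atLeastLessThan_concat[of 0 t n "\<lambda>k. pmf (\<omega> (x k)) (x (Suc k) - x k)"]
            prod.atLeastLessThan_shift_0[of "\<lambda>k. pmf (\<omega> (x k)) (x (Suc k) - x k)" t n] by (simp add: atLeast0LessThan)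
        then show ?thesis using True
          by (simp add: quenched_cyl after_def shift_env_def ennreal_mult[symmetric] prod_nonneg mult.commute)
      qed (simp add: quenched_cyl)
      finally show ?thesis .
    qed
    finally show "emeasure ?Q (cyl x n) = emeasure ?R (cyl x n)" by simp
  qed
qed

lemma quenched_Markov:
  assumes P: "det_by t P" and y: "\<And>X. P X \<Longrightarrow> X t = y" and C[measurable]: "C \<in> sets path_space"
  shows "emeasure (quenched_law \<omega>) ({X. P X} \<inter> after t -` C) =
    emeasure (quenched_law \<omega>) {X. P X} * emeasure (quenched_law (shift_env y \<omega>)) C"
proof -
  let ?Q = "quenched_law \<omega>"
  note [measurable] = sets_det_by[OF P]
  have aft[measurable]: "after t -` C \<in> sets path_space"
    using measurable_sets[OF measurable_after C] by simp
  have mq: "(\<lambda>X. quenched_law (shift_env (X t) \<omega>)) \<in> path_space \<rightarrow>\<^sub>M subprob_algebra path_space"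
    by (rule measurable_compose[OF measurable_path_component[of t]])
       (auto intro!: measurable_space[OF measurable_quenched_law])
  have K: "(\<lambda>X. distr (quenched_law (shift_env (X t) \<omega>)) path_space (join t X)) \<in> ?Q \<rightarrow>\<^sub>M subprob_algebra path_space"
    unfolding measurable_cong_sets[OF sets_quenched_law refl] by (rule measurable_distr2[OF _ mq]) measurable
  have mj: "join t X \<in> quenched_law \<omega>' \<rightarrow>\<^sub>M path_space" for X and \<omega>' :: "'a env"
    using measurable_Pair2[OF measurable_join[of t]] by (simp add: measurable_cong_sets[OF sets_quenched_law refl])
  have PJ: "P (join t X Y) = P X" for X Y
    using P by (auto simp: det_by_def join_def)
  have "emeasure ?Q ({X. P X} \<inter> after t -` C) =
     (\<integral>\<^sup>+X. emeasure (quenched_law (shift_env (X t) \<omega>)) (join t X -` ({X. P X} \<inter> after t -` C)) \<partial>?Q)"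
    by (subst quenched_Markov_bind[of \<omega> t], subst emeasure_bind[OF _ K]) (auto simp: emeasure_distr[OF mj])
  also have "\<dots> = (\<integral>\<^sup>+X. emeasure (quenched_law (shift_env y \<omega>)) C * indicator {X. P X} X \<partial>?Q)"
  proof (rule nn_integral_cong)
    fix X
    have "emeasure (quenched_law (shift_env (X t) \<omega>)) (join t X -` ({X. P X} \<inter> after t -` C)) =
       emeasure (quenched_law (shift_env (X t) \<omega>)) (if P X then C else {})"
    proof (rule emeasure_eq_AE)
      show "join t X -` ({X. P X} \<inter> after t -` C) \<in> sets (quenched_law (shift_env (X t) \<omega>))"
        using measurable_sets[OF mj[of X], of "{X. P X} \<inter> after t -` C"] by simp
      show "AE Y in quenched_law (shift_env (X t) \<omega>).
          (Y \<in> join t X -` ({X. P X} \<inter> after t -` C)) = (Y \<in> (if P X then C else {}))"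
        using quenched_start
      proof eventually_elim
        case (elim Y)
        have "after t (join t X Y) = Y" using elim by (auto simp: after_def join_def fun_eq_iff)
        then show ?case by (simp add: PJ)
      qed
    qed (simp add: sets_quenched_law)
    then show "emeasure (quenched_law (shift_env (X t) \<omega>)) (join t X -` ({X. P X} \<inter> after t -` C)) =
       emeasure (quenched_law (shift_env y \<omega>)) C * indicator {X. P X} X"
      using y[of X] by (auto simp: indicator_def)
  qed
  also have "\<dots> = emeasure ?Q {X. P X} * emeasure (quenched_law (shift_env y \<omega>)) C"
    using sets_det_by[OF P] by (subst nn_integral_cmult_indicator) (simp_all add: sets_quenched_law mult.commute)
  finally show ?thesis .
qed

section \<open>The walk averaged over the environment\<close>

lemma UNIV_sets_path_space [simp, intro]: "UNIV \<in> sets path_space"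
  using sets.top[of path_space] by simp

definition walk_law :: "(int ^ 'd::finite) pmf pmf \<Rightarrow> 'd path measure" where
  "walk_law \<mu> = env_law \<mu> \<bind> quenched_law"

lemma measurable_quenched_law_env [measurable]:
  "quenched_law \<in> env_law \<mu> \<rightarrow>\<^sub>M subprob_algebra path_space"
  using measurable_quenched_law by (simp add: measurable_cong_sets[OF sets_env_law refl])

lemma sets_walk_law [measurable_cong, simp]: "sets (walk_law \<mu>) = sets path_space"
  unfolding walk_law_def by (rule sets_bind) (auto simp: sets_quenched_law)

lemma space_walk_law [simp]: "space (walk_law \<mu>) = UNIV"
  using sets_eq_imp_space_eq[OF sets_walk_law] by simp

lemma emeasure_walk_law:
  assumes "A \<in> sets path_space"
  shows "emeasure (walk_law \<mu>) A = (\<integral>\<^sup>+\<omega>. emeasure (quenched_law \<omega>) A \<partial>env_law \<mu>)"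
  unfolding walk_law_def using assms by (intro emeasure_bind) auto

lemma prob_space_walk_law: "prob_space (walk_law \<mu>)"
  unfolding walk_law_def
  by (rule prob_space.prob_space_bind[OF prob_space_env_law _ measurable_quenched_law_env])
     (auto simp: prob_space_quenched_law)

lemma AE_walk_lawI:
  assumes "AE \<omega> in env_law \<mu>. AE X in quenched_law \<omega>. P X" "{X. P X} \<in> sets path_space"
  shows "AE X in walk_law \<mu>. P X"
  unfolding walk_law_def using assms
  by (subst AE_bind[OF measurable_quenched_law_env]) (auto simp: pred_def)

lemma env_law_shift: "distr (env_law \<mu>) (env_law \<mu>) (shift_env y) = env_law (\<mu> :: (int^'d::finite) pmf pmf)"
proof -
  have "distr (PiM UNIV (\<lambda>_. measure_pmf \<mu>)) (PiM UNIV (\<lambda>_. measure_pmf \<mu>)) (\<lambda>\<omega>. \<lambda>n\<in>UNIV. \<omega> (y + n)) =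
     PiM (UNIV :: (int^'d) set) (\<lambda>_. measure_pmf \<mu>)"
    by (rule distr_PiM_reindex) (auto simp: inj_on_def prob_space_measure_pmf)
  then show ?thesis unfolding env_law_def shift_env_def[abs_def] by (simp add: restrict_def)
qed

lemma nn_integral_env_shift:
  assumes [measurable]: "f \<in> borel_measurable env_space"
  shows "(\<integral>\<^sup>+\<omega>. f (shift_env y \<omega>) \<partial>env_law \<mu>) = (\<integral>\<^sup>+\<omega>. f \<omega> \<partial>env_law \<mu>)"
  by (subst (2) env_law_shift[symmetric, of _ y], subst nn_integral_distr) simp_all

text \<open>The level \<open>l\<close> stands for a signed coordinate. Both signs are instantiated
  in \<open>walk_velocity_exists\<close>, so each statement in this locale concerns one direction
  only.\<close>

locale leveled_walk =
  fixes l :: "int ^ 'd::finite \<Rightarrow> int" and \<mu> :: "(int ^ 'd) pmf pmf"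
  assumes l_add: "l (x + y) = l x + l y"
    and l_unit: "e \<in> unit_vectors \<Longrightarrow> \<bar>l e\<bar> \<le> 1"
    and steps: "set_pmf \<mu> \<subseteq> step_laws"
begin

abbreviation "Q \<equiv> walk_law \<mu>"

sublocale Q: prob_space "walk_law \<mu>" by (rule prob_space_walk_law)

lemma l_0 [simp]: "l 0 = 0" using l_add[of 0 0] by simp
lemma l_diff: "l (x - y) = l x - l y" using l_add[of "x - y" y] by simp

lemma measurable_l [measurable]: "(\<lambda>X. l (X n)) \<in> path_space \<rightarrow>\<^sub>M count_space UNIV"
  by (rule measurable_compose[OF measurable_path_component]) simp

section \<open>Events that read the environment of a half-space only\<close>

definition nonneg :: "'d path set" where "nonneg = {X. \<forall>n. 0 \<le> l (X n)}"

lemma sets_nonneg [measurable]: "nonneg \<in> sets path_space"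
proof -
  have "{X \<in> space path_space. \<forall>n. 0 \<le> l (X n)} \<in> sets path_space" by measurable
  then show ?thesis by (simp add: nonneg_def)
qed

text \<open>A path in \<open>nonneg\<close> never leaves a site of negative level, so the
  environment there does not enter its weight. Cylinders are not contained in \<open>nonneg\<close>;
  hence both laws are first restricted to it and the restrictions are compared on cylinders.\<close>

lemma quenched_nonneg_cong:
  assumes \<omega>: "\<And>z. 0 \<le> l z \<Longrightarrow> \<omega> z = \<omega>' z" and C: "C \<in> sets path_space" "C \<subseteq> nonneg"
  shows "emeasure (quenched_law \<omega>) C = emeasure (quenched_law \<omega>') C"
proof -
  let ?M = "\<lambda>\<omega>. density (quenched_law \<omega>) (indicator nonneg)"
  have em: "emeasure (?M \<omega>) A = emeasure (quenched_law \<omega>) (A \<inter> nonneg)" if "A \<in> sets path_space" for A \<omega>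
    using that by (subst emeasure_density) (auto simp: indicator_inter_arith[symmetric] sets_quenched_law Int_commute)
  have "?M \<omega> = ?M \<omega>'"
  proof (rule path_measure_eqI)
    interpret R0: prob_space "quenched_law \<omega>" by (rule prob_space_quenched_law)
    show "finite_measure (?M \<omega>)"
      using sets.top[of "path_space :: 'd path measure"] R0.emeasure_finite
      by (intro finite_measureI) (simp add: em)
    fix x :: "'d path" and n
    \<comment> \<open>The infinite constraint is approached by finite ones: these events decrease to
      \<open>cyl x n \<inter> nonneg\<close>, and each is decided at time \<open>n + m\<close>,
      where weights are finite products.\<close>
    let ?B = "\<lambda>m. {X. X \<in> cyl x n \<and> (\<forall>k\<le>n + m. 0 \<le> l (X k))}"
    have d: "det_by (n + m) (\<lambda>X. X \<in> cyl x n \<and> (\<forall>k\<le>n + m. 0 \<le> l (X k)))" for m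
      by (auto simp: det_by_def cyl_def)
    have eq: "emeasure (quenched_law \<omega>) (?B m) = emeasure (quenched_law \<omega>') (?B m)" for m
    proof -
      have "emeasure (quenched_law \<omega>) (?B m \<inter> UNIV) = 1 * emeasure (quenched_law \<omega>') (?B m \<inter> UNIV)"
      proof (rule emeasure_det_sum_eq[OF _ _ d])
        fix x' assume x': "x' \<in> cyl x n \<and> (\<forall>k\<le>n + m. 0 \<le> l (x' k))"
        have "(\<Prod>k<n + m. pmf (\<omega> (x' k)) (x' (Suc k) - x' k)) = (\<Prod>k<n + m. pmf (\<omega>' (x' k)) (x' (Suc k) - x' k))"
          using x' by (intro prod.cong) (auto simp: \<omega>)
        then show "emeasure (quenched_law \<omega>) (cyl x' (n + m) \<inter> UNIV) = 1 * emeasure (quenched_law \<omega>') (cyl x' (n + m) \<inter> UNIV)"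
          by (simp add: quenched_cyl)
      qed (auto simp: sets_quenched_law)
      then show ?thesis by simp
    qed
    have lim: "(\<lambda>m. emeasure (quenched_law \<omega>) (?B m)) \<longlonglongrightarrow> emeasure (quenched_law \<omega>) (cyl x n \<inter> nonneg)" for \<omega>
    proof -
      interpret R: prob_space "quenched_law \<omega>" by (rule prob_space_quenched_law)
      have "(\<lambda>m. emeasure (quenched_law \<omega>) (?B m)) \<longlonglongrightarrow> emeasure (quenched_law \<omega>) (\<Inter>m. ?B m)"
        using sets_det_by[OF d] by (intro Lim_emeasure_decseq) (auto simp: sets_quenched_law decseq_def)
      also have "(\<Inter>m. ?B m) = cyl x n \<inter> nonneg"
        by (auto simp: nonneg_def) (metis le_add2)
      finally show ?thesis .
    qed
    show "emeasure (?M \<omega>) (cyl x n) = emeasure (?M \<omega>') (cyl x n)"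
      using LIMSEQ_unique[OF lim[of \<omega>]] lim[of \<omega>'] by (simp add: em eq)
  qed (auto simp: sets_quenched_law)
  then have "emeasure (?M \<omega>) C = emeasure (?M \<omega>') C" by simp
  moreover have "C \<inter> nonneg = C" using C by auto
  ultimately show ?thesis using C by (simp add: em)
qed

text \<open>Inclusion in \<open>nonneg\<close> would be too narrow: a path in \<open>esc L\<close>
  may drop below level 0 after reaching \<open>L\<close>. What independence requires is only that
  the quenched probability does not see the environment below level 0.\<close>

definition upper :: "'d path set \<Rightarrow> bool" where
  "upper C \<longleftrightarrow> C \<in> sets path_space \<and> (\<forall>\<omega> \<omega>'. (\<forall>z. 0 \<le> l z \<longrightarrow> \<omega> z = \<omega>' z) \<longrightarrow>
     emeasure (quenched_law \<omega>) C = emeasure (quenched_law \<omega>') C)"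

lemma sets_upper: "upper C \<Longrightarrow> C \<in> sets path_space"
  by (simp add: upper_def)

lemma upper_nonneg: "C \<in> sets path_space \<Longrightarrow> C \<subseteq> nonneg \<Longrightarrow> upper C"
  unfolding upper_def using quenched_nonneg_cong by blast

text \<open>The strict bound \<open>k < t\<close> is enough because a site contributes to the weight
  of a path only when the path leaves it.\<close>

lemma upper_det:
  assumes P: "det_by t P" and nonneg: "\<And>X k. P X \<Longrightarrow> k < t \<Longrightarrow> 0 \<le> l (X k)"
  shows "upper {X. P X}"
  unfolding upper_def
proof (intro conjI allI impI)
  show "{X. P X} \<in> sets path_space" by (rule sets_det_by[OF P])
  fix \<omega> \<omega>' :: "'d env" assume \<omega>: "\<forall>z. 0 \<le> l z \<longrightarrow> \<omega> z = \<omega>' z"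
  have "emeasure (quenched_law \<omega>) ({X. P X} \<inter> UNIV) = 1 * emeasure (quenched_law \<omega>') ({X. P X} \<inter> UNIV)"
  proof (rule emeasure_det_sum_eq[OF _ _ P])
    fix x assume "P x"
    then have "(\<Prod>k<t. pmf (\<omega> (x k)) (x (Suc k) - x k)) = (\<Prod>k<t. pmf (\<omega>' (x k)) (x (Suc k) - x k))"
      using nonneg \<omega> by (intro prod.cong) auto
    then show "emeasure (quenched_law \<omega>) (cyl x t \<inter> UNIV) = 1 * emeasure (quenched_law \<omega>') (cyl x t \<inter> UNIV)"
      by (simp add: quenched_cyl)
  qed (auto simp: sets_quenched_law)
  then show "emeasure (quenched_law \<omega>) {X. P X} = emeasure (quenched_law \<omega>') {X. P X}" by simp
qed

lemma upper_UN:
  assumes "\<And>t::nat. upper (C t)" "disjoint_family C"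
  shows "upper (\<Union>t. C t)"
  unfolding upper_def
proof (intro conjI allI impI)
  have [measurable]: "C t \<in> sets path_space" for t using assms(1) by (rule sets_upper)
  show "(\<Union>t. C t) \<in> sets path_space" by measurable
  fix \<omega> \<omega>' :: "'d env" assume \<omega>: "\<forall>z. 0 \<le> l z \<longrightarrow> \<omega> z = \<omega>' z"
  have *: "emeasure (quenched_law \<omega>) (\<Union>t. C t) = (\<Sum>t. emeasure (quenched_law \<omega>) (C t))" for \<omega>
    using assms(2) by (intro suminf_emeasure[symmetric]) (auto simp: sets_quenched_law)
  have "emeasure (quenched_law \<omega>) (C t) = emeasure (quenched_law \<omega>') (C t)" for t
    using assms(1)[of t] \<omega> unfolding upper_def by blast
  then show "emeasure (quenched_law \<omega>) (\<Union>t. C t) = emeasure (quenched_law \<omega>') (\<Union>t. C t)"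
    by (simp add: *)
qed

text \<open>The past leaves only sites of level below \<open>m\<close>, while the future started
  from \<open>y\<close> reads only sites of level at least \<open>m\<close>. The two factors depend
  on disjoint parts of the product environment, and stationarity removes the shift by
  \<open>y\<close>.\<close>

lemma quenched_fresh_indep:
  assumes x: "\<And>k. k < t \<Longrightarrow> l (x k) < m" and y: "l y = m" and C: "upper C"
  shows "(\<integral>\<^sup>+\<omega>. emeasure (quenched_law \<omega>) (cyl x t) * emeasure (quenched_law (shift_env y \<omega>)) C \<partial>env_law \<mu>) =
    emeasure Q (cyl x t) * emeasure Q C"
proof -
  note [measurable] = sets_upper[OF C]
  have e[measurable]: "(\<lambda>\<omega>. emeasure (quenched_law \<omega>) A) \<in> borel_measurable env_space" if "A \<in> sets path_space" for A :: "'d path set"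
    using that by measurable
  have "(\<integral>\<^sup>+\<omega>. emeasure (quenched_law \<omega>) (cyl x t) * emeasure (quenched_law (shift_env y \<omega>)) C \<partial>env_law \<mu>) =
    (\<integral>\<^sup>+\<omega>. emeasure (quenched_law \<omega>) (cyl x t) \<partial>env_law \<mu>) * (\<integral>\<^sup>+\<omega>. emeasure (quenched_law (shift_env y \<omega>)) C \<partial>env_law \<mu>)"
    unfolding env_law_def
  proof (rule nn_integral_PiM_indep[where J="{z. m \<le> l z}"])
    show "(\<lambda>\<omega>. emeasure (quenched_law \<omega>) (cyl x t)) \<in> borel_measurable (PiM UNIV (\<lambda>_. measure_pmf \<mu>))"
      "(\<lambda>\<omega>. emeasure (quenched_law (shift_env y \<omega>)) C) \<in> borel_measurable (PiM UNIV (\<lambda>_. measure_pmf \<mu>))"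
      unfolding env_law_def[symmetric] by measurable
    fix \<omega> \<omega>' :: "'d env"
    show "emeasure (quenched_law \<omega>) (cyl x t) = emeasure (quenched_law \<omega>') (cyl x t)"
      if "\<And>i. i \<notin> {z. m \<le> l z} \<Longrightarrow> \<omega> i = \<omega>' i"
    proof -
      have "(\<Prod>k<t. pmf (\<omega> (x k)) (x (Suc k) - x k)) = (\<Prod>k<t. pmf (\<omega>' (x k)) (x (Suc k) - x k))"
        using that x by (intro prod.cong refl) (metis lessThan_iff mem_Collect_eq not_le)
      then show ?thesis by (simp add: quenched_cyl)
    qed
    show "emeasure (quenched_law (shift_env y \<omega>)) C = emeasure (quenched_law (shift_env y \<omega>')) C"
      if "\<And>i. i \<in> {z. m \<le> l z} \<Longrightarrow> \<omega> i = \<omega>' i"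
      using that C unfolding upper_def by (auto simp: shift_env_def l_add y)
  qed (rule prob_space_measure_pmf)
  also have "\<dots> = emeasure Q (cyl x t) * emeasure Q C"
    by (subst nn_integral_env_shift[of "\<lambda>\<omega>. emeasure (quenched_law \<omega>) C"]) (auto simp: emeasure_walk_law)
  finally show ?thesis .
qed

text \<open>Strictness is essential: it leaves the site \<open>X t\<close> itself, and everything at
  or above its level, unread before time \<open>t\<close>.\<close>

definition rec_time :: "nat \<Rightarrow> 'd path \<Rightarrow> bool" where
  "rec_time t X \<longleftrightarrow> (\<forall>s<t. l (X s) < l (X t))"

lemma det_record: "det_by t (rec_time t)"
  by (auto simp: det_by_def rec_time_def)

lemma sets_after [measurable (raw)]: "C \<in> sets path_space \<Longrightarrow> after t -` C \<in> sets path_space"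
  using measurable_sets[OF measurable_after, of C] by simp

lemma det_cyl: "det_by t (\<lambda>X. X \<in> cyl x t)"
  by (auto simp: det_by_def cyl_def)

text \<open>At a record all sites left so far lie strictly below \<open>X t\<close>, so
  \<open>quenched_fresh_indep\<close> applies to each prefix and the averaged probability of
  \<open>C\<close> factors out.\<close>

lemma record_split:
  assumes P: "det_by t P" "\<And>X. P X \<Longrightarrow> rec_time t X" and C: "upper C"
  shows "emeasure Q ({X. P X} \<inter> after t -` C) = emeasure Q {X. P X} * emeasure Q C"
proof -
  have "emeasure Q ({X. P X} \<inter> after t -` C) = emeasure Q C * emeasure Q ({X. P X} \<inter> UNIV)"
  proof (rule emeasure_det_sum_eq[OF _ _ P(1)])
    fix x assume "P x"
    then have x: "l (x k) < l (x t)" if "k < t" for k using P(2)[of x] that by (auto simp: rec_time_def)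
    have "emeasure Q (cyl x t \<inter> after t -` C) = (\<integral>\<^sup>+\<omega>. emeasure (quenched_law \<omega>) (cyl x t \<inter> after t -` C) \<partial>env_law \<mu>)"
      using sets_after[OF sets_upper[OF C]] by (intro emeasure_walk_law) auto
    also have "\<dots> = (\<integral>\<^sup>+\<omega>. emeasure (quenched_law \<omega>) (cyl x t) * emeasure (quenched_law (shift_env (x t) \<omega>)) C \<partial>env_law \<mu>)"
      using quenched_Markov[OF det_cyl[of t x], of "x t" C] sets_upper[OF C] by (intro nn_integral_cong) (auto simp: cyl_def)
    also have "\<dots> = emeasure Q (cyl x t) * emeasure Q C"
      using x C by (intro quenched_fresh_indep) auto
    finally show "emeasure Q (cyl x t \<inter> after t -` C) = emeasure Q C * emeasure Q (cyl x t \<inter> UNIV)"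
      by (simp add: mult.commute)
  qed (use sets_upper[OF C] in \<open>auto intro: sets_after\<close>)
  then show ?thesis by (simp add: mult.commute)
qed

definition box :: "nat \<Rightarrow> (int ^ 'd) set" where
  "box n = {z. \<forall>i. \<bar>z $ i\<bar> \<le> int n}"

lemma finite_box: "finite (box n)"
proof -
  have "box n \<subseteq> (\<lambda>f. \<chi> i. f i) ` (PiE UNIV (\<lambda>_. {- int n..int n}))"
  proof
    fix z assume "z \<in> box n"
    then show "z \<in> (\<lambda>f. \<chi> i. f i) ` (PiE UNIV (\<lambda>_. {- int n..int n}))"
      by (intro image_eqI[of _ _ "\<lambda>i. z $ i"]) (auto simp: box_def abs_le_iff minus_le_iff)
  qed
  then show ?thesis by (rule finite_subset) (intro finite_imageI finite_PiE, auto)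
qed

definition nn_path :: "'d path \<Rightarrow> bool" where
  "nn_path X \<longleftrightarrow> X 0 = 0 \<and> (\<forall>n. X (Suc n) - X n \<in> unit_vectors)"

lemma nn_path_sets [measurable]: "Measurable.pred path_space nn_path"
  unfolding nn_path_def[abs_def] by measurable

lemma AE_nn_path: "AE X in Q. nn_path X"
proof (rule AE_walk_lawI)
  have "AE \<omega> in env_law \<mu>. \<forall>x. \<omega> x \<in> step_laws"
  proof (subst AE_all_countable, intro allI)
    fix x :: "int^'d"
    show "AE \<omega> in env_law \<mu>. \<omega> x \<in> step_laws"
      unfolding env_law_def
      by (rule AE_PiM_component) (use steps in \<open>auto simp: prob_space_measure_pmf AE_measure_pmf_iff\<close>)
  qed
  then show "AE \<omega> in env_law \<mu>. AE X in quenched_law \<omega>. nn_path X"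
  proof eventually_elim
    case (elim \<omega>)
    have "AE X in quenched_law \<omega>. X (Suc n) - X n \<in> unit_vectors" for n
    proof -
      have "emeasure (quenched_law \<omega>) {X. X (Suc n) - X n \<notin> unit_vectors} = 0"
      proof -
        have d: "det_by (Suc n) (\<lambda>X :: 'd path. X (Suc n) - X n \<notin> unit_vectors)"
          by (auto simp: det_by_def)
        have "emeasure (quenched_law \<omega>) ({X. X (Suc n) - X n \<notin> unit_vectors} \<inter> UNIV) = 0 * emeasure (quenched_law \<omega>) ({X. X (Suc n) - X n \<notin> unit_vectors} \<inter> UNIV)"
        proof (rule emeasure_det_sum_eq[OF _ _ d])
          fix x :: "'d path" assume "x (Suc n) - x n \<notin> unit_vectors"
          then have "x (Suc n) - x n \<notin> set_pmf (\<omega> (x n))" using elim by (auto simp: step_laws_def)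
          then have "pmf (\<omega> (x n)) (x (Suc n) - x n) = 0" by (simp add: set_pmf_iff)
          then show "emeasure (quenched_law \<omega>) (cyl x (Suc n) \<inter> UNIV) = 0 * emeasure (quenched_law \<omega>) (cyl x (Suc n) \<inter> UNIV)"
            by (simp add: quenched_cyl)
        qed (auto simp: sets_quenched_law)
        then show ?thesis by simp
      qed
      then show ?thesis
        by (subst AE_iff_measurable[OF _ refl]) (auto simp: sets_quenched_law intro!: sets_det_by[of "Suc n"] simp: det_by_def)
    qed
    then have "AE X in quenched_law \<omega>. \<forall>n. X (Suc n) - X n \<in> unit_vectors" by (simp add: AE_all_countable)
    with quenched_start[of \<omega>] show ?case by eventually_elim (simp add: nn_path_def)
  qed
  show "{X. nn_path X} \<in> sets path_space"
    using nn_path_sets by (simp add: pred_def)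
qed

lemma unit_vector_abs_le: "e \<in> unit_vectors \<Longrightarrow> \<bar>(e::int^'d) $ i\<bar> \<le> 1"
  by (auto simp: unit_vectors_def axis_def)

lemma nn_path_box: "nn_path X \<Longrightarrow> X (t + n) - X t \<in> box n"
proof (induction n)
  case (Suc n)
  then have "X (Suc (t + n)) - X (t + n) \<in> unit_vectors" by (simp add: nn_path_def)
  from unit_vector_abs_le[OF this] have "\<bar>X (Suc (t + n)) $ i - X (t + n) $ i\<bar> \<le> 1" for i
    by simp
  moreover have "\<bar>X (t + n) $ i - X t $ i\<bar> \<le> int n" for i
    using Suc by (simp add: box_def)
  ultimately have "\<bar>X (Suc (t + n)) $ i - X t $ i\<bar> \<le> 1 + int n" for i
    using abs_triangle_ineq[of "X (Suc (t + n)) $ i - X (t + n) $ i" "X (t + n) $ i - X t $ i"]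
    by (fastforce dest: order_trans[OF _ add_mono])
  then show ?case by (simp add: box_def)
qed (simp add: box_def)

text \<open>When the walk is back at the record level after \<open>i\<close> steps, the half-space
  above is no longer fresh. For a fixed displacement \<open>z\<close> the event of being at
  \<open>X t + z\<close> is dropped: the quenched chance of \<open>C\<close> from there is still
  independent of the path up to \<open>t\<close>. The price is one summand for each
  \<open>z\<close>, hence the factor \<open>card (box i)\<close>.\<close>

lemma record_late_split:
  assumes P: "det_by t P" "\<And>X. P X \<Longrightarrow> rec_time t X" and C: "upper C"
  shows "emeasure Q ({X. P X} \<inter> {X. l (X (t + i)) = l (X t) \<and> after (t + i) X \<in> C}) \<le>
    emeasure Q {X. P X} * (of_nat (card (box i)) * emeasure Q C)"
proof -
  have bnd: "emeasure Q (cyl x t \<inter> {X. X (t + i) = x t + z \<and> after (t + i) X \<in> C}) \<le> emeasure Q (cyl x t) * emeasure Q C"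
    if x: "P x" and z: "l z = 0" for x z
  proof -
    have r: "l (x k) < l (x t)" if "k < t" for k using P(2)[OF x] that by (auto simp: rec_time_def)
    have d: "det_by (t + i) (\<lambda>X. X \<in> cyl x t \<and> X (t + i) = x t + z)"
      by (auto simp: det_by_def cyl_def)
    have dd: "det_by (t + i) (\<lambda>X. X (t + i) = x t + z)" by (auto simp: det_by_def)
    have [measurable]: "{X. X (t + i) = x t + z} \<in> sets path_space" by (rule sets_det_by[OF dd])
    have [measurable]: "after (t + i) -` C \<in> sets path_space" by (rule sets_after[OF sets_upper[OF C]])
    have eq: "cyl x t \<inter> {X. X (t + i) = x t + z \<and> after (t + i) X \<in> C} = {X. X \<in> cyl x t \<and> X (t + i) = x t + z} \<inter> after (t + i) -` C"
      by auto
    have "emeasure Q ({X. X \<in> cyl x t \<and> X (t + i) = x t + z} \<inter> after (t + i) -` C) =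
      (\<integral>\<^sup>+\<omega>. emeasure (quenched_law \<omega>) ({X. X \<in> cyl x t \<and> X (t + i) = x t + z} \<inter> after (t + i) -` C) \<partial>env_law \<mu>)"
      using sets_det_by[OF d] by (intro emeasure_walk_law) auto
    also have "\<dots> = (\<integral>\<^sup>+\<omega>. emeasure (quenched_law \<omega>) {X. X \<in> cyl x t \<and> X (t + i) = x t + z} * emeasure (quenched_law (shift_env (x t + z) \<omega>)) C \<partial>env_law \<mu>)"
      by (intro nn_integral_cong quenched_Markov[OF d]) (auto simp: sets_upper[OF C])
    \<comment> \<open>This discards the stretch between \<open>t\<close> and \<open>t + i\<close>,
      the only part of the past that may have read the environment at or above the record
      level.\<close>
    also have "\<dots> \<le> (\<integral>\<^sup>+\<omega>. emeasure (quenched_law \<omega>) (cyl x t) * emeasure (quenched_law (shift_env (x t + z) \<omega>)) C \<partial>env_law \<mu>)"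
      by (intro nn_integral_mono mult_right_mono emeasure_mono) (auto simp: sets_quenched_law)
    also have "\<dots> = emeasure Q (cyl x t) * emeasure Q C"
      using r C z by (intro quenched_fresh_indep) (auto simp: l_add)
    finally show ?thesis unfolding eq .
  qed
  let ?Z = "{z\<in>box i. l z = 0}"
  have A: "{X. l (X (t + i)) = l (X t) \<and> after (t + i) X \<in> C} \<in> sets path_space"
  proof -
    have "det_by (t + i) (\<lambda>X. l (X (t + i)) = l (X t))" by (auto simp: det_by_def)
    from sets.Int[OF sets_det_by[OF this] sets_after[OF sets_upper[OF C], of "t + i"]] show ?thesis by (simp add: Collect_conj_eq vimage_def)
  qed
  have cylb: "emeasure Q (cyl x t \<inter> {X. l (X (t + i)) = l (X t) \<and> after (t + i) X \<in> C}) \<le>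
     (of_nat (card (box i)) * emeasure Q C) * emeasure Q (cyl x t)" if x: "P x" for x
  proof -
    have m: "cyl x t \<inter> {X. X (t + i) = x t + z \<and> after (t + i) X \<in> C} \<in> sets path_space" for z
    proof -
      have "det_by (t + i) (\<lambda>X. X (t + i) = x t + z)" by (auto simp: det_by_def)
      from sets.Int[OF sets_cyl[of x t] sets.Int[OF sets_det_by[OF this] sets_after[OF sets_upper[OF C], of "t + i"]]]
      show ?thesis by (simp add: Collect_conj_eq vimage_def)
    qed
    have "emeasure Q (cyl x t \<inter> {X. l (X (t + i)) = l (X t) \<and> after (t + i) X \<in> C}) \<le>
      emeasure Q (\<Union>z\<in>?Z. cyl x t \<inter> {X. X (t + i) = x t + z \<and> after (t + i) X \<in> C})"
    proof (rule emeasure_mono_AE)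
      show "AE X in Q. X \<in> cyl x t \<inter> {X. l (X (t + i)) = l (X t) \<and> after (t + i) X \<in> C} \<longrightarrow>
        X \<in> (\<Union>z\<in>?Z. cyl x t \<inter> {X. X (t + i) = x t + z \<and> after (t + i) X \<in> C})"
        using AE_nn_path
      proof eventually_elim
        case (elim X)
        from nn_path_box[OF this, of t i] show ?case
          by (auto simp: cyl_def l_diff intro!: exI[of _ "X (t + i) - X t"])
      qed
    next
      show "(\<Union>z\<in>?Z. cyl x t \<inter> {X. X (t + i) = x t + z \<and> after (t + i) X \<in> C}) \<in> sets Q"
        using m finite_box[of i] by (intro sets.finite_UN) (simp_all del: Int_UN_distrib)
    qed
    also have "\<dots> \<le> (\<Sum>z\<in>?Z. emeasure Q (cyl x t \<inter> {X. X (t + i) = x t + z \<and> after (t + i) X \<in> C}))"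
      using m finite_box[of i] by (intro emeasure_subadditive_finite) auto
    also have "\<dots> \<le> (\<Sum>z\<in>?Z. emeasure Q (cyl x t) * emeasure Q C)"
      by (intro sum_mono bnd x) auto
    also have "\<dots> \<le> (\<Sum>z\<in>box i. emeasure Q (cyl x t) * emeasure Q C)"
      by (intro sum_mono2 finite_box) auto
    also have "\<dots> = (of_nat (card (box i)) * emeasure Q C) * emeasure Q (cyl x t)"
      by (simp add: mult_ac)
    finally show ?thesis .
  qed
  let ?A = "{X. l (X (t + i)) = l (X t) \<and> after (t + i) X \<in> C}" and ?c = "of_nat (card (box i)) * emeasure Q C"
  have mP: "{X. P X} \<in> sets path_space" by (rule sets_det_by[OF P(1)])
  have "emeasure Q ({X. P X} \<inter> ?A \<inter> {X. prefix t X = p}) \<le> ?c * emeasure Q ({X. P X} \<inter> {X. prefix t X = p})" for p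
  proof (cases "\<exists>x. P x \<and> prefix t x = p")
    case True
    then obtain x where x: "P x" "prefix t x = p" by auto
    have "{X. P X} \<inter> ?A \<inter> {X. prefix t X = p} = cyl x t \<inter> ?A" "{X. P X} \<inter> {X. prefix t X = p} = cyl x t"
      using x P(1) by (auto simp: cyl_def prefix_eq_iff det_by_def simp flip: x(2))
    with cylb[OF x(1)] show ?thesis by simp
  next
    case False
    then have "{X. P X} \<inter> ?A \<inter> {X. prefix t X = p} = {}" by auto
    then show ?thesis by simp
  qed
  then have "emeasure Q ({X. P X} \<inter> ?A) \<le> (\<integral>\<^sup>+p. ?c * emeasure Q ({X. P X} \<inter> {X. prefix t X = p}) \<partial>count_space UNIV)"
    using A mP by (subst emeasure_prefix_sum[where t=t]) (auto intro!: nn_integral_mono)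
  also have "\<dots> = ?c * emeasure Q {X. P X}"
    using mP by (subst (2) emeasure_prefix_sum[where t=t]) (auto simp: nn_integral_cmult)
  finally show ?thesis by (simp add: mult.commute)
qed

end

section \<open>Zero escape probability\<close>

definition hits :: "(nat \<Rightarrow> int) \<Rightarrow> int \<Rightarrow> nat \<Rightarrow> bool" where
  "hits y m t \<longleftrightarrow> y t = m \<and> (\<forall>s<t. y s < m)"

text \<open>A delayed partial escape from level \<open>m\<close>. The delay \<open>i\<close> is
  bounded by \<open>K\<close> so that a union bound over it is affordable, and the escape is
  required only up to \<open>m + L\<close> so that the event is decided at the first visit of that
  level.\<close>

definition late :: "nat \<Rightarrow> nat \<Rightarrow> nat \<Rightarrow> (nat \<Rightarrow> int) \<Rightarrow> bool" where
  "late K L m y \<longleftrightarrow> (\<exists>t t' i. hits y (int m) t \<and> hits y (int (m + L)) t' \<and> i \<le> K \<and> t + i < t' \<and>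
     y (t + i) = int m \<and> (\<forall>s. t + i \<le> s \<and> s \<le> t' \<longrightarrow> int m \<le> y s))"

lemma hits_unique: "hits y m t \<Longrightarrow> hits y m t' \<Longrightarrow> t = t'"
  unfolding hits_def by (metis less_irrefl nat_neq_iff)

lemma hits_mono: "hits y m t \<Longrightarrow> hits y m' t' \<Longrightarrow> m < m' \<Longrightarrow> t < t'"
  unfolding hits_def by (metis less_asym linorder_neqE_nat order_less_irrefl)

lemma hits_exists:
  assumes y0: "y 0 = 0" and step: "\<And>n. \<bar>y (Suc n) - y n\<bar> \<le> 1" and m: "0 \<le> m" "m \<le> y n"
  shows "\<exists>t\<le>n. hits y m t"
proof -
  define t where "t = (LEAST t. m \<le> y t)"
  have t: "m \<le> y t" "t \<le> n" unfolding t_def using m by (auto intro: LeastI Least_le)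
  have lt: "y s < m" if "s < t" for s
    using not_less_Least[of s "\<lambda>t. m \<le> y t"] that unfolding t_def by auto
  have "y t = m"
  proof (cases t)
    case 0
    then show ?thesis using t y0 m by auto
  next
    case (Suc k)
    then show ?thesis using t lt[of k] step[of k] by auto
  qed
  then show ?thesis using t lt by (auto simp: hits_def)
qed

text \<open>Read backwards from \<open>b\<close>: unit steps cannot jump over \<open>m\<close>, so a
  path that is above \<open>m\<close> and did not touch it one step earlier was above it
  then.\<close>

lemma stays_above:
  assumes step: "\<And>n. \<bar>y (Suc n) - y n\<bar> \<le> (1::int)" and ne: "\<And>s. a < s \<Longrightarrow> s \<le> b \<Longrightarrow> y s \<noteq> m"
    and end_: "m < y b" and s: "a < s" "s \<le> b"
  shows "m < y s"
  using s(2) s(1)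
proof (induction rule: inc_induct)
  case base
  then show ?case using end_ by simp
next
  case (step n)
  then have "m < y (Suc n)" by simp
  then show ?case using assms(1)[of n] ne[of n] step by auto
qed

text \<open>Pigeonhole over scales. If \<open>y n = M\<close> and \<open>n \<le> C * M\<close>, then
  returns to level \<open>m\<close> made between the first visits of \<open>m + Ls j\<close> and
  \<open>m + Ls (Suc j)\<close> are different times for different pairs \<open>(j, m)\<close>. So
  one of the \<open>16 * C\<close> scales has at most \<open>M / 16\<close> levels with such a
  return. By telescoping, at most \<open>M / 16\<close> levels need more than
  \<open>16 * C * Ls j\<close> steps to climb \<open>Ls j\<close>. All other levels below
  \<open>M'\<close> are \<open>late\<close>, more than the half that \<open>ev\<close>
  permits.\<close>

lemma slow_contradiction:
  fixes y :: "nat \<Rightarrow> int" and C :: nat and Ls :: "nat \<Rightarrow> nat"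
  assumes y0: "y 0 = 0" and step: "\<And>n. \<bar>y (Suc n) - y n\<bar> \<le> 1"
    and Ls: "\<And>j. 1 \<le> Ls j" "\<And>j. Ls j < Ls (Suc j)" and C: "1 \<le> C"
    and freq: "\<exists>\<^sub>\<infinity>n. int n \<le> int C * y n"
    and ev: "\<And>j. j < 16 * C \<Longrightarrow> \<forall>\<^sub>F M in sequentially.
        2 * card {m. m < M \<and> late (16 * C * Ls j) (Ls (Suc j)) m y} \<le> M + 2 * Ls (Suc j)"
  shows False
proof -
  define J where "J = 16 * C"
  define B where "B = Ls J"
  have Lsm: "Ls i < Ls j" if "i < j" for i j
    using that by (rule lift_Suc_mono_less[of Ls, OF Ls(2)])
  then have Lsm': "Ls i \<le> Ls j" if "i \<le> j" for i j
    using that by (metis le_less)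
  have "\<forall>\<^sub>F M in sequentially. \<forall>j\<in>{..<J}. 2 * card {m. m < M \<and> late (16 * C * Ls j) (Ls (Suc j)) m y} \<le> M + 2 * Ls (Suc j)"
    using ev by (intro eventually_ball_finite) (auto simp: J_def)
  then obtain N0 where N0: "\<And>M j. N0 \<le> M \<Longrightarrow> j < J \<Longrightarrow> 2 * card {m. m < M \<and> late (16 * C * Ls j) (Ls (Suc j)) m y} \<le> M + 2 * Ls (Suc j)"
    unfolding eventually_sequentially by auto
  \<comment> \<open>So large that \<open>M\<close>, which is at least \<open>n / C\<close>, exceeds
    \<open>N0\<close> and \<open>16 * B\<close>. The latter pays for the \<open>B\<close> discarded
    top levels and for the additive term \<open>2 * Ls (Suc j)\<close>.\<close>
  obtain n where n: "C * (N0 + 16 * B) < n" "int n \<le> int C * y n"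
    using freq unfolding INFM_nat by blast
  define M where "M = nat (y n)"
  have "0 < int C * y n" using n by linarith
  then have yp: "0 < y n" using C by (simp add: zero_less_mult_iff)
  have yn: "y n = int M" using yp by (simp add: M_def)
  have nM: "n \<le> C * M" using n(2) unfolding yn by (metis of_nat_le_iff of_nat_mult)
  have MB: "N0 + 16 * B < M"
  proof -
    have "C * (N0 + 16 * B) < C * M" using n(1) nM by linarith
    then show ?thesis by simp
  qed
  define \<tau> where "\<tau> m = (THE t. hits y (int m) t)" for m
  have hit: "hits y (int m) (\<tau> m)" "\<tau> m \<le> n" if "m \<le> M" for m
  proof -
    have "\<exists>t\<le>n. hits y (int m) t"
      using that yn by (intro hits_exists[OF y0 step]) auto
    then obtain t where t: "t \<le> n" "hits y (int m) t" by blast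
    then have "\<tau> m = t" unfolding \<tau>_def by (intro the_equality) (auto intro: hits_unique)
    with t show "hits y (int m) (\<tau> m)" "\<tau> m \<le> n" by auto
  qed
  have \<tau>_less: "\<tau> m < \<tau> m'" if "m < m'" "m' \<le> M" for m m'
    using hits_mono[OF hit(1)[of m] hit(1)[of m']] that by auto
  have \<tau>_le: "\<tau> m \<le> \<tau> m'" if "m \<le> m'" "m' \<le> M" for m m'
    using \<tau>_less[of m m'] that by (cases "m = m'") auto
  \<comment> \<open>Levels within \<open>B\<close> of the top are discarded, so that every
    \<open>m + Ls j\<close> considered is reached by time \<open>n\<close>.\<close>
  define M' where "M' = M - B"
  have M'B: "M' + B = M" using MB by (simp add: M'_def)
  have BJ: "Ls j \<le> B" if "j \<le> J" for j using Lsm'[OF that] by (simp add: B_def)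
  have mLs: "m + Ls j \<le> M" if "m < M'" "j \<le> J" for m j
    using BJ[OF that(2)] that(1) M'B by linarith
  define bad where "bad j = {m. m < M' \<and> (\<exists>s. y s = int m \<and> \<tau> (m + Ls j) \<le> s \<and> s < \<tau> (m + Ls (Suc j)))}" for j
  have fin_bad: "finite (bad j)" for j unfolding bad_def by simp
  have "\<exists>j<J. 16 * card (bad j) \<le> M"
  proof (rule ccontr)
    assume "\<not> (\<exists>j<J. 16 * card (bad j) \<le> M)"
    then have b: "M + 1 \<le> 16 * card (bad j)" if "j < J" for j using that by (auto simp: not_le Suc_le_eq)
    define \<phi> where "\<phi> = (\<lambda>(j, m). SOME s. y s = int m \<and> \<tau> (m + Ls j) \<le> s \<and> s < \<tau> (m + Ls (Suc j)))"
    have \<phi>: "y (\<phi> (j, m)) = int m" "\<tau> (m + Ls j) \<le> \<phi> (j, m)" "\<phi> (j, m) < \<tau> (m + Ls (Suc j))" if "m \<in> bad j" for j m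
    proof -
      from that obtain s where "y s = int m \<and> \<tau> (m + Ls j) \<le> s \<and> s < \<tau> (m + Ls (Suc j))" by (auto simp: bad_def)
      from someI[of "\<lambda>s. y s = int m \<and> \<tau> (m + Ls j) \<le> s \<and> s < \<tau> (m + Ls (Suc j))", OF this]
      show "y (\<phi> (j, m)) = int m" "\<tau> (m + Ls j) \<le> \<phi> (j, m)" "\<phi> (j, m) < \<tau> (m + Ls (Suc j))"
        by (auto simp: \<phi>_def)
    qed
    have jj: "\<not> j < j'" if "m \<in> bad j" "m \<in> bad j'" "j' < J" "\<phi> (j, m) = \<phi> (j', m)" for j j' m
    proof
      assume "j < j'"
      then have "Ls (Suc j) \<le> Ls j'" by (intro Lsm') simp
      moreover have "m + Ls j' \<le> M" using that by (intro mLs) (auto simp: bad_def)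
      ultimately have "\<tau> (m + Ls (Suc j)) \<le> \<tau> (m + Ls j')" by (intro \<tau>_le) auto
      then show False using \<phi>(3)[OF that(1)] \<phi>(2)[OF that(2)] that(4) by simp
    qed
    have "inj_on \<phi> (SIGMA j:{..<J}. bad j)"
    proof (rule inj_onI)
      fix p q assume pq: "p \<in> (SIGMA j:{..<J}. bad j)" "q \<in> (SIGMA j:{..<J}. bad j)" "\<phi> p = \<phi> q"
      obtain j m j' m' where e: "p = (j, m)" "q = (j', m')" by (metis surj_pair)
      with pq have a: "j < J" "m \<in> bad j" "j' < J" "m' \<in> bad j'" "\<phi> (j, m) = \<phi> (j', m')" by auto
      then have "int m = int m'" using \<phi>(1) by metis
      then have "m = m'" by simp
      with a jj[of m j j'] jj[of m j' j] have "j = j'" by (metis nat_neq_iff)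
      with \<open>m = m'\<close> show "p = q" by (simp add: e)
    qed
    moreover have "\<phi> ` (SIGMA j:{..<J}. bad j) \<subseteq> {..<n}"
    proof clarsimp
      fix j m assume a: "j < J" "m \<in> bad j"
      have "m + Ls (Suc j) \<le> M" using a by (intro mLs) (auto simp: bad_def)
      from hit(2)[OF this] \<phi>(3)[OF a(2)] show "\<phi> (j, m) < n" by simp
    qed
    ultimately have "card (SIGMA j:{..<J}. bad j) \<le> card {..<n}" by (intro card_inj_on_le) auto
    then have "(\<Sum>j<J. card (bad j)) \<le> n" using fin_bad by (simp add: card_SigmaI)
    moreover have "(\<Sum>j<J. M + 1) \<le> (\<Sum>j<J. 16 * card (bad j))" using b by (intro sum_mono) auto
    ultimately have "J * (M + 1) \<le> 16 * n" by (simp add: sum_distrib_left[symmetric])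
    also have "16 * n \<le> J * M" using nM by (simp add: J_def)
    also have "J * M < J * (M + 1)" using C by (simp add: J_def)
    finally show False by simp
  qed
  then obtain j where j: "j < J" "16 * card (bad j) \<le> M" by blast
  define K where "K = 16 * C * Ls j"
  define slow where "slow = {m. m < M' \<and> \<tau> m + K < \<tau> (m + Ls j)}"
  have fin_slow: "finite slow" unfolding slow_def by simp
  \<comment> \<open>For each of the \<open>L\<close> units of height the increments of the hitting
    times telescope over \<open>m\<close> and contribute at most \<open>n\<close>.\<close>
  have tele: "(\<Sum>m<M'. int (\<tau> (m + L)) - int (\<tau> m)) \<le> int (L * n)" if "M' + L \<le> M" for L
    using that
  proof (induction L)
    case (Suc L)
    have "(\<Sum>m<M'. int (\<tau> (m + Suc L)) - int (\<tau> m)) =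
      (\<Sum>m<M'. int (\<tau> (m + L)) - int (\<tau> m)) + (\<Sum>m<M'. int (\<tau> (Suc m + L)) - int (\<tau> (m + L)))"
      by (simp add: sum.distrib[symmetric])
    also have "(\<Sum>m<M'. int (\<tau> (Suc m + L)) - int (\<tau> (m + L))) = int (\<tau> (M' + L)) - int (\<tau> (0 + L))"
      by (rule sum_lessThan_telescope)
    also have "\<dots> \<le> int n" using hit(2)[of "M' + L"] Suc by simp
    finally show ?case using Suc by simp
  qed simp
  have "16 * card slow \<le> M"
  proof -
    have "int (card slow * K) = (\<Sum>m\<in>slow. int K)" by simp
    also have "\<dots> \<le> (\<Sum>m\<in>slow. int (\<tau> (m + Ls j)) - int (\<tau> m))"
      by (intro sum_mono) (auto simp: slow_def)
    also have "\<dots> \<le> (\<Sum>m<M'. int (\<tau> (m + Ls j)) - int (\<tau> m))"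
    proof (rule sum_mono2)
      fix m assume "m \<in> {..<M'} - slow"
      then have "m + Ls j \<le> M" using j by (intro mLs) auto
      then show "0 \<le> int (\<tau> (m + Ls j)) - int (\<tau> m)" using \<tau>_le[of m "m + Ls j"] by simp
    qed (auto simp: slow_def)
    also have "\<dots> \<le> int (Ls j * n)" using BJ[of j] j M'B by (intro tele) simp
    finally have "card slow * K \<le> Ls j * n" by (metis of_nat_le_iff)
    also have "\<dots> \<le> Ls j * (C * M)" using nM by simp
    finally have "(16 * card slow) * (C * Ls j) \<le> M * (C * Ls j)" by (simp add: K_def mult_ac)
    then show ?thesis using C Ls(1)[of j] by simp
  qed
  have good: "late K (Ls (Suc j)) m y" if m: "m < M'" "m \<notin> bad j" "m \<notin> slow" for m
  proof -
    define t' where "t' = \<tau> (m + Ls (Suc j))"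
    have mM: "m + Ls (Suc j) \<le> M" using j m by (intro mLs) auto
    then have mM': "m + Ls j \<le> M" using Ls(2)[of j] by simp
    have t': "hits y (int (m + Ls (Suc j))) t'" using hit(1)[OF mM] by (simp add: t'_def)
    have tm: "hits y (int m) (\<tau> m)" using hit(1)[of m] mM by simp
    have lt: "\<tau> m < t'" unfolding t'_def using Ls(1)[of "Suc j"] mM by (intro \<tau>_less) auto
    \<comment> \<open>The last visit to \<open>m\<close> before \<open>t'\<close> starts the
      required stretch: it precedes \<open>\<tau> (m + Ls j)\<close> because \<open>m\<close> is not
      bad, and that time is within \<open>K\<close> of \<open>\<tau> m\<close> because
      \<open>m\<close> is not slow.\<close>
    define s where "s = (GREATEST s. s \<le> t' \<and> y s = int m)"
    have s: "s \<le> t' \<and> y s = int m"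
      unfolding s_def by (rule GreatestI_nat[of _ "\<tau> m" t']) (use tm lt in \<open>auto simp: hits_def\<close>)
    have sg: "x \<le> s" if "x \<le> t'" "y x = int m" for x
      unfolding s_def by (rule Greatest_le_nat[of _ _ t']) (use that in auto)
    have s1: "\<tau> m \<le> s" using sg[of "\<tau> m"] tm lt by (simp add: hits_def)
    have yt': "y t' = int (m + Ls (Suc j))" using t' by (simp add: hits_def)
    have "s \<noteq> t'" using s yt' Ls(1)[of "Suc j"] by auto
    then have s2: "s < t'" using s by simp
    have "\<not> \<tau> (m + Ls j) \<le> s" using m(1,2) s s2 unfolding bad_def t'_def by blast
    moreover have "\<tau> (m + Ls j) \<le> \<tau> m + K" using m(1,3) unfolding slow_def by auto
    ultimately have "s - \<tau> m \<le> K" using s1 by simp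
    moreover have "int m \<le> y x" if "s \<le> x" "x \<le> t'" for x
    proof (cases "x = s")
      case False
      then show ?thesis
        using stays_above[of y s t' "int m" x, OF step] sg that yt' Ls(1)[of "Suc j"] by fastforce
    qed (use s in simp)
    ultimately show ?thesis unfolding late_def
      using s s1 s2 tm t' by (intro exI[of _ "\<tau> m"] exI[of _ t'] exI[of _ "s - \<tau> m"]) auto
  qed
  have "M' \<le> card {m. m < M \<and> late K (Ls (Suc j)) m y} + card (bad j) + card slow"
  proof -
    have "M' = card {..<M'}" by simp
    also have "\<dots> \<le> card ({m. m < M \<and> late K (Ls (Suc j)) m y} \<union> bad j \<union> slow)"
      using good fin_bad fin_slow M'B by (intro card_mono) auto
    also have "\<dots> \<le> card {m. m < M \<and> late K (Ls (Suc j)) m y} + card (bad j) + card slow"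
      by (meson card_Un_le le_trans add_le_mono1)
    finally show ?thesis .
  qed
  moreover have "2 * card {m. m < M \<and> late K (Ls (Suc j)) m y} \<le> M + 2 * Ls (Suc j)"
    unfolding K_def using MB j by (intro N0) auto
  moreover have "Ls (Suc j) \<le> B" using BJ[of "Suc j"] j by simp
  ultimately show False using j(2) \<open>16 * card slow \<le> M\<close> M'B MB by linarith
qed

section \<open>Late levels are rare if escape has probability zero\<close>

context leveled_walk
begin

abbreviation lv :: "'d path \<Rightarrow> nat \<Rightarrow> int" where "lv X \<equiv> (\<lambda>n. l (X n))"

lemma nn_path_lv:
  assumes "nn_path X"
  shows "lv X 0 = 0" "\<bar>lv X (Suc n) - lv X n\<bar> \<le> 1"
  using assms l_unit[of "X (Suc n) - X n"] by (auto simp: nn_path_def l_diff)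

lemma nn_path_lv_le: "nn_path X \<Longrightarrow> lv X n \<le> int n"
proof (induction n)
  case (Suc n)
  then show ?case using nn_path_lv(2)[of X n] by auto
qed (simp add: nn_path_lv)

definition esc :: "nat \<Rightarrow> 'd path set" where
  "esc L = {X. \<exists>t. hits (lv X) (int L) t \<and> (\<forall>s\<le>t. 0 \<le> lv X s)}"

definition escape :: "'d path set" where
  "escape = {X \<in> nonneg. \<forall>m. \<exists>n. int m \<le> lv X n}"

lemma upper_esc: "upper (esc L)"
proof -
  have "esc L = (\<Union>t. {X. hits (lv X) (int L) t \<and> (\<forall>s\<le>t. 0 \<le> lv X s)})" by (auto simp: esc_def)
  also have "upper \<dots>"
  proof (rule upper_UN)
    show "upper {X. hits (lv X) (int L) t \<and> (\<forall>s\<le>t. 0 \<le> lv X s)}" for t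
      by (rule upper_det[of t]) (auto simp: det_by_def hits_def)
    show "disjoint_family (\<lambda>t. {X. hits (lv X) (int L) t \<and> (\<forall>s\<le>t. 0 \<le> lv X s)})"
      by (auto simp: disjoint_family_on_def dest: hits_unique)
  qed
  finally show ?thesis .
qed

lemma sets_esc [measurable]: "esc L \<in> sets path_space"
  by (rule sets_upper[OF upper_esc])

lemma sets_escape [measurable]: "escape \<in> sets path_space"
proof -
  have "{X \<in> space path_space. (\<forall>n. 0 \<le> l (X n)) \<and> (\<forall>m. \<exists>n. int m \<le> l (X n))} \<in> sets path_space" by measurable
  then show ?thesis by (simp add: nonneg_def escape_def)
qed

lemma upper_escape: "upper escape"
  by (rule upper_nonneg) (auto simp: escape_def)

text \<open>Level \<open>Suc s\<close> cannot be reached by time \<open>s\<close>. A path that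
  reaches every level before going below 0 is therefore nonnegative at every time.\<close>

lemma esc_tendsto: "(\<lambda>L. Q.prob (esc L)) \<longlonglongrightarrow> Q.prob escape"
proof -
  let ?N = "{X. nn_path X}"
  have N[measurable]: "?N \<in> sets path_space" using nn_path_sets by (simp add: pred_def)
  have "(\<lambda>L. Q.prob (esc L \<inter> ?N)) \<longlonglongrightarrow> Q.prob (\<Inter>L. esc L \<inter> ?N)"
  proof (rule Q.finite_Lim_measure_decseq)
    show "decseq (\<lambda>L. esc L \<inter> ?N)"
    proof (rule decseq_SucI, rule subsetI)
      fix L X assume "X \<in> esc (Suc L) \<inter> ?N"
      then obtain t where X: "nn_path X" and t: "hits (lv X) (int (Suc L)) t" "\<forall>s\<le>t. 0 \<le> lv X s"
        by (auto simp: esc_def)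
      have "\<exists>u\<le>t. hits (lv X) (int L) u"
        using t by (intro hits_exists nn_path_lv X) (auto simp: hits_def)
      then show "X \<in> esc L \<inter> ?N" using X t by (auto simp: esc_def)
    qed
  qed auto
  also have "(\<Inter>L. esc L \<inter> ?N) = escape \<inter> ?N"
  proof (intro set_eqI iffI)
    fix X assume "X \<in> (\<Inter>L. esc L \<inter> ?N)"
    then have X: "nn_path X" and e: "\<And>L. X \<in> esc L" by auto
    have "0 \<le> lv X s" for s
    proof -
      obtain t where t: "hits (lv X) (int (Suc s)) t" "\<forall>u\<le>t. 0 \<le> lv X u" using e[of "Suc s"] by (auto simp: esc_def)
      then have "s \<le> t" using nn_path_lv_le[OF X, of t] by (auto simp: hits_def)
      then show ?thesis using t by auto
    qed
    moreover have "\<exists>n. int m \<le> lv X n" for m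
    proof -
      obtain t where "lv X t = int m" using e[of m] by (auto simp: esc_def hits_def)
      then show ?thesis by (intro exI[of _ t]) simp
    qed
    ultimately show "X \<in> escape \<inter> ?N" using X by (auto simp: escape_def nonneg_def)
  next
    fix X assume "X \<in> escape \<inter> ?N"
    then have X: "nn_path X" "X \<in> escape" by auto
    have "X \<in> esc L" for L
    proof -
      obtain n where "int L \<le> lv X n" using X by (auto simp: escape_def)
      then have "\<exists>t\<le>n. hits (lv X) (int L) t" by (intro hits_exists nn_path_lv X) auto
      then show ?thesis using X by (auto simp: esc_def escape_def nonneg_def)
    qed
    then show "X \<in> (\<Inter>L. esc L \<inter> ?N)" using X by auto
  qed
  finally have *: "(\<lambda>L. Q.prob (esc L \<inter> ?N)) \<longlonglongrightarrow> Q.prob (escape \<inter> ?N)" .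
  have "Q.prob (A \<inter> ?N) = Q.prob A" if "A \<in> sets path_space" for A
    using AE_nn_path that by (intro Q.finite_measure_eq_AE) auto
  with * show ?thesis by simp
qed

text \<open>The union bound over the delay in \<open>record_late_split\<close>. Only the second
  factor depends on \<open>L\<close>, so if escape has probability zero the bound becomes small for
  fixed \<open>K\<close> and large \<open>L\<close>.\<close>

definition late_bound :: "nat \<Rightarrow> nat \<Rightarrow> real" where
  "late_bound K L = (\<Sum>i\<le>K. real (card (box i))) * Q.prob (esc L)"

lemma sets_late [measurable]: "{X. late K L m (lv X)} \<in> sets path_space"
proof -
  have "{X \<in> space path_space. late K L m (lv X)} \<in> sets path_space"
    unfolding late_def hits_def by measurable
  then show ?thesis by simp
qed

lemma late_after_hit:
  assumes P: "det_by t P" "\<And>X. P X \<Longrightarrow> hits (lv X) (int m) t"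
  shows "Q.prob {X. P X \<and> late K L m (lv X)} \<le> Q.prob {X. P X} * late_bound K L"
proof -
  let ?A = "\<lambda>i. {X. P X} \<inter> {X. l (X (t + i)) = l (X t) \<and> after (t + i) X \<in> esc L}"
  have mP[measurable]: "{X. P X} \<in> sets path_space" by (rule sets_det_by[OF P(1)])
  have mA[measurable]: "?A i \<in> sets path_space" for i
  proof -
    have "det_by (t + i) (\<lambda>X. l (X (t + i)) = l (X t))" by (auto simp: det_by_def)
    from sets.Int[OF sets_det_by[OF this] sets_after[OF sets_esc, of "t + i"]] mP
    show ?thesis by (auto simp: Collect_conj_eq vimage_def)
  qed
  have "{X. P X \<and> late K L m (lv X)} \<subseteq> (\<Union>i\<in>{..K}. ?A i)"
  proof (intro subsetI, clarsimp)
    fix X assume X: "P X" "late K L m (lv X)"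
    then obtain u t' i where h: "hits (lv X) (int m) u" "hits (lv X) (int (m + L)) t'" "i \<le> K" "u + i < t'"
     "lv X (u + i) = int m" "\<forall>s. u + i \<le> s \<and> s \<le> t' \<longrightarrow> int m \<le> lv X s" unfolding late_def by blast
    have u: "u = t" using hits_unique[OF h(1) P(2)[OF X(1)]] .
    have "hits (lv (after (t + i) X)) (int L) (t' - (t + i))"
    proof -
      have "lv X (t + i + s) < int (m + L)" if "s < t' - (t + i)" for s
        using h(2) that unfolding hits_def by simp
      moreover have "lv X t' = int (m + L)" using h(2) by (simp add: hits_def)
      ultimately show ?thesis using h(4,5) unfolding u hits_def after_def l_diff by force
    qed
    moreover have "0 \<le> lv (after (t + i) X) s" if "s \<le> t' - (t + i)" for s
      using h that unfolding u after_def l_diff by auto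
    ultimately have "after (t + i) X \<in> esc L" unfolding esc_def by auto
    moreover have "l (X (t + i)) = l (X t)" using h unfolding u hits_def by simp
    ultimately show "\<exists>i\<in>{..K}. l (X (t + i)) = l (X t) \<and> after (t + i) X \<in> esc L" using h(3) by auto
  qed
  then have "Q.prob {X. P X \<and> late K L m (lv X)} \<le> Q.prob (\<Union>i\<in>{..K}. ?A i)"
    by (intro Q.finite_measure_mono) auto
  also have "\<dots> \<le> (\<Sum>i\<le>K. Q.prob (?A i))"
    by (intro Q.finite_measure_subadditive_finite) auto
  also have "\<dots> \<le> (\<Sum>i\<le>K. Q.prob {X. P X} * (real (card (box i)) * Q.prob (esc L)))"
  proof (rule sum_mono)
    fix i
    have "rec_time t X" if "P X" for X using P(2)[OF that] by (auto simp: hits_def rec_time_def)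
    from record_late_split[OF P(1) this upper_esc[of L], where i = i]
    have "ennreal (Q.prob (?A i)) \<le> ennreal (Q.prob {X. P X} * (real (card (box i)) * Q.prob (esc L)))"
      by (simp add: Q.emeasure_eq_measure ennreal_mult' ennreal_of_nat_eq_real_of_nat)
    then show "Q.prob (?A i) \<le> Q.prob {X. P X} * (real (card (box i)) * Q.prob (esc L))"
      by (subst (asm) ennreal_le_iff) auto
  qed
  also have "\<dots> = Q.prob {X. P X} * late_bound K L"
    by (simp add: late_bound_def sum_distrib_left sum_distrib_right)
  finally show ?thesis .
qed

lemma late_bound_nonneg: "0 \<le> late_bound K L"
  by (simp add: late_bound_def sum_nonneg)

text \<open>Lateness of \<open>m\<close> is decided at the first visit of \<open>m + L\<close>,
  hence by the first visit of the next level in \<open>S\<close>. Removing the largest level and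
  applying \<open>late_after_hit\<close> there gives one factor per level; \<open>lt t\<close> is
  the version of \<open>late\<close> that is decided by time \<open>t\<close>.\<close>

lemma late_separated:
  assumes "finite S" "\<And>m m'. m \<in> S \<Longrightarrow> m' \<in> S \<Longrightarrow> m < m' \<Longrightarrow> m + L \<le> m'"
  shows "Q.prob {X. \<forall>m\<in>S. late K L m (lv X)} \<le> late_bound K L ^ card S"
  using assms
proof (induction S rule: finite_linorder_max_induct)
  case (insert b A)
  define lt where "lt t m y \<longleftrightarrow> (\<exists>u t' i. hits y (int m) u \<and> t' \<le> t \<and> hits y (int (m + L)) t' \<and> i \<le> K \<and> u + i < t' \<and>
     y (u + i) = int m \<and> (\<forall>s. u + i \<le> s \<and> s \<le> t' \<longrightarrow> int m \<le> y s))" for t m and y :: "nat \<Rightarrow> int"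
  define P where "P t X \<longleftrightarrow> hits (lv X) (int b) t \<and> (\<forall>m\<in>A. lt t m (lv X))" for t X
  have hc: "hits y m u = hits y' m u" if "\<forall>k\<le>t. y k = y' k" "u \<le> t" for y y' m u t
    using that unfolding hits_def by (metis le_trans less_imp_le)
  have ltc: "lt t m y'" if e: "\<forall>k\<le>t. y k = y' k" and "lt t m y" for t m y y'
  proof -
    from that obtain u t' i where h: "hits y (int m) u" "t' \<le> t" "hits y (int (m + L)) t'" "i \<le> K" "u + i < t'"
      "y (u + i) = int m" "\<forall>s. u + i \<le> s \<and> s \<le> t' \<longrightarrow> int m \<le> y s" unfolding lt_def by blast
    have "hits y' (int m) u" "hits y' (int (m + L)) t'" using h hc[OF e, of u] hc[OF e, of t'] by auto
    moreover have "y' (u + i) = int m" using e h by auto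
    moreover have "\<forall>s. u + i \<le> s \<and> s \<le> t' \<longrightarrow> int m \<le> y' s" using e h by (metis le_trans)
    ultimately show ?thesis using h unfolding lt_def by blast
  qed
  have dP: "det_by t (P t)" for t
    unfolding det_by_def
  proof (intro allI impI)
    fix X Y :: "'d path" assume "\<forall>k\<le>t. X k = Y k"
    then have e: "\<forall>k\<le>t. lv X k = lv Y k" "\<forall>k\<le>t. lv Y k = lv X k" by auto
    show "P t X = P t Y" unfolding P_def using hc[OF e(1), of t] ltc[OF e(1)] ltc[OF e(2)] by blast
  qed
  have hP: "hits (lv X) (int b) t" if "P t X" for t X using that by (simp add: P_def)
  have mP[measurable]: "{X. P t X} \<in> sets path_space" for t by (rule sets_det_by[OF dP])
  have dis: "disjoint_family (\<lambda>t. {X. P t X})"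
    using hits_unique[OF hP hP] by (auto simp: disjoint_family_on_def)
  have mPl[measurable]: "{X. P t X \<and> late K L b (lv X)} \<in> sets path_space" for t
    using sets.Int[OF mP[of t] sets_late[of K L b]] by (simp add: Collect_conj_eq)
  have mA: "{X. \<forall>m\<in>A. late K L m (lv X)} \<in> sets path_space"
  proof -
    have "{X \<in> space path_space. \<forall>m\<in>A. late K L m (lv X)} \<in> sets path_space"
      using insert(1) by (intro sets.sets_Collect_finite_All) auto
    then show ?thesis by simp
  qed
  have "{X. \<forall>m\<in>insert b A. late K L m (lv X)} \<subseteq> (\<Union>t. {X. P t X \<and> late K L b (lv X)})"
  proof (intro subsetI, clarsimp)
    fix X assume b: "late K L b (lv X)" and A: "\<forall>m\<in>A. late K L m (lv X)"
    obtain t where t: "hits (lv X) (int b) t" using b by (auto simp: late_def)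
    have "lt t m (lv X)" if m: "m \<in> A" for m
    proof -
      from A m obtain u t' i where h: "hits (lv X) (int m) u" "hits (lv X) (int (m + L)) t'" "i \<le> K" "u + i < t'"
        "lv X (u + i) = int m" "\<forall>s. u + i \<le> s \<and> s \<le> t' \<longrightarrow> int m \<le> lv X s" unfolding late_def by blast
      have "m + L \<le> b" using m insert by auto
      then have "t' \<le> t" using hits_mono[OF h(2) t] hits_unique[OF h(2), of t] t by (cases "m + L = b") auto
      with h show ?thesis unfolding lt_def by blast
    qed
    with t show "\<exists>t. P t X" by (auto simp: P_def)
  qed
  then have "Q.prob {X. \<forall>m\<in>insert b A. late K L m (lv X)} \<le> Q.prob (\<Union>t. {X. P t X \<and> late K L b (lv X)})"
    by (intro Q.finite_measure_mono) auto
  also have "\<dots> \<le> Q.prob {X. \<forall>m\<in>A. late K L m (lv X)} * late_bound K L"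
  proof -
    have "(\<lambda>t. Q.prob {X. P t X \<and> late K L b (lv X)}) sums Q.prob (\<Union>t. {X. P t X \<and> late K L b (lv X)})"
      using dis by (intro Q.finite_measure_UNION) (auto simp: disjoint_family_on_def)
    moreover have "(\<lambda>t. Q.prob {X. P t X} * late_bound K L) sums (Q.prob (\<Union>t. {X. P t X}) * late_bound K L)"
      using dis by (intro sums_mult2 Q.finite_measure_UNION) (auto simp: disjoint_family_on_def)
    ultimately have "Q.prob (\<Union>t. {X. P t X \<and> late K L b (lv X)}) \<le> Q.prob (\<Union>t. {X. P t X}) * late_bound K L"
      using late_after_hit[OF dP hP] by (rule sums_le[rotated])
    also have "\<dots> \<le> Q.prob {X. \<forall>m\<in>A. late K L m (lv X)} * late_bound K L"
    proof (intro mult_right_mono Q.finite_measure_mono late_bound_nonneg)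
      show "(\<Union>t. {X. P t X}) \<subseteq> {X. \<forall>m\<in>A. late K L m (lv X)}"
        unfolding P_def lt_def late_def by blast
    qed (use mA in simp)
    finally show ?thesis .
  qed
  also have "\<dots> \<le> late_bound K L ^ card A * late_bound K L"
    using insert by (intro mult_right_mono late_bound_nonneg) auto
  also have "\<dots> = late_bound K L ^ card (insert b A)"
    using insert by (subst card_insert_disjoint) auto
  finally show ?case .
qed simp

text \<open>Levels in one residue class modulo \<open>L\<close> are separated. That at least half of
  \<open>n\<close> such levels are late has probability at most \<open>2 ^ n\<close> (choices of the
  late set) times \<open>(1 / 4) ^ n\<close>, since two factors \<open>1 / 4\<close> make up each
  \<open>1 / 16\<close>; this is summable and explains the constant. The term \<open>2 * L\<close>
  accounts for the incomplete last block.\<close>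

lemma late_count:
  assumes L: "1 \<le> L" and small: "late_bound K L \<le> 1 / 16"
  shows "AE X in Q. \<forall>\<^sub>F M in sequentially. 2 * card {m. m < M \<and> late K L m (lv X)} \<le> M + 2 * L"
proof -
  define E where "E r n = {X. n \<le> 2 * card {k. k < n \<and> late K L (r + k * L) (lv X)}}" for r n
  have mE[measurable]: "E r n \<in> sets path_space" for r n
  proof -
    have "{X \<in> space path_space. n \<le> 2 * card {k. k < n \<and> late K L (r + k * L) (lv X)}} \<in> sets path_space"
    proof -
      have "(\<lambda>X. card {k. k < n \<and> late K L (r + k * L) (lv X)}) = (\<lambda>X. \<Sum>k<n. if late K L (r + k * L) (lv X) then 1 else 0)"
        by (auto simp: fun_eq_iff sum.If_cases Collect_conj_eq lessThan_def)
      moreover have "(\<lambda>X. \<Sum>k<n. if late K L (r + k * L) (lv X) then 1 else (0::nat)) \<in> path_space \<rightarrow>\<^sub>M count_space UNIV"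
        using sets_late by (intro measurable_sum_nat measurable_If) auto
      ultimately have f: "(\<lambda>X. card {k. k < n \<and> late K L (r + k * L) (lv X)}) \<in> path_space \<rightarrow>\<^sub>M count_space UNIV"
        by simp
      show ?thesis
        using measurable_sets[OF f, of "{c. n \<le> 2 * c}"] by (simp add: vimage_def)
    qed
    then show ?thesis by (simp add: E_def)
  qed
  have bound: "Q.prob (E r n) \<le> (1/2) ^ n" for r n
  proof -
    let ?I = "\<lambda>S. {X. \<forall>m\<in>(\<lambda>k. r + k * L) ` S. late K L m (lv X)}"
    have mI: "?I S \<in> sets path_space" if "finite S" for S
    proof -
      have "{X \<in> space path_space. \<forall>m\<in>(\<lambda>k. r + k * L) ` S. late K L m (lv X)} \<in> sets path_space"
        using that by (intro sets.sets_Collect_finite_All) auto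
      then show ?thesis by simp
    qed
    let ?F = "{S. S \<subseteq> {..<n} \<and> n \<le> 2 * card S}"
    have fF: "finite ?F" by simp
    have "E r n \<subseteq> (\<Union>S\<in>?F. ?I S)"
    proof
      fix X assume "X \<in> E r n"
      then show "X \<in> (\<Union>S\<in>?F. ?I S)"
        by (intro UN_I[of "{k. k < n \<and> late K L (r + k * L) (lv X)}"]) (auto simp: E_def)
    qed
    then have "Q.prob (E r n) \<le> Q.prob (\<Union>S\<in>?F. ?I S)"
      using fF mI by (intro Q.finite_measure_mono) (auto intro!: sets.finite_UN dest: finite_subset)
    also have "\<dots> \<le> (\<Sum>S\<in>?F. Q.prob (?I S))"
      using fF mI by (intro Q.finite_measure_subadditive_finite) (auto dest: finite_subset)
    also have "\<dots> \<le> (\<Sum>S\<in>?F. (1/4) ^ n)"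
    proof (rule sum_mono)
      fix S assume S: "S \<in> ?F"
      then have fS: "finite S" by (auto dest: finite_subset)
      have inj: "inj_on (\<lambda>k. r + k * L) S" using L by (auto intro!: inj_onI)
      have "Q.prob (?I S) \<le> late_bound K L ^ card ((\<lambda>k. r + k * L) ` S)"
      proof (rule late_separated)
        fix m m' assume "m \<in> (\<lambda>k. r + k * L) ` S" "m' \<in> (\<lambda>k. r + k * L) ` S" "m < m'"
        then obtain k k' where k: "m = r + k * L" "m' = r + k' * L" by auto
        with \<open>m < m'\<close> L have "Suc k \<le> k'" by (auto simp: Suc_le_eq)
        then have "Suc k * L \<le> k' * L" by (rule mult_right_mono) simp
        then show "m + L \<le> m'" using k by simp
      qed (use fS in simp)
      also have "\<dots> = late_bound K L ^ card S" using inj by (simp add: card_image)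
      also have "\<dots> \<le> (1 / 16) ^ card S" using small by (intro power_mono late_bound_nonneg)
      also have "\<dots> = (1 / 4) ^ (2 * card S)" by (simp add: power_mult power2_eq_square)
      also have "\<dots> \<le> (1 / 4) ^ n" using S by (intro power_decreasing) auto
      finally show "Q.prob (?I S) \<le> (1/4) ^ n" .
    qed
    also have "\<dots> = card ?F * (1/4) ^ n" by simp
    also have "\<dots> \<le> 2 ^ n * (1/4) ^ n"
    proof -
      have "card ?F \<le> card (Pow {..<n})" by (intro card_mono) auto
      then show ?thesis by (simp add: card_Pow)
    qed
    also have "\<dots> = (1/2) ^ n" by (simp add: power_mult_distrib[symmetric])
    finally show ?thesis .
  qed
  have "AE X in Q. \<forall>\<^sub>F n in sequentially. X \<notin> E r n" for r
  proof -
    have "AE X in Q. \<forall>\<^sub>F n in sequentially. X \<in> space Q - E r n"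
    proof (rule borel_cantelli_AE1)
      show "summable (\<lambda>n. Q.prob (E r n))"
      proof (rule summable_comparison_test[OF _ summable_geometric[of "1/2 :: real"]])
        show "\<exists>N. \<forall>n\<ge>N. norm (Q.prob (E r n)) \<le> (1 / 2) ^ n" using bound[of r] by simp
      qed simp
      show "E r n \<in> sets Q" for n by simp
      show "emeasure Q (E r n) < \<infinity>" for n by (simp add: Q.emeasure_eq_measure)
    qed
    then show ?thesis by simp
  qed
  then have "AE X in Q. \<forall>r. \<forall>\<^sub>F n in sequentially. X \<notin> E r n" by (simp add: AE_all_countable)
  then show ?thesis
  proof eventually_elim
    case (elim X)
    let ?l = "\<lambda>m. late K L m (lv X)"
    have "\<forall>\<^sub>F n in sequentially. \<forall>r\<in>{..<L}. X \<notin> E r n"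
      using elim by (intro eventually_ball_finite) auto
    then obtain N where N: "\<And>n r. N \<le> n \<Longrightarrow> r < L \<Longrightarrow> X \<notin> E r n"
      unfolding eventually_sequentially by auto
    have "2 * card {m. m < M \<and> ?l m} \<le> M + 2 * L" if M: "N * L \<le> M" for M
    proof -
      define n where "n = M div L"
      have n: "N \<le> n" using M L by (simp add: n_def less_eq_div_iff_mult_less_eq)
      have "M = n * L + M mod L" "M mod L < L" using L by (simp_all add: n_def)
      then have Mn: "n * L \<le> M" "M < n * L + L" by linarith+
      have "{m. m < n * L \<and> ?l m} \<subseteq> (\<Union>r<L. (\<lambda>k. r + k * L) ` {k. k < n \<and> ?l (r + k * L)})"
      proof clarsimp
        fix m assume m: "m < n * L" "?l m"
        have "m div L < n" using m(1) L by (simp add: less_mult_imp_div_less)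
        then show "\<exists>r\<in>{..<L}. m \<in> (\<lambda>k. r + k * L) ` {k. k < n \<and> ?l (r + k * L)}"
          using m(2) L by (intro bexI[of _ "m mod L"] image_eqI[of _ _ "m div L"]) simp_all
      qed
      then have "card {m. m < n * L \<and> ?l m} \<le> card (\<Union>r<L. (\<lambda>k. r + k * L) ` {k. k < n \<and> ?l (r + k * L)})"
        by (intro card_mono) auto
      also have "\<dots> \<le> (\<Sum>r<L. card ((\<lambda>k. r + k * L) ` {k. k < n \<and> ?l (r + k * L)}))"
        by (rule card_UN_le) simp
      also have "\<dots> \<le> (\<Sum>r<L. card {k. k < n \<and> ?l (r + k * L)})"
        by (intro sum_mono card_image_le) simp
      finally have "2 * card {m. m < n * L \<and> ?l m} \<le> (\<Sum>r<L. 2 * card {k. k < n \<and> ?l (r + k * L)})"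
        by (simp add: sum_distrib_left[symmetric])
      also have "\<dots> \<le> (\<Sum>r<L. n)"
        using N[OF n] by (intro sum_mono less_imp_le) (auto simp: E_def not_le)
      finally have a: "2 * card {m. m < n * L \<and> ?l m} \<le> n * L" by (simp add: mult.commute)
      have "card {m. m < M \<and> ?l m} \<le> card ({m. m < n * L \<and> ?l m} \<union> {n * L..<M})"
        by (intro card_mono) auto
      also have "\<dots> \<le> card {m. m < n * L \<and> ?l m} + card {n * L..<M}" by (rule card_Un_le)
      also have "card {n * L..<M} \<le> L" using Mn by simp
      finally show ?thesis using a Mn by linarith
    qed
    then show ?case unfolding eventually_sequentially by blast
  qed
qed

text \<open>The scales are chosen recursively: the delay \<open>16 * C * Ls j\<close> is fixed
  before \<open>Ls (Suc j)\<close>, so the vanishing of the probability of \<open>esc L'\<close>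
  brings \<open>late_bound\<close> below \<open>1 / 16\<close>. Finiteness for every
  \<open>C\<close> says that the limsup of \<open>lv X n / n\<close> is at most 0.\<close>

lemma no_escape_slow:
  assumes "Q.prob escape = 0"
  shows "AE X in Q. \<forall>C::nat. finite {n. int n \<le> int C * lv X n}"
proof (subst AE_all_countable, intro allI)
  fix C :: nat
  show "AE X in Q. finite {n. int n \<le> int C * lv X n}"
  proof (cases "C = 0")
    case True
    then show ?thesis by simp
  next
    case False
    have ex: "\<exists>L'>L. late_bound (16 * C * L) L' \<le> 1 / 16" for L
    proof -
      define c where "c = (\<Sum>i\<le>16 * C * L. real (card (box i)))"
      have "(\<lambda>L'. c * Q.prob (esc L')) \<longlonglongrightarrow> c * 0"
        using esc_tendsto assms by (intro tendsto_mult) auto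
      then have "\<forall>\<^sub>F L' in sequentially. c * Q.prob (esc L') < 1 / 16"
        by (intro order_tendstoD(2)) auto
      then have "\<forall>\<^sub>F L' in sequentially. c * Q.prob (esc L') < 1 / 16 \<and> L < L'"
        by (intro eventually_conj eventually_gt_at_top)
      then show ?thesis unfolding eventually_sequentially late_bound_def c_def by (meson less_imp_le order_refl)
    qed
    have "\<exists>Ls. \<forall>j::nat. 1 \<le> Ls j \<and> (Ls j < Ls (Suc j) \<and> late_bound (16 * C * Ls j) (Ls (Suc j)) \<le> 1 / 16)"
    proof (rule dependent_nat_choice)
      show "\<exists>x::nat. 1 \<le> x" by auto
      fix L n :: nat assume "1 \<le> L"
      then show "\<exists>y\<ge>1. L < y \<and> late_bound (16 * C * L) y \<le> 1 / 16" using ex[of L] by (meson le_trans less_imp_le)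
    qed
    then obtain Ls :: "nat \<Rightarrow> nat" where Ls: "\<And>j. 1 \<le> Ls j" "\<And>j. Ls j < Ls (Suc j)"
        "\<And>j. late_bound (16 * C * Ls j) (Ls (Suc j)) \<le> 1 / 16" by blast
    have "AE X in Q. \<forall>j. \<forall>\<^sub>F M in sequentially. 2 * card {m. m < M \<and> late (16 * C * Ls j) (Ls (Suc j)) m (lv X)} \<le> M + 2 * Ls (Suc j)"
      by (subst AE_all_countable, intro allI late_count Ls)
    with AE_nn_path show ?thesis
    proof eventually_elim
      case (elim X)
      show ?case
      proof (rule ccontr)
        assume "infinite {n. int n \<le> int C * lv X n}"
        then have "\<exists>\<^sub>\<infinity>n. int n \<le> int C * lv X n" by (simp add: INFM_iff_infinite)
        from slow_contradiction[where y = "lv X" and C = C and Ls = Ls, OF nn_path_lv[OF elim(1)] Ls(1,2) _ this]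
        show False using elim(2) False by auto
      qed
    qed
  qed
qed

end

section \<open>Ergodic averages\<close>

lemma Int_stable_vimage_sets: "Int_stable {f -` A \<inter> S | A. A \<in> sets N}"
proof (rule Int_stableI)
  fix a b assume "a \<in> {f -` A \<inter> S | A. A \<in> sets N}" "b \<in> {f -` A \<inter> S | A. A \<in> sets N}"
  then obtain A B where "A \<in> sets N" "B \<in> sets N" "a = f -` A \<inter> S" "b = f -` B \<inter> S" by blast
  then have "A \<inter> B \<in> sets N" "a \<inter> b = f -` (A \<inter> B) \<inter> S" by auto
  then show "a \<inter> b \<in> {f -` A \<inter> S | A. A \<in> sets N}" by blast
qed

text \<open>Between \<open>r ^ 2\<close> and the next square the sequence moves by at most a
  multiple of \<open>c * r\<close>, negligible against \<open>r ^ 2\<close>. Squares are used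
  because Chebyshev bounds of order \<open>1 / k ^ 2\<close> are summable.\<close>

lemma averages_from_squares:
  fixes a :: "nat \<Rightarrow> real"
  assumes step: "\<And>n. \<bar>a (Suc n) - a n\<bar> \<le> c" and sq: "(\<lambda>k. a (k ^ 2) / real (k ^ 2)) \<longlonglongrightarrow> 0"
  shows "(\<lambda>n. a n / real n) \<longlonglongrightarrow> 0"
proof -
  have c: "0 \<le> c" using step[of 0] by linarith
  have inc: "\<bar>a (m + n) - a m\<bar> \<le> c * real n" for m n
  proof (induction n)
    case (Suc n)
    then show ?case using step[of "m + n"] by (simp add: algebra_simps)
  qed simp
  define r where "r n = nat \<lfloor>sqrt (real n)\<rfloor>" for n :: nat
  have r: "(r n)^2 \<le> n" "n < (Suc (r n))^2" for n
  proof -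
    have a: "real (r n) \<le> sqrt (real n)" "sqrt (real n) < real (Suc (r n))"
      unfolding r_def by (simp, simp, linarith)
    have "(real (r n))^2 \<le> (sqrt (real n))^2" "(sqrt (real n))^2 < (real (Suc (r n)))^2"
      using a by (intro power_mono power_strict_mono; simp)+
    then have "real ((r n)^2) \<le> real n" "real n < real ((Suc (r n))^2)" by simp_all
    then show "(r n)^2 \<le> n" "n < (Suc (r n))^2" by linarith+
  qed
  have r_top: "filterlim r at_top sequentially"
    unfolding filterlim_at_top eventually_sequentially
  proof
    fix Z
    have "Z \<le> r n" if "Z^2 \<le> n" for n
    proof -
      have "real Z \<le> sqrt (real n)" using that by (intro real_le_rsqrt) (simp flip: of_nat_power)
      then show ?thesis unfolding r_def by (rule le_nat_floor)
    qed
    then show "\<exists>N. \<forall>n\<ge>N. Z \<le> r n" by blast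
  qed
  have bound: "norm (a n / real n) \<le> \<bar>a ((r n)^2) / real ((r n)^2)\<bar> + 3 * c / real (r n)" if "1 \<le> n" for n
  proof -
    have r1: "1 \<le> r n" using r(2)[of n] that by (cases "r n") auto
    have "\<bar>a n - a ((r n)^2)\<bar> \<le> c * real (n - (r n)^2)" using inc[of "(r n)^2" "n - (r n)^2"] r(1)[of n] by simp
    also have "\<dots> \<le> c * (3 * real (r n))"
    proof (rule mult_left_mono[OF _ c])
      have "n \<le> (r n)^2 + 2 * r n" using r(2)[of n] by (simp add: power2_eq_square)
      then show "real (n - (r n)^2) \<le> 3 * real (r n)" by linarith
    qed
    finally have "\<bar>a n\<bar> \<le> \<bar>a ((r n)^2)\<bar> + 3 * c * real (r n)" by linarith
    then have "\<bar>a n\<bar> / real n \<le> (\<bar>a ((r n)^2)\<bar> + 3 * c * real (r n)) / real n" by (intro divide_right_mono) auto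
    also have "\<dots> \<le> (\<bar>a ((r n)^2)\<bar> + 3 * c * real (r n)) / real ((r n)^2)"
      using r(1)[of n] r1 c that by (intro divide_left_mono mult_pos_pos add_nonneg_nonneg mult_nonneg_nonneg) (auto simp flip: of_nat_power)
    also have "\<dots> = \<bar>a ((r n)^2) / real ((r n)^2)\<bar> + 3 * c / real (r n)"
      using r1 by (simp add: field_simps power2_eq_square)
    finally show ?thesis by simp
  qed
  have "(\<lambda>n. \<bar>a ((r n)^2) / real ((r n)^2)\<bar> + 3 * c / real (r n)) \<longlonglongrightarrow> \<bar>0\<bar> + 0"
  proof (intro tendsto_intros)
    show "(\<lambda>n. a ((r n)^2) / real ((r n)^2)) \<longlonglongrightarrow> 0"
      using filterlim_compose[OF sq r_top] by simp
    show "(\<lambda>n. 3 * c / real (r n)) \<longlonglongrightarrow> 0"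
      by (intro tendsto_divide_0[OF tendsto_const] filterlim_at_top_imp_at_infinity
          filterlim_compose[OF filterlim_real_sequentially r_top])
  qed
  then have lim: "(\<lambda>n. \<bar>a ((r n)^2) / real ((r n)^2)\<bar> + 3 * c / real (r n)) \<longlonglongrightarrow> 0" by simp
  show ?thesis
    by (rule Lim_null_comparison[OF _ lim]) (use bound in \<open>auto simp: eventually_sequentially\<close>)
qed

locale mpt = prob_space +
  fixes T :: "'a \<Rightarrow> 'a"
  assumes T[measurable]: "T \<in> M \<rightarrow>\<^sub>M M" and mp: "distr M M T = M"
begin

lemma measurable_iter [measurable]: "(T ^^ n) \<in> M \<rightarrow>\<^sub>M M"
proof (induction n)
  case (Suc n)
  then show ?case using measurable_comp[OF Suc T] by simp
qed (simp add: id_def)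

lemma distr_iter: "distr M M (T ^^ n) = M"
proof (induction n)
  case (Suc n)
  have "distr M M (T ^^ Suc n) = distr (distr M M (T ^^ n)) M T"
    by (subst distr_distr) auto
  then show ?case using Suc mp by metis
qed (simp add: id_def distr_id2)

lemma integral_iter: "f \<in> borel_measurable M \<Longrightarrow> (\<integral>x. f ((T ^^ n) x) \<partial>M) = (\<integral>x. f x \<partial>M)" for f :: "'a \<Rightarrow> real"
  by (subst (2) distr_iter[symmetric, of n], subst integral_distr) auto

lemma integrable_iter: "integrable M f \<Longrightarrow> integrable M (\<lambda>x. f ((T ^^ n) x))" for f :: "'a \<Rightarrow> real"
  by (rule integrable_distr[OF measurable_iter[of n]]) (simp add: distr_iter)

definition S :: "('a \<Rightarrow> real) \<Rightarrow> nat \<Rightarrow> 'a \<Rightarrow> real" where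
  "S f n x = (\<Sum>i<n. f ((T ^^ i) x))"

lemma measurable_S [measurable]: "f \<in> borel_measurable M \<Longrightarrow> S f n \<in> borel_measurable M"
  unfolding S_def[abs_def]
  by (intro borel_measurable_sum measurable_compose[OF measurable_iter]) auto

text \<open>Garsia's recursion for the running maximum of the partial sums.\<close>

primrec run_max :: "('a \<Rightarrow> real) \<Rightarrow> nat \<Rightarrow> 'a \<Rightarrow> real" where
  "run_max f 0 = (\<lambda>x. 0)"
| "run_max f (Suc n) = (\<lambda>x. max 0 (f x + run_max f n (T x)))"

lemma run_max_mono: "run_max f n x \<le> run_max f (Suc n) x"
proof (induction n arbitrary: x)
  case (Suc n)
  show ?case using Suc[of "T x"] by simp
qed simp

lemma run_max_ge: "S f n x \<le> run_max f n x"
proof (induction n arbitrary: x)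
  case (Suc n)
  have "S f (Suc n) x = f x + S f n (T x)"
    unfolding S_def by (subst sum.lessThan_Suc_shift) (simp add: funpow_swap1)
  then show ?case using Suc[of "T x"] by simp
qed (simp add: S_def)

lemma run_max_measurable [measurable]:
  assumes [measurable]: "f \<in> borel_measurable M"
  shows "run_max f n \<in> borel_measurable M"
proof (induction n)
  case (Suc n)
  note [measurable] = Suc
  show ?case unfolding run_max.simps by measurable
qed simp

lemma run_max_integrable: "integrable M f \<Longrightarrow> integrable M (run_max f n)"
proof (induction n)
  case (Suc n)
  then have "integrable M (\<lambda>x. run_max f n (T x))" using integrable_iter[of "run_max f n" 1] by simp
  with Suc show ?case by (auto intro!: integrable_max)
qed simp

text \<open>With \<open>f = g - l\<close>, invariance of the measure makes the integral of
  \<open>run_max f (Suc n) x - run_max f (Suc n) (T x)\<close> vanish. The integrand is at most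
  \<open>f\<close> where the maximum is positive and at most 0 elsewhere, so \<open>f\<close> has
  nonnegative integral over the set where it is positive.\<close>

lemma maximal_inequality:
  assumes g: "integrable M g" "\<And>x. 0 \<le> g x" and l: "0 < (l::real)"
  shows "prob {x\<in>space M. \<exists>n. l * real n < S g n x} \<le> (\<integral>x. g x \<partial>M) / l"
proof -
  have [measurable]: "g \<in> borel_measurable M" using g by auto
  define f where "f x = g x - l" for x
  have f: "integrable M f" unfolding f_def using g by auto
  then have [measurable]: "f \<in> borel_measurable M" by auto
  let ?B = "\<lambda>n. {x\<in>space M. 0 < run_max f (Suc n) x}"
  have B: "prob (?B n) \<le> (\<integral>x. g x \<partial>M) / l" for n
  proof -
    have "0 = (\<integral>x. run_max f (Suc n) x - run_max f (Suc n) (T x) \<partial>M)"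
      using integral_iter[of "run_max f (Suc n)" 1] run_max_integrable[OF f, of "Suc n"] integrable_iter[of "run_max f (Suc n)" 1]
      by (subst Bochner_Integration.integral_diff) (auto simp del: run_max.simps)
    also have "\<dots> \<le> (\<integral>x. f x * indicator (?B n) x \<partial>M)"
    proof (rule integral_mono)
      show "integrable M (\<lambda>x. run_max f (Suc n) x - run_max f (Suc n) (T x))"
        using run_max_integrable[OF f, of "Suc n"] integrable_iter[of "run_max f (Suc n)" 1] by (auto simp del: run_max.simps)
      show "integrable M (\<lambda>x. f x * indicator (?B n) x)"
        using f by (intro integrable_real_mult_indicator) auto
      fix x assume x: "x \<in> space M"
      have m: "run_max f n (T x) \<le> run_max f (Suc n) (T x)" by (rule run_max_mono)
      have p: "0 \<le> run_max f (Suc n) (T x)" by simp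
      show "run_max f (Suc n) x - run_max f (Suc n) (T x) \<le> f x * indicator (?B n) x"
      proof (cases "0 < run_max f (Suc n) x")
        case True
        then have "run_max f (Suc n) x = f x + run_max f n (T x)" by (simp add: max_def split: if_splits)
        then show ?thesis using True x m by (simp del: run_max.simps)
      next
        case False
        then have "run_max f (Suc n) x \<le> 0" by simp
        then show ?thesis using False p by (simp del: run_max.simps)
      qed
    qed
    also have "\<dots> \<le> (\<integral>x. g x - l * indicator (?B n) x \<partial>M)"
    proof (rule integral_mono)
      show "integrable M (\<lambda>x. f x * indicator (?B n) x)"
        using f by (intro integrable_real_mult_indicator) auto
      show "integrable M (\<lambda>x. g x - l * indicator (?B n) x)"
        using g by (intro Bochner_Integration.integrable_diff integrable_mult_right integrable_real_indicator) (auto simp: emeasure_eq_measure)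
    qed (use g in \<open>auto simp: f_def indicator_def\<close>)
    also have "\<dots> = (\<integral>x. g x \<partial>M) - l * prob (?B n)"
      using g by (subst Bochner_Integration.integral_diff) (auto intro!: integrable_mult_right integrable_real_indicator simp: emeasure_eq_measure)
    finally show ?thesis using l by (simp add: field_simps)
  qed
  have inc: "incseq ?B"
    using run_max_mono[of f "Suc _"] by (intro incseq_SucI) (auto simp del: run_max.simps intro: less_le_trans)
  have lim: "(\<lambda>n. prob (?B n)) \<longlonglongrightarrow> prob (\<Union>n. ?B n)"
    using inc by (intro finite_Lim_measure_incseq) auto
  have "prob (\<Union>n. ?B n) \<le> (\<integral>x. g x \<partial>M) / l"
    by (rule LIMSEQ_le_const2[OF lim]) (use B in auto)
  moreover have "{x\<in>space M. \<exists>n. l * real n < S g n x} \<subseteq> (\<Union>n. ?B n)"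
  proof
    fix x assume "x \<in> {x\<in>space M. \<exists>n. l * real n < S g n x}"
    then obtain n where x: "x \<in> space M" "l * real n < S g n x" by blast
    have "S f n x = S g n x - l * real n" by (simp add: S_def f_def sum_subtractf)
    then have "0 < run_max f n x" using run_max_ge[of f n x] x by linarith
    then have "0 < run_max f (Suc n) x" using run_max_mono[of f n x] by linarith
    with x show "x \<in> (\<Union>n. ?B n)" by (intro UN_I[of n]) (simp_all del: run_max.simps)
  qed
  then have "prob {x\<in>space M. \<exists>n. l * real n < S g n x} \<le> prob (\<Union>n. ?B n)"
    by (intro finite_measure_mono) auto
  ultimately show ?thesis by linarith
qed

end

text \<open>Independence of \<open>F\<close> from everything pulled back by \<open>T\<close> makes
  the iterates of \<open>F\<close> along \<open>T\<close> i.i.d. This form fits regeneration: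
  \<open>T\<close> moves to the next regeneration, and \<open>F\<close> describes the stretch before
  it.\<close>

locale iid_mpt = mpt +
  fixes F :: "'a \<Rightarrow> real"
  assumes F[measurable]: "F \<in> borel_measurable M" and F0: "\<And>x. 0 \<le> F x"
    and indep: "\<And>A B. A \<in> sets borel \<Longrightarrow> B \<in> sets M \<Longrightarrow>
      prob ((F -` A \<inter> space M) \<inter> (T -` B \<inter> space M)) = prob (F -` A \<inter> space M) * prob B"
begin

lemma indep_F_T:
  fixes G :: "'a \<Rightarrow> real"
  assumes G[measurable]: "G \<in> borel_measurable M"
  shows "indep_var borel F borel (\<lambda>x. G (T x))"
  unfolding indep_var_eq
proof (intro conjI F indep_set_sigma_sets)
  show GT: "(\<lambda>x. G (T x)) \<in> borel_measurable M" by measurable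
  have *: "prob (T -` B \<inter> space M) = prob B" if "B \<in> sets M" for B
    using that measure_distr[OF T, of B] by (simp add: mp)
  have eq: "(\<lambda>x. G (T x)) -` B \<inter> space M = T -` (G -` B \<inter> space M) \<inter> space M" for B
    using measurable_space[OF T] by auto
  have B: "G -` B \<inter> space M \<in> sets M" if "B \<in> sets borel" for B
    using that by (rule measurable_sets[OF G])
  show "indep_set {F -` A \<inter> space M |A. A \<in> sets borel} {(\<lambda>x. G (T x)) -` A \<inter> space M |A. A \<in> sets borel}"
  proof (rule indep_setI)
    show "{F -` A \<inter> space M |A. A \<in> sets borel} \<subseteq> events"
      by (auto intro: measurable_sets[OF F])
    show "{(\<lambda>x. G (T x)) -` A \<inter> space M |A. A \<in> sets borel} \<subseteq> events"
      by (auto intro: measurable_sets[OF GT])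
    fix a b assume "a \<in> {F -` A \<inter> space M |A. A \<in> sets borel}" "b \<in> {(\<lambda>x. G (T x)) -` A \<inter> space M |A. A \<in> sets borel}"
    then obtain A B' where "A \<in> sets borel" "B' \<in> sets borel" and ab: "a = F -` A \<inter> space M" "b = (\<lambda>x. G (T x)) -` B' \<inter> space M"
      by blast
    then show "prob (a \<inter> b) = prob a * prob b"
      unfolding ab eq using indep[OF _ B] *[OF B] by simp
  qed
  show "Int_stable {F -` A \<inter> space M |A. A \<in> sets borel}" by (rule Int_stable_vimage_sets)
  show "Int_stable {(\<lambda>x. G (T x)) -` A \<inter> space M |A. A \<in> sets borel}" by (rule Int_stable_vimage_sets)
qed

definition trunc :: "real \<Rightarrow> 'a \<Rightarrow> real" where "trunc K x = min (F x) K"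

lemma trunc_measurable [measurable]: "trunc K \<in> borel_measurable M"
  unfolding trunc_def[abs_def] by measurable

lemma trunc_bounds: "0 \<le> K \<Longrightarrow> 0 \<le> trunc K x" "trunc K x \<le> K"
  using F0[of x] by (simp_all add: trunc_def)

lemma trunc_integrable: "0 \<le> K \<Longrightarrow> integrable M (trunc K)"
  by (intro integrable_const_bound[of _ K]) (auto simp: trunc_bounds abs_of_nonneg)

text \<open>Stationarity moves the pair of times to \<open>0\<close> and \<open>j - i\<close>; the
  first factor is then a function of \<open>F\<close> and the second a function of
  \<open>T x\<close>.\<close>

lemma trunc_uncorrelated:
  assumes K: "0 \<le> K" and ij: "i < j"
  shows "(\<integral>x. trunc K ((T ^^ i) x) * trunc K ((T ^^ j) x) \<partial>M) = (\<integral>x. trunc K x \<partial>M)\<^sup>2"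
proof -
  obtain k where k: "j = Suc k + i" using ij less_imp_Suc_add[of i j] by auto
  have "(\<integral>x. trunc K ((T ^^ i) x) * trunc K ((T ^^ j) x) \<partial>M) =
    (\<integral>x. trunc K ((T ^^ i) x) * trunc K ((T ^^ Suc k) ((T ^^ i) x)) \<partial>M)"
    by (simp only: k funpow_add comp_def)
  also have "\<dots> = (\<integral>x. trunc K x * trunc K ((T ^^ Suc k) x) \<partial>M)"
    by (rule integral_iter) measurable
  also have "\<dots> = (\<integral>x. trunc K x \<partial>M) * (\<integral>x. trunc K ((T ^^ Suc k) x) \<partial>M)"
  proof (rule indep_var_lebesgue_integral)
    have "indep_var borel ((\<lambda>r. min r K) \<circ> F) borel ((\<lambda>r. r) \<circ> (\<lambda>x. trunc K ((T ^^ k) (T x))))"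
      by (rule indep_var_compose[OF indep_F_T[of "\<lambda>x. trunc K ((T ^^ k) x)"]]) measurable
    then show "indep_var borel (trunc K) borel (\<lambda>x. trunc K ((T ^^ Suc k) x))"
      by (simp add: comp_def trunc_def[abs_def] funpow_swap1)
    show "integrable M (trunc K)" "integrable M (\<lambda>x. trunc K ((T ^^ Suc k) x))"
      using trunc_integrable[OF K] integrable_iter[of "trunc K" "Suc k"] by auto
  qed
  also have "(\<integral>x. trunc K ((T ^^ Suc k) x) \<partial>M) = (\<integral>x. trunc K x \<partial>M)"
    by (rule integral_iter) measurable
  finally show ?thesis by (simp add: power2_eq_square)
qed

text \<open>Uncorrelated bounded terms give partial sums of second moment at most
  \<open>n * K ^ 2\<close>. Chebyshev and Borel-Cantelli yield convergence along squares, and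
  boundedness fills the gaps.\<close>

lemma slln_trunc:
  assumes K: "0 \<le> K"
  shows "AE x in M. (\<lambda>n. S (trunc K) n x / real n) \<longlonglongrightarrow> (\<integral>x. trunc K x \<partial>M)"
proof -
  define e where "e = (\<integral>x. trunc K x \<partial>M)"
  define Z where "Z i x = trunc K ((T ^^ i) x) - e" for i x
  have [measurable]: "Z i \<in> borel_measurable M" for i unfolding Z_def[abs_def] by measurable
  have e: "0 \<le> e" "e \<le> K"
    using integral_mono[OF trunc_integrable[OF K] integrable_const[of K]] trunc_bounds K
    by (auto simp: e_def prob_space intro!: integral_nonneg_AE)
  have Zb: "\<bar>Z i x\<bar> \<le> K" for i x
    using trunc_bounds(1)[OF K, of "(T ^^ i) x"] trunc_bounds(2)[of K "(T ^^ i) x"] e by (auto simp: Z_def)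
  have bi: "integrable M f" if "f \<in> borel_measurable M" "\<And>x. \<bar>f x\<bar> \<le> c" for f and c :: real
    using that by (intro integrable_const_bound[of _ c]) auto
  have iZZ: "integrable M (\<lambda>x. Z i x * Z j x)" for i j
    by (rule bi[of _ "K * K"]) (auto simp: abs_mult intro!: mult_mono Zb K)
  have it: "integrable M (\<lambda>x. trunc K ((T ^^ i) x))" for i by (rule integrable_iter[OF trunc_integrable[OF K]])
  have itt: "integrable M (\<lambda>x. trunc K ((T ^^ i) x) * trunc K ((T ^^ j) x))" for i j
    using trunc_bounds K by (intro bi[of _ "K * K"]) (auto simp: abs_mult intro!: mult_mono)
  have ZZ: "(\<integral>x. Z i x * Z j x \<partial>M) = 0" if "i < j" for i j
  proof -
    have "(\<integral>x. Z i x * Z j x \<partial>M) = (\<integral>x. trunc K ((T ^^ i) x) * trunc K ((T ^^ j) x) - e * trunc K ((T ^^ i) x) - e * trunc K ((T ^^ j) x) + e * e \<partial>M)"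
      by (simp add: Z_def algebra_simps)
    also have "\<dots> = (\<integral>x. trunc K ((T ^^ i) x) * trunc K ((T ^^ j) x) \<partial>M) - e * (\<integral>x. trunc K ((T ^^ i) x) \<partial>M) - e * (\<integral>x. trunc K ((T ^^ j) x) \<partial>M) + e * e"
      using it itt by (simp add: prob_space)
    also have "\<dots> = 0"
      using integral_iter[of "trunc K"] trunc_uncorrelated[OF K that] by (simp add: e_def power2_eq_square)
    finally show ?thesis .
  qed
  have ZZ': "(\<integral>x. Z i x * Z j x \<partial>M) = 0" if "i \<noteq> j" for i j
    using ZZ[of i j] ZZ[of j i] that by (cases "i < j") (auto simp: mult.commute)
  define W where "W n x = (\<Sum>i<n. Z i x)" for n x
  have [measurable]: "W n \<in> borel_measurable M" for n unfolding W_def[abs_def] by measurable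
  have W2: "integrable M (\<lambda>x. (W n x)\<^sup>2)" "(\<integral>x. (W n x)\<^sup>2 \<partial>M) \<le> real n * K\<^sup>2" for n
  proof -
    have eq: "(W n x)\<^sup>2 = (\<Sum>i<n. \<Sum>j<n. Z i x * Z j x)" for x
      by (simp add: W_def power2_eq_square sum_product)
    show "integrable M (\<lambda>x. (W n x)\<^sup>2)" unfolding eq using iZZ by auto
    have "(\<integral>x. (W n x)\<^sup>2 \<partial>M) = (\<Sum>i<n. \<Sum>j<n. \<integral>x. Z i x * Z j x \<partial>M)"
      unfolding eq using iZZ by (simp add: Bochner_Integration.integral_sum)
    also have "\<dots> = (\<Sum>i<n. \<Sum>j<n. if i = j then \<integral>x. Z i x * Z i x \<partial>M else 0)"
      by (intro sum.cong refl) (auto simp: ZZ')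
    also have "\<dots> = (\<Sum>i<n. \<integral>x. Z i x * Z i x \<partial>M)" by simp
    also have "\<dots> \<le> (\<Sum>i<n. K\<^sup>2)"
    proof (rule sum_mono)
      fix i
      have "Z i x * Z i x \<le> K\<^sup>2" for x
        using abs_le_square_iff[of "Z i x" K] Zb[of i x] K by (simp add: power2_eq_square)
      then have "(\<integral>x. Z i x * Z i x \<partial>M) \<le> (\<integral>x. K\<^sup>2 \<partial>M)" using iZZ by (intro integral_mono) auto
      then show "(\<integral>x. Z i x * Z i x \<partial>M) \<le> K\<^sup>2" by (simp add: prob_space)
    qed
    finally show "(\<integral>x. (W n x)\<^sup>2 \<partial>M) \<le> real n * K\<^sup>2" by simp
  qed
  have "AE x in M. \<forall>\<^sub>F k in sequentially. \<bar>W (k^2) x / real (k^2)\<bar> < 1 / real (Suc m)" for m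
  proof -
    define E where "E k = {x\<in>space M. 1 / real (Suc m) \<le> \<bar>W (k^2) x / real (k^2)\<bar>}" for k
    have [measurable]: "E k \<in> sets M" for k unfolding E_def by measurable
    have "prob (E k) \<le> (real (Suc m) * K)\<^sup>2 * inverse ((real k)\<^sup>2)" for k
    proof (cases "k = 0")
      case True
      then show ?thesis by (simp add: E_def)
    next
      case False
      have "prob (E k) = prob {x\<in>space M. (real (k^2) / real (Suc m))\<^sup>2 \<le> (W (k^2) x)\<^sup>2}"
      proof (intro arg_cong[where f=prob])
        have "(1 / real (Suc m) \<le> \<bar>w / real (k^2)\<bar>) = ((real (k^2) / real (Suc m))\<^sup>2 \<le> w\<^sup>2)" for w
          using False by (subst abs_le_square_iff[symmetric]) (simp add: field_simps abs_divide)
        then show "E k = {x\<in>space M. (real (k^2) / real (Suc m))\<^sup>2 \<le> (W (k^2) x)\<^sup>2}" by (simp add: E_def)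
      qed
      also have "\<dots> \<le> (\<integral>x. (W (k^2) x)\<^sup>2 \<partial>M) / (real (k^2) / real (Suc m))\<^sup>2"
        using False W2 by (intro integral_Markov_inequality_measure[where A="{}"]) auto
      also have "\<dots> \<le> (real (k^2) * K\<^sup>2) / (real (k^2) / real (Suc m))\<^sup>2"
        using W2(2)[of "k^2"] by (intro divide_right_mono) simp_all
      also have "\<dots> = (real (Suc m) * K)\<^sup>2 * inverse ((real k)\<^sup>2)"
        using False by (simp add: field_simps power2_eq_square)
      finally show ?thesis .
    qed
    moreover have "summable (\<lambda>k. (real (Suc m) * K)\<^sup>2 * inverse ((real k)\<^sup>2))"
      by (intro summable_mult inverse_power_summable) simp
    ultimately have "summable (\<lambda>k. prob (E k))"
      by (intro summable_comparison_test[of "\<lambda>k. prob (E k)"] exI[of _ 0]) (simp_all only: real_norm_def abs_of_nonneg measure_nonneg simp_thms)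
    then have "AE x in M. \<forall>\<^sub>F k in sequentially. x \<in> space M - E k"
      by (intro borel_cantelli_AE1) (auto simp: emeasure_eq_measure)
    then show ?thesis
      by (rule AE_mp) (auto simp: E_def not_le elim!: eventually_mono intro!: AE_I2)
  qed
  then have "AE x in M. \<forall>m. \<forall>\<^sub>F k in sequentially. \<bar>W (k^2) x / real (k^2)\<bar> < 1 / real (Suc m)"
    by (simp add: AE_all_countable)
  then show ?thesis
  proof eventually_elim
    case (elim x)
    have "(\<lambda>k. W (k^2) x / real (k^2)) \<longlonglongrightarrow> 0"
    proof (rule tendstoI)
      fix r :: real assume "0 < r"
      then obtain m where m: "1 / real (Suc m) < r" using nat_approx_posE by metis
      show "\<forall>\<^sub>F k in sequentially. dist (W (k^2) x / real (k^2)) 0 < r"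
        using elim[rule_format, of m] by eventually_elim (use m in simp)
    qed
    then have "(\<lambda>n. W n x / real n) \<longlonglongrightarrow> 0"
      by (intro averages_from_squares[of "\<lambda>n. W n x" K]) (auto simp: W_def Zb)
    then have "(\<lambda>n. W n x / real n + e) \<longlonglongrightarrow> 0 + e" by (intro tendsto_intros)
    moreover have "\<forall>\<^sub>F n in sequentially. W n x / real n + e = S (trunc K) n x / real n"
      using eventually_gt_at_top[of 0]
      by eventually_elim (simp add: W_def Z_def S_def sum_subtractf field_simps)
    ultimately show ?case by (simp add: e_def[symmetric] tendsto_cong)
  qed
qed

lemma trunc_lim: "(\<lambda>k. ennreal (\<integral>x. trunc (real k) x \<partial>M)) \<longlonglongrightarrow> (\<integral>\<^sup>+x. ennreal (F x) \<partial>M)"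
proof -
  have eq: "ennreal (\<integral>x. trunc (real k) x \<partial>M) = (\<integral>\<^sup>+x. ennreal (trunc (real k) x) \<partial>M)" for k
    by (intro nn_integral_eq_integral[symmetric] trunc_integrable) (auto simp: trunc_bounds)
  show ?thesis unfolding eq
  proof (rule nn_integral_LIMSEQ)
    show "incseq (\<lambda>k x. ennreal (trunc (real k) x))"
      by (intro incseq_SucI le_funI ennreal_leI) (auto simp: trunc_def)
    show "(\<lambda>k. ennreal (trunc (real k) x)) \<longlonglongrightarrow> ennreal (F x)" for x
    proof (rule tendsto_eventually)
      obtain N where N: "F x \<le> real N" using real_arch_simple by blast
      show "\<forall>\<^sub>F k in sequentially. ennreal (trunc (real k) x) = ennreal (F x)"
        using eventually_ge_at_top[of N] by eventually_elim (use N in \<open>auto simp: trunc_def\<close>)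
    qed
  qed measurable
qed

lemma S_mono: "(\<And>x. f x \<le> g x) \<Longrightarrow> S f n x \<le> S g n x"
  unfolding S_def by (rule sum_mono)

text \<open>The averages of each truncation bound those of \<open>F\<close> from below, and the
  truncated means tend to infinity.\<close>

lemma slln_infinite:
  assumes "\<not> integrable M F"
  shows "AE x in M. filterlim (\<lambda>n. S F n x / real n) at_top sequentially"
proof -
  have inf: "(\<integral>\<^sup>+x. ennreal (F x) \<partial>M) = \<infinity>"
  proof -
    have "\<not> (\<integral>\<^sup>+x. ennreal (norm (F x)) \<partial>M) < \<infinity>" using assms by (simp add: integrable_iff_bounded)
    moreover have "(\<integral>\<^sup>+x. ennreal (norm (F x)) \<partial>M) = (\<integral>\<^sup>+x. ennreal (F x) \<partial>M)"
      by (intro nn_integral_cong) (simp add: F0)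
    ultimately show ?thesis by (metis infinity_ennreal_def less_top)
  qed
  have "AE x in M. \<forall>k. (\<lambda>n. S (trunc (real k)) n x / real n) \<longlonglongrightarrow> (\<integral>x. trunc (real k) x \<partial>M)"
    by (subst AE_all_countable) (auto intro: slln_trunc)
  then show ?thesis
  proof eventually_elim
    case (elim x)
    show ?case
    proof (subst filterlim_at_top, intro allI)
      fix Z :: real
      have "\<forall>\<^sub>F k in sequentially. ennreal (max Z 0) < ennreal (\<integral>x. trunc (real k) x \<partial>M)"
        using trunc_lim unfolding inf by (rule order_tendstoD) simp
      then obtain k where "ennreal (max Z 0) < ennreal (\<integral>x. trunc (real k) x \<partial>M)"
        unfolding eventually_sequentially by blast
      then have k: "Z < (\<integral>x. trunc (real k) x \<partial>M)"
        using ennreal_leI[of "\<integral>x. trunc (real k) x \<partial>M" "max Z 0"] by (meson max.cobounded1 not_le order_trans)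
      show "\<forall>\<^sub>F n in sequentially. Z \<le> S F n x / real n"
        using order_tendstoD(1)[OF elim[rule_format, of k] k]
      proof eventually_elim
        case (elim n)
        have "S (trunc (real k)) n x / real n \<le> S F n x / real n"
          by (intro divide_right_mono S_mono) (auto simp: trunc_def)
        with elim show ?case by simp
      qed
    qed
  qed
qed

text \<open>Truncations give the lower bound. For the upper bound, the excess of \<open>F\<close>
  over \<open>trunc k\<close> has small mean, so by the maximal inequality its averages are unlikely
  ever to exceed \<open>r\<close>; almost every point lies outside \<open>Bad k\<close> for some
  \<open>k\<close>.\<close>

lemma slln_integrable:
  assumes int: "integrable M F"
  shows "AE x in M. (\<lambda>n. S F n x / real n) \<longlonglongrightarrow> (\<integral>x. F x \<partial>M)"
proof -
  define e where "e = (\<integral>x. F x \<partial>M)"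
  have lim: "(\<lambda>k. \<integral>x. trunc (real k) x \<partial>M) \<longlonglongrightarrow> e"
  proof -
    have "(\<integral>\<^sup>+x. ennreal (F x) \<partial>M) = ennreal e" unfolding e_def using int F0 by (intro nn_integral_eq_integral) auto
    with trunc_lim have "(\<lambda>k. ennreal (\<integral>x. trunc (real k) x \<partial>M)) \<longlonglongrightarrow> ennreal e" by simp
    then show ?thesis
      using trunc_bounds F0 unfolding e_def by (subst (asm) tendsto_ennreal_iff) (auto intro!: integral_nonneg_AE always_eventually)
  qed
  have le: "(\<integral>x. trunc (real k) x \<partial>M) \<le> e" for k
    unfolding e_def using int by (intro integral_mono trunc_integrable) (auto simp: trunc_def)
  have trunc_all: "AE x in M. \<forall>k. (\<lambda>n. S (trunc (real k)) n x / real n) \<longlonglongrightarrow> (\<integral>x. trunc (real k) x \<partial>M)"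
    by (subst AE_all_countable) (auto intro: slln_trunc)
  have upper: "AE x in M. \<forall>\<^sub>F n in sequentially. S F n x / real n < e + 2 * r" if r: "0 < r" for r
  proof -
    define Bad where "Bad k = {x\<in>space M. \<exists>n. r * real n < S (\<lambda>x. F x - trunc (real k) x) n x}" for k
    have [measurable]: "Bad k \<in> sets M" for k unfolding Bad_def by measurable
    have "prob (Bad k) \<le> (e - (\<integral>x. trunc (real k) x \<partial>M)) / r" for k
    proof -
      have i: "integrable M (\<lambda>x. F x - trunc (real k) x)" using int trunc_integrable[of "real k"] by simp
      have "prob (Bad k) \<le> (\<integral>x. F x - trunc (real k) x \<partial>M) / r"
        unfolding Bad_def by (rule maximal_inequality[OF i _ r]) (simp add: trunc_def)
      also have "(\<integral>x. F x - trunc (real k) x \<partial>M) = e - (\<integral>x. trunc (real k) x \<partial>M)"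
        unfolding e_def by (rule Bochner_Integration.integral_diff[OF int]) (simp add: trunc_integrable)
      finally show ?thesis .
    qed
    moreover have "(\<lambda>k. (e - (\<integral>x. trunc (real k) x \<partial>M)) / r) \<longlonglongrightarrow> (e - e) / r"
      using r by (intro tendsto_intros lim) auto
    ultimately have Bl: "(\<lambda>k. prob (Bad k)) \<longlonglongrightarrow> 0"
      by (intro tendsto_sandwich[of "\<lambda>_. 0" "\<lambda>k. prob (Bad k)" sequentially "\<lambda>k. (e - (\<integral>x. trunc (real k) x \<partial>M)) / r" 0]) auto
    have "prob (\<Inter>k. Bad k) \<le> prob (Bad k)" for k
      by (intro finite_measure_mono) auto
    then have "prob (\<Inter>k. Bad k) \<le> 0" by (intro LIMSEQ_le_const[OF Bl]) auto
    then have "prob (\<Inter>k. Bad k) = 0" using measure_nonneg[of M "\<Inter>k. Bad k"] by linarith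
    then have "AE x in M. x \<notin> (\<Inter>k. Bad k)"
      by (intro AE_not_in) (auto simp: emeasure_eq_measure null_sets_def)
    with trunc_all AE_space show ?thesis
    proof eventually_elim
      case (elim x)
      then obtain k where k: "x \<notin> Bad k" by auto
      have "(\<integral>x. trunc (real k) x \<partial>M) < e + r" using le[of k] r by linarith
      from order_tendstoD(2)[OF elim(1)[rule_format, of k] this] eventually_gt_at_top[of 0] show ?case
      proof eventually_elim
        case (elim n)
        have "S (\<lambda>x. F x - trunc (real k) x) n x \<le> r * real n" using k \<open>x \<in> space M\<close> by (auto simp: Bad_def not_less)
        then have "S F n x \<le> S (trunc (real k)) n x + r * real n" by (simp add: S_def sum_subtractf)
        then have "S F n x / real n \<le> S (trunc (real k)) n x / real n + r" using elim by (simp add: field_simps)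
        with elim show ?case by linarith
      qed
    qed
  qed
  have "AE x in M. \<forall>m. \<forall>\<^sub>F n in sequentially. S F n x / real n < e + 2 * (1 / real (Suc m))"
    by (subst AE_all_countable, intro allI, rule upper) simp
  with trunc_all show ?thesis
  proof eventually_elim
    case (elim x)
    show ?case unfolding e_def[symmetric]
    proof (rule order_tendstoI)
      fix a assume "a < e"
      from order_tendstoD(1)[OF lim this] obtain k where k: "a < (\<integral>x. trunc (real k) x \<partial>M)"
        unfolding eventually_sequentially by blast
      show "\<forall>\<^sub>F n in sequentially. a < S F n x / real n"
        using order_tendstoD(1)[OF elim(1)[rule_format, of k] k]
      proof eventually_elim
        case (elim n)
        have "S (trunc (real k)) n x / real n \<le> S F n x / real n"
          by (intro divide_right_mono S_mono) (auto simp: trunc_def)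
        with elim show ?case by simp
      qed
    next
      fix a assume "e < a"
      then obtain m where m: "1 / real (Suc m) < (a - e) / 2" using nat_approx_posE[of "(a - e) / 2"] by auto
      show "\<forall>\<^sub>F n in sequentially. S F n x / real n < a"
        using elim(2)[rule_format, of m]
      proof eventually_elim
        case (elim n)
        also have "e + 2 * (1 / real (Suc m)) < e + 2 * ((a - e) / 2)"
          using m by (intro add_strict_left_mono mult_strict_left_mono) simp_all
        also have "\<dots> = a" by (simp add: field_simps)
        finally show ?case .
      qed
    qed
  qed
qed

end

section \<open>Regeneration levels\<close>

context leveled_walk
begin

definition regen :: "nat \<Rightarrow> 'd path \<Rightarrow> bool" where
  "regen t X \<longleftrightarrow> rec_time t X \<and> after t X \<in> escape"

lemma sets_rec_time [measurable]: "{X. rec_time t X} \<in> sets path_space"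
  by (rule sets_det_by[OF det_record])

lemma sets_regen [measurable]: "{X. regen t X} \<in> sets path_space"
  using sets.Int[OF sets_rec_time[of t] sets_after[OF sets_escape, of t]]
  by (simp add: regen_def[abs_def] Collect_conj_eq vimage_def)

definition fresh_at :: "nat \<Rightarrow> 'd path set" where
  "fresh_at k = {X. \<exists>t. hits (lv X) (int k) t \<and> after t X \<in> escape}"

definition hit_at :: "nat \<Rightarrow> 'd path set" where
  "hit_at k = {X. \<exists>t. hits (lv X) (int k) t}"

lemma det_hits: "det_by t (\<lambda>X. hits (lv X) m t)"
  by (auto simp: det_by_def hits_def)

lemma hits_rec_time: "hits (lv X) m t \<Longrightarrow> rec_time t X"
  by (auto simp: hits_def rec_time_def)

lemma sets_hit_at [measurable]: "hit_at k \<in> sets path_space"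
proof -
  have "hit_at k = (\<Union>t. {X. hits (lv X) (int k) t})" by (auto simp: hit_at_def)
  also have "\<dots> \<in> sets path_space" using sets_det_by[OF det_hits] by auto
  finally show ?thesis .
qed

lemma sets_fresh_at [measurable]: "fresh_at k \<in> sets path_space"
proof -
  have "fresh_at k = (\<Union>t. {X. hits (lv X) (int k) t} \<inter> after t -` escape)" by (auto simp: fresh_at_def)
  also have "\<dots> \<in> sets path_space" using sets_det_by[OF det_hits] sets_after[OF sets_escape] by auto
  finally show ?thesis .
qed

text \<open>The first visit of level \<open>k\<close> is a record and happens at no more than one
  time; summing \<open>record_split\<close> over the possible times removes the fixed time.\<close>

lemma fresh_split:
  assumes P: "\<And>t. det_by t (P t)" "\<And>t X. P t X \<Longrightarrow> hits (lv X) (int k) t" and C: "upper C"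
  shows "Q.prob {X. \<exists>t. P t X \<and> after t X \<in> C} = Q.prob {X. \<exists>t. P t X} * Q.prob C"
proof -
  have mP: "{X. P t X} \<in> sets path_space" for t by (rule sets_det_by[OF P(1)])
  have dis: "disjoint_family (\<lambda>t. {X. P t X})"
    using hits_unique[OF P(2) P(2)] by (auto simp: disjoint_family_on_def)
  then have dis': "disjoint_family (\<lambda>t. {X. P t X} \<inter> after t -` C)"
    by (auto simp: disjoint_family_on_def)
  have "(\<lambda>t. Q.prob ({X. P t X} \<inter> after t -` C)) sums Q.prob (\<Union>t. {X. P t X} \<inter> after t -` C)"
    using dis' mP sets_after[OF sets_upper[OF C]] by (intro Q.finite_measure_UNION) auto
  moreover have "Q.prob ({X. P t X} \<inter> after t -` C) = Q.prob {X. P t X} * Q.prob C" for t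
    using record_split[OF P(1) _ C, of t] hits_rec_time[OF P(2)]
    by (simp add: Q.emeasure_eq_measure ennreal_mult[symmetric])
  moreover have "(\<lambda>t. Q.prob {X. P t X} * Q.prob C) sums (Q.prob (\<Union>t. {X. P t X}) * Q.prob C)"
    using dis mP by (intro sums_mult2 Q.finite_measure_UNION) auto
  ultimately have "Q.prob (\<Union>t. {X. P t X} \<inter> after t -` C) = Q.prob (\<Union>t. {X. P t X}) * Q.prob C"
    using sums_unique2 by force
  moreover have "(\<Union>t. {X. P t X} \<inter> after t -` C) = {X. \<exists>t. P t X \<and> after t X \<in> C}" "(\<Union>t. {X. P t X}) = {X. \<exists>t. P t X}"
    by auto
  ultimately show ?thesis by simp
qed

lemma nn_path_hits_ge: "nn_path X \<Longrightarrow> hits (lv X) (int k) t \<Longrightarrow> k \<le> t"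
  using nn_path_lv_le[of X t] by (simp add: hits_def)

text \<open>Escaping above a high level is asymptotically independent of any fixed event: for a cylinder
  the two are exactly independent as soon as the level exceeds its length.\<close>

lemma fresh_mixing:
  assumes "H \<in> sets path_space"
  shows "(\<lambda>k. Q.prob (H \<inter> fresh_at k) - Q.prob escape * Q.prob (H \<inter> hit_at k)) \<longlonglongrightarrow> 0"
proof -
  let ?G = "insert {} (range (\<lambda>(n, x :: 'd path). cyl x n))"
  have sg: "sets path_space = sigma_sets UNIV ?G"
    unfolding path_space_eq_sigma cyl_def ..
  let ?d = "\<lambda>H k. Q.prob (H \<inter> fresh_at k) - Q.prob escape * Q.prob (H \<inter> hit_at k)"
  have sub: "\<bar>?d H k\<bar> \<le> Q.prob H" if [measurable]: "H \<in> sets path_space" for H k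
  proof -
    have "Q.prob (H \<inter> fresh_at k) \<le> Q.prob H" "Q.prob (H \<inter> hit_at k) \<le> Q.prob H"
      by (intro Q.finite_measure_mono; simp)+
    moreover have "Q.prob escape * Q.prob (H \<inter> hit_at k) \<le> 1 * Q.prob (H \<inter> hit_at k)"
      by (intro mult_right_mono) auto
    moreover have "0 \<le> Q.prob escape * Q.prob (H \<inter> hit_at k)" by simp
    ultimately show ?thesis using measure_nonneg[of Q "H \<inter> fresh_at k"] by linarith
  qed
  have UN: "?d UNIV k = 0" for k
    using fresh_split[of "\<lambda>t X. hits (lv X) (int k) t", OF det_hits _ upper_escape] by (simp add: fresh_at_def hit_at_def mult.commute)
  have "H \<in> sigma_sets UNIV ?G" using assms sg by simp
  have "?G \<subseteq> Pow UNIV" by simp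
  from Int_stable_cyl this \<open>H \<in> sigma_sets UNIV ?G\<close> show ?thesis
  proof (induct rule: sigma_sets_induct_disjoint)
    case (basic A)
    then consider "A = {}" | n x where "A = cyl x n" by auto
    then show ?case
    proof cases
      case 1 then show ?thesis by simp
    next
      case 2
      \<comment> \<open>A nearest-neighbour path needs at least \<open>k\<close> steps to reach
        level \<open>k\<close>, so membership in a cylinder of length \<open>n < k\<close> is known
        at the first visit.\<close>
      have "?d A k = 0" if k: "n < k" for k
      proof -
        let ?P = "\<lambda>t X. hits (lv X) (int k) t \<and> n \<le> t \<and> X \<in> A"
        have dP: "det_by t (?P t)" for t
          unfolding det_by_def 2 cyl_def hits_def by auto
        have mP: "{X. \<exists>t. ?P t X} \<in> sets path_space"
          using sets.countable_UN[of "\<lambda>t. {X. ?P t X}" UNIV path_space] sets_det_by[OF dP] by (auto simp: Collect_ex_eq)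
        have mP2: "{X. \<exists>t. ?P t X \<and> after t X \<in> escape} \<in> sets path_space"
        proof -
          have "{X. \<exists>t. ?P t X \<and> after t X \<in> escape} = (\<Union>t. {X. ?P t X} \<inter> after t -` escape)" by auto
          also have "\<dots> \<in> sets path_space" using sets_det_by[OF dP] sets_after[OF sets_escape] by auto
          finally show ?thesis .
        qed
        have [measurable]: "A \<in> sets path_space" by (simp add: 2)
        have "Q.prob (A \<inter> fresh_at k) = Q.prob {X. \<exists>t. ?P t X \<and> after t X \<in> escape}"
        proof (rule Q.finite_measure_eq_AE)
          show "AE X in Q. (X \<in> A \<inter> fresh_at k) = (X \<in> {X. \<exists>t. ?P t X \<and> after t X \<in> escape})"
            using AE_nn_path by eventually_elim (use k nn_path_hits_ge in \<open>fastforce simp: fresh_at_def\<close>)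
        qed (use mP2 in auto)
        moreover have "Q.prob (A \<inter> hit_at k) = Q.prob {X. \<exists>t. ?P t X}"
        proof (rule Q.finite_measure_eq_AE)
          show "AE X in Q. (X \<in> A \<inter> hit_at k) = (X \<in> {X. \<exists>t. ?P t X})"
            using AE_nn_path by eventually_elim (use k nn_path_hits_ge in \<open>fastforce simp: hit_at_def\<close>)
        qed (use mP in auto)
        ultimately show ?thesis using fresh_split[OF dP _ upper_escape, of k] by (simp add: mult.commute)
      qed
      then show ?thesis
        by (intro tendsto_eventually) (auto simp: eventually_sequentially intro!: exI[of _ "Suc n"])
    qed
  next
    case empty then show ?case by simp
  next
    case (compl A)
    then have [measurable]: "A \<in> sets path_space" using sg by simp
    have "?d (UNIV - A) k = - ?d A k" for k
    proof -
      have *: "Q.prob ((UNIV - A) \<inter> B) = Q.prob B - Q.prob (A \<inter> B)" if [measurable]: "B \<in> sets path_space" for B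
      proof -
        have "(UNIV - A) \<inter> B = B - (A \<inter> B)" by auto
        then show ?thesis using Q.finite_measure_Diff[of B "A \<inter> B"] by simp
      qed
      show ?thesis unfolding *[OF sets_fresh_at] *[OF sets_hit_at] using UN[of k] by (simp add: right_diff_distrib)
    qed
    then show ?case using tendsto_minus[OF compl(2)] by simp
  next
    case (union A)
    then have mA: "A i \<in> sets path_space" for i using sg by auto
    have split: "(\<lambda>i. Q.prob (A i \<inter> B)) sums Q.prob ((\<Union>i. A i) \<inter> B)" if [measurable]: "B \<in> sets path_space" for B
    proof -
      have "(\<lambda>i. Q.prob (A i \<inter> B)) sums Q.prob (\<Union>i. A i \<inter> B)"
        using mA union(1) by (intro Q.finite_measure_UNION) (auto simp: disjoint_family_on_def)
      then show ?thesis by (simp add: Int_UN_distrib2)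
    qed
    have s: "?d (\<Union>i. A i) k = (\<Sum>i. ?d (A i) k)" for k
      by (intro sums_unique sums_diff sums_mult split) auto
    have sm: "summable (\<lambda>i. Q.prob (A i))"
      using split[of UNIV] by (auto simp: sums_iff)
    \<comment> \<open>Termwise limit, dominated by the summable probabilities of the disjoint
      pieces.\<close>
    have "(\<lambda>k. \<Sum>i. ?d (A i) k) \<longlonglongrightarrow> (\<Sum>i. 0)"
    proof (rule tannerys_theorem[where F = sequentially and M = "\<lambda>i. Q.prob (A i)", THEN conjunct2, THEN conjunct2])
      show "\<forall>\<^sub>F (i, k) in at_top \<times>\<^sub>F sequentially. norm (?d (A i) k) \<le> Q.prob (A i)"
        using sub[OF mA] by (intro always_eventually) auto
    qed (use union(3) sm in auto)
    then show ?case unfolding s by simp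
  qed
qed

text \<open>Let \<open>H\<close> be the paths that are unbounded above but do not regenerate after
  time \<open>N\<close>. They visit every level, yet for \<open>k > N\<close> they never escape at
  the first visit of \<open>k\<close>, which would be a regeneration at a time at least
  \<open>k\<close>. Mixing then forces \<open>Q.prob escape * Q.prob H = 0\<close>.\<close>

lemma escape_regen:
  assumes pos: "0 < Q.prob escape"
  shows "AE X in Q. (\<forall>m. \<exists>n. int m \<le> lv X n) \<longrightarrow> (\<exists>\<^sub>\<infinity>t. regen t X)"
proof -
  have "AE X in Q. (\<forall>m. \<exists>n. int m \<le> lv X n) \<longrightarrow> (\<exists>t>N. regen t X)" for N
  proof -
    define H where "H = {X. nn_path X \<and> (\<forall>m. \<exists>n. int m \<le> l (X n)) \<and> (\<forall>t>N. \<not> regen t X)}"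
    have [measurable]: "Measurable.pred path_space (regen t)" for t
      using sets_regen[of t] by (simp add: pred_def)
    have "{X \<in> space path_space. nn_path X \<and> (\<forall>m. \<exists>n. int m \<le> l (X n)) \<and> (\<forall>t>N. \<not> regen t X)} \<in> sets path_space"
      by measurable
    then have H[measurable]: "H \<in> sets path_space" by (simp add: H_def)
    have a: "H \<inter> hit_at k = H" for k
    proof -
      have "X \<in> hit_at k" if "X \<in> H" for X
      proof -
        from that have X: "nn_path X" and "\<exists>n. int k \<le> lv X n" by (auto simp: H_def)
        then obtain n where "int k \<le> lv X n" by auto
        then have "\<exists>t\<le>n. hits (lv X) (int k) t" by (intro hits_exists nn_path_lv X) auto
        then show ?thesis by (auto simp: hit_at_def)
      qed
      then show ?thesis by auto
    qed
    have b: "H \<inter> fresh_at k = {}" if "N < k" for k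
    proof -
      have "X \<notin> fresh_at k" if "X \<in> H" for X
        using that \<open>N < k\<close> nn_path_hits_ge[of X k] hits_rec_time
        by (fastforce simp: H_def fresh_at_def regen_def)
      then show ?thesis by auto
    qed
    have "\<forall>\<^sub>F k in sequentially. Q.prob (H \<inter> fresh_at k) - Q.prob escape * Q.prob (H \<inter> hit_at k) = - (Q.prob escape * Q.prob H)"
      using eventually_gt_at_top[of N] by eventually_elim (simp add: a b)
    then have "(\<lambda>k. Q.prob (H \<inter> fresh_at k) - Q.prob escape * Q.prob (H \<inter> hit_at k)) \<longlonglongrightarrow> - (Q.prob escape * Q.prob H)"
      by (rule tendsto_eventually)
    from LIMSEQ_unique[OF this fresh_mixing[OF H]] pos have "Q.prob H = 0" by simp
    then have "AE X in Q. X \<notin> H"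
      by (intro AE_not_in) (auto simp: Q.emeasure_eq_measure null_sets_def)
    with AE_nn_path show ?thesis by eventually_elim (auto simp: H_def)
  qed
  then have "AE X in Q. \<forall>N. (\<forall>m. \<exists>n. int m \<le> lv X n) \<longrightarrow> (\<exists>t>N. regen t X)"
    by (subst AE_all_countable) blast
  then show ?thesis by eventually_elim (auto simp: INFM_nat)
qed

end

text \<open>Between two renewals the path stays between its values there, so \<open>y n / n\<close>
  is squeezed by ratios at neighbouring renewal times. Taking the limit of
  \<open>k / \<tau> k\<close> rather than of its inverse admits \<open>\<rho> = 0\<close>, the case
  of gaps with infinite mean.\<close>

lemma limit_between_renewals:
  fixes y :: "nat \<Rightarrow> int" and \<tau> :: "nat \<Rightarrow> nat" and h \<rho> :: real
  assumes \<tau>: "\<tau> 0 = 0" "strict_mono \<tau>"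
    and between: "\<And>k n. \<tau> k \<le> n \<Longrightarrow> n \<le> \<tau> (Suc k) \<Longrightarrow> y (\<tau> k) \<le> y n \<and> y n \<le> y (\<tau> (Suc k))"
    and nonneg: "\<And>n. 0 \<le> y n"
    and h: "(\<lambda>k. real_of_int (y (\<tau> k)) / real k) \<longlonglongrightarrow> h"
    and \<rho>: "(\<lambda>k. real k / real (\<tau> k)) \<longlonglongrightarrow> \<rho>"
  shows "(\<lambda>n. real_of_int (y n) / real n) \<longlonglongrightarrow> h * \<rho>"
proof -
  have ge: "k \<le> \<tau> k" for k using \<tau>(2) by (rule strict_mono_imp_increasing)
  define \<kappa> where "\<kappa> n = (GREATEST k. \<tau> k \<le> n)" for n
  have \<kappa>: "\<tau> (\<kappa> n) \<le> n" "n < \<tau> (Suc (\<kappa> n))" for n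
  proof -
    have b: "\<And>k. \<tau> k \<le> n \<Longrightarrow> k \<le> n" using ge le_trans by blast
    show "\<tau> (\<kappa> n) \<le> n" unfolding \<kappa>_def
      by (rule GreatestI_nat[of "\<lambda>k. \<tau> k \<le> n" 0 n]) (use b \<tau>(1) in auto)
    show "n < \<tau> (Suc (\<kappa> n))"
    proof (rule ccontr)
      assume "\<not> n < \<tau> (Suc (\<kappa> n))"
      then have "Suc (\<kappa> n) \<le> \<kappa> n" unfolding \<kappa>_def by (intro Greatest_le_nat[of _ _ n]) (use b in auto)
      then show False by simp
    qed
  qed
  have \<kappa>_top: "filterlim \<kappa> at_top sequentially"
    unfolding filterlim_at_top eventually_sequentially
  proof
    fix Z
    have "Z \<le> \<kappa> n" if "\<tau> Z \<le> n" for n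
    proof (rule ccontr)
      assume "\<not> Z \<le> \<kappa> n"
      then have "\<tau> (Suc (\<kappa> n)) \<le> \<tau> Z" using \<tau>(2) by (simp add: strict_mono_less_eq)
      with \<kappa>(2)[of n] that show False by simp
    qed
    then show "\<exists>N. \<forall>n\<ge>N. Z \<le> \<kappa> n" by blast
  qed
  let ?L = "\<lambda>k. real_of_int (y (\<tau> k)) / real k * (real k / real (Suc k)) * (real (Suc k) / real (\<tau> (Suc k)))"
  let ?U = "\<lambda>k. real_of_int (y (\<tau> (Suc k))) / real (Suc k) * (real (Suc k) / real k) * (real k / real (\<tau> k))"
  have r1: "(\<lambda>k. real k / real (Suc k)) \<longlonglongrightarrow> 1" by (rule LIMSEQ_n_over_Suc_n)
  have r2: "(\<lambda>k. real (Suc k) / real k) \<longlonglongrightarrow> 1" by (rule LIMSEQ_Suc_n_over_n)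
  have L: "?L \<longlonglongrightarrow> h * 1 * \<rho>"
    by (intro tendsto_mult h r1 LIMSEQ_Suc[OF \<rho>])
  have U: "?U \<longlonglongrightarrow> h * 1 * \<rho>"
    by (intro tendsto_mult LIMSEQ_Suc[OF h] r2 \<rho>)
  have lim: "(\<lambda>n. ?L (\<kappa> n)) \<longlonglongrightarrow> h * \<rho>" "(\<lambda>n. ?U (\<kappa> n)) \<longlonglongrightarrow> h * \<rho>"
    using filterlim_compose[OF L \<kappa>_top] filterlim_compose[OF U \<kappa>_top] by (simp_all only: mult_1_right)
  have ev: "\<forall>\<^sub>F n in sequentially. 1 \<le> \<kappa> n"
    using \<kappa>_top unfolding filterlim_at_top by blast
  show ?thesis
  proof (rule tendsto_sandwich[OF _ _ lim])
    show "\<forall>\<^sub>F n in sequentially. ?L (\<kappa> n) \<le> real_of_int (y n) / real n"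
      using ev
    proof eventually_elim
      case (elim n)
      have k: "real (\<kappa> n) > 0" using elim by simp
      have n0: "0 < n" using \<kappa>(1)[of n] ge[of "\<kappa> n"] elim by linarith
      have "?L (\<kappa> n) = real_of_int (y (\<tau> (\<kappa> n))) / real (\<tau> (Suc (\<kappa> n)))" using k by simp
      also have "\<dots> \<le> real_of_int (y (\<tau> (\<kappa> n))) / real n"
        using \<kappa>(2)[of n] n0 nonneg by (intro divide_left_mono mult_pos_pos) auto
      also have "\<dots> \<le> real_of_int (y n) / real n"
        using between[of "\<kappa> n" n] \<kappa>[of n] by (intro divide_right_mono) auto
      finally show ?case .
    qed
    show "\<forall>\<^sub>F n in sequentially. real_of_int (y n) / real n \<le> ?U (\<kappa> n)"
      using ev
    proof eventually_elim
      case (elim n)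
      have k: "real (\<kappa> n) > 0" using elim by simp
      have t0: "0 < \<tau> (\<kappa> n)" using ge[of "\<kappa> n"] elim by linarith
      have "real_of_int (y n) / real n \<le> real_of_int (y (\<tau> (Suc (\<kappa> n)))) / real n"
        using between[of "\<kappa> n" n] \<kappa>[of n] by (intro divide_right_mono) auto
      also have "\<dots> \<le> real_of_int (y (\<tau> (Suc (\<kappa> n)))) / real (\<tau> (\<kappa> n))"
        using \<kappa>(1)[of n] t0 nonneg by (intro divide_left_mono mult_pos_pos) auto
      also have "\<dots> = ?U (\<kappa> n)" using k by simp
      finally show ?case .
    qed
  qed
qed

section \<open>Independent increments between regenerations\<close>

lemma after_after: "after a (after b X) = after (b + a) X" for X :: "nat \<Rightarrow> 'a::ab_group_add"
  by (simp add: after_def fun_eq_iff add.assoc)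

context leveled_walk
begin

text \<open>Meaningful on \<open>good\<close> only, where a later regeneration exists; otherwise
  \<open>LEAST\<close> returns an unspecified number.\<close>

definition nxt :: "'d path \<Rightarrow> nat" where "nxt X = (LEAST t. 0 < t \<and> regen t X)"

definition shift_next :: "'d path \<Rightarrow> 'd path" where "shift_next X = after (nxt X) X"

definition height :: "'d path \<Rightarrow> nat" where "height X = nat (lv X (nxt X))"

definition good :: "'d path set" where "good = {X \<in> escape. \<exists>t>0. regen t X}"

lemma pred_regen [measurable]: "Measurable.pred path_space (regen t)"
  using sets_regen[of t] by (simp add: pred_def)

lemma measurable_nxt [measurable]: "nxt \<in> path_space \<rightarrow>\<^sub>M count_space UNIV"
  unfolding nxt_def[abs_def] by measurable

lemma measurable_shift_next [measurable]: "shift_next \<in> path_space \<rightarrow>\<^sub>M path_space"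
  unfolding shift_next_def[abs_def]
  by (rule measurable_compose_countable[OF _ measurable_nxt]) simp

lemma measurable_height [measurable]: "height \<in> path_space \<rightarrow>\<^sub>M count_space UNIV"
  unfolding height_def[abs_def]
  by (rule measurable_compose_countable[OF _ measurable_nxt], rule measurable_compose[OF measurable_l]) simp

lemma sets_good [measurable]: "good \<in> sets path_space"
proof -
  have "{X \<in> space path_space. X \<in> escape \<and> (\<exists>t>0. regen t X)} \<in> sets path_space" by measurable
  then show ?thesis by (simp add: good_def)
qed

lemma good_nxt:
  assumes "X \<in> good"
  shows "0 < nxt X" "regen (nxt X) X"
  using LeastI_ex[of "\<lambda>t. 0 < t \<and> regen t X"] assms by (auto simp: good_def nxt_def)

lemma nxt_le: "0 < t \<Longrightarrow> regen t X \<Longrightarrow> nxt X \<le> t"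
  unfolding nxt_def by (rule Least_le) simp

lemma escapeD:
  assumes "X \<in> escape"
  shows "0 \<le> lv X n" "\<exists>n. int m \<le> lv X n"
  using assms by (auto simp: escape_def nonneg_def)

lemma after_escape_le: "after t X \<in> escape \<Longrightarrow> t \<le> n \<Longrightarrow> lv X t \<le> lv X n"
  using escapeD(1)[of "after t X" "n - t"] by (simp add: after_def l_diff)

text \<open>The part of the event \<open>nxt X = t\<close> that is visible at time \<open>t\<close>.
  An earlier record \<open>s\<close> fails to be a regeneration only if the path drops below it; if
  the path escapes from \<open>t\<close>, the drop must have occurred by then, since later levels
  are at least \<open>lv X t\<close>, which exceeds \<open>lv X s\<close>.\<close>

definition first_regen :: "nat \<Rightarrow> 'd path \<Rightarrow> bool" where
  "first_regen t X \<longleftrightarrow> 0 < t \<and> rec_time t X \<and> (\<forall>s\<le>t. 0 \<le> lv X s) \<and>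
     (\<forall>s. 0 < s \<and> s < t \<and> rec_time s X \<longrightarrow> (\<exists>r\<le>t. s \<le> r \<and> lv X r < lv X s))"

lemma det_first_regen: "det_by t (first_regen t)"
  unfolding det_by_def
proof (intro allI impI)
  fix X Y :: "'d path" assume e: "\<forall>k\<le>t. X k = Y k"
  have rt: "rec_time s X = rec_time s Y" if "s \<le> t" for s using e that by (auto simp: rec_time_def)
  have l: "lv X s = lv Y s" if "s \<le> t" for s using e that by simp
  have "(\<forall>s. 0 < s \<and> s < t \<and> rec_time s X \<longrightarrow> (\<exists>r\<le>t. s \<le> r \<and> lv X r < lv X s)) \<longleftrightarrow>
     (\<forall>s. 0 < s \<and> s < t \<and> rec_time s Y \<longrightarrow> (\<exists>r\<le>t. s \<le> r \<and> lv Y r < lv Y s))"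
    using rt e by (intro all_cong1 imp_cong) auto
  then show "first_regen t X = first_regen t Y"
    unfolding first_regen_def using rt[of t] l by auto
qed

lemma first_regen_iff:
  "first_regen t X \<and> after t X \<in> escape \<longleftrightarrow> X \<in> good \<and> nxt X = t"
proof
  assume a: "first_regen t X \<and> after t X \<in> escape"
  then have t: "0 < t" "regen t X" by (auto simp: first_regen_def regen_def)
  have "0 \<le> lv X n" for n
    using a after_escape_le[of t X n] by (cases "n \<le> t") (auto simp: first_regen_def intro: order_trans)
  moreover have "\<exists>n. int m \<le> lv X n" for m
  proof -
    obtain n where "int m \<le> lv (after t X) n" using a escapeD(2) by blast
    moreover have "0 \<le> lv X t" by fact
    ultimately have "int m \<le> lv X (t + n)" by (simp add: after_def l_diff)
    then show ?thesis by blast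
  qed
  ultimately have X: "X \<in> escape" by (simp add: escape_def nonneg_def)
  then have g: "X \<in> good" using t by (auto simp: good_def)
  have "\<not> nxt X < t"
  proof
    assume "nxt X < t"
    with a good_nxt[OF g] obtain r where "nxt X \<le> r" "lv X r < lv X (nxt X)"
      unfolding first_regen_def regen_def by blast
    with after_escape_le[of "nxt X" X r] good_nxt[OF g] show False by (simp add: regen_def)
  qed
  with nxt_le[OF t] g show "X \<in> good \<and> nxt X = t" by simp
next
  assume a: "X \<in> good \<and> nxt X = t"
  then have t: "0 < t" "regen t X" using good_nxt[of X] by auto
  have X: "X \<in> escape" using a by (simp add: good_def)
  have "\<exists>r\<le>t. s \<le> r \<and> lv X r < lv X s" if s: "0 < s" "s < t" "rec_time s X" for s
  proof (rule ccontr)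
    assume no: "\<not> (\<exists>r\<le>t. s \<le> r \<and> lv X r < lv X s)"
    have ge: "lv X s \<le> lv X r" if "s \<le> r" for r
    proof (cases "r \<le> t")
      case False
      then have "lv X t \<le> lv X r" using t by (intro after_escape_le) (auto simp: regen_def)
      moreover have "lv X s \<le> lv X t" using no s(2) by (meson less_imp_le order_refl not_le)
      ultimately show ?thesis by simp
    qed (use no that in \<open>auto simp: not_less\<close>)
    have "\<exists>n. int m \<le> lv (after s X) n" for m
    proof -
      obtain n where n: "int (m + nat (lv X s)) \<le> lv X n" using escapeD(2)[OF X] by blast
      have "s \<le> n"
      proof (rule ccontr)
        assume "\<not> s \<le> n"
        then have "lv X n < lv X s" using s by (simp add: rec_time_def)
        with n escapeD(1)[OF X, of s] show False by simp
      qed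
      with n escapeD(1)[OF X, of s] show ?thesis by (intro exI[of _ "n - s"]) (auto simp: after_def l_diff)
    qed
    with ge have "after s X \<in> escape" by (auto simp: escape_def nonneg_def after_def l_diff)
    then have "regen s X" using s by (simp add: regen_def)
    from nxt_le[OF s(1) this] a s show False by simp
  qed
  with t escapeD(1)[OF X] show "first_regen t X \<and> after t X \<in> escape"
    by (auto simp: first_regen_def regen_def)
qed

lemma height_le:
  assumes X: "0 < t" "regen t X" and e: "X \<in> escape"
  shows "int (height X) \<le> lv X t"
proof -
  have g: "X \<in> good" using X e by (auto simp: good_def)
  have "nxt X \<le> t" by (rule nxt_le[OF X])
  then have "lv X (nxt X) \<le> lv X t" using X by (cases "nxt X = t") (auto simp: regen_def rec_time_def less_imp_le)
  then show ?thesis using escapeD(1)[OF e] by (simp add: height_def)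
qed

text \<open>\<open>first_regen\<close> is decided at a record, and the future from there only has to
  lie in \<open>B \<inter> escape\<close>, so \<open>record_split\<close> factors every term.
  Comparison with the case \<open>B = UNIV\<close> turns that factor into a probability conditioned
  on \<open>escape\<close>.\<close>

lemma renewal_split:
  assumes pos: "0 < Q.prob escape" and B[measurable]: "B \<in> sets path_space"
  shows "Q.prob {X \<in> good. (nxt X, height X) \<in> A \<and> shift_next X \<in> B} =
    Q.prob {X \<in> good. (nxt X, height X) \<in> A} * (Q.prob (B \<inter> escape) / Q.prob escape)"
proof -
  let ?P = "\<lambda>t X. first_regen t X \<and> (t, nat (lv X t)) \<in> A"
  have dP: "det_by t (?P t)" for t
    using det_first_regen[of t] unfolding det_by_def by (metis order_refl)
  have s: "(\<lambda>t. Q.prob {X. ?P t X} * Q.prob (C \<inter> escape)) sums Q.prob {X \<in> good. (nxt X, height X) \<in> A \<and> shift_next X \<in> C}"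
    if C[measurable]: "C \<in> sets path_space" for C
  proof -
    have u: "upper (C \<inter> escape)" by (rule upper_nonneg) (auto simp: escape_def)
    have eq: "{X. ?P t X} \<inter> after t -` (C \<inter> escape) = {X \<in> good. nxt X = t \<and> (nxt X, height X) \<in> A \<and> shift_next X \<in> C}" for t
    proof (intro set_eqI)
      fix X
      show "X \<in> {X. ?P t X} \<inter> after t -` (C \<inter> escape) \<longleftrightarrow>
          X \<in> {X \<in> good. nxt X = t \<and> (nxt X, height X) \<in> A \<and> shift_next X \<in> C}"
        using first_regen_iff[of t X] by (cases "nxt X = t") (auto simp: height_def shift_next_def)
    qed
    have "(\<lambda>t. Q.prob ({X. ?P t X} \<inter> after t -` (C \<inter> escape))) sums Q.prob (\<Union>t. {X. ?P t X} \<inter> after t -` (C \<inter> escape))"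
    proof (rule Q.finite_measure_UNION)
      show "disjoint_family (\<lambda>t. {X. ?P t X} \<inter> after t -` (C \<inter> escape))"
        unfolding eq by (auto simp: disjoint_family_on_def)
    qed (use sets_det_by[OF dP] sets_after[of "C \<inter> escape"] in auto)
    also have "(\<Union>t. {X. ?P t X} \<inter> after t -` (C \<inter> escape)) = {X \<in> good. (nxt X, height X) \<in> A \<and> shift_next X \<in> C}"
      unfolding eq by auto
    finally show ?thesis
      using record_split[OF dP _ u] by (simp add: first_regen_def Q.emeasure_eq_measure ennreal_mult[symmetric])
  qed
  have "(\<lambda>t. Q.prob {X. ?P t X} * Q.prob escape) sums Q.prob {X \<in> good. (nxt X, height X) \<in> A}"
    using s[of UNIV] by simp
  then have "(\<lambda>t. (Q.prob {X. ?P t X} * Q.prob escape) * (Q.prob (B \<inter> escape) / Q.prob escape)) sums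
    (Q.prob {X \<in> good. (nxt X, height X) \<in> A} * (Q.prob (B \<inter> escape) / Q.prob escape))"
    by (rule sums_mult2)
  with s[OF B] pos show ?thesis by (simp add: sums_iff)
qed

text \<open>Let \<open>D k\<close> say that the path, nonnegative so far, regenerates at level
  \<open>k\<close> and has its next regeneration level above \<open>m\<close>. No two levels
  \<open>k \<le> m\<close> can both qualify, because the larger one would be a regeneration level
  too low for the smaller, so the probabilities add up to at most 1; each dominates the
  corresponding summand. This is the renewal bound behind the finite mean of
  \<open>height\<close>.\<close>

lemma sum_height_tail:
  "(\<Sum>k\<le>m. Q.prob escape * Q.prob {X \<in> escape. m - k < height X}) \<le> 1"
proof -
  let ?C = "\<lambda>j. {X \<in> escape. j < height X}"
  have mC[measurable]: "?C j \<in> sets path_space" for j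
  proof -
    have "{X \<in> space path_space. X \<in> escape \<and> j < height X} \<in> sets path_space" by measurable
    then show ?thesis by simp
  qed
  have uC: "upper (?C j)" for j by (rule upper_nonneg[OF mC]) (auto simp: escape_def)
  define P where "P k t X \<longleftrightarrow> hits (lv X) (int k) t \<and> (\<forall>s\<le>t. 0 \<le> lv X s)" for k t X
  have dP: "det_by t (P k t)" for k t by (auto simp: P_def det_by_def hits_def)
  define D where "D k = {X. \<exists>t. P k t X \<and> after t X \<in> ?C (m - k)}" for k
  have mD[measurable]: "D k \<in> sets path_space" for k
  proof -
    have "D k = (\<Union>t. {X. P k t X} \<inter> after t -` ?C (m - k))" by (auto simp: D_def)
    also have "\<dots> \<in> sets path_space" using sets_det_by[OF dP] sets_after[OF mC] by auto
    finally show ?thesis .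
  qed
  have "Q.prob escape * Q.prob (?C (m - k)) \<le> Q.prob (D k)" for k
  proof -
    have "Q.prob (D k) = Q.prob {X. \<exists>t. P k t X} * Q.prob (?C (m - k))"
      unfolding D_def by (rule fresh_split[where k = k, OF dP _ uC]) (simp add: P_def)
    moreover have "Q.prob escape \<le> Q.prob {X. \<exists>t. P k t X}"
    proof (rule Q.finite_measure_mono_AE)
      show "AE X in Q. X \<in> escape \<longrightarrow> X \<in> {X. \<exists>t. P k t X}"
        using AE_nn_path
      proof eventually_elim
        case (elim X)
        show ?case
        proof
          assume X: "X \<in> escape"
          obtain n where "int k \<le> lv X n" using escapeD(2)[OF X] by blast
          then have "\<exists>t\<le>n. hits (lv X) (int k) t" by (intro hits_exists nn_path_lv elim) auto
          then show "X \<in> {X. \<exists>t. P k t X}" using escapeD(1)[OF X] by (auto simp: P_def)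
        qed
      qed
      show "{X. \<exists>t. P k t X} \<in> sets Q"
        using sets_esc[of k] by (simp add: esc_def P_def)
    qed
    ultimately show ?thesis by (simp add: mult_right_mono)
  qed
  then have "(\<Sum>k\<le>m. Q.prob escape * Q.prob (?C (m - k))) \<le> (\<Sum>k\<le>m. Q.prob (D k))"
    by (intro sum_mono)
  also have "\<dots> = Q.prob (\<Union>k\<in>{..m}. D k)"
  proof (rule Q.finite_measure_finite_Union[symmetric])
    have no: False if X: "X \<in> D k" "X \<in> D k'" "k < k'" "k' \<le> m" for X k k'
    proof -
      from X obtain t t' where t: "P k t X" "after t X \<in> ?C (m - k)" "P k' t' X" "after t' X \<in> ?C (m - k')"
        by (auto simp: D_def)
      have h: "hits (lv X) (int k) t" "hits (lv X) (int k') t'" using t by (auto simp: P_def)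
      have tt: "t < t'" using hits_mono[OF h] X by simp
      \<comment> \<open>Seen from \<open>t\<close>, the time \<open>t'\<close> is a regeneration at
        height \<open>k' - k\<close>, which contradicts a next height above
        \<open>m - k\<close>.\<close>
      have "regen (t' - t) (after t X)"
        using h tt t(4) by (auto simp: regen_def rec_time_def hits_def after_after after_def l_diff)
      then have "int (height (after t X)) \<le> lv (after t X) (t' - t)"
        using tt t(2) by (intro height_le) auto
      also have "\<dots> = int k' - int k" using h tt by (simp add: after_def l_diff hits_def)
      finally show False using t(2) X by auto
    qed
    show "disjoint_family_on D {..m}"
      unfolding disjoint_family_on_def using no by (metis (no_types, lifting) atMost_iff disjoint_iff nat_neq_iff)
  qed auto
  also have "\<dots> \<le> 1" by simp
  finally show ?thesis .
qed

text \<open>Conditioned on \<open>escape\<close>, moving to the next regeneration preserves the law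
  and is independent of the gap and height just passed. The height has finite mean, but the gap need
  not; if its mean is infinite, the speed is 0. The result is mean height times limiting number of
  renewals per unit time.\<close>

lemma escape_speed:
  assumes pos: "0 < Q.prob escape"
  shows "\<exists>v. AE X in Q. X \<in> escape \<longrightarrow> (\<lambda>n. real_of_int (lv X n) / real n) \<longlonglongrightarrow> v"
proof -
  define P where "P = uniform_measure Q escape"
  have e0: "emeasure Q escape \<noteq> 0" using pos by (simp add: Q.emeasure_eq_measure)
  have eI: "emeasure Q escape < \<infinity>" by (simp add: Q.emeasure_eq_measure)
  interpret P: prob_space P unfolding P_def by (rule prob_space_uniform_measure) (use e0 eI in auto)
  have sP[measurable_cong, simp]: "sets P = sets path_space" by (simp add: P_def)
  have spP[simp]: "space P = UNIV" using sets_eq_imp_space_eq[OF sP] by simp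
  have Pp: "P.prob B = Q.prob (escape \<inter> B) / Q.prob escape" if "B \<in> sets path_space" for B
    unfolding P_def using that e0 eI by (subst measure_uniform_measure) auto
  have AEP: "(AE X in P. R X) \<longleftrightarrow> (AE X in Q. X \<in> escape \<longrightarrow> R X)" for R
    unfolding P_def by (rule AE_uniform_measure[OF e0 eI])
  have good: "AE X in P. X \<in> good"
    unfolding AEP using escape_regen[OF pos]
  proof eventually_elim
    case (elim X)
    show ?case
    proof
      assume X: "X \<in> escape"
      then have "\<exists>\<^sub>\<infinity>t. regen t X" using elim by (auto simp: escape_def)
      then show "X \<in> good" using X by (auto simp: good_def INFM_nat)
    qed
  qed
  have ind: "P.prob {X. (nxt X, height X) \<in> A \<and> shift_next X \<in> B} = P.prob {X. (nxt X, height X) \<in> A} * P.prob B"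
    if B[measurable]: "B \<in> sets path_space" for A B
  proof -
    have mA[measurable]: "{X. (nxt X, height X) \<in> A} \<in> sets path_space"
    proof -
      have "(\<lambda>X. (nxt X, height X)) \<in> path_space \<rightarrow>\<^sub>M count_space UNIV"
        by (rule measurable_compose_countable[OF _ measurable_nxt], rule measurable_compose[OF measurable_height]) simp
      from measurable_sets[OF this, of A] show ?thesis by (simp add: vimage_def)
    qed
    have mB: "{X. shift_next X \<in> B} \<in> sets path_space"
      using measurable_sets[OF measurable_shift_next B] by (simp add: vimage_def)
    have mAB: "{X. (nxt X, height X) \<in> A \<and> shift_next X \<in> B} \<in> sets path_space"
      using sets.Int[OF mA mB] by (simp add: Collect_conj_eq)
    have g: "P.prob C = Q.prob (good \<inter> C) / Q.prob escape" if C[measurable]: "C \<in> sets path_space" for C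
    proof -
      have "P.prob C = P.prob (good \<inter> C)" using good by (intro P.finite_measure_eq_AE) auto
      also have "escape \<inter> (good \<inter> C) = good \<inter> C" by (auto simp: good_def)
      then have "P.prob (good \<inter> C) = Q.prob (good \<inter> C) / Q.prob escape" using Pp[of "good \<inter> C"] by simp
      finally show ?thesis .
    qed
    have "P.prob {X. (nxt X, height X) \<in> A \<and> shift_next X \<in> B} = Q.prob {X \<in> good. (nxt X, height X) \<in> A \<and> shift_next X \<in> B} / Q.prob escape"
      unfolding g[OF mAB] by (simp add: Int_def)
    also have "\<dots> = (Q.prob {X \<in> good. (nxt X, height X) \<in> A} / Q.prob escape) * (Q.prob (B \<inter> escape) / Q.prob escape)"
      by (simp add: renewal_split[OF pos B])
    also have "Q.prob {X \<in> good. (nxt X, height X) \<in> A} / Q.prob escape = P.prob {X. (nxt X, height X) \<in> A}"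
      unfolding g[OF mA] by (simp add: Int_def)
    also have "Q.prob (B \<inter> escape) / Q.prob escape = P.prob B" using Pp[OF B] by (simp add: Int_commute)
    finally show ?thesis .
  qed
  have T[measurable]: "shift_next \<in> P \<rightarrow>\<^sub>M P"
    using measurable_shift_next by (simp add: measurable_cong_sets[OF sP sP])
  have mp: "distr P P shift_next = P"
  proof (rule measure_eqI)
    fix B assume "B \<in> sets (distr P P shift_next)"
    then have B: "B \<in> sets path_space" by simp
    have "emeasure (distr P P shift_next) B = ennreal (P.prob {X. shift_next X \<in> B})"
      using B by (subst emeasure_distr[OF T]) (auto simp: P.emeasure_eq_measure vimage_def)
    also have "P.prob {X. shift_next X \<in> B} = P.prob B"
      using ind[OF B, of UNIV] P.prob_space by simp
    finally show "emeasure (distr P P shift_next) B = emeasure P B" by (simp add: P.emeasure_eq_measure)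
  qed simp
  interpret mpt P shift_next by unfold_locales (use T mp in auto)
  have iid: "iid_mpt P shift_next (\<lambda>X. f (nxt X, height X))" if f: "\<And>z. 0 \<le> f z" for f :: "nat \<times> nat \<Rightarrow> real"
  proof unfold_locales
    have "(\<lambda>X. f (nxt X, height X)) \<in> borel_measurable path_space"
      by (rule measurable_compose_countable[OF _ measurable_nxt], rule measurable_compose_countable[OF _ measurable_height]) simp
    then show "(\<lambda>X. f (nxt X, height X)) \<in> borel_measurable P" by (simp add: measurable_cong_sets[OF sP refl])
    show "P.prob ((\<lambda>X. f (nxt X, height X)) -` A \<inter> space P \<inter> (shift_next -` B \<inter> space P)) =
       P.prob ((\<lambda>X. f (nxt X, height X)) -` A \<inter> space P) * P.prob B" if "B \<in> sets P" for A B
      using ind[of B "f -` A"] that by (simp add: vimage_def Int_def)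
  qed (rule f)
  interpret D: iid_mpt P shift_next "\<lambda>X. real (nxt X)" using iid[of "\<lambda>z. real (fst z)"] by simp
  interpret H: iid_mpt P shift_next "\<lambda>X. real (height X)" using iid[of "\<lambda>z. real (snd z)"] by simp
  have intH: "integrable P (\<lambda>X. real (height X))"
  proof (rule integrableI_bounded)
    have *: "P.prob {X. t < height X} = Q.prob {X \<in> escape. t < height X} / Q.prob escape" for t
    proof -
      have "{X \<in> space path_space. t < height X} \<in> sets path_space" by measurable
      then show ?thesis using Pp[of "{X. t < height X}"] by (simp add: Int_def)
    qed
    \<comment> \<open>The mean height is the sum of its tail probabilities. Reversed, the sum is
      that of \<open>sum_height_tail\<close>; one factor \<open>Q.prob escape\<close> in the
      denominator comes from there, the other from conditioning.\<close>
    have "(\<Sum>t<n. emeasure P {X. t < height X}) \<le> ennreal (1 / (Q.prob escape)\<^sup>2)" for n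
    proof (cases n)
      case (Suc m)
      have "(\<Sum>t\<le>m. P.prob {X. t < height X}) = (\<Sum>k\<le>m. P.prob {X. m - k < height X})"
        by (rule sum.reindex_bij_witness[of _ "\<lambda>k. m - k" "\<lambda>k. m - k"]) auto
      also have "\<dots> = (\<Sum>k\<le>m. Q.prob escape * Q.prob {X \<in> escape. m - k < height X}) / (Q.prob escape)\<^sup>2"
        using pos by (simp add: * sum_divide_distrib power2_eq_square)
      also have "\<dots> \<le> 1 / (Q.prob escape)\<^sup>2"
        by (intro divide_right_mono sum_height_tail) simp
      finally show ?thesis
        using Suc by (simp add: P.emeasure_eq_measure lessThan_Suc_atMost sum_ennreal)
    qed simp
    then have "(\<Sum>t. emeasure P {X. t < height X}) \<le> ennreal (1 / (Q.prob escape)\<^sup>2)"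
      by (intro suminf_le_const) auto
    moreover have "(\<integral>\<^sup>+X. ennreal (norm (real (height X))) \<partial>P) = (\<Sum>t. emeasure P {X. t < height X})"
    proof -
      have "height \<in> P \<rightarrow>\<^sub>M count_space UNIV"
        using measurable_height by (simp add: measurable_cong_sets[OF sP refl])
      from nn_integral_nat_function[OF this] show ?thesis by (simp add: ennreal_of_nat_eq_real_of_nat)
    qed
    ultimately show "(\<integral>\<^sup>+X. ennreal (norm (real (height X))) \<partial>P) < \<infinity>"
      by (metis ennreal_less_top infinity_ennreal_def order_le_less_trans)
  qed (rule H.F)
  obtain \<rho> where \<rho>: "AE X in P. (\<lambda>n. real n / S (\<lambda>X. real (nxt X)) n X) \<longlonglongrightarrow> \<rho>"
  proof (cases "integrable P (\<lambda>X. real (nxt X))")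
    case True
    define d where "d = (\<integral>X. real (nxt X) \<partial>P)"
    have "1 \<le> d"
    proof -
      have "(\<integral>X. 1 \<partial>P) \<le> d" unfolding d_def
        using True good by (intro integral_mono_AE) (auto elim!: eventually_mono dest: good_nxt(1))
      then show ?thesis using P.prob_space by simp
    qed
    from D.slln_integrable[OF True] have "AE X in P. (\<lambda>n. real n / S (\<lambda>X. real (nxt X)) n X) \<longlonglongrightarrow> inverse d"
      unfolding d_def[symmetric]
    proof eventually_elim
      case (elim X)
      from tendsto_inverse[OF elim] \<open>1 \<le> d\<close> show ?case by (simp add: inverse_eq_divide)
    qed
    then show ?thesis by (rule that)
  next
    case False
    from D.slln_infinite[OF False] have "AE X in P. (\<lambda>n. real n / S (\<lambda>X. real (nxt X)) n X) \<longlonglongrightarrow> 0"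
    proof eventually_elim
      case (elim X)
      from tendsto_inverse_0_at_top[OF elim] show ?case by (simp add: inverse_eq_divide)
    qed
    then show ?thesis by (rule that)
  qed
  define h where "h = (\<integral>X. real (height X) \<partial>P)"
  have goodk: "AE X in P. \<forall>k. (shift_next ^^ k) X \<in> good"
  proof (subst AE_all_countable, intro allI)
    fix k
    have "AE X in distr P P (shift_next ^^ k). X \<in> good" using good by (subst distr_iter)
    then show "AE X in P. (shift_next ^^ k) X \<in> good"
      by (rule AE_distrD[OF measurable_iter])
  qed
  have "AE X in P. nn_path X" unfolding AEP using AE_nn_path by eventually_elim simp
  with goodk \<rho> H.slln_integrable[OF intH]
  have "AE X in P. (\<lambda>n. real_of_int (lv X n) / real n) \<longlonglongrightarrow> h * \<rho>"
  proof eventually_elim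
    case (elim X)
    define \<tau> where "\<tau> k = (\<Sum>i<k. nxt ((shift_next ^^ i) X))" for k
    have X0: "X 0 = 0" using elim(4) by (simp add: nn_path_def)
    have sh: "(shift_next ^^ k) X = after (\<tau> k) X" for k
    proof (induction k)
      case 0
      then show ?case using X0 by (simp add: after_def \<tau>_def fun_eq_iff)
    next
      case (Suc k)
      have "(shift_next ^^ Suc k) X = shift_next ((shift_next ^^ k) X)" by simp
      also have "\<dots> = after (nxt ((shift_next ^^ k) X)) (after (\<tau> k) X)"
        unfolding shift_next_def[of "(shift_next ^^ k) X"] by (simp only: Suc)
      also have "\<dots> = after (\<tau> (Suc k)) X" by (simp add: after_after \<tau>_def)
      finally show ?case .
    qed
    have G: "after (\<tau> k) X \<in> good" for k using elim(1) by (simp add: sh[symmetric])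
    have E: "after (\<tau> k) X \<in> escape" for k using G[of k] by (simp add: good_def)
    have \<tau>S: "\<tau> (Suc k) = \<tau> k + nxt (after (\<tau> k) X)" for k
      unfolding sh[symmetric] by (simp add: \<tau>_def)
    have R: "rec_time (nxt (after (\<tau> k) X)) (after (\<tau> k) X)" "0 < nxt (after (\<tau> k) X)" for k
      using good_nxt[OF G[of k]] by (auto simp: regen_def)
    have t0: "\<tau> 0 = 0" by (simp add: \<tau>_def)
    have lvS: "lv X (\<tau> (Suc k)) = lv X (\<tau> k) + int (height (after (\<tau> k) X))" for k
    proof -
      have "0 \<le> lv (after (\<tau> k) X) (nxt (after (\<tau> k) X))" by (rule escapeD(1)[OF E])
      then show ?thesis by (simp add: height_def \<tau>S after_def l_diff)
    qed
    have Y: "real_of_int (lv X (\<tau> k)) = S (\<lambda>X. real (height X)) k X" for k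
    proof (induction k)
      case 0
      then show ?case by (simp add: t0 X0 S_def)
    next
      case (Suc k)
      then show ?case by (simp add: lvS S_def sh)
    qed
    have St: "S (\<lambda>X. real (nxt X)) k X = real (\<tau> k)" for k by (simp add: S_def \<tau>_def)
    show ?case
    proof (rule limit_between_renewals[where \<tau> = \<tau> and y = "lv X", OF t0])
      show "strict_mono \<tau>" using R(2) by (intro strict_monoI_Suc) (simp add: \<tau>S)
      show "lv X (\<tau> k) \<le> lv X n \<and> lv X n \<le> lv X (\<tau> (Suc k))" if n: "\<tau> k \<le> n" "n \<le> \<tau> (Suc k)" for k n
      proof
        show "lv X (\<tau> k) \<le> lv X n" by (rule after_escape_le[OF E n(1)])
        show "lv X n \<le> lv X (\<tau> (Suc k))"
        proof (cases "n = \<tau> (Suc k)")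
          case False
          then have "lv (after (\<tau> k) X) (n - \<tau> k) < lv (after (\<tau> k) X) (nxt (after (\<tau> k) X))"
            using R(1)[of k] n unfolding rec_time_def \<tau>S by simp
          then show ?thesis using n by (simp add: \<tau>S after_def l_diff)
        qed simp
      qed
      show "0 \<le> lv X n" for n using escapeD(1)[OF E[of 0], of n] by (simp add: t0 after_def X0)
      show "(\<lambda>k. real_of_int (lv X (\<tau> k)) / real k) \<longlonglongrightarrow> h" using elim(3) unfolding Y h_def .
      show "(\<lambda>k. real k / real (\<tau> k)) \<longlonglongrightarrow> \<rho>" using elim(2) unfolding St .
    qed
  qed
  then show ?thesis unfolding AEP by blast
qed

text \<open>A path unbounded above has a regeneration, from which on it is an escaping path, and by
  \<open>record_split\<close> the exceptional null set is not met by the future from any record.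
  This transfers the deterministic speed from escaping paths to all unbounded ones; a path bounded
  above satisfies the second alternative.\<close>

lemma one_sided_speed:
  "\<exists>v. AE X in Q. (\<lambda>n. real_of_int (lv X n) / real n) \<longlonglongrightarrow> v \<or> (\<forall>C::nat. finite {n. int n \<le> int C * lv X n})"
proof (cases "Q.prob escape = 0")
  case True
  from no_escape_slow[OF this] show ?thesis by (intro exI) (auto elim: eventually_mono)
next
  case False
  then have pos: "0 < Q.prob escape" by (simp add: zero_less_measure_iff)
  obtain v where "AE X in Q. X \<in> escape \<longrightarrow> (\<lambda>n. real_of_int (lv X n) / real n) \<longlonglongrightarrow> v"
    using escape_speed[OF pos] by blast
  then obtain N where N: "N \<in> null_sets Q" "{X. \<not> (X \<in> escape \<longrightarrow> (\<lambda>n. real_of_int (lv X n) / real n) \<longlonglongrightarrow> v)} \<subseteq> N"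
    by (auto elim: AE_E simp: null_sets_def) 
  have [measurable]: "N \<in> sets path_space" using N by auto
  have "AE X in Q. \<not> (rec_time t X \<and> after t X \<in> N \<inter> escape)" for t
  proof -
    have u: "upper (N \<inter> escape)" by (rule upper_nonneg) (auto simp: escape_def)
    have z: "emeasure Q (N \<inter> escape) = 0"
    proof -
      have "emeasure Q (N \<inter> escape) \<le> emeasure Q N" by (intro emeasure_mono) auto
      with null_setsD1[OF N(1)] show ?thesis by simp
    qed
    have "emeasure Q ({X. rec_time t X} \<inter> after t -` (N \<inter> escape)) = 0"
      using record_split[OF det_record[of t] _ u] by (simp add: z)
    moreover have "{X. rec_time t X} \<inter> after t -` (N \<inter> escape) \<in> sets Q"
      using sets.Int[OF sets_rec_time sets_after[of "N \<inter> escape"]] by simp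
    ultimately have "{X. rec_time t X} \<inter> after t -` (N \<inter> escape) \<in> null_sets Q" by (rule null_setsI)
    from AE_not_in[OF this] show ?thesis by eventually_elim blast
  qed
  then have "AE X in Q. \<forall>t. \<not> (rec_time t X \<and> after t X \<in> N \<inter> escape)" by (subst AE_all_countable) blast
  with escape_regen[OF pos]
  have "AE X in Q. (\<lambda>n. real_of_int (lv X n) / real n) \<longlonglongrightarrow> v \<or> (\<forall>C::nat. finite {n. int n \<le> int C * lv X n})"
  proof eventually_elim
    case (elim X)
    show ?case
    proof (cases "\<forall>m. \<exists>n. int m \<le> lv X n")
      case True
      then obtain t where t: "regen t X" using elim(1) by (auto simp: INFM_nat)
      then have "after t X \<notin> N" "after t X \<in> escape" using elim(2) by (auto simp: regen_def)
      then have lim: "(\<lambda>n. real_of_int (lv (after t X) n) / real n) \<longlonglongrightarrow> v" using N(2) by blast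
      have "(\<lambda>n. real_of_int (lv (after t X) n) / real n * (real n / real (n + t)) + real_of_int (lv X t) / real (n + t)) \<longlonglongrightarrow> v * 1 + 0"
      proof (intro tendsto_intros lim)
        have z: "(\<lambda>n. c / real (n + t)) \<longlonglongrightarrow> 0" for c
          by (rule LIMSEQ_ignore_initial_segment[OF lim_const_over_n])
        show "(\<lambda>n. real_of_int (lv X t) / real (n + t)) \<longlonglongrightarrow> 0" by (rule z)
        have "(\<lambda>n. 1 - real t / real (n + t)) \<longlonglongrightarrow> 1 - 0" by (intro tendsto_intros z)
        moreover have "\<forall>\<^sub>F n in sequentially. 1 - real t / real (n + t) = real n / real (n + t)"
          using eventually_gt_at_top[of 0] by eventually_elim (simp add: field_simps)
        ultimately show "(\<lambda>n. real n / real (n + t)) \<longlonglongrightarrow> 1" by (simp add: tendsto_cong)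
      qed
      moreover have "\<forall>\<^sub>F n in sequentially. real_of_int (lv (after t X) n) / real n * (real n / real (n + t)) + real_of_int (lv X t) / real (n + t)
          = real_of_int (lv X (n + t)) / real (n + t)"
        using eventually_gt_at_top[of 0]
        by eventually_elim (simp add: after_def l_diff add_divide_distrib[symmetric] add.commute)
      ultimately have "(\<lambda>n. real_of_int (lv X (n + t)) / real (n + t)) \<longlonglongrightarrow> v" by (simp add: tendsto_cong)
      then show ?thesis by (intro disjI1) (rule LIMSEQ_offset)
    next
      case False
      then obtain m where m: "\<And>n. lv X n < int m" by (auto simp: not_le)
      have "{n. int n \<le> int C * lv X n} \<subseteq> {..C * m}" for C
      proof clarsimp
        fix n assume a: "int n \<le> int C * lv X n"
        have "int C * lv X n \<le> int C * int m" using m[of n] by (intro mult_left_mono) auto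
        with a have "int n \<le> int (C * m)" by simp
        then show "n \<le> C * m" by (simp only: of_nat_le_iff)
      qed
      then show ?thesis by (meson finite_atMost finite_subset)
    qed
  qed
  then show ?thesis by blast
qed

end

section \<open>Combining the two directions of each coordinate\<close>

lemma converges_of_one_sided:
  fixes y :: "nat \<Rightarrow> int"
  assumes "(\<lambda>n. real_of_int (y n) / real n) \<longlonglongrightarrow> v \<or> (\<forall>C::nat. finite {n. int n \<le> int C * y n})"
    and "(\<lambda>n. real_of_int (- y n) / real n) \<longlonglongrightarrow> w \<or> (\<forall>C::nat. finite {n. int n \<le> int C * (- y n)})"
  shows "convergent (\<lambda>n. real_of_int (y n) / real n)"
proof -
  consider "(\<lambda>n. real_of_int (y n) / real n) \<longlonglongrightarrow> v" | "(\<lambda>n. real_of_int (- y n) / real n) \<longlonglongrightarrow> w"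
    | "\<forall>C::nat. finite {n. int n \<le> int C * y n}" "\<forall>C::nat. finite {n. int n \<le> int C * (- y n)}"
    using assms by blast
  then show ?thesis
  proof cases
    case 2
    from tendsto_minus[OF this] show ?thesis by (auto simp: convergent_def)
  next
    \<comment> \<open>Neither direction has positive speed: for every \<open>m\<close>, eventually
      \<open>\<bar>y n\<bar> / n\<close> is below \<open>1 / Suc m\<close>, so the limit is
      0.\<close>
    case 3
    have "(\<lambda>n. real_of_int (y n) / real n) \<longlonglongrightarrow> 0"
    proof (rule tendstoI)
      fix e :: real assume "0 < e"
      then obtain m where m: "1 / real (Suc m) < e" using nat_approx_posE by metis
      have "finite ({n. int n \<le> int (Suc m) * y n} \<union> {n. int n \<le> int (Suc m) * (- y n)})" using 3 by blast
      then obtain N where "\<And>n. n \<in> {n. int n \<le> int (Suc m) * y n} \<union> {n. int n \<le> int (Suc m) * (- y n)} \<Longrightarrow> n < N"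
        using finite_nat_set_iff_bounded by metis
      then have N: "int (Suc m) * \<bar>y n\<bar> < int n" if "N \<le> n" for n
        using that by (cases "0 \<le> y n") (fastforce simp: not_less abs_if)+
      have "dist (real_of_int (y n) / real n) 0 < e" if "N \<le> n" for n
      proof -
        have "real_of_int (int (Suc m) * \<bar>y n\<bar>) < real_of_int (int n)" using N[OF that] by (simp only: of_int_less_iff)
        then have "real (Suc m) * \<bar>real_of_int (y n)\<bar> < real n" by simp
        then have "\<bar>real_of_int (y n)\<bar> / real n < 1 / real (Suc m)"
          by (cases "n = 0") (simp_all add: field_simps)
        with m show ?thesis by simp
      qed
      then show "\<forall>\<^sub>F n in sequentially. dist (real_of_int (y n) / real n) 0 < e"
        unfolding eventually_sequentially by blast
    qed
    then show ?thesis by (auto simp: convergent_def)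
  qed (auto simp: convergent_def)
qed

theorem walk_velocity_exists:
  fixes \<mu> :: "(int ^ 'd::finite) pmf pmf"
  assumes "set_pmf \<mu> \<subseteq> step_laws"
  shows "AE X in walk_law \<mu>. convergent (mean_velocity X)"
proof -
  have "AE X in walk_law \<mu>. convergent (\<lambda>n. real_of_int (X n $ i) / real n)" for i
  proof -
    interpret p: leveled_walk "\<lambda>x. x $ i" \<mu>
      by unfold_locales (use assms in \<open>auto simp: unit_vectors_def axis_def\<close>)
    interpret m: leveled_walk "\<lambda>x. - (x $ i)" \<mu>
      by unfold_locales (use assms in \<open>auto simp: unit_vectors_def axis_def\<close>)
    obtain v w where
      "AE X in walk_law \<mu>. (\<lambda>n. real_of_int (X n $ i) / real n) \<longlonglongrightarrow> v \<or> (\<forall>C::nat. finite {n. int n \<le> int C * (X n $ i)})"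
      "AE X in walk_law \<mu>. (\<lambda>n. real_of_int (- (X n $ i)) / real n) \<longlonglongrightarrow> w \<or> (\<forall>C::nat. finite {n. int n \<le> int C * (- (X n $ i))})"
      using p.one_sided_speed m.one_sided_speed by blast
    then show ?thesis by eventually_elim (rule converges_of_one_sided)
  qed
  then have "AE X in walk_law \<mu>. \<forall>i. convergent (\<lambda>n. real_of_int (X n $ i) / real n)"
    by (intro AE_finite_allI[where S = UNIV, simplified]) auto
  then show ?thesis
  proof eventually_elim
    case (elim X)
    then obtain V where V: "\<And>i. (\<lambda>n. real_of_int (X n $ i) / real n) \<longlonglongrightarrow> V i"
      unfolding convergent_def by metis
    have "mean_velocity X \<longlonglongrightarrow> (\<chi> i. V i)"
      unfolding mean_velocity_def[abs_def] rvec_def using V by (intro vec_tendstoI) (simp add: divide_inverse mult.commute)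
    then show ?case by (auto simp: convergent_def)
  qed
qed

section \<open>The coupling\<close>

type_synonym 'd site_or_step = "(int ^ 'd) + bool \<times> nat"
type_synonym 'd sample = "'d site_or_step \<Rightarrow> real \<times> (int ^ 'd)"

locale two_laws =
  fixes \<gamma>1 \<gamma>2 :: "(int ^ 'd::finite) pmf"
  assumes step1: "\<gamma>1 \<in> step_laws" and step2: "\<gamma>2 \<in> step_laws" and neq: "\<gamma>1 \<noteq> \<gamma>2"
begin

definition law :: "bool \<Rightarrow> (int ^ 'd) pmf" where "law c = (if c then \<gamma>1 else \<gamma>2)"

abbreviation V :: "(real \<times> (int ^ 'd)) measure" where "V \<equiv> borel \<Otimes>\<^sub>M count_space UNIV"

text \<open>Sites carry a uniform label (with a dummy step), stack entries carry a step (with a dummy label).\<close>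

definition coord :: "'d site_or_step \<Rightarrow> (real \<times> (int ^ 'd)) measure" where
  "coord i = (case i of Inl x \<Rightarrow> distr (uniform_measure lborel {0..1}) V (\<lambda>u. (u, 0))
     | Inr cj \<Rightarrow> distr (measure_pmf (law (fst cj))) V (\<lambda>e. (0, e)))"

definition N :: "'d sample measure" where "N = PiM UNIV coord"

lemma sets_coord [simp, measurable_cong]: "sets (coord i) = sets V"
  by (simp add: coord_def split: sum.split)

lemma prob_space_uniform: "prob_space (uniform_measure lborel {0..1::real})"
  by (rule prob_space_uniform_measure) auto

lemma prob_space_coord: "prob_space (coord i)"
proof (cases i)
  case (Inl x)
  have "(\<lambda>u. (u, 0)) \<in> uniform_measure lborel {0..1} \<rightarrow>\<^sub>M V" by measurable
  with prob_space_uniform show ?thesis by (simp add: coord_def Inl prob_space.prob_space_distr)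
next
  case (Inr cj)
  have "(\<lambda>e. (0, e)) \<in> measure_pmf (law (fst cj)) \<rightarrow>\<^sub>M V" by (simp add: space_pair_measure)
  from prob_space.prob_space_distr[OF prob_space_measure_pmf this] show ?thesis by (simp add: coord_def Inr)
qed

sublocale N: prob_space N
  unfolding N_def by (rule prob_space_PiM[OF prob_space_coord])

lemma space_N [simp]: "space N = UNIV"
proof -
  have "space (coord i) = UNIV" for i using sets_eq_imp_space_eq[OF sets_coord[of i]] by (simp add: space_pair_measure)
  then show ?thesis by (simp add: N_def space_PiM)
qed

lemma measurable_coord: "(\<lambda>s. s i) \<in> N \<rightarrow>\<^sub>M V"
  using measurable_component_singleton[of i UNIV coord] unfolding N_def
  by (simp only: measurable_cong_sets[OF refl sets_coord] UNIV_I simp_thms)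

section \<open>The walks driven by labels and stacks\<close>

definition label :: "'d sample \<Rightarrow> int ^ 'd \<Rightarrow> real" where "label s x = fst (s (Inl x))"
definition stack :: "'d sample \<Rightarrow> bool \<Rightarrow> nat \<Rightarrow> int ^ 'd" where "stack s c j = snd (s (Inr (c, j)))"
definition stack_sum :: "'d sample \<Rightarrow> bool \<Rightarrow> nat \<Rightarrow> int ^ 'd" where "stack_sum s c n = (\<Sum>j<n. stack s c j)"
definition pos :: "'d sample \<Rightarrow> nat \<Rightarrow> nat \<Rightarrow> int ^ 'd" where "pos s a b = stack_sum s True a + stack_sum s False b"

text \<open>The position is a function of the two read counts, which add up to \<open>n\<close>, so
  one counter drives the walk. Recursion on the counter rather than on the position makes
  monotonicity in \<open>p\<close> an induction on numbers.\<close>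

primrec cnt :: "real \<Rightarrow> 'd sample \<Rightarrow> nat \<Rightarrow> nat" where
  "cnt p s 0 = 0"
| "cnt p s (Suc n) = cnt p s n + (if label s (pos s (cnt p s n) (n - cnt p s n)) < p then 1 else 0)"

definition W :: "real \<Rightarrow> 'd sample \<Rightarrow> 'd path" where "W p s n = pos s (cnt p s n) (n - cnt p s n)"
definition om :: "real \<Rightarrow> 'd sample \<Rightarrow> 'd env" where "om p s x = law (label s x < p)"

lemma law_eq_iff: "law c = \<gamma>1 \<longleftrightarrow> c"
  using neq by (auto simp: law_def)

lemma measurable_label [measurable]: "(\<lambda>s. label s x) \<in> borel_measurable N"
  unfolding label_def by (rule measurable_compose[OF measurable_coord measurable_fst])

lemma measurable_stack [measurable]: "(\<lambda>s. stack s c j) \<in> N \<rightarrow>\<^sub>M count_space UNIV"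
  unfolding stack_def by (rule measurable_compose[OF measurable_coord measurable_snd])

lemma measurable_plus_count:
  fixes f g :: "'a \<Rightarrow> int ^ 'd"
  assumes "f \<in> M \<rightarrow>\<^sub>M count_space UNIV" "g \<in> M \<rightarrow>\<^sub>M count_space UNIV"
  shows "(\<lambda>x. f x + g x) \<in> M \<rightarrow>\<^sub>M count_space UNIV"
proof (rule measurable_compose_countable[OF _ assms(1)])
  show "(\<lambda>x. z + g x) \<in> M \<rightarrow>\<^sub>M count_space UNIV" for z
    by (rule measurable_compose[OF assms(2)]) simp
qed

lemma measurable_stack_sum [measurable]: "(\<lambda>s. stack_sum s c n) \<in> N \<rightarrow>\<^sub>M count_space UNIV"
proof (induction n)
  case (Suc n)
  from measurable_plus_count[OF this measurable_stack[of c n]] show ?case by (simp add: stack_sum_def)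
qed (simp add: stack_sum_def)

lemma measurable_pos [measurable]: "(\<lambda>s. pos s a b) \<in> N \<rightarrow>\<^sub>M count_space UNIV"
  unfolding pos_def by (rule measurable_plus_count[OF measurable_stack_sum measurable_stack_sum])

lemma measurable_label_pos [measurable]: "(\<lambda>s. label s (pos s a b)) \<in> borel_measurable N"
  by (rule measurable_compose_countable[where f = "\<lambda>x s. label s x" and g = "\<lambda>s. pos s a b", OF measurable_label measurable_pos])

lemma measurable_cnt [measurable]: "(\<lambda>s. cnt p s n) \<in> N \<rightarrow>\<^sub>M count_space UNIV"
proof (induction n)
  case (Suc n)
  have "(\<lambda>s. i + (if label s (pos s i (n - i)) < p then 1 else 0)) \<in> N \<rightarrow>\<^sub>M count_space UNIV" for i :: nat
  proof -
    have "(\<lambda>s. label s (pos s i (n - i)) < p) \<in> N \<rightarrow>\<^sub>M count_space UNIV" by measurable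
    from measurable_compose[OF this, of "\<lambda>b. i + (if b then 1 else 0)"] show ?thesis by simp
  qed
  then have "(\<lambda>s. cnt p s n + (if label s (pos s (cnt p s n) (n - cnt p s n)) < p then 1 else 0)) \<in> N \<rightarrow>\<^sub>M count_space UNIV"
    by (intro measurable_compose_countable[where f = "\<lambda>i s. i + (if label s (pos s i (n - i)) < p then 1 else 0)" and g = "\<lambda>s. cnt p s n"] Suc)
  then show ?case by (simp only: cnt.simps)
qed simp

lemma measurable_W_comp [measurable]: "(\<lambda>s. W p s n) \<in> N \<rightarrow>\<^sub>M count_space UNIV"
  unfolding W_def 
  by (rule measurable_compose_countable[where f = "\<lambda>i s. pos s i (n - i)" and g = "\<lambda>s. cnt p s n", OF measurable_pos measurable_cnt])

lemma measurable_W [measurable]: "W p \<in> N \<rightarrow>\<^sub>M path_space"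
proof -
  have "(\<lambda>s n. W p s n) \<in> N \<rightarrow>\<^sub>M (PiM UNIV (\<lambda>_. count_space UNIV) :: 'd path measure)"
    by (rule measurable_PiM_single') auto
  then show ?thesis by (simp add: path_space_def)
qed

lemma measurable_om [measurable]: "om p \<in> N \<rightarrow>\<^sub>M env_space"
proof -
  have "(\<lambda>s x. om p s x) \<in> N \<rightarrow>\<^sub>M (PiM UNIV (\<lambda>_. count_space UNIV) :: 'd env measure)"
  proof (rule measurable_PiM_single')
    show "(\<lambda>s. om p s x) \<in> N \<rightarrow>\<^sub>M count_space UNIV" for x
    proof -
      have "(\<lambda>s. label s x < p) \<in> N \<rightarrow>\<^sub>M count_space UNIV" by measurable
      from measurable_compose[OF this, of law] show ?thesis by (simp add: om_def)
    qed
  qed auto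
  then show ?thesis by (simp add: env_space_def)
qed

lemma cnt_le: "cnt p s n \<le> n"
  by (induction n) auto

lemma cnt_mono: "m \<le> n \<Longrightarrow> cnt p s m \<le> cnt p s n"
  by (rule lift_Suc_mono_le[of "cnt p s"]) auto

lemma cnt_compl_mono: "m \<le> n \<Longrightarrow> m - cnt p s m \<le> n - cnt p s n"
proof (rule lift_Suc_mono_le[of "\<lambda>n. n - cnt p s n"])
  show "n - cnt p s n \<le> Suc n - cnt p s (Suc n)" for n using cnt_le[of p s n] by auto
qed

lemma cnt_Suc_W: "cnt p s (Suc n) = cnt p s n + (if label s (W p s n) < p then 1 else 0)"
  by (simp add: W_def)

lemma W_0 [simp]: "W p s 0 = 0"
  by (simp add: W_def pos_def stack_sum_def)

lemma W_Suc: "W p s (Suc n) = W p s n +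
    (if label s (W p s n) < p then stack s True (cnt p s n) else stack s False (n - cnt p s n))"
proof -
  have "stack_sum s c (Suc j) = stack_sum s c j + stack s c j" for c j by (simp add: stack_sum_def)
  then have *: "pos s (Suc a) b = pos s a b + stack s True a" "pos s a (Suc b) = pos s a b + stack s False b" for a b
    by (simp_all add: pos_def)
  show ?thesis
  proof (cases "label s (W p s n) < p")
    case True
    then have "cnt p s (Suc n) = Suc (cnt p s n)" by (simp add: W_def)
    then show ?thesis using True * by (simp add: W_def[of p s "Suc n"] W_def[of p s n, symmetric])
  next
    case False
    then have "cnt p s (Suc n) = cnt p s n" by (simp add: W_def)
    moreover have "Suc n - cnt p s n = Suc (n - cnt p s n)" using cnt_le[of p s n] by simp
    ultimately show ?thesis using False * by (simp add: W_def[of p s "Suc n"] W_def[of p s n, symmetric])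
  qed
qed

lemma visits_eq_cnt: "visits \<gamma>1 (om p s) (W p s) n = cnt p s n"
proof (induction n)
  case 0
  then show ?case by (simp add: visits_def)
next
  case (Suc n)
  have "{m. m < Suc n \<and> om p s (W p s m) = \<gamma>1} =
     (if label s (W p s n) < p then insert n {m. m < n \<and> om p s (W p s m) = \<gamma>1} else {m. m < n \<and> om p s (W p s m) = \<gamma>1})"
    by (auto simp: om_def law_eq_iff less_Suc_eq)
  with Suc show ?case by (simp add: visits_def cnt_Suc_W del: cnt.simps)
qed

text \<open>Two coupled walks that have used equally many steps of each kind sit at the same site.\<close>

lemma cnt_coupled: "p \<le> p' \<Longrightarrow> cnt p s n \<le> cnt p' s n"
proof (induction n)
  case (Suc n)
  show ?case
  proof (cases "cnt p s n = cnt p' s n")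
    case True
    then show ?thesis using Suc by auto
  qed (use Suc in auto)
qed simp

text \<open>Up to time \<open>n\<close> the walk of \<open>s\<close> reads only entries below
  \<open>ma\<close> and \<open>mb\<close>. Agreement there makes the two walks take the same
  decisions at each step, so \<open>s'\<close> reads the same entries.\<close>

lemma cnt_cong:
  assumes lab: "\<And>x. label s' x = label s x"
    and st: "\<And>j. j < ma \<Longrightarrow> stack s' True j = stack s True j" "\<And>j. j < mb \<Longrightarrow> stack s' False j = stack s False j"
    and n: "cnt p s n \<le> ma" "n - cnt p s n \<le> mb" and k: "k \<le> n"
  shows "cnt p s' k = cnt p s k \<and> W p s' k = W p s k"
proof -
  have P: "pos s' a b = pos s a b" if "a \<le> ma" "b \<le> mb" for a b
    using that st by (auto simp: pos_def stack_sum_def intro!: arg_cong2[where f="(+)"] sum.cong)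
  have "cnt p s' k = cnt p s k"
    using k
  proof (induction k)
    case (Suc k)
    have "cnt p s k \<le> ma" "k - cnt p s k \<le> mb"
      using cnt_mono[of k n p s] cnt_compl_mono[of k n p s] n Suc by auto
    then show ?case using Suc by (simp add: lab P)
  qed simp
  moreover have "cnt p s k \<le> ma" "k - cnt p s k \<le> mb"
    using cnt_mono[of k n p s] cnt_compl_mono[of k n p s] n k by auto
  ultimately show ?thesis by (simp add: W_def P)
qed

lemma nn_integral_indep:
  fixes f g :: "'d sample \<Rightarrow> ennreal"
  assumes "f \<in> borel_measurable N" "g \<in> borel_measurable N"
    and "\<And>s s'. (\<And>i. i \<notin> J \<Longrightarrow> s i = s' i) \<Longrightarrow> f s = f s'"
    and "\<And>s s'. (\<And>i. i \<in> J \<Longrightarrow> s i = s' i) \<Longrightarrow> g s = g s'"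
  shows "(\<integral>\<^sup>+s. f s * g s \<partial>N) = (\<integral>\<^sup>+s. f s \<partial>N) * (\<integral>\<^sup>+s. g s \<partial>N)"
  unfolding N_def
proof (rule nn_integral_PiM_indep[where J=J and M=coord, OF prob_space_coord])
  show "f s = f s'" if "\<And>i. i \<notin> J \<Longrightarrow> s i = s' i" for s s' using that by (rule assms(3))
  show "g s = g s'" if "\<And>i. i \<in> J \<Longrightarrow> s i = s' i" for s s' using that by (rule assms(4))
qed (use assms(1,2) in \<open>simp_all only: N_def\<close>)

lemma emeasure_indep:
  assumes B: "B \<in> sets N" and C: "C \<in> sets N"
    and BJ: "\<And>s s'. (\<And>i. i \<notin> J \<Longrightarrow> s i = s' i) \<Longrightarrow> s \<in> B \<Longrightarrow> s' \<in> B"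
    and CJ: "\<And>s s'. (\<And>i. i \<in> J \<Longrightarrow> s i = s' i) \<Longrightarrow> s \<in> C \<Longrightarrow> s' \<in> C"
  shows "emeasure N (B \<inter> C) = emeasure N B * emeasure N C"
proof -
  have "emeasure N (B \<inter> C) = (\<integral>\<^sup>+s. indicator B s * indicator C s \<partial>N)"
    using B C by (simp flip: indicator_inter_arith add: sets.Int)
  also have "\<dots> = (\<integral>\<^sup>+s. indicator B s \<partial>N) * (\<integral>\<^sup>+s. indicator C s \<partial>N)"
  proof (rule nn_integral_indep[where J=J])
    fix s s' :: "'d sample"
    show "indicator B s = (indicator B s' :: ennreal)" if "\<And>i. i \<notin> J \<Longrightarrow> s i = s' i"
      using BJ[of s s'] BJ[of s' s] that by (auto simp: indicator_def)
    show "indicator C s = (indicator C s' :: ennreal)" if "\<And>i. i \<in> J \<Longrightarrow> s i = s' i"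
      using CJ[of s s'] CJ[of s' s] that by (auto simp: indicator_def)
  qed (use B C in auto)
  finally show ?thesis using B C by simp
qed

section \<open>The annealed law of a single coupled walk\<close>

lemma distr_stack: "distr N (count_space UNIV) (\<lambda>s. stack s c j) = measure_pmf (law c)"
proof -
  have m1: "(\<lambda>s. s (Inr (c, j))) \<in> N \<rightarrow>\<^sub>M coord (Inr (c, j))"
    unfolding N_def by (rule measurable_component_singleton) simp
  have m2: "snd \<in> coord (Inr (c, j)) \<rightarrow>\<^sub>M count_space UNIV"
    unfolding measurable_cong_sets[OF sets_coord refl] by (rule measurable_snd)
  have m3: "(\<lambda>e. (0, e)) \<in> measure_pmf (law c) \<rightarrow>\<^sub>M V" by (simp add: space_pair_measure)
  have "distr N (count_space UNIV) (\<lambda>s. stack s c j) = distr (distr N (coord (Inr (c, j))) (\<lambda>s. s (Inr (c, j)))) (count_space UNIV) snd"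
    unfolding distr_distr[OF m2 m1] by (simp add: comp_def stack_def)
  also have "distr N (coord (Inr (c, j))) (\<lambda>s. s (Inr (c, j))) = coord (Inr (c, j))"
    unfolding N_def by (rule distr_PiM_component[OF prob_space_coord]) simp
  also have "distr (coord (Inr (c, j))) (count_space UNIV) snd = distr (measure_pmf (law c)) (count_space UNIV) (\<lambda>e. e)"
    unfolding coord_def sum.case fst_conv distr_distr[OF measurable_snd m3] by (simp only: comp_def snd_conv)
  also have "\<dots> = measure_pmf (law c)" by (rule distr_id2) simp
  finally show ?thesis .
qed

lemma emeasure_stack: "emeasure N {s. stack s c j \<in> E} = emeasure (law c) E"
proof -
  have "emeasure (distr N (count_space UNIV) (\<lambda>s. stack s c j)) E = emeasure N ((\<lambda>s. stack s c j) -` E \<inter> space N)"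
    by (rule emeasure_distr[OF measurable_stack]) simp
  then show ?thesis by (simp add: distr_stack vimage_def)
qed

lemma AE_stack_in_support: "AE s in N. \<forall>c j. stack s c j \<in> set_pmf (law c)"
proof -
  have "AE s in N. stack s c j \<in> set_pmf (law c)" for c j
  proof -
    have "AE e in distr N (count_space UNIV) (\<lambda>s. stack s c j). e \<in> set_pmf (law c)"
      unfolding distr_stack by (simp add: AE_measure_pmf)
    then show ?thesis by (rule AE_distrD[OF measurable_stack])
  qed
  then show ?thesis by (simp add: AE_all_countable)
qed

lemma emeasure_label:
  assumes "0 \<le> p" "p \<le> 1"
  shows "emeasure (coord (Inl x)) {v. law (fst v < p) \<in> F} = emeasure (two_point_law \<gamma>1 \<gamma>2 p) F"
proof -
  let ?U = "uniform_measure lborel {0..1::real}"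
  have sU: "sets ?U = sets borel" by simp
  have m: "{v. law (fst v < p) \<in> F} \<in> sets V"
  proof -
    have "(\<lambda>v. fst v < p) \<in> V \<rightarrow>\<^sub>M count_space UNIV" by measurable
    from measurable_sets[OF this, of "{b. law b \<in> F}"] show ?thesis by (simp add: vimage_def space_pair_measure)
  qed
  have a: "emeasure (coord (Inl x)) {v. law (fst v < p) \<in> F} = emeasure ?U {u. law (u < p) \<in> F}"
    unfolding coord_def using m by (simp, subst emeasure_distr) (auto simp: vimage_def)
  have "{0..1} \<inter> {u. u < p} = {0..<p}" "{0..1} \<inter> {u. \<not> u < p} = {p..1}" using assms by auto
  then have lt: "emeasure ?U {u. u < p} = ennreal p" and ge: "emeasure ?U {u. \<not> u < p} = ennreal (1 - p)"
    using assms by (simp_all add: divide_ennreal_def)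
  have un: "emeasure ?U UNIV = 1" using prob_space.emeasure_space_1[OF prob_space_uniform] by simp
  have b: "emeasure (two_point_law \<gamma>1 \<gamma>2 p) F = emeasure (bernoulli_pmf p) {c. law c \<in> F}"
    by (simp add: two_point_law_def law_def vimage_def)
  have T: "emeasure (bernoulli_pmf p) {True} = ennreal p" "emeasure (bernoulli_pmf p) {False} = ennreal (1 - p)"
    using assms by (simp_all add: emeasure_pmf_single)
  consider "{c. law c \<in> F} = UNIV" "{u. law (u < p) \<in> F} = UNIV" | "{c. law c \<in> F} = {}" "{u. law (u < p) \<in> F} = {}"
    | "{c. law c \<in> F} = {True}" "{u. law (u < p) \<in> F} = {u. u < p}" | "{c. law c \<in> F} = {False}" "{u. law (u < p) \<in> F} = {u. \<not> u < p}"
  proof (cases "law True \<in> F"; cases "law False \<in> F")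
    assume h: "law True \<in> F" "law False \<in> F"
    then have "law c \<in> F" for c by (cases c) auto
    then show ?thesis using that(1) by auto
  next
    assume h: "law True \<in> F" "law False \<notin> F"
    then have "law c \<in> F \<longleftrightarrow> c" for c by (cases c) auto
    then show ?thesis using that(3) by auto
  next
    assume h: "law True \<notin> F" "law False \<in> F"
    then have "law c \<in> F \<longleftrightarrow> \<not> c" for c by (cases c) auto
    then show ?thesis using that(4) by auto
  next
    assume h: "law True \<notin> F" "law False \<notin> F"
    then have "law c \<notin> F" for c by (cases c) auto
    then show ?thesis using that(2) by auto
  qed
  then show ?thesis
    unfolding a b by cases (simp_all only: un lt ge T emeasure_empty, simp)
qed

lemma distr_om:
  assumes p: "0 \<le> p" "p \<le> 1"
  shows "distr N env_space (om p) = env_law (two_point_law \<gamma>1 \<gamma>2 p)"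
proof -
  let ?\<mu> = "two_point_law \<gamma>1 \<gamma>2 p"
  interpret E: product_prob_space "\<lambda>_ :: int^'d. measure_pmf ?\<mu>" UNIV
    by (rule product_prob_spaceI) (rule prob_space_measure_pmf)
  show ?thesis unfolding env_law_def
  proof (rule E.PiM_eq)
    show "sets (distr N env_space (om p)) = sets (PiM UNIV (\<lambda>_. measure_pmf ?\<mu>))"
      using sets_env_law[of ?\<mu>] by (simp add: env_law_def)
    fix J :: "(int^'d) set" and F :: "int^'d \<Rightarrow> (int^'d) pmf set"
    assume J: "finite J"
    let ?X = "\<lambda>i. case i of Inl x \<Rightarrow> {v. law (fst v < p) \<in> F x} | Inr _ \<Rightarrow> UNIV"
    have mX: "?X i \<in> sets (coord i)" for i
    proof (cases i)
      case (Inl x)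
      have "(\<lambda>v. fst v < p) \<in> V \<rightarrow>\<^sub>M count_space UNIV" by measurable
      from measurable_sets[OF this, of "{b. law b \<in> F x}"] show ?thesis by (simp add: Inl vimage_def space_pair_measure)
    next
      case (Inr _)
      then show ?thesis using sets.top[of V] by (simp add: space_pair_measure)
    qed
    have E: "prod_emb UNIV (\<lambda>_. measure_pmf ?\<mu>) J (Pi\<^sub>E J F) = {\<omega>. \<forall>x\<in>J. \<omega> x \<in> F x}"
      by (auto simp: prod_emb_def restrict_def PiE_iff extensional_def)
    have "{\<omega>. \<forall>x\<in>J. \<omega> x \<in> F x} \<in> sets env_space"
    proof -
      have "{\<omega> \<in> space env_space. \<forall>x\<in>J. \<omega> x \<in> F x} \<in> sets env_space"
        using J unfolding env_space_def by (intro sets.sets_Collect_finite_All sets_Collect_single') auto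
      then show ?thesis by simp
    qed
    then have "emeasure (distr N env_space (om p)) {\<omega>. \<forall>x\<in>J. \<omega> x \<in> F x} = emeasure N {s. \<forall>i\<in>Inl ` J. s i \<in> ?X i}"
      by (subst emeasure_distr) (auto simp: vimage_def om_def label_def)
    also have "\<dots> = (\<Prod>i\<in>Inl ` J. emeasure (coord i) (?X i))"
    proof -
      interpret P: product_prob_space coord UNIV by (rule product_prob_spaceI) (rule prob_space_coord)
      show ?thesis
        using P.emeasure_PiM_Collect[of "Inl ` J" ?X] J mX space_N unfolding N_def by simp
    qed
    also have "\<dots> = (\<Prod>x\<in>J. emeasure ?\<mu> (F x))"
      using emeasure_label[OF p] by (subst prod.reindex) auto
    finally show "emeasure (distr N env_space (om p)) (prod_emb UNIV (\<lambda>_. measure_pmf ?\<mu>) J (Pi\<^sub>E J F)) = (\<Prod>x\<in>J. emeasure ?\<mu> (F x))"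
      unfolding E .
  qed
qed

lemma N_Collect [measurable (raw)]: "Measurable.pred N P \<Longrightarrow> {s. P s} \<in> sets N"
  by (simp add: pred_def)

lemma stack_indep:
  assumes B: "B \<in> sets N"
    and BJ: "\<And>s s'. (\<And>i. i \<noteq> Inr (c, j) \<Longrightarrow> s i = s' i) \<Longrightarrow> s \<in> B \<Longrightarrow> s' \<in> B"
  shows "emeasure N (B \<inter> {s. stack s c j \<in> E}) = emeasure N B * emeasure (law c) E"
proof -
  have m: "{s. stack s c j \<in> E} \<in> sets N"
    using measurable_sets[OF measurable_stack[of c j], of E] by (simp add: vimage_def)
  have "emeasure N (B \<inter> {s. stack s c j \<in> E}) = emeasure N B * emeasure N {s. stack s c j \<in> E}"
  proof (rule emeasure_indep[OF B m, where J = "{Inr (c, j)}"])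
    show "s' \<in> B" if "\<And>i. i \<notin> {Inr (c, j)} \<Longrightarrow> s i = s' i" "s \<in> B" for s s'
      using BJ[OF _ that(2), of s'] that(1) by simp
    show "s' \<in> {s. stack s c j \<in> E}" if "\<And>i. i \<in> {Inr (c, j)} \<Longrightarrow> s i = s' i" "s \<in> {s. stack s c j \<in> E}" for s s'
      using that by (simp add: stack_def)
  qed
  then show ?thesis by (simp add: emeasure_stack)
qed

lemma sets_om [measurable]: "A \<in> sets env_space \<Longrightarrow> {s. om p s \<in> A} \<in> sets N"
  using measurable_sets[OF measurable_om, of A] by (simp add: vimage_def)

lemma sets_W [measurable]: "A \<in> sets path_space \<Longrightarrow> {s. W p s \<in> A} \<in> sets N"
  using measurable_sets[OF measurable_W, of A] by (simp add: vimage_def)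

text \<open>Once the count at time \<open>n\<close> is known to be \<open>i\<close>, the next entry
  at a site of type \<open>c\<close> has the deterministic index \<open>idx i\<close> and has not
  been read, so it is independent of the environment and the past. Splitting over \<open>i\<close>
  is what makes the index deterministic.\<close>

lemma walk_step_law:
  assumes A: "A \<in> sets env_space"
  shows "emeasure N {s. om p s \<in> A \<and> om p s (x n) = law c \<and> W p s \<in> cyl x (Suc n)} =
    emeasure N {s. om p s \<in> A \<and> om p s (x n) = law c \<and> W p s \<in> cyl x n} * pmf (law c) (x (Suc n) - x n)"
proof -
  define idx where "idx i = (if c then i else n - i)" for i
  let ?z = "x (Suc n) - x n"
  define B where "B i = {s. om p s \<in> A \<and> om p s (x n) = law c \<and> W p s \<in> cyl x n \<and> cnt p s n = i}" for i
  have law_inj: "law b = law c \<longleftrightarrow> b = c" for b using neq by (auto simp: law_def)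
  have mA: "{\<omega>. \<omega> (x n) = law c} \<in> sets env_space"
  proof -
    have "(\<lambda>\<omega>. \<omega> (x n)) \<in> env_space \<rightarrow>\<^sub>M count_space UNIV" unfolding env_space_def by simp
    from measurable_sets[OF this, of "{law c}"] show ?thesis by (simp add: vimage_def)
  qed
  have mB: "B i \<in> sets N" for i
  proof -
    have "{s. cnt p s n = i} \<in> sets N"
      using measurable_sets[OF measurable_cnt, of "{i}" p n] by (simp add: vimage_def)
    then have "{s. om p s \<in> A} \<inter> {s. om p s \<in> {\<omega>. \<omega> (x n) = law c}} \<inter> {s. W p s \<in> cyl x n} \<inter> {s. cnt p s n = i} \<in> sets N"
      using sets_om[OF A] sets_om[OF mA] sets_W[OF sets_cyl] by (intro sets.Int)
    also have "{s. om p s \<in> A} \<inter> {s. om p s \<in> {\<omega>. \<omega> (x n) = law c}} \<inter> {s. W p s \<in> cyl x n} \<inter> {s. cnt p s n = i} = B i"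
      by (auto simp: B_def)
    finally show ?thesis .
  qed
  have dis: "disjoint_family_on B {..n}" by (auto simp: disjoint_family_on_def B_def)
  have step: "W p s (Suc n) = W p s n + stack s c (idx i)" if "s \<in> B i" for s i
  proof -
    have "W p s n = x n" using that by (auto simp: B_def cyl_def)
    moreover have "(label s (x n) < p) = c" using that law_inj by (auto simp: B_def om_def)
    moreover have "cnt p s n = i" using that by (auto simp: B_def)
    ultimately show ?thesis by (simp add: W_Suc idx_def)
  qed
  have ind: "emeasure N (B i \<inter> {s. stack s c (idx i) \<in> {?z}}) = emeasure N (B i) * emeasure (law c) {?z}" for i
  proof (rule stack_indep[OF mB])
    fix s s' :: "'d sample" assume e: "\<And>k. k \<noteq> Inr (c, idx i) \<Longrightarrow> s k = s' k" and s: "s \<in> B i"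
    have lab: "label s' y = label s y" for y using e[of "Inl y"] by (simp add: label_def)
    have om: "om p s' = om p s" by (simp add: om_def[abs_def] lab)
    have st: "stack s' b j = stack s b j" if "(b, j) \<noteq> (c, idx i)" for b j
      using e[of "Inr (b, j)"] that by (simp add: stack_def)
    have i: "cnt p s n = i" using s by (simp add: B_def)
    have "cnt p s' k = cnt p s k \<and> W p s' k = W p s k" if "k \<le> n" for k
    proof (rule cnt_cong[where ma = i and mb = "n - i", OF lab])
      show "stack s' True j = stack s True j" if "j < i" for j
        using st[of True j] that by (cases c) (auto simp: idx_def)
      show "stack s' False j = stack s False j" if "j < n - i" for j
        using st[of False j] that by (cases c) (auto simp: idx_def)
    qed (use i that in auto)
    then show "s' \<in> B i" using s om by (auto simp: B_def cyl_def)
  qed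
  have "{s. om p s \<in> A \<and> om p s (x n) = law c \<and> W p s \<in> cyl x (Suc n)} = (\<Union>i\<in>{..n}. B i \<inter> {s. stack s c (idx i) \<in> {?z}})"
  proof (intro set_eqI iffI)
    fix s assume s: "s \<in> {s. om p s \<in> A \<and> om p s (x n) = law c \<and> W p s \<in> cyl x (Suc n)}"
    then have b: "s \<in> B (cnt p s n)" by (auto simp: B_def cyl_def)
    moreover have "stack s c (idx (cnt p s n)) = ?z" using step[OF b] s by (auto simp: cyl_def)
    ultimately show "s \<in> (\<Union>i\<in>{..n}. B i \<inter> {s. stack s c (idx i) \<in> {?z}})" using cnt_le[of p s n] by auto
  next
    fix s assume "s \<in> (\<Union>i\<in>{..n}. B i \<inter> {s. stack s c (idx i) \<in> {?z}})"
    then obtain i where i: "s \<in> B i" "stack s c (idx i) = ?z" by auto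
    have "W p s n = x n" using i by (auto simp: B_def cyl_def)
    then have "W p s (Suc n) = x (Suc n)" using step[OF i(1)] i(2) by simp
    then show "s \<in> {s. om p s \<in> A \<and> om p s (x n) = law c \<and> W p s \<in> cyl x (Suc n)}"
      using i(1) by (auto simp: B_def cyl_def le_Suc_eq)
  qed
  also have "emeasure N \<dots> = (\<Sum>i\<le>n. emeasure N (B i \<inter> {s. stack s c (idx i) \<in> {?z}}))"
  proof (rule sum_emeasure[symmetric])
    show "(\<lambda>i. B i \<inter> {s. stack s c (idx i) \<in> {?z}}) ` {..n} \<subseteq> sets N"
    proof clarify
      fix i
      have "{s. stack s c (idx i) \<in> {?z}} \<in> sets N"
        using measurable_sets[OF measurable_stack, of "{?z}" c "idx i"] by (simp add: vimage_def)
      then show "B i \<inter> {s. stack s c (idx i) \<in> {?z}} \<in> sets N" by (intro sets.Int mB)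
    qed
    show "disjoint_family_on (\<lambda>i. B i \<inter> {s. stack s c (idx i) \<in> {?z}}) {..n}"
      using dis by (auto simp: disjoint_family_on_def)
  qed simp
  also have "\<dots> = (\<Sum>i\<le>n. emeasure N (B i)) * pmf (law c) ?z"
    unfolding ind by (simp add: sum_distrib_right emeasure_pmf_single)
  also have "(\<Sum>i\<le>n. emeasure N (B i)) = emeasure N (\<Union>i\<in>{..n}. B i)"
    using mB dis by (intro sum_emeasure) auto
  also have "(\<Union>i\<in>{..n}. B i) = {s. om p s \<in> A \<and> om p s (x n) = law c \<and> W p s \<in> cyl x n}"
    using cnt_le[of p _ n] by (auto simp: B_def)
  finally show ?thesis .
qed

text \<open>\<open>A\<close> varies in the induction: the step intersects it with the event that
  \<open>x n\<close> carries one of the two laws, which turns the factor of that step into a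
  constant.\<close>

lemma walk_cyl_law:
  assumes p: "0 \<le> p" "p \<le> 1" and A: "A \<in> sets env_space"
  shows "emeasure N {s. om p s \<in> A \<and> W p s \<in> cyl x n} =
    (\<integral>\<^sup>+\<omega>. (if x 0 = 0 then ennreal (\<Prod>k<n. pmf (\<omega> (x k)) (x (Suc k) - x k)) else 0) * indicator A \<omega>
      \<partial>env_law (two_point_law \<gamma>1 \<gamma>2 p))"
  using A
proof (induction n arbitrary: A)
  case 0
  let ?E = "env_law (two_point_law \<gamma>1 \<gamma>2 p)"
  show ?case
  proof (cases "x 0 = 0")
    case True
    have "emeasure N {s. om p s \<in> A \<and> W p s \<in> cyl x 0} = emeasure (distr N env_space (om p)) A"
      using True 0 by (subst emeasure_distr) (auto simp: cyl_def vimage_def)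
    then show ?thesis using True 0 by (simp add: distr_om[OF p])
  next
    case False
    then have e: "{s. om p s \<in> A \<and> W p s \<in> cyl x 0} = {}" by (auto simp: cyl_def)
    show ?thesis unfolding e using False by simp
  qed
next
  case (Suc n)
  let ?E = "env_law (two_point_law \<gamma>1 \<gamma>2 p)"
  let ?w = "\<lambda>n \<omega>. (if x 0 = 0 then ennreal (\<Prod>k<n. pmf (\<omega> (x k)) (x (Suc k) - x k)) else 0)"
  let ?A = "\<lambda>c. {\<omega>. \<omega> \<in> A \<and> \<omega> (x n) = law c}"
  have comp: "(\<lambda>\<omega>. \<omega> y) \<in> env_space \<rightarrow>\<^sub>M count_space UNIV" for y :: "int^'d" unfolding env_space_def by simp
  have mA: "?A c \<in> sets env_space" for c
  proof -
    have "{\<omega>. \<omega> (x n) = law c} \<in> sets env_space"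
      using measurable_sets[OF comp, of "{law c}" "x n"] by (simp add: vimage_def)
    from sets.Int[OF Suc.prems this] show ?thesis by (simp add: Int_def)
  qed
  have mw: "?w n \<in> borel_measurable ?E" for n
  proof -
    have "(\<lambda>\<omega>. pmf (\<omega> (x k)) (x (Suc k) - x k)) \<in> borel_measurable env_space" for k
      by (rule measurable_compose[OF comp]) simp
    then have "(\<lambda>\<omega>. ennreal (\<Prod>k<n. pmf (\<omega> (x k)) (x (Suc k) - x k))) \<in> borel_measurable env_space"
      by (intro measurable_compose[OF borel_measurable_prod measurable_ennreal])
    then show ?thesis by (cases "x 0 = 0") (simp_all add: measurable_cong_sets[OF sets_env_law refl])
  qed
  have mW: "{s. om p s \<in> B \<and> W p s \<in> cyl x m} \<in> sets N" if "B \<in> sets env_space" for B m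
    using sets.Int[OF sets_om[OF that, of p] sets_W[OF sets_cyl[of x m], of p]] by (simp add: Int_def)
  have law_om: "om p s y = law True \<or> om p s y = law False" for s y
    unfolding om_def by (cases "label s y < p") simp_all
  have law_ne: "law True \<noteq> law False" using neq by (simp add: law_def)
  have split: "{s. om p s \<in> A \<and> W p s \<in> cyl x (Suc n)} =
    {s. om p s \<in> ?A True \<and> W p s \<in> cyl x (Suc n)} \<union> {s. om p s \<in> ?A False \<and> W p s \<in> cyl x (Suc n)}"
    using law_om by auto
  have "emeasure N {s. om p s \<in> A \<and> W p s \<in> cyl x (Suc n)} =
    emeasure N {s. om p s \<in> ?A True \<and> W p s \<in> cyl x (Suc n)} + emeasure N {s. om p s \<in> ?A False \<and> W p s \<in> cyl x (Suc n)}"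
    unfolding split using law_ne by (intro plus_emeasure[symmetric] mW mA) auto
  also have "\<dots> = (\<integral>\<^sup>+\<omega>. ?w n \<omega> * indicator (?A True) \<omega> \<partial>?E) * pmf (law True) (x (Suc n) - x n) +
     (\<integral>\<^sup>+\<omega>. ?w n \<omega> * indicator (?A False) \<omega> \<partial>?E) * pmf (law False) (x (Suc n) - x n)"
  proof -
    have "emeasure N {s. om p s \<in> ?A c \<and> W p s \<in> cyl x (Suc n)} =
        (\<integral>\<^sup>+\<omega>. ?w n \<omega> * indicator (?A c) \<omega> \<partial>?E) * pmf (law c) (x (Suc n) - x n)" for c
      using walk_step_law[OF Suc.prems, of p x n c] Suc.IH[OF mA[of c]] by simp
    then show ?thesis by simp
  qed
  also have "\<dots> = (\<integral>\<^sup>+\<omega>. ?w n \<omega> * indicator (?A True) \<omega> * pmf (law True) (x (Suc n) - x n) +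
     ?w n \<omega> * indicator (?A False) \<omega> * pmf (law False) (x (Suc n) - x n) \<partial>?E)"
  proof -
    have mi: "(\<lambda>\<omega>. ?w n \<omega> * indicator (?A c) \<omega>) \<in> borel_measurable ?E" for c
      using mw[of n] mA[of c] by (intro borel_measurable_times_ennreal borel_measurable_indicator) simp_all
    then show ?thesis
      by (subst nn_integral_add) (auto simp: nn_integral_multc intro!: borel_measurable_times_ennreal)
  qed
  also have "\<dots> = (\<integral>\<^sup>+\<omega>. ?w (Suc n) \<omega> * indicator A \<omega> \<partial>?E)"
  proof (rule nn_integral_cong_AE)
    have "AE \<omega> in ?E. \<omega> (x n) \<in> set_pmf (two_point_law \<gamma>1 \<gamma>2 p)"
      unfolding env_law_def by (rule AE_PiM_component) (simp_all add: prob_space_measure_pmf AE_measure_pmf)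
    then show "AE \<omega> in ?E. ?w n \<omega> * indicator (?A True) \<omega> * pmf (law True) (x (Suc n) - x n) +
        ?w n \<omega> * indicator (?A False) \<omega> * pmf (law False) (x (Suc n) - x n) = ?w (Suc n) \<omega> * indicator A \<omega>"
    proof eventually_elim
      case (elim \<omega>)
      then have "\<omega> (x n) = law True \<or> \<omega> (x n) = law False"
        by (auto simp: two_point_law_def law_def split: if_splits)
      then show ?case using law_ne
        by (auto simp: indicator_def ennreal_mult prod_nonneg)
    qed
  qed
  finally show ?case .
qed

theorem coupled_law:
  assumes p: "0 \<le> p" "p \<le> 1"
  shows "(\<lambda>s. (om p s, W p s)) \<in> N \<rightarrow>\<^sub>M env_space \<Otimes>\<^sub>M path_space"
    and "distr N (env_space \<Otimes>\<^sub>M path_space) (\<lambda>s. (om p s, W p s)) = annealed_law (two_point_law \<gamma>1 \<gamma>2 p)"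
proof -
  let ?\<mu> = "two_point_law \<gamma>1 \<gamma>2 p"
  let ?L = "distr N (env_space \<Otimes>\<^sub>M path_space) (\<lambda>s. (om p s, W p s))"
  show m: "(\<lambda>s. (om p s, W p s)) \<in> N \<rightarrow>\<^sub>M env_space \<Otimes>\<^sub>M path_space"
    by (rule measurable_Pair[OF measurable_om measurable_W])
  have mK: "(\<lambda>\<omega>. distr (quenched_law \<omega>) (env_space \<Otimes>\<^sub>M path_space) (\<lambda>X. (\<omega>, X))) \<in>
      env_law ?\<mu> \<rightarrow>\<^sub>M subprob_algebra (env_space \<Otimes>\<^sub>M path_space)"
    by (rule measurable_distr2[where f=Pair and M=path_space]) measurable
  have sA: "sets (annealed_law ?\<mu>) = sets (env_space \<Otimes>\<^sub>M path_space :: ('d env \<times> 'd path) measure)"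
    unfolding annealed_law_def by (rule sets_bind) auto
  have sp: "space (env_space \<Otimes>\<^sub>M path_space :: ('d env \<times> 'd path) measure) = UNIV"
    by (simp add: space_pair_measure)
  \<comment> \<open>With \<open>A\<close> fixed, both sides are finite measures in the path alone,
    and cylinders determine them.\<close>
  have fixA: "emeasure ?L (A \<times> B) = emeasure (annealed_law ?\<mu>) (A \<times> B)"
    if A: "A \<in> sets env_space" and B: "B \<in> sets path_space" for A B
  proof -
    let ?R = "\<lambda>M. distr (density M (indicator (A \<times> UNIV))) path_space snd"
    have AU: "A \<times> UNIV \<in> sets (env_space \<Otimes>\<^sub>M path_space :: ('d env \<times> 'd path) measure)"
      using A by (intro pair_measureI) auto
    have em: "emeasure (?R M) B = emeasure M (A \<times> B)"
      if M: "sets M = sets (env_space \<Otimes>\<^sub>M path_space)" and B: "B \<in> sets path_space" for M and B :: "'d path set"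
    proof -
      have spM: "space M = UNIV" using sets_eq_imp_space_eq[OF M] sp by simp
      have UB: "UNIV \<times> B \<in> sets M" unfolding M using B by (intro pair_measureI) (auto intro: sets.top[of env_space, simplified])
      have "snd \<in> density M (indicator (A \<times> UNIV)) \<rightarrow>\<^sub>M path_space"
        by (simp add: measurable_cong_sets[OF M refl])
      then have "emeasure (?R M) B = emeasure (density M (indicator (A \<times> UNIV))) (UNIV \<times> B)"
        using B by (subst emeasure_distr) (auto simp: spM intro!: arg_cong2[where f=emeasure])
      also have "\<dots> = emeasure M ((A \<times> UNIV) \<inter> (UNIV \<times> B))"
        using UB AU M by (subst emeasure_density) (auto simp: indicator_inter_arith[symmetric])
      finally show ?thesis by (simp add: Times_Int_Times)
    qed
    have "?R ?L = ?R (annealed_law ?\<mu>)"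
    proof (rule path_measure_eqI)
      show "finite_measure (?R ?L)"
      proof (rule finite_measureI)
        have "emeasure (?R ?L) UNIV \<le> emeasure N UNIV"
          using em[of ?L UNIV] A emeasure_space[of N "(\<lambda>s. (om p s, W p s)) -` (A \<times> UNIV)"]
          by (simp add: emeasure_distr[OF m AU])
        also have "\<dots> = 1" using N.emeasure_space_1 by simp
        finally show "emeasure (?R ?L) (space (?R ?L)) \<noteq> \<infinity>" by (auto simp: top_unique)
      qed
      fix x :: "'d path" and n
      have AC: "A \<times> cyl x n \<in> sets (env_space \<Otimes>\<^sub>M path_space)" using A by (intro pair_measureI) auto
      have "emeasure ?L (A \<times> cyl x n) = emeasure N {s. om p s \<in> A \<and> W p s \<in> cyl x n}"
        using AC by (subst emeasure_distr[OF m]) (auto simp: vimage_def)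
      also have "\<dots> = emeasure (annealed_law ?\<mu>) (A \<times> cyl x n)"
        using annealed_law_cylinder[OF A, of ?\<mu> n x] walk_cyl_law[OF p A, of x n] by (simp add: cyl_def)
      finally show "emeasure (?R ?L) (cyl x n) = emeasure (?R (annealed_law ?\<mu>)) (cyl x n)"
        using em[of ?L "cyl x n"] em[of "annealed_law ?\<mu>" "cyl x n", OF sA] by simp
    qed simp_all
    then show ?thesis
      using em[of ?L B, OF _ B] em[of "annealed_law ?\<mu>" B, OF sA B] by simp
  qed
  show "?L = annealed_law ?\<mu>"
  proof (rule measure_eqI_generator_eq[where \<Omega> = UNIV and E = "{a \<times> b | a b. a \<in> sets env_space \<and> b \<in> sets path_space}" and A = "\<lambda>_. UNIV"])
    show "Int_stable {a \<times> b | a b. a \<in> sets (env_space :: 'd env measure) \<and> b \<in> sets (path_space :: 'd path measure)}"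
      by (rule Int_stable_pair_measure_generator)
    show "sets ?L = sigma_sets UNIV {a \<times> b | a b. a \<in> sets env_space \<and> b \<in> sets path_space}"
      by (simp add: sets_pair_measure)
    then show "sets (annealed_law ?\<mu>) = sigma_sets UNIV {a \<times> b | a b. a \<in> sets env_space \<and> b \<in> sets path_space}"
      using sA by simp
    show "range (\<lambda>_. UNIV) \<subseteq> {a \<times> b | a b. a \<in> sets (env_space :: 'd env measure) \<and> b \<in> sets (path_space :: 'd path measure)}"
      using sets.top[of "env_space :: 'd env measure"] by (force simp: UNIV_Times_UNIV[symmetric] simp del: UNIV_Times_UNIV)
    show "emeasure ?L UNIV \<noteq> \<infinity>"
    proof -
      interpret L: prob_space ?L by (rule N.prob_space_distr[OF m])
      show ?thesis using L.emeasure_space_1 sp by simp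
    qed
    show "emeasure ?L X = emeasure (annealed_law ?\<mu>) X" if "X \<in> {a \<times> b | a b. a \<in> sets env_space \<and> b \<in> sets path_space}" for X
      using that fixA by auto
  qed auto
qed

section \<open>Concentration for the stack entries\<close>

lemma law_step: "law c \<in> step_laws"
  using step1 step2 by (simp add: law_def)

lemma law_support: "e \<in> set_pmf (law c) \<Longrightarrow> e \<in> unit_vectors"
  using law_step[of c] by (auto simp: step_laws_def)

definition drift :: "'d \<Rightarrow> bool \<Rightarrow> real" where "drift i c = local_drift (law c) $ i"

lemma finite_unit_vectors: "finite (unit_vectors :: (int^'d) set)"
  by (simp add: unit_vectors_def)

lemma unit_vector_component_le: "e \<in> unit_vectors \<Longrightarrow> \<bar>(e :: int^'d) $ i\<bar> \<le> 1"
  by (auto simp: unit_vectors_def axis_def)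

lemma drift_expectation: "drift i c = measure_pmf.expectation (law c) (\<lambda>e. real_of_int (e $ i))"
proof -
  have "measure_pmf.expectation (law c) (\<lambda>e. real_of_int (e $ i)) = (\<Sum>e\<in>unit_vectors. pmf (law c) e * real_of_int (e $ i))"
    using law_support[of _ c] by (subst integral_measure_pmf[OF finite_unit_vectors]) auto
  then show ?thesis by (simp add: drift_def local_drift_def rvec_def)
qed

text \<open>The component lies in an interval of length 2, so the exponent
  \<open>t ^ 2 * 2 ^ 2 / 8\<close> of Hoeffding's lemma is \<open>t ^ 2 / 2\<close>.\<close>

lemma hoeffding_step:
  assumes t: "0 < t" and \<sigma>: "\<sigma> = 1 \<or> \<sigma> = (-1 :: real)"
  shows "(\<integral>\<^sup>+e. ennreal (exp (t * (\<sigma> * (real_of_int (e $ i) - drift i c)))) \<partial>law c) \<le> ennreal (exp (t\<^sup>2 / 2))"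
proof -
  have bd: "AE e in law c. \<sigma> * real_of_int (e $ i) \<in> {-1..1}"
    using law_support[of _ c] unit_vector_component_le[of _ i] \<sigma> by (fastforce simp: AE_measure_pmf_iff abs_le_iff)
  interpret interval_bounded_random_variable "measure_pmf (law c)" "\<lambda>e. \<sigma> * real_of_int (e $ i)" "-1" 1
    by unfold_locales (use bd in auto)
  show ?thesis
    using Hoeffdings_lemma_nn_integral[OF t] by (simp add: right_diff_distrib drift_expectation)
qed

lemma nn_integral_stack:
  "(\<integral>\<^sup>+s. h (stack s c j) \<partial>N) = (\<integral>\<^sup>+e. h e \<partial>law c)" for h :: "int^'d \<Rightarrow> ennreal"
  by (subst distr_stack[symmetric, of c j], subst nn_integral_distr) auto

definition fluct :: "'d \<Rightarrow> bool \<Rightarrow> nat \<Rightarrow> nat \<Rightarrow> 'd sample \<Rightarrow> real" where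
  "fluct i c a k s = (\<Sum>j<k. real_of_int (stack s c (a + j) $ i) - drift i c)"

lemma measurable_stack_comp [measurable]: "(\<lambda>s. real_of_int (stack s c j $ i)) \<in> borel_measurable N"
  by (rule measurable_compose[OF measurable_stack]) simp

lemma measurable_fluct [measurable]: "fluct i c a k \<in> borel_measurable N"
  unfolding fluct_def[abs_def] by measurable

text \<open>The event \<open>B\<close> may depend on everything except the stack entries from \<open>a\<close> on, so this bound
  applies at a random starting index.\<close>

lemma chernoff:
  assumes B: "B \<in> sets N" and \<delta>: "0 < \<delta>" and \<sigma>: "\<sigma> = 1 \<or> \<sigma> = (-1 :: real)"
    and BJ: "\<And>s s'. (\<And>x. s (Inl x) = s' (Inl x)) \<Longrightarrow> (\<And>b j. b \<noteq> c \<or> j < a \<Longrightarrow> s (Inr (b, j)) = s' (Inr (b, j))) \<Longrightarrow> s \<in> B \<Longrightarrow> s' \<in> B"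
  shows "emeasure N (B \<inter> {s. \<delta> * real k \<le> \<sigma> * fluct i c a k s}) \<le> emeasure N B * ennreal (exp (- (\<delta>\<^sup>2 / 2)) ^ k)"
proof -
  let ?h = "\<lambda>e. ennreal (exp (\<delta> * (\<sigma> * (real_of_int (e $ i) - drift i c))))"
  have mh: "(\<lambda>s. ?h (stack s c j)) \<in> borel_measurable N" for j
    by (rule measurable_compose[OF measurable_stack]) simp
  \<comment> \<open>Entry \<open>a + k\<close> is independent of \<open>B\<close> and of the entries
    before it, so every further entry costs one Hoeffding factor.\<close>
  have E: "(\<integral>\<^sup>+s. indicator B s * (\<Prod>j<k. ?h (stack s c (a + j))) \<partial>N) \<le> emeasure N B * ennreal (exp (\<delta>\<^sup>2 / 2)) ^ k" for k
  proof (induction k)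
    case 0
    then show ?case using B by simp
  next
    case (Suc k)
    have "(\<integral>\<^sup>+s. indicator B s * (\<Prod>j<Suc k. ?h (stack s c (a + j))) \<partial>N) =
      (\<integral>\<^sup>+s. (indicator B s * (\<Prod>j<k. ?h (stack s c (a + j)))) * ?h (stack s c (a + k)) \<partial>N)"
      by (simp add: mult.assoc)
    also have "\<dots> = (\<integral>\<^sup>+s. indicator B s * (\<Prod>j<k. ?h (stack s c (a + j))) \<partial>N) * (\<integral>\<^sup>+s. ?h (stack s c (a + k)) \<partial>N)"
    proof (rule nn_integral_indep[where J = "{Inr (c, a + k)}"])
      show "(\<lambda>s. indicator B s * (\<Prod>j<k. ?h (stack s c (a + j)))) \<in> borel_measurable N"
        using B mh by (intro borel_measurable_times_ennreal borel_measurable_prod_ennreal borel_measurable_indicator)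
      show "(\<lambda>s. ?h (stack s c (a + k))) \<in> borel_measurable N" by (rule mh)
      fix s s' :: "'d sample"
      show "indicator B s * (\<Prod>j<k. ?h (stack s c (a + j))) = indicator B s' * (\<Prod>j<k. ?h (stack s' c (a + j)))"
        if e: "\<And>i. i \<notin> {Inr (c, a + k)} \<Longrightarrow> s i = s' i"
      proof (intro arg_cong2[where f = "(*)"] prod.cong refl)
        have e': "s (Inl x) = s' (Inl x)" "b \<noteq> c \<or> j < a \<Longrightarrow> s (Inr (b, j)) = s' (Inr (b, j))" for x b j
          by (rule e, simp) (rule e, auto)
        have "s \<in> B \<longleftrightarrow> s' \<in> B"
        proof
          show "s' \<in> B" if "s \<in> B" using e' that by (rule BJ)
          show "s \<in> B" if "s' \<in> B" using e'[symmetric] that by (rule BJ)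
        qed
        then show "indicator B s = (indicator B s' :: ennreal)" by (simp add: indicator_def)
        show "?h (stack s c (a + j)) = ?h (stack s' c (a + j))" if "j \<in> {..<k}" for j
          using that e[of "Inr (c, a + j)"] by (simp add: stack_def)
      qed
      show "?h (stack s c (a + k)) = ?h (stack s' c (a + k))" if "\<And>i. i \<in> {Inr (c, a + k)} \<Longrightarrow> s i = s' i"
        using that by (simp add: stack_def)
    qed
    also have "\<dots> \<le> (emeasure N B * ennreal (exp (\<delta>\<^sup>2 / 2)) ^ k) * ennreal (exp (\<delta>\<^sup>2 / 2))"
      unfolding nn_integral_stack[of ?h] by (intro mult_mono Suc hoeffding_step \<delta> \<sigma>) auto
    finally show ?case by (simp add: mult_ac)
  qed
  \<comment> \<open>Exponential Markov inequality with parameter \<open>\<delta>\<close>: the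
    threshold contributes the exponent \<open>- \<delta> ^ 2 * k\<close>, the moment bound only
    \<open>\<delta> ^ 2 * k / 2\<close>.\<close>
  let ?c = "exp (- (\<delta>\<^sup>2)) ^ k"
  have sets: "B \<inter> {s. \<delta> * real k \<le> \<sigma> * fluct i c a k s} \<in> sets N"
  proof -
    have "{s \<in> space N. \<delta> * real k \<le> \<sigma> * fluct i c a k s} \<in> sets N" by measurable
    with B show ?thesis by auto
  qed
  have "emeasure N (B \<inter> {s. \<delta> * real k \<le> \<sigma> * fluct i c a k s}) =
     (\<integral>\<^sup>+s. indicator (B \<inter> {s. \<delta> * real k \<le> \<sigma> * fluct i c a k s}) s \<partial>N)"
    using sets by simp
  also have "\<dots> \<le> (\<integral>\<^sup>+s. ennreal ?c * (indicator B s * (\<Prod>j<k. ?h (stack s c (a + j)))) \<partial>N)"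
  proof (rule nn_integral_mono)
    fix s
    show "indicator (B \<inter> {s. \<delta> * real k \<le> \<sigma> * fluct i c a k s}) s \<le> ennreal ?c * (indicator B s * (\<Prod>j<k. ?h (stack s c (a + j))))"
    proof (cases "s \<in> B \<and> \<delta> * real k \<le> \<sigma> * fluct i c a k s")
      case True
      have "(\<Prod>j<k. ?h (stack s c (a + j))) = ennreal (exp (\<delta> * (\<sigma> * fluct i c a k s)))"
        by (subst prod_ennreal) (simp_all add: exp_sum[symmetric] fluct_def sum_distrib_left)
      moreover have "1 \<le> ?c * exp (\<delta> * (\<sigma> * fluct i c a k s))"
      proof -
        have "?c = exp (- (\<delta> * (\<delta> * real k)))" by (simp add: exp_of_nat_mult[symmetric] power2_eq_square mult_ac)
        moreover have "\<delta> * (\<delta> * real k) \<le> \<delta> * (\<sigma> * fluct i c a k s)" using True \<delta> by (intro mult_left_mono) auto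
        ultimately show ?thesis by (simp add: exp_add[symmetric])
      qed
      ultimately show ?thesis using True by (simp add: ennreal_mult[symmetric])
    qed auto
  qed
  also have "\<dots> = ennreal ?c * (\<integral>\<^sup>+s. indicator B s * (\<Prod>j<k. ?h (stack s c (a + j))) \<partial>N)"
    using B mh by (intro nn_integral_cmult borel_measurable_times_ennreal borel_measurable_prod_ennreal borel_measurable_indicator)
  also have "\<dots> \<le> ennreal ?c * (emeasure N B * ennreal (exp (\<delta>\<^sup>2 / 2)) ^ k)"
    by (intro mult_left_mono E) simp
  also have "\<dots> = emeasure N B * (ennreal ?c * ennreal (exp (\<delta>\<^sup>2 / 2) ^ k))"
    by (simp add: ennreal_power mult_ac)
  also have "ennreal ?c * ennreal (exp (\<delta>\<^sup>2 / 2) ^ k) = ennreal (exp (- (\<delta>\<^sup>2 / 2)) ^ k)"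
  proof -
    have "exp (- (\<delta>\<^sup>2)) * exp (\<delta>\<^sup>2 / 2) = exp (- (\<delta>\<^sup>2 / 2))" by (simp add: exp_add[symmetric])
    then show ?thesis by (simp add: ennreal_mult[symmetric] power_mult_distrib[symmetric])
  qed
  finally show ?thesis .
qed

text \<open>The Chernoff bound with \<open>B = UNIV\<close>, for either sign and every
  \<open>1 / Suc m\<close>, is summable in \<open>n\<close>, so Borel-Cantelli applies.\<close>

lemma stack_slln: "AE s in N. \<forall>i c. (\<lambda>n. fluct i c 0 n s / real n) \<longlonglongrightarrow> 0"
proof -
  have "AE s in N. \<forall>\<^sub>F n in sequentially. \<sigma> * fluct i c 0 n s < \<delta> * real n"
    if \<delta>: "0 < \<delta>" and \<sigma>: "\<sigma> = 1 \<or> \<sigma> = -1" for i c \<sigma> \<delta>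
  proof -
    let ?E = "\<lambda>n. {s. \<delta> * real n \<le> \<sigma> * fluct i c 0 n s}"
    have mE: "?E n \<in> sets N" for n
    proof -
      have "{s \<in> space N. \<delta> * real n \<le> \<sigma> * fluct i c 0 n s} \<in> sets N" by measurable
      then show ?thesis by simp
    qed
    have "N.prob (?E n) \<le> exp (- (\<delta>\<^sup>2 / 2)) ^ n" for n
    proof -
      have "emeasure N (UNIV \<inter> ?E n) \<le> emeasure N UNIV * ennreal (exp (- (\<delta>\<^sup>2 / 2)) ^ n)"
        using sets.top[of N] by (intro chernoff \<delta> \<sigma>) auto
      then show ?thesis
        using N.emeasure_space_1 by (simp add: N.emeasure_eq_measure)
    qed
    then have b: "norm (N.prob (?E n)) \<le> exp (- (\<delta>\<^sup>2 / 2)) ^ n" for n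
      by (simp only: real_norm_def abs_of_nonneg[OF measure_nonneg])
    have "summable (\<lambda>n. exp (- (\<delta>\<^sup>2 / 2)) ^ n)"
      using \<delta> by (intro summable_geometric) simp
    then have "summable (\<lambda>n. N.prob (?E n))"
      by (rule summable_comparison_test[OF exI[of _ 0], rotated]) (intro allI impI b)
    then have "AE s in N. \<forall>\<^sub>F n in sequentially. s \<in> space N - ?E n"
      by (intro borel_cantelli_AE1 mE) (simp_all only: N.emeasure_eq_measure ennreal_less_top infinity_ennreal_def)
    then show ?thesis
    proof eventually_elim
      case (elim s)
      then show ?case by eventually_elim (simp add: not_le)
    qed
  qed
  note ev = this
  have "AE s in N. \<forall>\<^sub>F n in sequentially. \<bar>fluct i c 0 n s\<bar> < 1 / real (Suc m) * real n" for i c m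
  proof -
    have pos: "0 < 1 / real (Suc m)" by simp
    from ev[OF pos, of 1 i c] ev[OF pos, of "-1" i c]
    have "AE s in N. \<forall>\<^sub>F n in sequentially. 1 * fluct i c 0 n s < 1 / real (Suc m) * real n"
      "AE s in N. \<forall>\<^sub>F n in sequentially. -1 * fluct i c 0 n s < 1 / real (Suc m) * real n" by blast+
    then show ?thesis
    proof eventually_elim
      case (elim s)
      then show ?case by eventually_elim linarith
    qed
  qed
  then have "AE s in N. \<forall>i c m. \<forall>\<^sub>F n in sequentially. \<bar>fluct i c 0 n s\<bar> < 1 / real (Suc m) * real n"
    by (simp only: AE_all_countable) blast
  then show ?thesis
  proof eventually_elim
    case (elim s)
    show ?case
    proof (intro allI tendstoI)
      fix i c and r :: real assume "0 < r"
      then obtain m where m: "1 / real (Suc m) < r" using nat_approx_posE by metis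
      show "\<forall>\<^sub>F n in sequentially. dist (fluct i c 0 n s / real n) 0 < r"
        using elim[rule_format, of i c m] eventually_gt_at_top[of 0]
      proof eventually_elim
        case (elim n)
        note elim(1)
        also have "1 / real (Suc m) * real n < r * real n" using m elim by (intro mult_strict_right_mono) auto
        finally show ?case using elim by (simp add: field_simps)
      qed
    qed
  qed
qed

section \<open>Comparison of velocities and of directions\<close>

lemma pos_component:
  "real_of_int (pos s a b $ i) = fluct i True 0 a s + fluct i False 0 b s + drift i True * real a + drift i False * real b"
  by (simp add: pos_def stack_sum_def fluct_def sum_subtractf)

text \<open>The index \<open>k n\<close> may stay bounded. While it is below \<open>M\<close>, the
  values of \<open>f\<close> are bounded by a constant that is negligible against \<open>n\<close>;
  once it is large, \<open>k n \<le> n\<close> carries the estimate over.\<close>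

lemma sublinear_subsequence:
  fixes f :: "nat \<Rightarrow> real"
  assumes f: "(\<lambda>n. f n / real n) \<longlonglongrightarrow> 0" and f0: "f 0 = 0" and k: "\<And>n. k n \<le> n"
  shows "(\<lambda>n. f (k n) / real n) \<longlonglongrightarrow> 0"
proof (rule tendstoI)
  fix r :: real assume r: "0 < r"
  have "\<forall>\<^sub>F n in sequentially. \<bar>f n / real n\<bar> < r / 2"
    using tendstoD[OF f, of "r / 2"] r by simp
  then obtain M where M: "\<And>n. M \<le> n \<Longrightarrow> \<bar>f n / real n\<bar> < r / 2" by (auto simp: eventually_sequentially)
  define C where "C = (\<Sum>m<M. \<bar>f m\<bar>)"
  have C: "\<bar>f m\<bar> \<le> C" if "m < M" for m unfolding C_def using that by (intro member_le_sum) auto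
  have "(\<lambda>n. C / real n) \<longlonglongrightarrow> 0" by (rule lim_const_over_n)
  then have "\<forall>\<^sub>F n in sequentially. \<bar>C / real n\<bar> < r / 2" using r by (auto dest: tendstoD[of _ _ _ "r / 2"])
  then show "\<forall>\<^sub>F n in sequentially. dist (f (k n) / real n) 0 < r"
    using eventually_gt_at_top[of 0]
  proof eventually_elim
    case (elim n)
    show ?case
    proof (cases "k n < M")
      case True
      then have "\<bar>f (k n)\<bar> / real n \<le> C / real n" by (intro divide_right_mono C) auto
      moreover have "C / real n < r / 2" using elim by (simp only: abs_less_iff)
      ultimately have "\<bar>f (k n)\<bar> / real n < r" using r by linarith
      then show ?thesis by simp
    next
      case False
      then have *: "\<bar>f (k n) / real (k n)\<bar> < r / 2" by (intro M) auto
      have "\<bar>f (k n)\<bar> / real n \<le> r / 2"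
      proof (cases "k n = 0")
        case False
        then have "\<bar>f (k n)\<bar> < r / 2 * real (k n)" using * by (simp add: field_simps)
        also have "\<dots> \<le> r / 2 * real n" using k[of n] r by (intro mult_left_mono) auto
        finally show ?thesis using elim by (simp add: field_simps)
      qed (use f0 r in simp)
      then have "\<bar>f (k n)\<bar> / real n < r" using r by linarith
      then show ?thesis by simp
    qed
  qed
qed

text \<open>Divided by \<open>n\<close>, the stack fluctuations vanish and leave a mixture of the
  two drifts with weight \<open>cnt p s n / n\<close>. The statement keeps the weight inside the
  limit, because its own limit is not determined when the drift difference is orthogonal to
  \<open>u\<close>.\<close>

lemma velocity_mixture:
  assumes s: "\<forall>i c. (\<lambda>n. fluct i c 0 n s / real n) \<longlonglongrightarrow> 0" and conv: "convergent (mean_velocity (W p s))"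
  shows "(\<lambda>n. local_drift \<gamma>2 \<bullet> u + real (cnt p s n) / real n * ((local_drift \<gamma>1 - local_drift \<gamma>2) \<bullet> u)) \<longlonglongrightarrow> velocity (W p s) \<bullet> u"
proof -
  have V: "mean_velocity (W p s) \<longlonglongrightarrow> velocity (W p s)"
    using conv by (simp add: velocity_def convergent_LIMSEQ_iff)
  have comp: "(\<lambda>n. local_drift \<gamma>2 $ i + real (cnt p s n) / real n * (local_drift \<gamma>1 $ i - local_drift \<gamma>2 $ i)) \<longlonglongrightarrow> velocity (W p s) $ i" for i
  proof -
    have f0: "fluct i c 0 0 s = 0" for c by (simp add: fluct_def)
    have "(\<lambda>n. fluct i True 0 (cnt p s n) s / real n) \<longlonglongrightarrow> 0"
      by (rule sublinear_subsequence[OF s[rule_format, of i True] f0 cnt_le])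
    moreover have "(\<lambda>n. fluct i False 0 (n - cnt p s n) s / real n) \<longlonglongrightarrow> 0"
      by (rule sublinear_subsequence[OF s[rule_format, of i False] f0 diff_le_self])
    ultimately have "(\<lambda>n. fluct i True 0 (cnt p s n) s / real n + fluct i False 0 (n - cnt p s n) s / real n) \<longlonglongrightarrow> 0 + 0"
      by (rule tendsto_add)
    from tendsto_diff[OF tendsto_vec_nth[OF V, of i] this]
    have "(\<lambda>n. mean_velocity (W p s) n $ i - (fluct i True 0 (cnt p s n) s / real n + fluct i False 0 (n - cnt p s n) s / real n))
        \<longlonglongrightarrow> velocity (W p s) $ i" by simp
    moreover have "\<forall>\<^sub>F n in sequentially. mean_velocity (W p s) n $ i - (fluct i True 0 (cnt p s n) s / real n + fluct i False 0 (n - cnt p s n) s / real n)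
        = local_drift \<gamma>2 $ i + real (cnt p s n) / real n * (local_drift \<gamma>1 $ i - local_drift \<gamma>2 $ i)"
      using eventually_gt_at_top[of 0]
    proof eventually_elim
      case (elim n)
      have "real (n - cnt p s n) = real n - real (cnt p s n)" using cnt_le[of p s n] by simp
      then show ?case using elim
        by (simp add: mean_velocity_def rvec_def W_def pos_component drift_def law_def field_simps)
    qed
    ultimately show ?thesis by (simp add: tendsto_cong)
  qed
  have "(\<lambda>n. \<Sum>i\<in>UNIV. (local_drift \<gamma>2 $ i + real (cnt p s n) / real n * (local_drift \<gamma>1 $ i - local_drift \<gamma>2 $ i)) * u $ i)
     \<longlonglongrightarrow> (\<Sum>i\<in>UNIV. velocity (W p s) $ i * u $ i)"
    by (intro tendsto_sum tendsto_mult comp tendsto_const)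
  moreover have "(\<Sum>i\<in>UNIV. (local_drift \<gamma>2 $ i + c * (local_drift \<gamma>1 $ i - local_drift \<gamma>2 $ i)) * u $ i)
     = local_drift \<gamma>2 \<bullet> u + c * ((local_drift \<gamma>1 - local_drift \<gamma>2) \<bullet> u)" for c
    by (simp add: inner_vec_def distrib_right sum.distrib sum_distrib_left mult.assoc)
  ultimately show ?thesis by (simp only: inner_vec_def inner_real_def)
qed

lemma velocity_compare:
  assumes pp: "p \<le> p'" and s: "\<forall>i c. (\<lambda>n. fluct i c 0 n s / real n) \<longlonglongrightarrow> 0"
    and conv: "convergent (mean_velocity (W p s))" "convergent (mean_velocity (W p' s))"
    and u: "0 \<le> (local_drift \<gamma>1 - local_drift \<gamma>2) \<bullet> u"
  shows "velocity (W p s) \<bullet> u \<le> velocity (W p' s) \<bullet> u"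
proof (rule LIMSEQ_le[OF velocity_mixture[OF s conv(1)] velocity_mixture[OF s conv(2)]])
  show "\<exists>N. \<forall>n\<ge>N. local_drift \<gamma>2 \<bullet> u + real (cnt p s n) / real n * ((local_drift \<gamma>1 - local_drift \<gamma>2) \<bullet> u)
      \<le> local_drift \<gamma>2 \<bullet> u + real (cnt p' s n) / real n * ((local_drift \<gamma>1 - local_drift \<gamma>2) \<bullet> u)"
    using cnt_coupled[OF pp] u by (intro exI[of _ 0] allI impI add_left_mono mult_right_mono divide_right_mono) auto
qed

lemma pos_difference:
  assumes "a \<le> a'" "b' \<le> b"
  shows "pos s a' b' - pos s a b = (\<Sum>j\<in>{a..<a'}. stack s True j) - (\<Sum>j\<in>{b'..<b}. stack s False j)"
proof -
  have "stack_sum s c n = stack_sum s c m + (\<Sum>j\<in>{m..<n}. stack s c j)" if "m \<le> n" for c m n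
    using sum.atLeastLessThan_concat[of 0 m n "stack s c"] that by (simp add: stack_sum_def atLeast0LessThan)
  from this[OF assms(1), of True] this[OF assms(2), of False] show ?thesis by (simp add: pos_def)
qed

lemma rvec_inner_axis: "rvec f \<bullet> rvec (axis i 1) = real_of_int (f $ i)" "rvec f \<bullet> rvec (- axis i 1) = - real_of_int (f $ i)"
proof -
  have "rvec (axis i 1) = axis i 1" "rvec (- axis i 1) = - axis i 1"
    by (simp_all add: rvec_def axis_def vec_eq_iff)
  then show "rvec f \<bullet> rvec (axis i 1) = real_of_int (f $ i)" "rvec f \<bullet> rvec (- axis i 1) = - real_of_int (f $ i)"
    by (simp_all add: inner_axis rvec_def)
qed

lemma unit_vector_component:
  assumes f: "(f :: int^'d) \<in> unit_vectors"
  shows "f $ i = 0 \<or> f = axis i 1 \<and> f $ i = 1 \<or> f = - axis i 1 \<and> f $ i = - 1"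
proof -
  obtain j where "f = axis j 1 \<or> f = - axis j 1" using f by (auto simp: unit_vectors_def)
  then show ?thesis by (cases "j = i") (auto simp: axis_def)
qed

lemma rvec_inner_unit:
  assumes e: "(e :: int^'d) \<in> unit_vectors" and f: "f \<in> unit_vectors"
  shows "f \<noteq> - e \<Longrightarrow> 0 \<le> rvec f \<bullet> rvec e" "f \<noteq> e \<Longrightarrow> rvec f \<bullet> rvec e \<le> 0"
proof -
  obtain i where i: "e = axis i 1 \<or> e = - axis i 1" using e by (auto simp: unit_vectors_def)
  show "f \<noteq> - e \<Longrightarrow> 0 \<le> rvec f \<bullet> rvec e"
    using i unit_vector_component[OF f, of i] by (elim disjE) (simp_all add: rvec_inner_axis)
  show "f \<noteq> e \<Longrightarrow> rvec f \<bullet> rvec e \<le> 0"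
    using i unit_vector_component[OF f, of i] by (elim disjE) (simp_all add: rvec_inner_axis)
qed

lemma rvec_sum: "rvec (sum f A) = (\<Sum>j\<in>A. rvec (f j))" for f :: "'b \<Rightarrow> int^'d"
  by (simp add: rvec_def vec_eq_iff sum_component)

text \<open>Only entries read by one walk and not by the other survive in the difference:
  first-stack steps, none equal to \<open>- e\<close>, minus second-stack steps, none equal to
  \<open>e\<close>. Both contributions along \<open>e\<close> are nonnegative.\<close>

lemma direction_compare:
  assumes pp: "p \<le> p'" and e: "e \<in> unit_vectors" "e \<notin> set_pmf \<gamma>2" "- e \<notin> set_pmf \<gamma>1"
    and s: "\<forall>c j. stack s c j \<in> set_pmf (law c)"
  shows "rvec (W p s n) \<bullet> rvec e \<le> rvec (W p' s n) \<bullet> rvec e"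
proof -
  have T: "0 \<le> rvec (stack s True j) \<bullet> rvec e" for j
  proof -
    have "stack s True j \<in> set_pmf \<gamma>1" using s[rule_format, of True j] by (simp add: law_def)
    then have "stack s True j \<noteq> - e" "stack s True j \<in> unit_vectors" using e s law_support[of _ True] by (auto simp: law_def)
    then show ?thesis by (simp add: rvec_inner_unit[OF e(1)])
  qed
  have F: "rvec (stack s False j) \<bullet> rvec e \<le> 0" for j
  proof -
    have "stack s False j \<in> set_pmf \<gamma>2" using s[rule_format, of False j] by (simp add: law_def)
    then have "stack s False j \<noteq> e" "stack s False j \<in> unit_vectors" using e s law_support[of _ False] by (auto simp: law_def)
    then show ?thesis by (simp add: rvec_inner_unit[OF e(1)])
  qed
  have "rvec (W p' s n) - rvec (W p s n) = rvec (W p' s n - W p s n)" by (simp add: rvec_def vec_eq_iff)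
  also have "W p' s n - W p s n = (\<Sum>j\<in>{cnt p s n..<cnt p' s n}. stack s True j) - (\<Sum>j\<in>{n - cnt p' s n..<n - cnt p s n}. stack s False j)"
    unfolding W_def using cnt_coupled[OF pp, of s n] by (intro pos_difference) auto
  also have "rvec \<dots> = (\<Sum>j\<in>{cnt p s n..<cnt p' s n}. rvec (stack s True j)) - (\<Sum>j\<in>{n - cnt p' s n..<n - cnt p s n}. rvec (stack s False j))"
    by (simp add: rvec_sum[symmetric]) (simp add: rvec_def vec_eq_iff)
  finally have "(rvec (W p' s n) - rvec (W p s n)) \<bullet> rvec e =
    (\<Sum>j\<in>{cnt p s n..<cnt p' s n}. rvec (stack s True j) \<bullet> rvec e) - (\<Sum>j\<in>{n - cnt p' s n..<n - cnt p s n}. rvec (stack s False j) \<bullet> rvec e)"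
    by (simp add: inner_diff_left inner_sum_left)
  moreover have "0 \<le> \<dots>"
    using sum_nonneg[of "{cnt p s n..<cnt p' s n}" "\<lambda>j. rvec (stack s True j) \<bullet> rvec e"] T
      sum_nonpos[of "{n - cnt p' s n..<n - cnt p s n}" "\<lambda>j. rvec (stack s False j) \<bullet> rvec e"] F by simp
  ultimately show ?thesis by (simp add: inner_diff_left)
qed

end

lemma (in finite_measure) AE_tendsto_measure_zero:
  assumes sets: "\<And>n. {s\<in>space M. R n s} \<in> sets M" and mono: "\<And>m n s. m \<le> n \<Longrightarrow> R n s \<Longrightarrow> R m s"
    and AE: "AE s in M. \<exists>n. \<not> R n s"
  shows "(\<lambda>n. measure M {s\<in>space M. R n s}) \<longlonglongrightarrow> 0"
proof -
  have "(\<lambda>n. measure M {s\<in>space M. R n s}) \<longlonglongrightarrow> measure M (\<Inter>n. {s\<in>space M. R n s})"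
    using sets mono by (intro finite_Lim_measure_decseq) (auto simp: decseq_def)
  also have "measure M (\<Inter>n. {s\<in>space M. R n s}) = measure M {}"
    using AE sets by (intro finite_measure_eq_AE) auto
  finally show ?thesis by simp
qed

section \<open>Both stacks are read without bound\<close>

context two_laws
begin

lemma sets_stack_eq: "{s. stack s c j = e} \<in> sets N"
  using measurable_sets[OF measurable_stack, of "{e}" c j] by (simp add: vimage_def)

lemma sets_run: "{s. \<forall>t<L. stack s c (a + t) = e} \<in> sets N"
proof -
  have "{s. \<forall>t<L. stack s c (a + t) = e} = (\<Inter>t. {s. t < L \<longrightarrow> stack s c (a + t) = e})" by auto
  also have "\<dots> \<in> sets N"
  proof (intro sets.countable_INT)
    show "range (\<lambda>t. {s. t < L \<longrightarrow> stack s c (a + t) = e}) \<subseteq> sets N"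
    proof (rule image_subsetI)
      show "{s. t < L \<longrightarrow> stack s c (a + t) = e} \<in> sets N" for t
        using sets_stack_eq[of c "a + t" e] sets.top[of N] by (cases "t < L") simp_all
    qed
  qed simp
  finally show ?thesis .
qed

lemma run_prob:
  assumes B: "B \<in> sets N"
    and BJ: "\<And>s s'. (\<And>x. s (Inl x) = s' (Inl x)) \<Longrightarrow> (\<And>b j. b \<noteq> c \<or> j < a \<Longrightarrow> s (Inr (b, j)) = s' (Inr (b, j))) \<Longrightarrow> s \<in> B \<Longrightarrow> s' \<in> B"
  shows "N.prob (B \<inter> {s. \<forall>t<L. stack s c (a + t) = e}) = N.prob B * pmf (law c) e ^ L"
proof (induction L)
  case (Suc L)
  let ?R = "\<lambda>L. {s. \<forall>t<L. stack s c (a + t) = e}"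
  have "B \<inter> ?R (Suc L) = (B \<inter> ?R L) \<inter> {s. stack s c (a + L) \<in> {e}}"
    by (auto simp: less_Suc_eq)
  also have "emeasure N \<dots> = emeasure N (B \<inter> ?R L) * emeasure (law c) {e}"
  proof (rule stack_indep)
    show "B \<inter> ?R L \<in> sets N" by (intro sets.Int B sets_run)
    fix s s' :: "'d sample" assume e: "\<And>i. i \<noteq> Inr (c, a + L) \<Longrightarrow> s i = s' i" and s: "s \<in> B \<inter> ?R L"
    have "s' \<in> B"
    proof (rule BJ)
      show "s (Inl x) = s' (Inl x)" for x by (rule e) simp
      show "s (Inr (b, j)) = s' (Inr (b, j))" if "b \<noteq> c \<or> j < a" for b j by (rule e) (use that in auto)
      show "s \<in> B" using s by simp
    qed
    moreover have "stack s' c (a + t) = stack s c (a + t)" if "t < L" for t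
      using e[of "Inr (c, a + t)"] that by (simp add: stack_def)
    ultimately show "s' \<in> B \<inter> ?R L" using s by simp
  qed
  finally have "ennreal (N.prob (B \<inter> ?R (Suc L))) = ennreal (N.prob (B \<inter> ?R L) * pmf (law c) e)"
    by (simp add: N.emeasure_eq_measure emeasure_pmf_single ennreal_mult)
  then have "N.prob (B \<inter> ?R (Suc L)) = N.prob (B \<inter> ?R L) * pmf (law c) e" by simp
  then show ?case unfolding Suc by (simp add: mult_ac)
qed simp

text \<open>Consecutive blocks of length \<open>L\<close> from \<open>q\<close> on use disjoint
  entries, and each is a run of \<open>e\<close> with probability \<open>\<kappa> > 0\<close>. So
  none of the first \<open>n\<close> blocks is a run with probability
  \<open>(1 - \<kappa>) ^ n\<close>.\<close>

lemma AE_runs: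
  assumes e: "e \<in> set_pmf (law c)"
  shows "AE s in N. \<forall>q L. \<exists>r. \<forall>t<L. stack s c (q + r + t) = e"
proof -
  have "AE s in N. \<exists>r. \<forall>t<L. stack s c (q + r + t) = e" for q L
  proof -
    define \<kappa> where "\<kappa> = pmf (law c) e ^ L"
    have \<kappa>: "0 < \<kappa>" "\<kappa> \<le> 1" using e by (auto simp: \<kappa>_def pmf_positive pmf_le_1 power_le_one)
    let ?A = "\<lambda>b. {s. \<forall>t<L. stack s c ((q + b * L) + t) = e}"
    define NR where "NR n = {s. \<forall>b<n. s \<notin> ?A b}" for n
    have mNR: "NR n \<in> sets N" for n
    proof -
      have "NR n = space N - (\<Union>b\<in>{..<n}. ?A b)" by (auto simp: NR_def)
      also have "\<dots> \<in> sets N" using sets_run by (intro sets.Diff sets.finite_UN sets.top finite_lessThan)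
      finally show ?thesis .
    qed
    have pNR: "N.prob (NR n) = (1 - \<kappa>) ^ n" for n
    proof (induction n)
      case 0
      then show ?case using N.prob_space by (simp add: NR_def)
    next
      case (Suc n)
      have "NR (Suc n) = NR n - (NR n \<inter> ?A n)" by (auto simp: NR_def less_Suc_eq)
      then have "N.prob (NR (Suc n)) = N.prob (NR n) - N.prob (NR n \<inter> ?A n)"
        using mNR sets_run by (simp add: N.finite_measure_Diff sets.Int)
      also have "N.prob (NR n \<inter> ?A n) = N.prob (NR n) * \<kappa>"
        unfolding \<kappa>_def
      proof (rule run_prob[OF mNR])
        fix s s' :: "'d sample"
        assume a: "\<And>b j. b \<noteq> c \<or> j < q + n * L \<Longrightarrow> s (Inr (b, j)) = s' (Inr (b, j))" and s: "s \<in> NR n"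
        have "stack s' c ((q + b * L) + t) = stack s c ((q + b * L) + t)" if "b < n" "t < L" for b t
        proof -
          have "Suc b * L \<le> n * L" using that by (intro mult_right_mono) auto
          then have "q + b * L + t < q + n * L" using that by simp
          then show ?thesis using a[of c] by (simp add: stack_def)
        qed
        then show "s' \<in> NR n" using s unfolding NR_def by fastforce
      qed
      finally show ?case using Suc by (simp add: algebra_simps)
    qed
    have "(\<lambda>n. N.prob {s\<in>space N. s \<in> NR n}) \<longlonglongrightarrow> 0"
      using LIMSEQ_power_zero[of "1 - \<kappa>"] \<kappa> by (simp add: pNR)
    moreover have "N.prob {s. \<forall>r. \<not> (\<forall>t<L. stack s c (q + r + t) = e)} \<le> N.prob (NR n)" for n
    proof (rule N.finite_measure_mono[OF _ mNR])
      show "{s. \<forall>r. \<not> (\<forall>t<L. stack s c (q + r + t) = e)} \<subseteq> NR n" unfolding NR_def by blast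
    qed
    ultimately have "N.prob {s. \<forall>r. \<not> (\<forall>t<L. stack s c (q + r + t) = e)} \<le> 0"
      by (intro LIMSEQ_le_const) auto
    then have z: "N.prob {s. \<forall>r. \<not> (\<forall>t<L. stack s c (q + r + t) = e)} = 0"
      using measure_nonneg[of N "{s. \<forall>r. \<not> (\<forall>t<L. stack s c (q + r + t) = e)}"] by linarith
    have "{s. \<forall>r. \<not> (\<forall>t<L. stack s c (q + r + t) = e)} = space N - (\<Union>r. {s. \<forall>t<L. stack s c (q + r + t) = e})" by auto
    also have "\<dots> \<in> sets N" using sets_run by (intro sets.Diff sets.countable_UN sets.top image_subsetI)
    finally have "{s. \<forall>r. \<not> (\<forall>t<L. stack s c (q + r + t) = e)} \<in> null_sets N"
      using z by (simp add: null_sets_def N.emeasure_eq_measure)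
    from AE_not_in[OF this] show ?thesis by eventually_elim simp
  qed
  then show ?thesis by (simp only: AE_all_countable) blast
qed

definition type_prob :: "real \<Rightarrow> bool \<Rightarrow> real" where "type_prob p d = (if d then p else 1 - p)"

lemma labels_prob:
  assumes p: "0 \<le> p" "p \<le> 1" and F: "finite F"
  shows "emeasure N {s. \<forall>x\<in>F. (label s x < p) = d} = ennreal (type_prob p d ^ card F)"
proof -
  interpret P: product_prob_space coord UNIV by (rule product_prob_spaceI) (rule prob_space_coord)
  let ?X = "\<lambda>i. {v. law (fst v < p) \<in> {law d}}"
  have eq: "law b = law d \<longleftrightarrow> b = d" for b using neq by (auto simp: law_def)
  have mX: "?X i \<in> sets (coord i)" for i
  proof -
    have "(\<lambda>v. fst v < p) \<in> V \<rightarrow>\<^sub>M count_space UNIV" by measurable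
    from measurable_sets[OF this, of "{b. law b \<in> {law d}}"] show ?thesis by (simp add: vimage_def space_pair_measure)
  qed
  have "{s. \<forall>x\<in>F. (label s x < p) = d} = {s\<in>space (PiM UNIV coord). \<forall>i\<in>Inl ` F. s i \<in> ?X i}"
    using space_N by (auto simp: label_def eq N_def)
  then have "emeasure N {s. \<forall>x\<in>F. (label s x < p) = d} = (\<Prod>i\<in>Inl ` F. emeasure (coord i) (?X i))"
    using P.emeasure_PiM_Collect[of "Inl ` F" ?X] F mX unfolding N_def by simp
  also have "\<dots> = (\<Prod>x\<in>F. emeasure (two_point_law \<gamma>1 \<gamma>2 p) {law d})"
    using emeasure_label[OF p, where F = "{law d}"] by (simp only: prod.reindex[OF inj_Inl] comp_def)
  also have "emeasure (two_point_law \<gamma>1 \<gamma>2 p) {law d} = ennreal (type_prob p d)"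
    using pmf_two_point_law[OF neq p] by (simp add: emeasure_pmf_single law_def type_prob_def)
  finally show ?thesis by (simp add: ennreal_power type_prob_def p)
qed

text \<open>A walk stuck on stack \<open>d\<close> moves along these sites with \<open>i\<close>,
  the number of reads of the other stack, frozen and \<open>q\<close> growing.\<close>

definition fresh_pos :: "bool \<Rightarrow> nat \<Rightarrow> nat \<Rightarrow> 'd sample \<Rightarrow> int ^ 'd" where
  "fresh_pos d i q s = (if d then pos s q i else pos s i q)"

lemma fresh_pos_add: "fresh_pos d i (q + t) s = fresh_pos d i q s + (\<Sum>j<t. stack s d (q + j))"
proof (induction t)
  case (Suc t)
  have "fresh_pos d i (Suc n) s = fresh_pos d i n s + stack s d n" for n
    by (cases d) (simp_all add: fresh_pos_def pos_def stack_sum_def)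
  then show ?case using Suc by (simp add: add.assoc)
qed simp

lemma measurable_fresh_pos [measurable]: "(\<lambda>s. fresh_pos d i q s) \<in> N \<rightarrow>\<^sub>M count_space UNIV"
  unfolding fresh_pos_def by (cases d) (simp_all add: measurable_pos)

lemma sets_label_fresh: "{s. \<forall>r. (label s (fresh_pos d i (q + r) s) < p) = d} \<in> sets N"
proof -
  have "{s. (label s (fresh_pos d i q s) < p) = d} \<in> sets N" for q
  proof -
    have "(\<lambda>s. label s (fresh_pos d i q s)) \<in> borel_measurable N"
      by (rule measurable_compose_countable[where f = "\<lambda>x s. label s x" and g = "fresh_pos d i q", OF measurable_label measurable_fresh_pos])
    then have "(\<lambda>s. label s (fresh_pos d i q s) < p) \<in> N \<rightarrow>\<^sub>M count_space UNIV" by measurable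
    from measurable_sets[OF this, of "{d}"] show ?thesis by (simp add: vimage_def)
  qed
  then have "(\<Inter>r. {s. (label s (fresh_pos d i (q + r) s) < p) = d}) \<in> sets N" by (intro sets.countable_INT) auto
  moreover have "(\<Inter>r. {s. (label s (fresh_pos d i (q + r) s) < p) = d}) = {s. \<forall>r. (label s (fresh_pos d i (q + r) s) < p) = d}" by auto
  ultimately show ?thesis by simp
qed

text \<open>A walk reading only one stack visits infinitely many sites, because that stack contains
  arbitrarily long runs of one step; their labels cannot all be of one type.\<close>

lemma stuck_null:
  assumes p: "0 \<le> p" "p \<le> 1" and d: "type_prob p d < 1"
  shows "AE s in N. \<not> (\<forall>r. (label s (fresh_pos d i (q + r) s) < p) = d)"
proof -
  let ?Z = "{s. \<forall>r. (label s (fresh_pos d i (q + r) s) < p) = d}"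
  let ?J = "range Inl :: 'd site_or_step set"
  \<comment> \<open>Labels come from the second copy, stacks from the first. The splice preserves
    \<open>N\<close>, so the stacks can be frozen while the labels are resampled.\<close>
  let ?f = "\<lambda>(x :: 'd sample, y :: 'd sample) k. if k \<in> ?J then y k else x k"
  have mZ: "?Z \<in> sets N" by (rule sets_label_fresh)
  have mf: "?f \<in> N \<Otimes>\<^sub>M N \<rightarrow>\<^sub>M N"
  proof -
    have "?f \<in> N \<Otimes>\<^sub>M N \<rightarrow>\<^sub>M PiM UNIV coord"
    proof (rule measurable_PiM_single')
      show "(\<lambda>\<omega>. ?f \<omega> k) \<in> N \<Otimes>\<^sub>M N \<rightarrow>\<^sub>M coord k" for k
        unfolding measurable_cong_sets[OF refl sets_coord]
        using measurable_compose[OF measurable_snd measurable_coord[of k]] measurable_compose[OF measurable_fst measurable_coord[of k]]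
        by (cases "k \<in> ?J") (simp_all add: split_beta')
      show "?f \<in> space (N \<Otimes>\<^sub>M N) \<rightarrow> (\<Pi>\<^sub>E i\<in>UNIV. space (coord i))"
        using space_N unfolding N_def space_PiM by auto
    qed
    then show ?thesis by (simp only: N_def)
  qed
  obtain e where e: "e \<in> set_pmf (law d)" using set_pmf_not_empty[of "law d"] by auto
  obtain k where k: "e $ k \<noteq> 0" using law_support[OF e] by (auto simp: unit_vectors_def axis_def)
  have tp: "0 \<le> type_prob p d" using p by (simp add: type_prob_def)
  have "emeasure N ?Z = emeasure (distr (N \<Otimes>\<^sub>M N) N ?f) ?Z"
    using PiM_splice[of coord ?J, OF prob_space_coord] by (simp only: N_def)
  also have "\<dots> = (\<integral>\<^sup>+s. emeasure N {s'. ?f (s, s') \<in> ?Z} \<partial>N)"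
    using mZ mf measurable_sets[OF mf mZ] by (simp add: emeasure_distr N.emeasure_pair_measure_alt vimage_def space_pair_measure)
  also have "\<dots> = (\<integral>\<^sup>+s. 0 \<partial>N)"
  proof (rule nn_integral_cong_AE)
    show "AE s in N. emeasure N {s'. ?f (s, s') \<in> ?Z} = 0"
      using AE_runs[OF e]
    proof eventually_elim
      case (elim s)
      have "emeasure N {s'. ?f (s, s') \<in> ?Z} \<le> ennreal (type_prob p d ^ L)" for L
      proof -
        \<comment> \<open>A run of \<open>L\<close> equal steps visits \<open>L\<close> distinct
          sites, told apart by a coordinate \<open>k\<close> in which the step is nonzero. Their
          labels are all of type \<open>d\<close> with probability \<open>type_prob p d ^ L\<close>,
          which tends to 0.\<close>
        obtain r where r: "\<forall>t<L. stack s d (q + r + t) = e" using elim by blast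
        define F where "F = (\<lambda>t. fresh_pos d i (q + r + t) s) ` {..<L}"
        have site: "fresh_pos d i (q + r + t) s $ k = fresh_pos d i (q + r) s $ k + int t * (e $ k)" if "t \<le> L" for t
        proof -
          have "(\<Sum>j<t. stack s d (q + r + j)) = (\<Sum>j<t. e)" using r that by (intro sum.cong) auto
          moreover have "(\<Sum>j<t. e) $ k = int t * (e $ k)" by (induction t) (simp_all add: algebra_simps)
          ultimately show ?thesis by (simp only: fresh_pos_add[of d i "q + r" t] vector_add_component)
        qed
        have "inj_on (\<lambda>t. fresh_pos d i (q + r + t) s) {..<L}"
        proof (rule inj_onI)
          fix t t' assume a: "t \<in> {..<L}" "t' \<in> {..<L}" and eq: "fresh_pos d i (q + r + t) s = fresh_pos d i (q + r + t') s"
          have "int t * (e $ k) = int t' * (e $ k)" using site[of t] site[of t'] a eq by fastforce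
          then show "t = t'" using k by simp
        qed
        then have card: "card F = L" by (simp add: F_def card_image)
        have finF: "finite F" by (simp add: F_def)
        have mF: "{s'. \<forall>x\<in>F. (label s' x < p) = d} \<in> sets N"
        proof -
          have "{s'\<in>space N. \<forall>x\<in>F. (label s' x < p) = d} \<in> sets N"
            using finF by (intro sets.sets_Collect_finite_All) (simp_all, measurable)
          then show ?thesis by simp
        qed
        have "emeasure N {s'. ?f (s, s') \<in> ?Z} \<le> emeasure N {s'. \<forall>x\<in>F. (label s' x < p) = d}"
        proof (rule emeasure_mono[OF _ mF])
          have st: "stack (?f (s, s')) = stack s" for s' by (auto simp: stack_def fun_eq_iff)
          have lb: "label (?f (s, s')) = label s'" for s' by (auto simp: label_def fun_eq_iff)
          have fp: "fresh_pos d i q' (?f (s, s')) = fresh_pos d i q' s" for q' s'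
            by (simp only: fresh_pos_def pos_def stack_sum_def st)
          show "{s'. ?f (s, s') \<in> ?Z} \<subseteq> {s'. \<forall>x\<in>F. (label s' x < p) = d}"
          proof
            fix s' assume "s' \<in> {s'. ?f (s, s') \<in> ?Z}"
            then have "(label s' (fresh_pos d i (q + r) s) < p) = d" for r
              unfolding mem_Collect_eq lb fp by blast
            then show "s' \<in> {s'. \<forall>x\<in>F. (label s' x < p) = d}" by (simp add: F_def add.assoc)
          qed
        qed
        also have "\<dots> = ennreal (type_prob p d ^ L)" using labels_prob[OF p finF] by (simp add: card)
        finally show ?thesis .
      qed
      moreover have "(\<lambda>L. ennreal (type_prob p d ^ L)) \<longlonglongrightarrow> ennreal 0"
        using LIMSEQ_power_zero[of "type_prob p d"] tp d by (intro tendsto_ennrealI) simp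
      ultimately have "emeasure N {s'. ?f (s, s') \<in> ?Z} \<le> ennreal 0"
        by (intro LIMSEQ_le_const) auto
      then show ?case by simp
    qed
  qed
  finally have "?Z \<in> null_sets N" using mZ by (simp add: null_sets_def)
  from AE_not_in[OF this] show ?thesis by eventually_elim simp
qed

definition used :: "bool \<Rightarrow> real \<Rightarrow> 'd sample \<Rightarrow> nat \<Rightarrow> nat" where
  "used c p s n = (if c then cnt p s n else n - cnt p s n)"

lemma used_mono: "m \<le> n \<Longrightarrow> used c p s m \<le> used c p s n"
  using cnt_mono cnt_compl_mono by (simp add: used_def)

text \<open>If the reads of stack \<open>c\<close> were bounded, their number would freeze at some
  \<open>i\<close>, and from then on the walk would follow the other stack through sites of the
  other type only. \<open>stuck_null\<close> excludes this for all \<open>i\<close> and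
  \<open>q\<close> at once.\<close>

lemma used_unbounded:
  assumes p: "0 \<le> p" "p \<le> 1" and c: "0 < type_prob p c"
  shows "AE s in N. \<forall>z. \<exists>n. z \<le> used c p s n"
proof -
  have d: "type_prob p (\<not> c) < 1" using c by (auto simp: type_prob_def split: if_splits)
  have "AE s in N. \<forall>i q. \<not> (\<forall>r. (label s (fresh_pos (\<not> c) i (q + r) s) < p) = (\<not> c))"
    by (simp only: AE_all_countable) (intro allI stuck_null p d)
  then show ?thesis
  proof eventually_elim
    case (elim s)
    show ?case
    proof (rule ccontr)
      assume "\<not> (\<forall>z. \<exists>n. z \<le> used c p s n)"
      then obtain z where z: "\<And>n. used c p s n < z" by (auto simp: not_le)
      define i where "i = Max (range (used c p s))"
      have fin: "finite (range (used c p s))" by (rule finite_subset[of _ "{..<z}"]) (use z in auto)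
      then have "i \<in> range (used c p s)" unfolding i_def by (intro Max_in) auto
      then obtain n1 where n1: "used c p s n1 = i" by auto
      have const: "used c p s n = i" if "n1 \<le> n" for n
        using used_mono[OF that, of c p s] n1 Max_ge[OF fin, of "used c p s n"] by (simp add: i_def)
      have in1: "i \<le> n1" using n1 cnt_le[of p s n1] by (auto simp: used_def)
      have "(label s (fresh_pos (\<not> c) i ((n1 - i) + r) s) < p) = (\<not> c)" for r
      proof -
        let ?n = "n1 + r"
        have u: "used c p s ?n = i" "used c p s (Suc ?n) = i" by (intro const; simp)+
        have "W p s ?n = fresh_pos (\<not> c) i ((n1 - i) + r) s"
          using u(1) cnt_le[of p s ?n] in1 by (cases c) (auto simp: used_def fresh_pos_def W_def)
        moreover have "(label s (W p s ?n) < p) = (\<not> c)"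
          using u cnt_le[of p s ?n] cnt_Suc_W[of p s ?n] by (cases c) (auto simp: used_def split: if_splits)
        ultimately show ?thesis by simp
      qed
      then show False using elim by blast
    qed
  qed
qed

section \<open>Overtaking\<close>

text \<open>A stack time is a position on the stack \<open>c\<close> that is determined by the labels, the other stack and
  the entries below it; the entries from it on are therefore unread.\<close>

definition agree :: "bool \<Rightarrow> nat \<Rightarrow> 'd sample \<Rightarrow> 'd sample \<Rightarrow> bool" where
  "agree c a s s' \<longleftrightarrow> (\<forall>x. s (Inl x) = s' (Inl x)) \<and> (\<forall>b j. b \<noteq> c \<or> j < a \<longrightarrow> s (Inr (b, j)) = s' (Inr (b, j)))"

definition stack_time :: "bool \<Rightarrow> ('d sample \<Rightarrow> nat) \<Rightarrow> bool" where
  "stack_time c X \<longleftrightarrow> X \<in> N \<rightarrow>\<^sub>M count_space UNIV \<and> (\<forall>s s'. agree c (X s) s s' \<longrightarrow> X s' = X s)"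

text \<open>Events of the filtration of stack \<open>c\<close>, with the labels and the whole other
  stack known from the start.\<close>

definition before :: "bool \<Rightarrow> nat \<Rightarrow> 'd sample set \<Rightarrow> bool" where
  "before c m B \<longleftrightarrow> B \<in> sets N \<and> (\<forall>s s'. agree c m s s' \<longrightarrow> s \<in> B \<longrightarrow> s' \<in> B)"

lemma agree_sym: "agree c a s s' \<Longrightarrow> agree c a s' s"
  unfolding agree_def by metis

lemma agree_mono: "agree c b s s' \<Longrightarrow> a \<le> b \<Longrightarrow> agree c a s s'"
  unfolding agree_def by (blast intro: less_le_trans)

lemma before_sets: "before c m B \<Longrightarrow> B \<in> sets N"
  by (simp add: before_def)

lemma before_mono: "before c m B \<Longrightarrow> m \<le> n \<Longrightarrow> before c n B"
  unfolding before_def by (blast intro: agree_mono)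

lemma before_Int: "before c m A \<Longrightarrow> before c m B \<Longrightarrow> before c m (A \<inter> B)"
  unfolding before_def by (intro conjI sets.Int; blast)

lemma stack_time_measurable: "stack_time c X \<Longrightarrow> X \<in> N \<rightarrow>\<^sub>M count_space UNIV"
  by (simp add: stack_time_def)

lemma sets_stack_time: "stack_time c X \<Longrightarrow> {s. P (X s)} \<in> sets N"
  using measurable_sets[OF stack_time_measurable, of c X "{n. P n}"] by (simp add: vimage_def)

lemma stack_timeD: "stack_time c X \<Longrightarrow> agree c (X s) s s' \<Longrightarrow> X s' = X s"
  unfolding stack_time_def by blast

lemma before_stack_time_eq: assumes X: "stack_time c X" shows "before c m {s. X s = m}"
  unfolding before_def
proof (intro conjI allI impI)
  show "{s. X s = m} \<in> sets N" by (rule sets_stack_time[OF X])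
  show "s' \<in> {s. X s = m}" if "agree c m s s'" "s \<in> {s. X s = m}" for s s'
    using stack_timeD[OF X, of s s'] that by simp
qed

text \<open>If \<open>X s' \<le> m\<close>, the two samples agree below the stack time
  \<open>X s'\<close>, which forces \<open>X s = X s'\<close>; so \<open>m < X s\<close> cannot be
  changed by entries from \<open>m\<close> on.\<close>

lemma before_stack_time_gr: assumes X: "stack_time c X" shows "before c m {s. m < X s}"
  unfolding before_def
proof (intro conjI allI impI)
  show "{s. m < X s} \<in> sets N" by (rule sets_stack_time[OF X])
  fix s s' assume a: "agree c m s s'" and s: "s \<in> {s. m < X s}"
  show "s' \<in> {s. m < X s}"
  proof (rule ccontr)
    assume n: "s' \<notin> {s. m < X s}"
    then have "X s' \<le> m" by simp
    then have "agree c (X s') s' s" by (rule agree_sym[OF agree_mono[OF a]])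
    then have "X s = X s'" by (rule stack_timeD[OF X])
    with n s show False by simp
  qed
qed

text \<open>Up to time \<open>n\<close> the walk has read exactly the entries below this count, so
  altering later entries leaves walk and count unchanged.\<close>

lemma stack_time_used: "stack_time c (\<lambda>s. used c p s n)"
  unfolding stack_time_def
proof (intro conjI allI impI)
  show "(\<lambda>s. used c p s n) \<in> N \<rightarrow>\<^sub>M count_space UNIV"
    unfolding used_def using measurable_compose[OF measurable_cnt[of p n], of "\<lambda>k. if c then k else n - k"] by simp
  fix s s' assume a: "agree c (used c p s n) s s'"
  have "cnt p s' n = cnt p s n \<and> W p s' n = W p s n"
  proof (rule cnt_cong[where ma = "cnt p s n" and mb = "n - cnt p s n"])
    show "label s' x = label s x" for x using a by (simp add: agree_def label_def)
    show "stack s' True j = stack s True j" if "j < cnt p s n" for j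
      using a that by (cases c) (simp_all add: agree_def stack_def used_def)
    show "stack s' False j = stack s False j" if "j < n - cnt p s n" for j
      using a that by (cases c) (simp_all add: agree_def stack_def used_def)
  qed (rule order_refl)+
  then show "used c p s' n = used c p s n" by (simp add: used_def)
qed

lemma used_le: "used c p s n \<le> n"
  using cnt_le[of p s n] by (simp add: used_def)

lemma chernoff_before:
  assumes "before c a B" "0 < \<delta>" "\<sigma> = 1 \<or> \<sigma> = (-1 :: real)"
  shows "emeasure N (B \<inter> {s. \<delta> * real k \<le> \<sigma> * fluct i c a k s}) \<le> emeasure N B * ennreal (exp (- (\<delta>\<^sup>2 / 2)) ^ k)"
proof (rule chernoff[OF before_sets[OF assms(1)] assms(2,3)])
  fix s s' :: "'d sample"
  assume "\<And>x. s (Inl x) = s' (Inl x)" "\<And>b j. b \<noteq> c \<or> j < a \<Longrightarrow> s (Inr (b, j)) = s' (Inr (b, j))" "s \<in> B"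
  then show "s' \<in> B" using assms(1) unfolding before_def agree_def by blast
qed

text \<open>On \<open>{s. X s = j}\<close>, which is decided before entry \<open>j\<close>, the
  starting index is constant. The probabilities of these events sum to at most 1, so the bound for a
  fixed index survives without loss.\<close>

lemma chernoff_stack_time:
  assumes X: "stack_time c X" and Xn: "\<And>s. X s \<le> n" and \<delta>: "0 < \<delta>" and \<sigma>: "\<sigma> = 1 \<or> \<sigma> = (-1 :: real)"
  shows "{s. \<delta> * real k \<le> \<sigma> * fluct i c (X s) k s} \<in> sets N"
    and "emeasure N {s. \<delta> * real k \<le> \<sigma> * fluct i c (X s) k s} \<le> ennreal (exp (- (\<delta>\<^sup>2 / 2)) ^ k)"
proof -
  let ?A = "\<lambda>j. {s. X s = j} \<inter> {s. \<delta> * real k \<le> \<sigma> * fluct i c j k s}"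
  have mA: "?A j \<in> sets N" for j
  proof (rule sets.Int[OF sets_stack_time[OF X]])
    have "{s \<in> space N. \<delta> * real k \<le> \<sigma> * fluct i c j k s} \<in> sets N" by measurable
    then show "{s. \<delta> * real k \<le> \<sigma> * fluct i c j k s} \<in> sets N" by simp
  qed
  have eq: "{s. \<delta> * real k \<le> \<sigma> * fluct i c (X s) k s} = (\<Union>j\<in>{..n}. ?A j)" using Xn by auto
  show "{s. \<delta> * real k \<le> \<sigma> * fluct i c (X s) k s} \<in> sets N"
    unfolding eq using mA by (intro sets.finite_UN) auto
  have "emeasure N (\<Union>j\<in>{..n}. ?A j) \<le> (\<Sum>j\<le>n. emeasure N (?A j))"
    by (rule emeasure_subadditive_finite) (use mA in auto)
  also have "\<dots> \<le> (\<Sum>j\<le>n. emeasure N {s. X s = j} * ennreal (exp (- (\<delta>\<^sup>2 / 2)) ^ k))"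
    by (intro sum_mono chernoff_before before_stack_time_eq X \<delta> \<sigma>)
  also have "\<dots> = (\<Sum>j\<le>n. emeasure N {s. X s = j}) * ennreal (exp (- (\<delta>\<^sup>2 / 2)) ^ k)"
    by (simp only: sum_distrib_right)
  also have "(\<Sum>j\<le>n. emeasure N {s. X s = j}) = emeasure N (\<Union>j\<in>{..n}. {s. X s = j})"
    by (rule sum_emeasure) (auto simp: disjoint_family_on_def intro: sets_stack_time[OF X])
  also have "\<dots> \<le> 1" by (rule N.emeasure_le_1)
  finally show "emeasure N {s. \<delta> * real k \<le> \<sigma> * fluct i c (X s) k s} \<le> ennreal (exp (- (\<delta>\<^sup>2 / 2)) ^ k)"
    unfolding eq by (simp add: mult_right_mono)
qed

text \<open>The union bound over the lengths \<open>k\<close> is a geometric sum. It does not depend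
  on \<open>X\<close>, which later gives estimates uniform in time.\<close>

lemma chernoff_tail:
  assumes X: "stack_time c X" and Xn: "\<And>s. X s \<le> n" and \<delta>: "0 < \<delta>" and \<sigma>: "\<sigma> = 1 \<or> \<sigma> = (-1 :: real)"
  shows "{s. \<exists>k\<ge>K. \<delta> * real k \<le> \<sigma> * fluct i c (X s) k s} \<in> sets N"
    and "N.prob {s. \<exists>k\<ge>K. \<delta> * real k \<le> \<sigma> * fluct i c (X s) k s} \<le> exp (- (\<delta>\<^sup>2 / 2)) ^ K / (1 - exp (- (\<delta>\<^sup>2 / 2)))"
proof -
  define r where "r = exp (- (\<delta>\<^sup>2 / 2))"
  have r: "0 < r" "r < 1" using \<delta> by (simp_all add: r_def)
  let ?A = "\<lambda>k. {s. \<delta> * real k \<le> \<sigma> * fluct i c (X s) k s}"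
  have mA: "?A k \<in> sets N" for k by (rule chernoff_stack_time(1)[OF X Xn \<delta> \<sigma>])
  have eq: "{s. \<exists>k\<ge>K. \<delta> * real k \<le> \<sigma> * fluct i c (X s) k s} = (\<Union>k. ?A (K + k))"
  proof (intro equalityI subsetI)
    fix s assume "s \<in> {s. \<exists>k\<ge>K. \<delta> * real k \<le> \<sigma> * fluct i c (X s) k s}"
    then obtain k where "K \<le> k" "s \<in> ?A k" by auto
    then have "s \<in> ?A (K + (k - K))" by simp
    then show "s \<in> (\<Union>k. ?A (K + k))" by blast
  next
    fix s assume "s \<in> (\<Union>k. ?A (K + k))"
    then obtain k where "s \<in> ?A (K + k)" by blast
    then show "s \<in> {s. \<exists>k\<ge>K. \<delta> * real k \<le> \<sigma> * fluct i c (X s) k s}" using le_add1[of K k] by blast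
  qed
  show "{s. \<exists>k\<ge>K. \<delta> * real k \<le> \<sigma> * fluct i c (X s) k s} \<in> sets N"
    unfolding eq by (intro sets.countable_UN image_subsetI mA)
  have "emeasure N (\<Union>k. ?A (K + k)) \<le> (\<Sum>k. emeasure N (?A (K + k)))"
    by (rule emeasure_subadditive_countably) (intro image_subsetI mA)
  also have "\<dots> \<le> (\<Sum>k. ennreal (r ^ (K + k)))"
    unfolding r_def by (intro suminf_le chernoff_stack_time(2)[OF X Xn \<delta> \<sigma>] summableI)
  also have "\<dots> = ennreal (r ^ K / (1 - r))"
  proof (rule suminf_ennreal_eq)
    show "(\<lambda>k. r ^ (K + k)) sums (r ^ K / (1 - r))"
      using sums_mult[OF geometric_sums[of r], of "r ^ K"] r by (simp add: power_add)
  qed (use r in simp)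
  finally have "ennreal (N.prob (\<Union>k. ?A (K + k))) \<le> ennreal (r ^ K / (1 - r))"
    by (simp add: N.emeasure_eq_measure)
  then show "N.prob {s. \<exists>k\<ge>K. \<delta> * real k \<le> \<sigma> * fluct i c (X s) k s} \<le> exp (- (\<delta>\<^sup>2 / 2)) ^ K / (1 - exp (- (\<delta>\<^sup>2 / 2)))"
    using r unfolding eq by (simp add: r_def ennreal_le_iff)
qed

lemma AE_stack_bound: "AE s in N. \<forall>c j. \<bar>real_of_int (stack s c j $ i)\<bar> \<le> 1"
  using AE_stack_in_support
proof eventually_elim
  case (elim s)
  show ?case
  proof (intro allI)
    fix c j
    have "\<bar>stack s c j $ i\<bar> \<le> 1" using elim by (intro unit_vector_component_le law_support) auto
    then show "\<bar>real_of_int (stack s c j $ i)\<bar> \<le> 1" by linarith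
  qed
qed

lemma drift_le: "\<bar>drift i c\<bar> \<le> 1"
proof -
  have "AE e in law c. \<bar>real_of_int (e $ i)\<bar> \<le> 1"
  proof (subst AE_measure_pmf_iff, intro ballI)
    fix e assume "e \<in> set_pmf (law c)"
    then have "\<bar>e $ i\<bar> \<le> 1" by (intro unit_vector_component_le law_support)
    then show "\<bar>real_of_int (e $ i)\<bar> \<le> 1" by linarith
  qed
  then have b: "AE e in law c. norm (real_of_int (e $ i)) \<le> 1" by simp
  have int: "integrable (measure_pmf (law c)) (\<lambda>e. real_of_int (e $ i))"
    by (rule measure_pmf.integrable_const_bound[OF b]) simp
  have "\<bar>drift i c\<bar> \<le> measure_pmf.expectation (law c) (\<lambda>e. \<bar>real_of_int (e $ i)\<bar>)"
    unfolding drift_expectation by (rule integral_abs_bound)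
  also have "\<dots> \<le> measure_pmf.expectation (law c) (\<lambda>e. 1)"
    by (rule integral_mono_AE) (use int b in auto)
  finally show ?thesis by simp
qed

text \<open>Entry \<open>m\<close> is independent of \<open>B\<close>, and its component is almost
  surely -1, 0 or 1, so both the drift and the integral reduce to the probabilities of the values 1
  and -1.\<close>

lemma centered:
  assumes B: "before c m B"
  shows "(\<integral>s. indicator B s * (real_of_int (stack s c m $ i) - drift i c) \<partial>N) = 0"
    and "integrable N (\<lambda>s. indicator B s * (real_of_int (stack s c m $ i) - drift i c))"
proof -
  let ?E = "\<lambda>z :: int. {e :: int ^ 'd. e $ i = z}"
  have mB: "B \<in> sets N" by (rule before_sets[OF B])
  have mS: "{s. stack s c m \<in> E} \<in> sets N" for E
    using measurable_sets[OF measurable_stack[of c m], of E] by (simp add: vimage_def)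
  have split: "real_of_int z = indicator {1} z - indicator {-1} z" if "\<bar>z\<bar> \<le> 1" for z :: int
  proof -
    have "z = 0 \<or> z = 1 \<or> z = -1" using that by linarith
    then show ?thesis by auto
  qed
  have p: "N.prob (B \<inter> {s. stack s c m \<in> E}) = N.prob B * measure (law c) E" for E
  proof -
    have "emeasure N (B \<inter> {s. stack s c m \<in> E}) = emeasure N B * emeasure (law c) E"
    proof (rule stack_indep[OF mB])
      fix s s' :: "'d sample" assume e: "\<And>k. k \<noteq> Inr (c, m) \<Longrightarrow> s k = s' k" and s: "s \<in> B"
      have "agree c m s s'" unfolding agree_def by (auto intro!: e)
      with s B show "s' \<in> B" by (auto simp: before_def)
    qed
    then show ?thesis
      by (simp add: N.emeasure_eq_measure measure_pmf.emeasure_eq_measure ennreal_mult[symmetric])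
  qed
  have d: "drift i c = measure (law c) (?E 1) - measure (law c) (?E (-1))"
  proof -
    have "drift i c = measure_pmf.expectation (law c) (\<lambda>e. indicator (?E 1) e - indicator (?E (-1)) e)"
      unfolding drift_expectation
    proof (rule integral_cong_AE)
      show "AE e in law c. real_of_int (e $ i) = indicator (?E 1) e - indicator (?E (-1)) e"
      proof (subst AE_measure_pmf_iff, intro ballI)
        fix e assume "e \<in> set_pmf (law c)"
        from split[OF unit_vector_component_le[OF law_support[OF this], of i]]
        show "real_of_int (e $ i) = indicator (?E 1) e - indicator (?E (-1)) e" by (simp add: indicator_def)
      qed
    qed simp_all
    moreover have "integrable (measure_pmf (law c)) (indicator (?E z) :: _ \<Rightarrow> real)" for z
      by (rule measure_pmf.integrable_const_bound[where B = 1]) (auto simp: indicator_def)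
    from Bochner_Integration.integral_diff[OF this[of 1] this[of "-1"]]
    have "measure_pmf.expectation (law c) (\<lambda>e. indicator (?E 1) e - indicator (?E (-1)) e) = measure (law c) (?E 1) - measure (law c) (?E (-1))"
      by simp
    ultimately show ?thesis by (rule trans)
  qed
  let ?S = "\<lambda>z. B \<inter> {s. stack s c m \<in> ?E z}"
  have "(\<integral>s. indicator B s * (real_of_int (stack s c m $ i) - drift i c) \<partial>N)
      = (\<integral>s. indicator (?S 1) s - indicator (?S (-1)) s - drift i c * indicator B s \<partial>N)"
  proof (rule integral_cong_AE)
    show "AE s in N. indicator B s * (real_of_int (stack s c m $ i) - drift i c) = indicator (?S 1) s - indicator (?S (-1)) s - drift i c * indicator B s"
      using AE_stack_in_support
    proof eventually_elim
      case (elim s)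
      then have "\<bar>stack s c m $ i\<bar> \<le> 1" by (intro unit_vector_component_le law_support) auto
      from split[OF this] show ?case by (auto simp: indicator_def)
    qed
  qed (use mB mS[of "?E 1"] mS[of "?E (-1)"] in \<open>measurable\<close>)
  also have "\<dots> = N.prob (?S 1) - N.prob (?S (-1)) - drift i c * N.prob B"
    using mB mS[of "?E 1"] mS[of "?E (-1)"] by (simp add: Bochner_Integration.integral_diff less_top[symmetric])
  also have "\<dots> = 0" unfolding p d by (simp add: algebra_simps)
  finally show "(\<integral>s. indicator B s * (real_of_int (stack s c m $ i) - drift i c) \<partial>N) = 0" .
  show "integrable N (\<lambda>s. indicator B s * (real_of_int (stack s c m $ i) - drift i c))"
  proof (rule N.integrable_const_bound[where B = 2])
    show "AE s in N. norm (indicator B s * (real_of_int (stack s c m $ i) - drift i c)) \<le> 2"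
      using AE_stack_bound[of i]
    proof eventually_elim
      case (elim s)
      then have "\<bar>real_of_int (stack s c m $ i)\<bar> \<le> 1" by blast
      then show ?case using drift_le[of i c] by (auto simp: indicator_def)
    qed
  qed (use mB in measurable)
qed

text \<open>\<open>fluct\<close> over the entries from \<open>x\<close> to \<open>y\<close>, cut off
  after \<open>K\<close> entries. The cut bounds it almost surely by \<open>2 * K\<close>, so that
  its integral over an event of small probability is small.\<close>

definition window :: "'d \<Rightarrow> bool \<Rightarrow> nat \<Rightarrow> nat \<Rightarrow> nat \<Rightarrow> 'd sample \<Rightarrow> real" where
  "window i c K x y s = (\<Sum>j<K. if x + j < y then real_of_int (stack s c (x + j) $ i) - drift i c else 0)"

lemma window_expand:
  assumes "X s \<le> n"
  shows "window i c K (X s) (Y s) s =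
    (\<Sum>x\<le>n. \<Sum>j<K. indicator ({s. X s = x} \<inter> {s. x + j < Y s}) s * (real_of_int (stack s c (x + j) $ i) - drift i c))"
proof -
  have "(\<Sum>x\<le>n. \<Sum>j<K. indicator ({s. X s = x} \<inter> {s. x + j < Y s}) s * (real_of_int (stack s c (x + j) $ i) - drift i c))
     = (\<Sum>x\<le>n. if x = X s then window i c K (X s) (Y s) s else 0)"
  proof (intro sum.cong refl)
    fix x
    show "(\<Sum>j<K. indicator ({s. X s = x} \<inter> {s. x + j < Y s}) s * (real_of_int (stack s c (x + j) $ i) - drift i c))
      = (if x = X s then window i c K (X s) (Y s) s else 0)"
    proof (cases "x = X s")
      case True
      then show ?thesis unfolding window_def True if_P[OF refl] by (intro sum.cong refl) (simp add: indicator_def)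
    next
      case False
      then show ?thesis by (simp add: indicator_def)
    qed
  qed
  then show ?thesis using assms by simp
qed

lemma measurable_window:
  assumes X: "stack_time c X" and Y: "stack_time c Y" and n: "\<And>s. X s \<le> n"
  shows "(\<lambda>s. window i c K (X s) (Y s) s) \<in> borel_measurable N"
  unfolding window_expand[where X = X and Y = Y, OF n]
proof (intro borel_measurable_sum borel_measurable_times borel_measurable_indicator)
  show "{s. X s = x} \<inter> {s. x + j < Y s} \<in> sets N" for x j
    by (intro sets.Int sets_stack_time[OF X] sets_stack_time[OF Y])
qed measurable

lemma AE_window_bound: "AE s in N. \<forall>c K x y. \<bar>window i c K x y s\<bar> \<le> 2 * real K"
  using AE_stack_bound[of i]
proof eventually_elim
  case (elim s)
  show ?case
  proof (intro allI)
    fix c K x y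
    have "\<bar>window i c K x y s\<bar> \<le> (\<Sum>j<K. \<bar>if x + j < y then real_of_int (stack s c (x + j) $ i) - drift i c else 0\<bar>)"
      unfolding window_def by (rule sum_abs)
    also have "\<dots> \<le> (\<Sum>j<K. 2)"
    proof (rule sum_mono)
      fix j
      have "\<bar>real_of_int (stack s c (x + j) $ i)\<bar> \<le> 1" using elim by blast
      then show "\<bar>if x + j < y then real_of_int (stack s c (x + j) $ i) - drift i c else 0\<bar> \<le> 2"
        using drift_le[of i c] by auto
    qed
    finally show "\<bar>window i c K x y s\<bar> \<le> 2 * real K" by simp
  qed
qed

lemma integrable_window:
  assumes X: "stack_time c X" and Y: "stack_time c Y" and n: "\<And>s. X s \<le> n" and A: "A \<in> sets N"
  shows "integrable N (\<lambda>s. indicator A s * window i c K (X s) (Y s) s)"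
proof (rule N.integrable_const_bound[where B = "2 * real K"])
  show "AE s in N. norm (indicator A s * window i c K (X s) (Y s) s) \<le> 2 * real K"
    using AE_window_bound[of i]
  proof eventually_elim
    case (elim s)
    then have "\<bar>window i c K (X s) (Y s) s\<bar> \<le> 2 * real K" by blast
    then show ?case by (auto simp: indicator_def)
  qed
  show "(\<lambda>s. indicator A s * window i c K (X s) (Y s) s) \<in> borel_measurable N"
    using A measurable_window[OF X Y n, of i K] by measurable
qed

text \<open>Optional stopping. With the start fixed at some \<open>x \<ge> m\<close>, whether entry
  \<open>x + j\<close> is counted is decided before that entry: \<open>A\<close> by the entries
  below \<open>m\<close>, and \<open>x + j < Y s\<close> because \<open>Y\<close> is a stack time.
  Every summand is then centred.\<close>

lemma window_integral_zero:
  assumes X: "stack_time c X" and Y: "stack_time c Y" and n: "\<And>s. X s \<le> n" and A: "before c m A"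
  shows "(\<integral>s. indicator (A \<inter> {s. m \<le> X s}) s * window i c K (X s) (Y s) s \<partial>N) = 0"
proof -
  let ?B = "\<lambda>x j. (if m \<le> x then A else {}) \<inter> ({s. X s = x} \<inter> {s. x + j < Y s})"
  have B: "before c (x + j) (?B x j)" for x j
  proof (intro before_Int)
    show "before c (x + j) (if m \<le> x then A else {})"
      using before_mono[OF A, of "x + j"] by (auto simp: before_def)
    show "before c (x + j) {s. X s = x}" by (rule before_mono[OF before_stack_time_eq[OF X]]) simp
    show "before c (x + j) {s. x + j < Y s}" by (rule before_stack_time_gr[OF Y])
  qed
  have "indicator (A \<inter> {s. m \<le> X s}) s * window i c K (X s) (Y s) s
     = (\<Sum>x\<le>n. \<Sum>j<K. indicator (?B x j) s * (real_of_int (stack s c (x + j) $ i) - drift i c))" for s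
    unfolding window_expand[where X = X and Y = Y, OF n] sum_distrib_left
    by (intro sum.cong refl) (auto simp: indicator_def)
  then have "(\<integral>s. indicator (A \<inter> {s. m \<le> X s}) s * window i c K (X s) (Y s) s \<partial>N)
     = (\<integral>s. (\<Sum>x\<le>n. \<Sum>j<K. indicator (?B x j) s * (real_of_int (stack s c (x + j) $ i) - drift i c)) \<partial>N)"
    by simp
  also have "\<dots> = (\<Sum>x\<le>n. \<Sum>j<K. \<integral>s. indicator (?B x j) s * (real_of_int (stack s c (x + j) $ i) - drift i c) \<partial>N)"
    by (subst Bochner_Integration.integral_sum; intro Bochner_Integration.integrable_sum centered(2)[OF B] sum.cong refl Bochner_Integration.integral_sum)
  also have "\<dots> = 0" by (simp only: centered(1)[OF B] sum.neutral_const)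
  finally show ?thesis .
qed

text \<open>The intersection \<open>?E\<close> need not be decided at any index. Replacing it by
  \<open>A m \<inter> {s. m \<le> X n s}\<close>, to which optional stopping applies, costs at most
  \<open>2 * K\<close> times the sum of \<open>N.prob (A m) - N.prob ?E\<close> and
  \<open>N.prob {s. X n s < m}\<close>. First \<open>m\<close> is chosen, then \<open>n\<close>,
  using that the unread start tends to infinity.\<close>

lemma window_integral_vanishes:
  assumes X: "\<And>n. stack_time c (X n)" and Y: "\<And>n. stack_time c (Y n)" and Xn: "\<And>n s. X n s \<le> n"
    and Xm: "\<And>m n s. m \<le> n \<Longrightarrow> X m s \<le> X n s" and Xu: "AE s in N. \<forall>z. \<exists>n. z \<le> X n s"
    and A: "\<And>m. before c m (A m)" and Am: "decseq A"
  shows "(\<lambda>n. \<integral>s. indicator (\<Inter>m. A m) s * window i c K (X n s) (Y n s) s \<partial>N) \<longlonglongrightarrow> 0"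
proof (cases "K = 0")
  case True
  then show ?thesis by (simp add: window_def)
next
  case False
  let ?E = "\<Inter>m. A m"
  have mA: "A m \<in> sets N" for m by (rule before_sets[OF A])
  have mE: "?E \<in> sets N" by (intro sets.countable_INT image_subsetI mA) simp
  have mX: "{s. P (X n s)} \<in> sets N" for P n by (rule sets_stack_time[OF X])
  have bound: "\<bar>\<integral>s. indicator ?E s * window i c K (X n s) (Y n s) s \<partial>N\<bar>
     \<le> 2 * real K * ((N.prob (A m) - N.prob ?E) + N.prob {s. X n s < m})" for m n
  proof -
    let ?w = "\<lambda>s. window i c K (X n s) (Y n s) s"
    let ?B = "A m \<inter> {s. m \<le> X n s}"
    have mB: "?B \<in> sets N" by (intro sets.Int mA mX)
    have iE: "integrable N (\<lambda>s. indicator ?E s * ?w s)" and iB: "integrable N (\<lambda>s. indicator ?B s * ?w s)"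
      by (rule integrable_window[OF X Y Xn mE], rule integrable_window[OF X Y Xn mB])
    have iD: "integrable N (\<lambda>s. 2 * real K * indicator S s :: real)" if "S \<in> sets N" for S
      using that by (intro integrable_mult_right integrable_real_indicator) (simp_all add: less_top[symmetric])
    have eq: "(\<integral>s. indicator ?E s * ?w s \<partial>N) = (\<integral>s. indicator ?E s * ?w s - indicator ?B s * ?w s \<partial>N)"
      using Bochner_Integration.integral_diff[OF iE iB] window_integral_zero[OF X Y Xn A, where i = i and K = K] by simp
    have "\<bar>\<integral>s. indicator ?E s * ?w s \<partial>N\<bar> \<le> (\<integral>s. \<bar>indicator ?E s * ?w s - indicator ?B s * ?w s\<bar> \<partial>N)" unfolding eq by (rule integral_abs_bound)
    also have "\<dots> \<le> (\<integral>s. 2 * real K * indicator (A m - ?E) s + 2 * real K * indicator {s. X n s < m} s \<partial>N)"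
    proof (rule integral_mono_AE)
      show "integrable N (\<lambda>s. \<bar>indicator ?E s * ?w s - indicator ?B s * ?w s\<bar>)"
        by (rule integrable_abs[OF Bochner_Integration.integrable_diff[OF iE iB]])
      show "integrable N (\<lambda>s. 2 * real K * indicator (A m - ?E) s + 2 * real K * indicator {s. X n s < m} s)"
        by (rule Bochner_Integration.integrable_add[OF iD[OF sets.Diff[OF mA mE]] iD[OF mX[of "\<lambda>x. x < m" n]]])
      show "AE s in N. \<bar>indicator ?E s * ?w s - indicator ?B s * ?w s\<bar> \<le> 2 * real K * indicator (A m - ?E) s + 2 * real K * indicator {s. X n s < m} s"
        using AE_window_bound[of i]
      proof eventually_elim
        case (elim s)
        then have w: "\<bar>?w s\<bar> \<le> 2 * real K" by blast
        show ?case
        proof (cases "s \<in> ?E")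
          case True
          then have "s \<in> A m" by blast
          then show ?thesis using True w by (simp add: indicator_def not_le del: INT_iff)
        next
          case False
          then show ?thesis using w by (simp add: indicator_def del: INT_iff)
        qed
      qed
    qed
    also have "\<dots> = 2 * real K * N.prob (A m - ?E) + 2 * real K * N.prob {s. X n s < m}"
    proof (subst Bochner_Integration.integral_add)
      show "integrable N (\<lambda>s. 2 * real K * indicator (A m - ?E) s :: real)" by (rule iD[OF sets.Diff[OF mA mE]])
      show "integrable N (\<lambda>s. 2 * real K * indicator {s. X n s < m} s :: real)" by (rule iD[OF mX[of "\<lambda>x. x < m" n]])
    qed (simp del: INT_iff)
    also have "N.prob (A m - ?E) = N.prob (A m) - N.prob ?E"
      by (rule N.finite_measure_Diff[OF mA mE]) blast
    finally show ?thesis by (simp add: algebra_simps)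
  qed
  have lim: "(\<lambda>m. N.prob (A m)) \<longlonglongrightarrow> N.prob ?E"
    by (rule N.finite_Lim_measure_decseq) (use mA Am in auto)
  have limX: "(\<lambda>n. N.prob {s. X n s < m}) \<longlonglongrightarrow> 0" for m
  proof -
    have "(\<lambda>n. N.prob {s\<in>space N. X n s < m}) \<longlonglongrightarrow> 0"
    proof (rule N.AE_tendsto_measure_zero)
      show "{s\<in>space N. X n s < m} \<in> sets N" for n using mX[of "\<lambda>x. x < m" n] by simp
      show "X k s < m" if "k \<le> n" "X n s < m" for k n s using Xm[OF that(1), of s] that(2) by simp
      show "AE s in N. \<exists>n. \<not> X n s < m" using Xu by eventually_elim (simp add: not_less)
    qed
    then show ?thesis by simp
  qed
  show ?thesis
  proof (rule LIMSEQ_I)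
    fix r :: real assume r: "0 < r"
    define h where "h = r / (4 * real K)"
    have h: "0 < h" using r False by (simp add: h_def)
    have "\<forall>\<^sub>F m in sequentially. N.prob (A m) < N.prob ?E + h" by (rule order_tendstoD(2)[OF lim]) (use h in simp)
    then obtain m where m: "N.prob (A m) < N.prob ?E + h" by (auto simp: eventually_sequentially)
    have "\<forall>\<^sub>F n in sequentially. N.prob {s. X n s < m} < h" by (rule order_tendstoD(2)[OF limX]) (rule h)
    then obtain n0 where n0: "\<And>n. n0 \<le> n \<Longrightarrow> N.prob {s. X n s < m} < h" by (auto simp: eventually_sequentially)
    show "\<exists>no. \<forall>n\<ge>no. norm ((\<integral>s. indicator ?E s * window i c K (X n s) (Y n s) s \<partial>N) - 0) < r"
    proof (intro exI allI impI)
      fix n assume n: "n0 \<le> n"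
      have "2 * real K * ((N.prob (A m) - N.prob ?E) + N.prob {s. X n s < m}) < 2 * real K * (h + h)"
        using m n0[OF n] False by (intro mult_strict_left_mono) auto
      also have "\<dots> = r" using False by (simp add: h_def)
      finally show "norm ((\<integral>s. indicator ?E s * window i c K (X n s) (Y n s) s \<partial>N) - 0) < r"
        using bound[of n m] by simp
    qed
  qed
qed

section \<open>The gap between two coupled walks\<close>

lemma fluct_add: "fluct i c 0 (a + k) s = fluct i c 0 a s + fluct i c a k s"
  by (induction k) (simp_all add: fluct_def)

lemma window_full: "k \<le> K \<Longrightarrow> window i c K x (x + k) s = fluct i c x k s"
  unfolding window_def fluct_def by (intro sum.mono_neutral_cong_right) auto

definition gap :: "'d \<Rightarrow> real \<Rightarrow> real \<Rightarrow> nat \<Rightarrow> 'd sample \<Rightarrow> real" where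
  "gap i p p' n s = real_of_int (W p' s n $ i) - real_of_int (W p s n $ i)"

definition lead :: "real \<Rightarrow> real \<Rightarrow> nat \<Rightarrow> 'd sample \<Rightarrow> nat" where
  "lead p p' n s = cnt p' s n - cnt p s n"

lemma used_lead:
  assumes "p \<le> p'"
  shows "used True p' s n = used True p s n + lead p p' n s" "used False p s n = used False p' s n + lead p p' n s"
  using cnt_coupled[OF assms, of s n] cnt_le[of p s n] cnt_le[of p' s n] by (auto simp: used_def lead_def)

text \<open>On the first stack walk \<open>p'\<close> has read \<open>lead\<close> entries beyond
  those of walk \<open>p\<close>; on the second stack the roles are exchanged. The entries read by
  both cancel.\<close>

lemma gap_eq:
  assumes "p \<le> p'"
  shows "gap i p p' n s = fluct i True (used True p s n) (lead p p' n s) s - fluct i False (used False p' s n) (lead p p' n s) s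
    + real (lead p p' n s) * (drift i True - drift i False)"
proof -
  have W: "W q s n = pos s (used True q s n) (used False q s n)" for q by (simp add: W_def used_def)
  show ?thesis
    unfolding gap_def W pos_component used_lead(1)[OF assms] used_lead(2)[OF assms] fluct_add by (simp add: algebra_simps)
qed

lemma measurable_gap: "gap i p p' n \<in> borel_measurable N"
proof -
  have "(\<lambda>s. real_of_int (W q s n $ i)) \<in> borel_measurable N" for q
    by (rule measurable_compose[OF measurable_W_comp[of q n]]) simp
  then show ?thesis unfolding gap_def[abs_def] by measurable
qed

lemma sets_gap: "{s. gap i p p' n s < 0} \<in> sets N"
proof -
  have "{s\<in>space N. gap i p p' n s < 0} \<in> sets N" using measurable_gap[of i p p' n] by measurable
  then show ?thesis by simp
qed

lemma sets_lead: "{s. P (lead p p' n s)} \<in> sets N"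
proof -
  have m: "(\<lambda>s. x - cnt p s n) \<in> N \<rightarrow>\<^sub>M count_space UNIV" for x
    by (rule measurable_compose[OF measurable_cnt[of p n]]) simp
  have "(\<lambda>s. lead p p' n s) \<in> N \<rightarrow>\<^sub>M count_space UNIV"
    unfolding lead_def by (rule measurable_compose_countable[where f = "\<lambda>x s. x - cnt p s n" and g = "\<lambda>s. cnt p' s n", OF m measurable_cnt])
  from measurable_sets[OF this, of "{x. P x}"] show ?thesis by (simp add: vimage_def)
qed

text \<open>With \<open>\<delta>\<close> half the drift difference, a negative gap at lead
  \<open>k\<close> forces one of two fluctuations of length \<open>k\<close> to deviate by at least
  \<open>\<delta> * k\<close>. Both start at stack times, so \<open>chernoff_tail\<close> applies
  and the bound is uniform in \<open>n\<close>.\<close>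

lemma lead_tail:
  assumes pp: "p \<le> p'" and d: "drift i False < drift i True"
  obtains r where "0 < r" "r < 1"
    "\<And>n K. N.prob ({s. gap i p p' n s < 0} \<inter> {s. K \<le> lead p p' n s}) \<le> 2 * r ^ K / (1 - r)"
proof -
  define \<delta> where "\<delta> = (drift i True - drift i False) / 2"
  have \<delta>: "0 < \<delta>" using d by (simp add: \<delta>_def)
  define r where "r = exp (- (\<delta>\<^sup>2 / 2))"
  have r: "0 < r" "r < 1" using \<delta> by (simp_all add: r_def)
  have "N.prob ({s. gap i p p' n s < 0} \<inter> {s. K \<le> lead p p' n s}) \<le> 2 * r ^ K / (1 - r)" for n K
  proof -
    let ?A = "{s. \<exists>k\<ge>K. \<delta> * real k \<le> - 1 * fluct i True (used True p s n) k s}"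
    let ?B = "{s. \<exists>k\<ge>K. \<delta> * real k \<le> 1 * fluct i False (used False p' s n) k s}"
    have mA: "?A \<in> sets N" by (rule chernoff_tail(1)[OF stack_time_used used_le \<delta>]) simp
    have mB: "?B \<in> sets N" by (rule chernoff_tail(1)[OF stack_time_used used_le \<delta>]) simp
    have pA: "N.prob ?A \<le> r ^ K / (1 - r)" unfolding r_def by (rule chernoff_tail(2)[OF stack_time_used used_le \<delta>]) simp
    have pB: "N.prob ?B \<le> r ^ K / (1 - r)" unfolding r_def by (rule chernoff_tail(2)[OF stack_time_used used_le \<delta>]) simp
    have "{s. gap i p p' n s < 0} \<inter> {s. K \<le> lead p p' n s} \<subseteq> ?A \<union> ?B"
    proof
      fix s assume s: "s \<in> {s. gap i p p' n s < 0} \<inter> {s. K \<le> lead p p' n s}"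
      let ?k = "lead p p' n s"
      have "fluct i True (used True p s n) ?k s - fluct i False (used False p' s n) ?k s + 2 * (\<delta> * real ?k) < 0"
      proof -
        have "2 * (\<delta> * real ?k) = real ?k * (drift i True - drift i False)" by (simp add: \<delta>_def)
        moreover have "gap i p p' n s < 0" using s by blast
        ultimately show ?thesis using gap_eq[OF pp, of i n s] by linarith
      qed
      then have "\<delta> * real ?k \<le> - 1 * fluct i True (used True p s n) ?k s \<or> \<delta> * real ?k \<le> 1 * fluct i False (used False p' s n) ?k s"
        by linarith
      moreover have "K \<le> ?k" using s by simp
      ultimately show "s \<in> ?A \<union> ?B" by blast
    qed
    then have "N.prob ({s. gap i p p' n s < 0} \<inter> {s. K \<le> lead p p' n s}) \<le> N.prob (?A \<union> ?B)"
      by (rule N.finite_measure_mono) (rule sets.Un[OF mA mB])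
    also have "\<dots> \<le> N.prob ?A + N.prob ?B" by (rule measure_Un_le[OF mA mB])
    also have "\<dots> \<le> r ^ K / (1 - r) + r ^ K / (1 - r)" by (rule add_mono[OF pA pB])
    finally show ?thesis by simp
  qed
  with that r show thesis by blast
qed

definition behind :: "'d \<Rightarrow> real \<Rightarrow> real \<Rightarrow> nat \<Rightarrow> nat \<Rightarrow> 'd sample set" where
  "behind i p p' n0 m = {s. \<forall>n\<in>{n0..m}. gap i p p' n s < 0}"

text \<open>By time \<open>m\<close> a walk has read at most \<open>m\<close> entries of either
  stack, so entries from \<open>m\<close> on do not influence the event.\<close>

lemma before_behind: "before c m (behind i p p' n0 m)"
  unfolding before_def
proof (intro conjI allI impI)
  have "behind i p p' n0 m = (\<Inter>n. {s. n \<in> {n0..m} \<longrightarrow> gap i p p' n s < 0})" by (auto simp: behind_def)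
  also have "\<dots> \<in> sets N"
  proof (intro sets.countable_INT image_subsetI)
    show "{s. n \<in> {n0..m} \<longrightarrow> gap i p p' n s < 0} \<in> sets N" for n
      using sets_gap[of i p p' n] sets.top[of N] by (cases "n \<in> {n0..m}") (simp_all del: atLeastAtMost_iff)
  qed simp
  finally show "behind i p p' n0 m \<in> sets N" .
  fix s s' :: "'d sample" assume a: "agree c m s s'" and s: "s \<in> behind i p p' n0 m"
  have "W q s' n = W q s n" if "n \<le> m" for q n
  proof -
    have "cnt q s' n = cnt q s n \<and> W q s' n = W q s n"
    proof (rule cnt_cong[where ma = m and mb = m and n = m])
      show "label s' x = label s x" for x using a by (simp add: agree_def label_def)
      show "stack s' True j = stack s True j" "stack s' False j = stack s False j" if "j < m" for j
        using a that by (simp_all add: agree_def stack_def)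
    qed (use cnt_le that in auto)
    then show ?thesis by simp
  qed
  then have "gap i p p' n s' = gap i p p' n s" if "n \<le> m" for n using that by (simp add: gap_def)
  then show "s' \<in> behind i p p' n0 m" using s by (simp add: behind_def)
qed

lemma INT_behind: "(\<Inter>m. behind i p p' n0 m) = {s. \<forall>n\<ge>n0. gap i p p' n s < 0}"
proof (intro equalityI subsetI)
  fix s assume "s \<in> (\<Inter>m. behind i p p' n0 m)"
  then have "gap i p p' n s < 0" if "n0 \<le> n" for n using that INT_D[of s "behind i p p' n0" UNIV n] by (simp add: behind_def)
  then show "s \<in> {s. \<forall>n\<ge>n0. gap i p p' n s < 0}" by simp
qed (simp add: behind_def)

text \<open>The linear factor is the cost of cutting windows at \<open>K\<close>, the geometric one
  comes from \<open>lead_tail\<close>.\<close>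

lemma behind_tendsto: "(0 < r \<and> r < 1) \<Longrightarrow> (\<lambda>K. (a + b * real K) * (2 * r ^ K / (1 - r))) \<longlonglongrightarrow> 0" for r :: real
proof -
  assume r: "0 < r \<and> r < 1"
  have "(\<lambda>K. 2 / (1 - r) * (a * r ^ K + b * (real K * r ^ K))) \<longlonglongrightarrow> 2 / (1 - r) * (a * 0 + b * 0)"
    using r powser_times_n_limit_0[of r] by (intro tendsto_intros LIMSEQ_power_zero) auto
  then show ?thesis by (simp add: field_simps)
qed

text \<open>While the walk is behind, the lead is positive, since lead 0 means equal positions. If
  the lead is at most \<open>K\<close>, the windows are the full fluctuations and a negative gap
  gives \<open>?wF - ?wT \<ge> ?\<Delta>\<close>. If it is larger, the windows are at most
  \<open>2 * K\<close> in absolute value, so adding \<open>?\<Delta> + 4 * K\<close> restores the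
  inequality on an event of geometric probability. After integration, \<open>n\<close> to infinity
  removes the windows and \<open>K\<close> to infinity removes the correction.\<close>

lemma behind_null_interior:
  assumes pp: "p \<le> p'" and d: "drift i False < drift i True"
    and u1: "AE s in N. \<forall>z. \<exists>n. z \<le> used True p s n" and u2: "AE s in N. \<forall>z. \<exists>n. z \<le> used False p' s n"
  shows "N.prob (\<Inter>m. behind i p p' n0 m) = 0"
proof -
  let ?E = "\<Inter>m. behind i p p' n0 m" and ?\<Delta> = "drift i True - drift i False"
  obtain r where r: "0 < r" "r < 1"
    and tail: "\<And>n K. N.prob ({s. gap i p p' n s < 0} \<inter> {s. K \<le> lead p p' n s}) \<le> 2 * r ^ K / (1 - r)"
    using lead_tail[OF pp d] by blast
  have mE: "?E \<in> sets N" by (intro sets.countable_INT image_subsetI before_sets[OF before_behind]) simp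
  let ?wT = "\<lambda>K n s. window i True K (used True p s n) (used True p' s n) s"
  let ?wF = "\<lambda>K n s. window i False K (used False p' s n) (used False p s n) s"
  have dec: "decseq (behind i p p' n0)" by (auto simp: decseq_def behind_def)
  have limT: "(\<lambda>n. \<integral>s. indicator ?E s * ?wT K n s \<partial>N) \<longlonglongrightarrow> 0" for K
    by (rule window_integral_vanishes[OF stack_time_used stack_time_used used_le used_mono u1 before_behind dec])
  have limF: "(\<lambda>n. \<integral>s. indicator ?E s * ?wF K n s \<partial>N) \<longlonglongrightarrow> 0" for K
    by (rule window_integral_vanishes[OF stack_time_used stack_time_used used_le used_mono u2 before_behind dec])
  have bound: "?\<Delta> * N.prob ?E \<le> (\<integral>s. indicator ?E s * ?wF K n s \<partial>N) - (\<integral>s. indicator ?E s * ?wT K n s \<partial>N)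
      + (?\<Delta> + 4 * real K) * (2 * r ^ K / (1 - r))" if n: "n0 \<le> n" for K n
  proof -
    let ?L = "{s. gap i p p' n s < 0} \<inter> {s. K \<le> lead p p' n s}"
    have mL: "?L \<in> sets N" by (rule sets.Int[OF sets_gap sets_lead])
    have iT: "integrable N (\<lambda>s. indicator ?E s * ?wT K n s)" by (rule integrable_window[OF stack_time_used stack_time_used used_le mE])
    have iF: "integrable N (\<lambda>s. indicator ?E s * ?wF K n s)" by (rule integrable_window[OF stack_time_used stack_time_used used_le mE])
    have iI: "integrable N (\<lambda>s. c * indicator S s :: real)" if "S \<in> sets N" for S c
      using that by (intro integrable_mult_right integrable_real_indicator) (simp_all add: less_top[symmetric])
    have "?\<Delta> * N.prob ?E = (\<integral>s. ?\<Delta> * indicator ?E s \<partial>N)" by (simp del: INT_iff)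
    also have "\<dots> \<le> (\<integral>s. (indicator ?E s * ?wF K n s - indicator ?E s * ?wT K n s) + (?\<Delta> + 4 * real K) * indicator ?L s \<partial>N)"
    proof (rule integral_mono_AE[OF iI[OF mE] Bochner_Integration.integrable_add[OF Bochner_Integration.integrable_diff[OF iF iT] iI[OF mL]]])
      show "AE s in N. ?\<Delta> * indicator ?E s \<le> (indicator ?E s * ?wF K n s - indicator ?E s * ?wT K n s) + (?\<Delta> + 4 * real K) * indicator ?L s"
        using AE_window_bound[of i]
      proof eventually_elim
        case (elim s)
        let ?k = "lead p p' n s"
        show ?case
        proof (cases "s \<in> ?E")
          case False
          have "0 \<le> (?\<Delta> + 4 * real K) * indicator ?L s" using d by simp
          then show ?thesis unfolding indicator_simps(2)[OF False] by simp
        next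
          case True
          then have g: "gap i p p' n s < 0" using n unfolding INT_behind by simp
          show ?thesis
          proof (cases "K < ?k")
            case True
            have "\<bar>?wT K n s\<bar> \<le> 2 * real K" "\<bar>?wF K n s\<bar> \<le> 2 * real K" by (rule elim[rule_format])+
            then have "?\<Delta> \<le> (?wF K n s - ?wT K n s) + (?\<Delta> + 4 * real K)" by linarith
            moreover have "s \<in> ?L" using True g by simp
            ultimately show ?thesis unfolding indicator_simps(1)[OF \<open>s \<in> ?E\<close>] by (simp only: indicator_simps(1) mult_1 mult_1_right)
          next
            case False
            have "?k \<noteq> 0"
            proof
              assume "?k = 0"
              then show False using g gap_eq[OF pp, of i n s] by (simp add: fluct_def)
            qed
            then have "?\<Delta> \<le> real ?k * ?\<Delta>" using d by simp
            moreover have "?wT K n s = fluct i True (used True p s n) ?k s" "?wF K n s = fluct i False (used False p' s n) ?k s"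
              using False unfolding used_lead(1)[OF pp] used_lead(2)[OF pp] by (intro window_full; simp)+
            ultimately have "?\<Delta> \<le> ?wF K n s - ?wT K n s" using g gap_eq[OF pp, of i n s] by linarith
            moreover have "0 \<le> (?\<Delta> + 4 * real K) * indicator ?L s" using d by simp
            ultimately show ?thesis unfolding indicator_simps(1)[OF \<open>s \<in> ?E\<close>] mult_1 mult_1_right by linarith
          qed
        qed
      qed
    qed
    also have "\<dots> = (\<integral>s. indicator ?E s * ?wF K n s \<partial>N) - (\<integral>s. indicator ?E s * ?wT K n s \<partial>N) + (?\<Delta> + 4 * real K) * N.prob ?L"
      unfolding Bochner_Integration.integral_add[OF Bochner_Integration.integrable_diff[OF iF iT] iI[OF mL]]
        Bochner_Integration.integral_diff[OF iF iT] using mL by simp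
    also have "\<dots> \<le> (\<integral>s. indicator ?E s * ?wF K n s \<partial>N) - (\<integral>s. indicator ?E s * ?wT K n s \<partial>N) + (?\<Delta> + 4 * real K) * (2 * r ^ K / (1 - r))"
      using d by (intro add_left_mono mult_left_mono tail) simp
    finally show ?thesis .
  qed
  have "?\<Delta> * N.prob ?E \<le> (?\<Delta> + 4 * real K) * (2 * r ^ K / (1 - r))" for K
  proof (rule LIMSEQ_le_const)
    show "(\<lambda>n. (\<integral>s. indicator ?E s * ?wF K n s \<partial>N) - (\<integral>s. indicator ?E s * ?wT K n s \<partial>N)
      + (?\<Delta> + 4 * real K) * (2 * r ^ K / (1 - r))) \<longlonglongrightarrow> (?\<Delta> + 4 * real K) * (2 * r ^ K / (1 - r))"
      using tendsto_add[OF tendsto_diff[OF limF[of K] limT[of K]] tendsto_const[of "(?\<Delta> + 4 * real K) * (2 * r ^ K / (1 - r))"]] by simp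
    show "\<exists>M. \<forall>n\<ge>M. ?\<Delta> * N.prob ?E \<le> (\<integral>s. indicator ?E s * ?wF K n s \<partial>N) - (\<integral>s. indicator ?E s * ?wT K n s \<partial>N)
      + (?\<Delta> + 4 * real K) * (2 * r ^ K / (1 - r))" using bound by blast
  qed
  then have "?\<Delta> * N.prob ?E \<le> 0" by (intro LIMSEQ_le_const[OF behind_tendsto[of r ?\<Delta> 4]]) (use r in auto)
  then have "N.prob ?E \<le> 0" using d by (simp add: mult_le_0_iff)
  then show ?thesis using measure_nonneg[of N ?E] by linarith
qed

text \<open>Here the lead tends to infinity, so being behind implies being behind at a large lead,
  whose probability is geometric in \<open>K\<close>. This serves \<open>p = 0\<close> and
  \<open>p' = 1\<close>, where one of the window starts in \<open>behind_null_interior\<close> stays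
  at 0.\<close>

lemma behind_null_boundary:
  assumes pp: "p \<le> p'" and d: "drift i False < drift i True"
    and u: "AE s in N. \<forall>z. \<exists>n. \<forall>m\<ge>n. z \<le> lead p p' m s"
  shows "N.prob (\<Inter>m. behind i p p' n0 m) = 0"
proof -
  let ?E = "\<Inter>m. behind i p p' n0 m"
  obtain r where r: "0 < r" "r < 1"
    and tail: "\<And>n K. N.prob ({s. gap i p p' n s < 0} \<inter> {s. K \<le> lead p p' n s}) \<le> 2 * r ^ K / (1 - r)"
    using lead_tail[OF pp d] by blast
  have "N.prob ?E \<le> 2 * r ^ K / (1 - r)" for K
  proof (rule LIMSEQ_le_const)
    let ?R = "\<lambda>n. {s. \<exists>m\<ge>n. lead p p' m s < K}"
    have mR: "?R n \<in> sets N" for n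
    proof -
      have "?R n = (\<Union>m\<in>{n..}. {s. lead p p' m s < K})" by auto
      also have "\<dots> \<in> sets N" by (intro sets.countable_UN' image_subsetI sets_lead) auto
      finally show ?thesis .
    qed
    have R: "(\<lambda>n. N.prob {s\<in>space N. \<exists>m\<ge>n. lead p p' m s < K}) \<longlonglongrightarrow> 0"
    proof (rule N.AE_tendsto_measure_zero[where R = "\<lambda>n s. \<exists>m\<ge>n. lead p p' m s < K"])
      show "{s\<in>space N. \<exists>m\<ge>n. lead p p' m s < K} \<in> sets N" for n
        using mR[of n] by (simp only: space_N UNIV_I simp_thms)
      show "\<exists>l\<ge>m. lead p p' l s < K" if mn: "m \<le> n" and ex: "\<exists>l\<ge>n. lead p p' l s < K" for m n s
      proof -
        obtain l where "n \<le> l" "lead p p' l s < K" using ex by blast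
        then show ?thesis using mn by (intro exI[of _ l]) simp
      qed
      show "AE s in N. \<exists>n. \<not> (\<exists>m\<ge>n. lead p p' m s < K)" using u
      proof eventually_elim
        case (elim s)
        then obtain n where "\<forall>m\<ge>n. K \<le> lead p p' m s" by blast
        then show ?case by (intro exI[of _ n]) (simp add: not_less)
      qed
    qed
    from tendsto_add[OF R[unfolded space_N] tendsto_const[of "2 * r ^ K / (1 - r)"]]
    show "(\<lambda>n. N.prob (?R n) + 2 * r ^ K / (1 - r)) \<longlonglongrightarrow> 2 * r ^ K / (1 - r)"
      by (simp only: UNIV_I simp_thms add_0)
    have "N.prob ?E \<le> N.prob (?R n) + 2 * r ^ K / (1 - r)" if n: "n0 \<le> n" for n
    proof -
      let ?L = "{s. gap i p p' n s < 0} \<inter> {s. K \<le> lead p p' n s}"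
      have mL: "?L \<in> sets N" by (rule sets.Int[OF sets_gap sets_lead])
      have "?E \<subseteq> ?R n \<union> ?L" unfolding INT_behind using n by (auto simp: not_le)
      then have "N.prob ?E \<le> N.prob (?R n \<union> ?L)" by (rule N.finite_measure_mono) (rule sets.Un[OF mR mL])
      also have "\<dots> \<le> N.prob (?R n) + N.prob ?L" by (rule measure_Un_le[OF mR mL])
      also have "\<dots> \<le> N.prob (?R n) + 2 * r ^ K / (1 - r)" by (rule add_left_mono[OF tail])
      finally show ?thesis .
    qed
    then show "\<exists>M. \<forall>n\<ge>M. N.prob ?E \<le> N.prob (?R n) + 2 * r ^ K / (1 - r)" by blast
  qed
  then have "N.prob ?E \<le> 0" by (intro LIMSEQ_le_const[OF behind_tendsto[of r 1 0]]) (use r in auto)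
  then show ?thesis using measure_nonneg[of N ?E] by linarith
qed

lemma used_zero:
  assumes p: "0 \<le> p" "p \<le> 1" and z: "type_prob p c = 0"
  shows "AE s in N. \<forall>n. used c p s n = 0"
proof -
  have "AE s in N. (label s x < p) \<noteq> c" for x
  proof -
    have m: "{s. (label s x < p) = c} \<in> sets N"
    proof -
      have "(\<lambda>s. label s x < p) \<in> N \<rightarrow>\<^sub>M count_space UNIV" by measurable
      from measurable_sets[OF this, of "{c}"] show ?thesis by (simp add: vimage_def)
    qed
    have "emeasure N {s. (label s x < p) = c} = 0" using labels_prob[OF p, of "{x}" c] z by simp
    then have "{s. (label s x < p) = c} \<in> null_sets N" using m by (simp add: null_sets_def)
    from AE_not_in[OF this] show ?thesis by eventually_elim simp
  qed
  then have "AE s in N. \<forall>x. (label s x < p) \<noteq> c" by (simp only: AE_all_countable) simp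
  then show ?thesis
  proof eventually_elim
    case (elim s)
    have "used c p s n = 0" for n
    proof (induction n)
      case (Suc n)
      have "(label s (W p s n) < p) \<noteq> c" using elim by blast
      then show ?case using Suc cnt_le[of p s n] cnt_Suc_W[of p s n] by (cases c) (simp_all add: used_def del: cnt.simps)
    qed (simp add: used_def)
    then show ?case by blast
  qed
qed

theorem overtakes_infinitely_often:
  assumes p: "0 \<le> p" "p < p'" "p' \<le> 1" and d: "drift i False < drift i True"
  shows "AE s in N. \<exists>\<^sub>\<infinity>n. W p s n $ i \<le> W p' s n $ i"
proof -
  have pp: "p \<le> p'" using p by simp
  have uT: "AE s in N. \<forall>z. \<exists>n. z \<le> used True q s n" if "0 < q" "q \<le> 1" for q
    using used_unbounded[of q True] that by (simp add: type_prob_def)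
  have uF: "AE s in N. \<forall>z. \<exists>n. z \<le> used False q s n" if "0 \<le> q" "q < 1" for q
    using used_unbounded[of q False] that by (simp add: type_prob_def)
  have "N.prob (\<Inter>m. behind i p p' n0 m) = 0" for n0
  proof -
    consider "0 < p" "p' < 1" | "p = 0" | "p' = 1" using p by linarith
    then show ?thesis
    proof cases
      case 1
      show ?thesis by (rule behind_null_interior[OF pp d uT uF]) (use 1 p in auto)
    next
      case 2
      have z: "AE s in N. \<forall>n. used True p s n = 0" using 2 by (intro used_zero) (simp_all add: type_prob_def)
      have "AE s in N. \<forall>z. \<exists>n. z \<le> used True p' s n" by (rule uT) (use p in auto)
      with z have "AE s in N. \<forall>z. \<exists>n. \<forall>m\<ge>n. z \<le> lead p p' m s"
      proof eventually_elim
        case (elim s)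
        then have "used True p' s n = lead p p' n s" for n using used_lead(1)[OF pp, of s n] by simp
        then show ?case using elim(2) used_mono[of _ _ True p' s] by (metis order_trans)
      qed
      then show ?thesis by (rule behind_null_boundary[OF pp d])
    next
      case 3
      have z: "AE s in N. \<forall>n. used False p' s n = 0" using 3 by (intro used_zero) (simp_all add: type_prob_def)
      have "AE s in N. \<forall>z. \<exists>n. z \<le> used False p s n" by (rule uF) (use p in auto)
      with z have "AE s in N. \<forall>z. \<exists>n. \<forall>m\<ge>n. z \<le> lead p p' m s"
      proof eventually_elim
        case (elim s)
        then have "used False p s n = lead p p' n s" for n using used_lead(2)[OF pp, of s n] by simp
        then show ?case using elim(2) used_mono[of _ _ False p s] by (metis order_trans)
      qed
      then show ?thesis by (rule behind_null_boundary[OF pp d])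
    qed
  qed
  moreover have "(\<Inter>m. behind i p p' n0 m) \<in> sets N" for n0
    by (intro sets.countable_INT image_subsetI before_sets[OF before_behind]) simp
  ultimately have "(\<Inter>m. behind i p p' n0 m) \<in> null_sets N" for n0
    by (simp add: null_sets_def N.emeasure_eq_measure del: INT_iff)
  from AE_not_in[OF this] have "AE s in N. s \<notin> (\<Inter>m. behind i p p' n0 m)" for n0 .
  then have "AE s in N. \<forall>n0. s \<notin> (\<Inter>m. behind i p p' n0 m)" by (simp only: AE_all_countable) simp
  then show ?thesis
  proof eventually_elim
    case (elim s)
    show ?case
      unfolding INFM_nat_le
    proof
      fix n0
      have "s \<notin> (\<Inter>m. behind i p p' n0 m)" using elim by blast
      then obtain n where "n0 \<le> n" "0 \<le> gap i p p' n s" unfolding INT_behind by (auto simp: not_less)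
      then show "\<exists>n\<ge>n0. W p s n $ i \<le> W p' s n $ i" by (auto simp: gap_def)
    qed
  qed
qed

end

section \<open>Velocities of the coupled walks and the final sample space\<close>

lemma (in two_laws) distr_W:
  assumes p: "0 \<le> p" "p \<le> 1"
  shows "distr N path_space (W p) = walk_law (two_point_law \<gamma>1 \<gamma>2 p)"
proof (rule path_measure_eqI)
  let ?\<mu> = "two_point_law \<gamma>1 \<gamma>2 p"
  interpret D: prob_space "distr N path_space (W p)" by (rule N.prob_space_distr) (rule measurable_W)
  show "finite_measure (distr N path_space (W p))" by unfold_locales
  show "sets (distr N path_space (W p)) = sets path_space" by simp
  show "sets (walk_law ?\<mu>) = sets path_space" by simp
  fix x :: "'d path" and n
  have UE: "(UNIV :: 'd env set) \<in> sets env_space" using sets.top[of env_space] by (simp add: env_space_def space_PiM)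
  have UC: "(UNIV :: 'd env set) \<times> cyl x n \<in> sets (env_space \<Otimes>\<^sub>M path_space)"
    by (rule pair_measureI[OF UE sets_cyl])
  have "emeasure (distr N path_space (W p)) (cyl x n) = emeasure N ((\<lambda>s. (om p s, W p s)) -` (UNIV \<times> cyl x n) \<inter> space N)"
    unfolding emeasure_distr[OF measurable_W sets_cyl] by (rule arg_cong[where f = "emeasure N"]) auto
  also have "\<dots> = emeasure (annealed_law ?\<mu>) (UNIV \<times> cyl x n)"
    unfolding coupled_law(2)[OF p, symmetric] by (rule emeasure_distr[OF coupled_law(1)[OF p] UC, symmetric])
  also have "\<dots> = (\<integral>\<^sup>+\<omega>. emeasure (quenched_law \<omega>) (cyl x n) \<partial>env_law ?\<mu>)"
    unfolding cyl_def annealed_law_cylinder[OF UE] quenched_law_cylinder by simp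
  also have "\<dots> = emeasure (walk_law ?\<mu>) (cyl x n)"
    by (rule emeasure_walk_law[OF sets_cyl, symmetric])
  finally show "emeasure (distr N path_space (W p)) (cyl x n) = emeasure (walk_law ?\<mu>) (cyl x n)" .
qed

lemma (in two_laws) AE_W_velocity:
  assumes p: "0 \<le> p" "p \<le> 1"
  shows "AE s in N. convergent (mean_velocity (W p s))"
proof (rule AE_distrD[OF measurable_W])
  have "set_pmf (two_point_law \<gamma>1 \<gamma>2 p) \<subseteq> step_laws"
    using step1 step2 by (auto simp: two_point_law_def split: if_splits)
  then show "AE X in distr N path_space (W p). convergent (mean_velocity X)"
    unfolding distr_W[OF p] by (rule walk_velocity_exists)
qed

text \<open>The law of \<open>\<Phi>\<close> on the largest \<open>\<sigma>\<close>-algebra making \<open>\<Phi>\<close> measurable: it retains even those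
  almost sure properties of \<open>\<Phi>\<close> that depend on uncountably many coordinates.\<close>

lemma (in prob_space) canonical_space:
  fixes \<Phi> :: "'a \<Rightarrow> 'b" and L :: "'c measure"
  assumes L: "space L = UNIV"
  shows "\<exists>Q. prob_space Q \<and>
    (\<forall>g. (\<lambda>s. g (\<Phi> s)) \<in> M \<rightarrow>\<^sub>M L \<longrightarrow> g \<in> Q \<rightarrow>\<^sub>M L \<and> distr Q L g = distr M L (\<lambda>s. g (\<Phi> s))) \<and>
    (\<forall>P. (AE s in M. P (\<Phi> s)) \<longrightarrow> (AE t in Q. P t))"
proof -
  \<comment> \<open>In the completion every almost sure property defines a measurable set, so all
    almost sure statements pass to the image.\<close>
  let ?C = "completion M"
  define S where "S = {A. \<Phi> -` A \<inter> space M \<in> sets ?C}"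
  have "sigma_algebra UNIV S"
    unfolding sigma_algebra_iff2
  proof (intro conjI ballI allI impI)
    show "{} \<in> S" by (simp add: S_def)
    show "UNIV - A \<in> S" if "A \<in> S" for A
    proof -
      have "\<Phi> -` (UNIV - A) \<inter> space M = space ?C - (\<Phi> -` A \<inter> space M)" by auto
      also have "\<dots> \<in> sets ?C" using that by (intro sets.compl_sets) (simp add: S_def)
      finally show ?thesis by (simp only: S_def mem_Collect_eq)
    qed
    show "\<Union> (range A) \<in> S" if "range A \<subseteq> S" for A :: "nat \<Rightarrow> 'b set"
    proof -
      have "\<Phi> -` (\<Union> (range A)) \<inter> space M = (\<Union>n. \<Phi> -` A n \<inter> space M)" by auto
      also have "\<dots> \<in> sets ?C" using that by (intro sets.countable_UN) (auto simp: S_def)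
      finally show ?thesis by (simp only: S_def mem_Collect_eq)
    qed
  qed simp
  then have sets_S: "sets (sigma UNIV S) = S" by (rule sigma_algebra.sets_measure_of_eq)
  define T where "T = sigma UNIV S"
  have T: "A \<in> sets T \<longleftrightarrow> \<Phi> -` A \<inter> space M \<in> sets ?C" for A
    unfolding T_def sets_S by (simp only: S_def mem_Collect_eq)
  have spT: "space T = UNIV" by (simp add: T_def space_measure_of_conv)
  have m\<Phi>: "\<Phi> \<in> ?C \<rightarrow>\<^sub>M T"
    by (rule measurableI) (simp_all add: T spT)
  define Q where "Q = distr ?C T \<Phi>"
  have setsQ: "A \<in> sets Q \<longleftrightarrow> \<Phi> -` A \<inter> space M \<in> sets ?C" for A by (simp add: Q_def T)
  have spQ: "space Q = UNIV" by (simp add: Q_def spT)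
  interpret C: prob_space ?C by (rule prob_space_completion)
  have ps: "prob_space Q" unfolding Q_def by (rule C.prob_space_distr[OF m\<Phi>])
  have gm: "g \<in> Q \<rightarrow>\<^sub>M L" if g: "(\<lambda>s. g (\<Phi> s)) \<in> M \<rightarrow>\<^sub>M L" for g
  proof (rule measurableI)
    show "g -` A \<inter> space Q \<in> sets Q" if A: "A \<in> sets L" for A
    proof -
      have "\<Phi> -` (g -` A) \<inter> space M = (\<lambda>s. g (\<Phi> s)) -` A \<inter> space M" by auto
      also have "\<dots> \<in> sets ?C" using measurable_sets[OF g A] by simp
      finally show ?thesis by (simp only: setsQ spQ Int_UNIV_right)
    qed
    show "g x \<in> space L" for x unfolding L by (rule UNIV_I)
  qed
  have ds: "distr Q L g = distr M L (\<lambda>s. g (\<Phi> s))" if g: "(\<lambda>s. g (\<Phi> s)) \<in> M \<rightarrow>\<^sub>M L" for g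
  proof -
    have "distr Q L g = distr ?C L (g \<circ> \<Phi>)"
      unfolding Q_def by (rule distr_distr[OF _ m\<Phi>]) (rule gm[OF g, unfolded Q_def measurable_distr_eq1])
    also have "\<dots> = distr M L (\<lambda>s. g (\<Phi> s))"
      unfolding comp_def by (rule distr_completion[OF g])
    finally show ?thesis .
  qed
  have ae: "AE t in Q. P t" if P: "AE s in M. P (\<Phi> s)" for P
  proof -
    have "AE s in M. \<not> \<not> P (\<Phi> s)" using P by simp
    from sets_completion_AE[OF this] have "{s\<in>space M. \<not> P (\<Phi> s)} \<in> sets ?C" by (simp add: pred_def)
    from sets.compl_sets[OF this] have "space M - {s\<in>space M. \<not> P (\<Phi> s)} \<in> sets ?C" by simp
    moreover have "space M - {s\<in>space M. \<not> P (\<Phi> s)} = \<Phi> -` {t. P t} \<inter> space M" by auto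
    ultimately have m: "{t\<in>space T. P t} \<in> sets T"
      by (simp add: T spT)
    show ?thesis unfolding Q_def AE_distr_iff[OF m\<Phi> m] by (rule AE_completion[OF P])
  qed
  show ?thesis by (intro exI[of _ Q] conjI allI impI ps) (rule gm ds ae, assumption)+
qed

theorem theorem4p1:
  fixes \<gamma>1 \<gamma>2 :: "(int ^ 'd::finite) pmf" and i1 :: 'd
  assumes "2 \<le> CARD('d)"
    and "\<gamma>1 \<in> step_laws" and "\<gamma>2 \<in> step_laws" and "\<gamma>1 \<noteq> \<gamma>2"
  shows "\<exists>(M :: (real \<Rightarrow> 'd env \<times> 'd path) measure) \<omega> X.
    rwre_coupling (two_point_law \<gamma>1 \<gamma>2) M \<omega> X \<and>
    (\<forall>p\<in>{0..1}. AE s in M. convergent (mean_velocity (X p s))) \<and>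
    (\<forall>p p'. 0 \<le> p \<and> p < p' \<and> p' \<le> 1 \<longrightarrow>
      (AE s in M. \<forall>n. visits \<gamma>1 (\<omega> p' s) (X p' s) n \<ge> visits \<gamma>1 (\<omega> p s) (X p s) n) \<and>
      (\<forall>e\<in>unit_vectors. e \<in> set_pmf \<gamma>1 \<inter> - set_pmf \<gamma>2 \<and> - e \<notin> set_pmf \<gamma>1 \<longrightarrow>
        (AE s in M. \<forall>n. rvec (X p' s n) \<bullet> rvec e \<ge> rvec (X p s n) \<bullet> rvec e)) \<and>
      (local_drift \<gamma>1 $ i1 > local_drift \<gamma>2 $ i1 \<longrightarrow>
        (AE s in M. \<exists>\<^sub>\<infinity>n. X p' s n $ i1 \<ge> X p s n $ i1)) \<and>
      (\<forall>u. u \<noteq> 0 \<longrightarrow>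
        ((local_drift \<gamma>1 - local_drift \<gamma>2) \<bullet> u \<ge> 0 \<longrightarrow>
          (AE s in M. velocity (X p' s) \<bullet> u \<ge> velocity (X p s) \<bullet> u)) \<and>
        ((local_drift \<gamma>1 - local_drift \<gamma>2) \<bullet> u \<le> 0 \<longrightarrow>
          (AE s in M. velocity (X p' s) \<bullet> u \<le> velocity (X p s) \<bullet> u))))"
proof -
  interpret two_laws \<gamma>1 \<gamma>2 by unfold_locales (use assms in auto)
  have sp: "space (env_space \<Otimes>\<^sub>M path_space :: ('d env \<times> 'd path) measure) = UNIV"
    by (simp add: space_pair_measure env_space_def path_space_def space_PiM)
  \<comment> \<open>Labels and stacks served to build the family; only the family of pairs, indexed
    by \<open>p\<close>, is carried over to the prescribed sample type.\<close>
  let ?\<Phi> = "\<lambda>s p. (om p s, W p s)"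
  obtain Q :: "(real \<Rightarrow> 'd env \<times> 'd path) measure" where Q: "prob_space Q"
    and law: "\<forall>g :: _ \<Rightarrow> 'd env \<times> 'd path. (\<lambda>s. g (?\<Phi> s)) \<in> N \<rightarrow>\<^sub>M env_space \<Otimes>\<^sub>M path_space \<longrightarrow> g \<in> Q \<rightarrow>\<^sub>M env_space \<Otimes>\<^sub>M path_space \<and>
      distr Q (env_space \<Otimes>\<^sub>M path_space) g = distr N (env_space \<Otimes>\<^sub>M path_space) (\<lambda>s. g (?\<Phi> s))"
    and ae: "\<forall>P. (AE s in N. P (?\<Phi> s)) \<longrightarrow> (AE t in Q. P t)"
    using N.canonical_space[OF sp, of ?\<Phi>] by (elim exE conjE) (rule that)
  have AE: "AE t in Q. P t" if "AE s in N. P (?\<Phi> s)" for P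
    by (rule mp[OF spec[OF ae] that])
  define \<omega> where "\<omega> p t = fst (t p)" for p :: real and t :: "real \<Rightarrow> 'd env \<times> 'd path"
  define X where "X p t = snd (t p)" for p :: real and t :: "real \<Rightarrow> 'd env \<times> 'd path"
  have drift: "drift i1 True = local_drift \<gamma>1 $ i1" "drift i1 False = local_drift \<gamma>2 $ i1"
    by (simp_all add: drift_def law_def)
  have vel: "AE t in Q. velocity (X p t) \<bullet> u \<le> velocity (X p' t) \<bullet> u"
    if p: "0 \<le> p" "p < p'" "p' \<le> 1" and u: "0 \<le> (local_drift \<gamma>1 - local_drift \<gamma>2) \<bullet> u" for p p' u
  proof (rule AE)
    have "AE s in N. convergent (mean_velocity (W p s))" "AE s in N. convergent (mean_velocity (W p' s))"
      using p by (intro AE_W_velocity; simp)+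
    with stack_slln show "AE s in N. velocity (X p (\<lambda>p. (om p s, W p s))) \<bullet> u \<le> velocity (X p' (\<lambda>p. (om p s, W p s))) \<bullet> u"
    proof eventually_elim
      case (elim s)
      then show ?case using velocity_compare[of p p' s u] p u by (simp add: X_def)
    qed
  qed
  have "rwre_coupling (two_point_law \<gamma>1 \<gamma>2) Q \<omega> X"
    unfolding rwre_coupling_def
  proof (intro conjI ballI Q)
    fix p :: real assume "p \<in> {0..1}"
    then have p: "0 \<le> p" "p \<le> 1" by auto
    have c: "(\<lambda>s. (\<lambda>t. (\<omega> p t, X p t)) (\<lambda>p. (om p s, W p s))) \<in> N \<rightarrow>\<^sub>M env_space \<Otimes>\<^sub>M path_space"
      unfolding \<omega>_def X_def fst_conv snd_conv by (rule coupled_law(1)[OF p])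
    show "(\<lambda>t. (\<omega> p t, X p t)) \<in> Q \<rightarrow>\<^sub>M env_space \<Otimes>\<^sub>M path_space" by (rule conjunct1[OF law[rule_format, OF c]])
    show "distr Q (env_space \<Otimes>\<^sub>M path_space) (\<lambda>t. (\<omega> p t, X p t)) = annealed_law (two_point_law \<gamma>1 \<gamma>2 p)"
      unfolding conjunct2[OF law[rule_format, OF c]] unfolding \<omega>_def X_def fst_conv snd_conv by (rule coupled_law(2)[OF p])
  qed
  moreover have "AE t in Q. convergent (mean_velocity (X p t))" if "p \<in> {0..1}" for p
    by (rule AE) (use AE_W_velocity[of p] that in \<open>simp add: X_def\<close>)
  moreover have "AE t in Q. \<forall>n. visits \<gamma>1 (\<omega> p' t) (X p' t) n \<ge> visits \<gamma>1 (\<omega> p t) (X p t) n" if "p < p'" for p p'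
    by (rule AE) (use cnt_coupled[of p p'] that in \<open>simp add: \<omega>_def X_def visits_eq_cnt\<close>)
  moreover have "AE t in Q. \<forall>n. rvec (X p' t n) \<bullet> rvec e \<ge> rvec (X p t n) \<bullet> rvec e"
    if "p < p'" "e \<in> unit_vectors" "e \<in> set_pmf \<gamma>1 \<inter> - set_pmf \<gamma>2 \<and> - e \<notin> set_pmf \<gamma>1" for p p' e
  proof (rule AE)
    show "AE s in N. \<forall>n. rvec (X p' (\<lambda>p. (om p s, W p s)) n) \<bullet> rvec e \<ge> rvec (X p (\<lambda>p. (om p s, W p s)) n) \<bullet> rvec e"
      using AE_stack_in_support
    proof eventually_elim
      case (elim s)
      then show ?case using direction_compare[of p p' e s] that by (simp add: X_def)
    qed
  qed
  moreover have "AE t in Q. \<exists>\<^sub>\<infinity>n. X p' t n $ i1 \<ge> X p t n $ i1"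
    if "0 \<le> p" "p < p'" "p' \<le> 1" "local_drift \<gamma>1 $ i1 > local_drift \<gamma>2 $ i1" for p p'
    by (rule AE) (use overtakes_infinitely_often[of p p' i1] that in \<open>simp add: X_def drift\<close>)
  moreover have "AE t in Q. velocity (X p' t) \<bullet> u \<le> velocity (X p t) \<bullet> u"
    if "0 \<le> p" "p < p'" "p' \<le> 1" "(local_drift \<gamma>1 - local_drift \<gamma>2) \<bullet> u \<le> 0" for p p' u
    using vel[of p p' "- u"] that by simp
  ultimately show ?thesis using vel by (intro exI[of _ Q] exI[of _ \<omega>] exI[of _ X]) blast
qed

end
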